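(* Let $R$ be a Dedekind domain. The following map is an isomorphism of abelian groups: \begin{align*} K_0( R\text{-}\mathbf{mod}\text{-}\mathbf{mod} ) &\longrightarrow K_0( \mathrm{Proj}( R\text{-}\mathbf{mod} ) ) \oplus \bigoplus_{\mathfrak{p} \in \mathrm{mSpec}(R),\ l\geq 1} \mathbb{Z}, \\ [\mathcal{G}] &\longmapsto \left( \mathrm{pr}(\mathcal{G}), (\mathrm{mult}^{\mathcal{G}}_{\mathfrak{p},l})_{\mathfrak{p},l} \right). \end{align*}
   Context: A Dedekind domain is a commutative noetherian domain $R$ of Krull dimension $1$ such that $R_{\mathfrak{p}}$ is a discrete valuation ring for every $\mathfrak{p} \in \mathrm{mSpec}(R)$, the set of maximal ideals. $R\text{-}\mathbf{mod}$ is the category of finitely presented $R$-modules, $|R\text{-}\mathbf{mod}|$ the same category regarded merely as an additive category, and $\mathrm{Proj}(R\text{-}\mathbf{mod})$ the additive full subcategory of projective objects. $R\text{-}\mathbf{mod}\text{-}\mathbf{mod}$ is the abelian category of finitely presented functors: additive functors $\mathcal{G}: R\text{-}\mathbf{mod} \to \mathbf{Ab}$ for which there is a morphism $\alpha: M \to N$ in $R\text{-}\mathbf{mod}$ and an exact sequence $\mathrm{Hom}(N,-) \xrightarrow{\mathrm{Hom}(\alpha,-)} \mathrm{Hom}(M,-) \to \mathcal{G} \to 0$ (a presentation given by $\alpha$). $K_0$ of a small additive category is the abelian group generated by symbols $[A]$ subject to $[C]=[A]+[B]$ whenever $C\cong A\oplus B$; $K_0$ of a small abelian category is generated by symbols $[A]$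 subject to $[C]=[A]+[B]$ for all short exact sequences $0\to A\to C\to B\to 0$. Structure theorem: every $M \in R\text{-}\mathbf{mod}$ is isomorphic to $\mathrm{pr}(M) \oplus \bigoplus_{\mathfrak{p},\, l\geq 1} (R/\mathfrak{p}^l)^{\oplus \mathrm{mult}^M_{\mathfrak{p},l}}$ with $\mathrm{pr}(M)$ finitely presented projective and non-negative integers $\mathrm{mult}^M_{\mathfrak{p},l}$, almost all zero; the isomorphism class of $\mathrm{pr}(M)$ and the $\mathrm{mult}^M_{\mathfrak{p},l}$ are determined by $M$. The maps $M \mapsto [\mathrm{pr}(M)]$ and $M \mapsto \mathrm{mult}^M_{\mathfrak{p},l}$ are additive on direct sums and hence induce homomorphisms $\mathrm{pr}: K_0(|R\text{-}\mathbf{mod}|) \to K_0(\mathrm{Proj}(R\text{-}\mathbf{mod}))$ and $\mathrm{mult}_{\mathfrak{p},l}: K_0(|R\text{-}\mathbf{mod}|) \to \mathbb{Z}$. For $\mathcal{G}$ with a presentation given by $\alpha: M\to N$, the left module class is $\mathrm{lmc}(\mathcal{G}) := [M]-[N]+[\mathrm{coker}(\alpha)] \in K_0(|R\text{-}\mathbf{mod}|)$ (independent of the presentation). Define $\mathrm{pr}(\mathcal{G}) := \mathrm{pr}(\mathrm{lmc}(\mathcal{G}))$ and $\mathrm{mult}^{\mathcal{G}}_{\mathfrak{p},l} := \mathrm{mult}_{\mathfrak{p},l}(\mathrm{lmc}(\mathcal{G}))$. *)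

theory Defs
  imports "HOL-Algebra.Algebra" "HOL-Library.Extended_Nat"
begin

section \<open>Dedekind domains\<close>

definition krull_dim :: "('a, 'b) ring_scheme \<Rightarrow> enat" where
  "krull_dim R =
     Sup {enat n | n. \<exists>c :: nat \<Rightarrow> 'a set.
       (\<forall>i\<le>n. primeideal (c i) R) \<and> (\<forall>i<n. c i \<subset> c (Suc i))}"

definition mSpec :: "('a, 'b) ring_scheme \<Rightarrow> 'a set set" where
  "mSpec R = {\<pp>. maximalideal \<pp> R}"

definition fraction_rel ::
    "('a, 'b) ring_scheme \<Rightarrow> 'a set \<Rightarrow> (('a \<times> 'a) \<times> ('a \<times> 'a)) set" where
  "fraction_rel R S =
     {((a, s), (b, t)). a \<in> carrier R \<and> s \<in> S \<and> b \<in> carrier R \<and> t \<in> S \<and>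
        (\<exists>u\<in>S. u \<otimes>\<^bsub>R\<^esub> (a \<otimes>\<^bsub>R\<^esub> t) = u \<otimes>\<^bsub>R\<^esub> (b \<otimes>\<^bsub>R\<^esub> s))}"

text \<open>The ring of fractions of \<open>R\<close> with respect to a multiplicative set \<open>S\<close>: a pair
  \<open>(a, s)\<close> stands for the fraction \<open>a / s\<close>.\<close>

definition localization ::
    "('a, 'b) ring_scheme \<Rightarrow> 'a set \<Rightarrow> ('a \<times> 'a) set ring" where
  "localization R S =
     \<lparr>carrier = (carrier R \<times> S) // fraction_rel R S,
      monoid.mult = (\<lambda>U V. \<Union>p\<in>U. \<Union>q\<in>V.
                fraction_rel R S `` {(fst p \<otimes>\<^bsub>R\<^esub> fst q, snd p \<otimes>\<^bsub>R\<^esub> snd q)}),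
      one = fraction_rel R S `` {(\<one>\<^bsub>R\<^esub>, \<one>\<^bsub>R\<^esub>)},
      ring.zero = fraction_rel R S `` {(\<zero>\<^bsub>R\<^esub>, \<one>\<^bsub>R\<^esub>)},
      ring.add = (\<lambda>U V. \<Union>p\<in>U. \<Union>q\<in>V.
                fraction_rel R S ``
                  {(fst p \<otimes>\<^bsub>R\<^esub> snd q \<oplus>\<^bsub>R\<^esub> fst q \<otimes>\<^bsub>R\<^esub> snd p, snd p \<otimes>\<^bsub>R\<^esub> snd q)})\<rparr>"

text \<open>A discrete valuation ring is a local principal ideal domain that is not a field.\<close>

definition discrete_valuation_ring :: "('a, 'b) ring_scheme \<Rightarrow> bool" where
  "discrete_valuation_ring R \<longleftrightarrow>
     principal_domain R \<and> \<not> field R \<and> (\<exists>!\<mm>. maximalideal \<mm> R)"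

definition dedekind_domain :: "('a, 'b) ring_scheme \<Rightarrow> bool" where
  "dedekind_domain R \<longleftrightarrow>
     noetherian_domain R \<and> krull_dim R = 1 \<and>
     (\<forall>\<pp>\<in>mSpec R. discrete_valuation_ring (localization R (carrier R - \<pp>)))"


section \<open>Preadditive categories\<close>

text \<open>The data of a small preadditive category. \<open>Hom C A B\<close> is the abelian group of morphisms
  from \<open>A\<close> to \<open>B\<close>, written multiplicatively like all abelian groups below, so its unit
  is the zero morphism and its product is the sum of morphisms. \<open>Comp C A g f\<close> is
  \<open>g\<close> after \<open>f\<close>, where \<open>A\<close> is the domain of \<open>f\<close>; morphisms will be functions
  that are undefined outside their domain, so the composition has to know the domain.\<close>

record ('o, 'm) precat =
  Obj :: "'o set"
  Hom :: "'o \<Rightarrow> 'o \<Rightarrow> 'm monoid"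
  IdMor :: "'o \<Rightarrow> 'm"
  Comp :: "'o \<Rightarrow> 'm \<Rightarrow> 'm \<Rightarrow> 'm"

abbreviation Mor :: "('o, 'm) precat \<Rightarrow> 'o \<Rightarrow> 'o \<Rightarrow> 'm set" where
  "Mor C A B \<equiv> carrier (Hom C A B)"

abbreviation ZeroMor :: "('o, 'm) precat \<Rightarrow> 'o \<Rightarrow> 'o \<Rightarrow> 'm" where
  "ZeroMor C A B \<equiv> \<one>\<^bsub>Hom C A B\<^esub>"

text \<open>\<open>S\<close> is isomorphic to the direct sum of \<open>A\<close> and \<open>B\<close>.\<close>

definition is_direct_sum :: "('o, 'm) precat \<Rightarrow> 'o \<Rightarrow> 'o \<Rightarrow> 'o \<Rightarrow> bool" where
  "is_direct_sum C A B S \<longleftrightarrow>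
     (\<exists>i\<in>Mor C A S. \<exists>j\<in>Mor C B S. \<exists>p\<in>Mor C S A. \<exists>q\<in>Mor C S B.
        Comp C A p i = IdMor C A \<and> Comp C B q j = IdMor C B \<and>
        Comp C A q i = ZeroMor C A B \<and> Comp C B p j = ZeroMor C B A \<and>
        Comp C S i p \<otimes>\<^bsub>Hom C S S\<^esub> Comp C S j q = IdMor C S)"

definition is_kernel :: "('o, 'm) precat \<Rightarrow> 'o \<Rightarrow> 'o \<Rightarrow> 'm \<Rightarrow> 'o \<Rightarrow> 'm \<Rightarrow> bool" where
  "is_kernel C A B f K k \<longleftrightarrow>
     K \<in> Obj C \<and> k \<in> Mor C K A \<and> Comp C K f k = ZeroMor C K B \<and>
     (\<forall>U\<in>Obj C. \<forall>g\<in>Mor C U A. Comp C U f g = ZeroMor C U B \<longrightarrow>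
        (\<exists>!h. h \<in> Mor C U K \<and> Comp C U k h = g))"

definition is_cokernel :: "('o, 'm) precat \<Rightarrow> 'o \<Rightarrow> 'o \<Rightarrow> 'm \<Rightarrow> 'o \<Rightarrow> 'm \<Rightarrow> bool" where
  "is_cokernel C A B f Q q \<longleftrightarrow>
     Q \<in> Obj C \<and> q \<in> Mor C B Q \<and> Comp C A q f = ZeroMor C A Q \<and>
     (\<forall>U\<in>Obj C. \<forall>g\<in>Mor C B U. Comp C A g f = ZeroMor C A U \<longrightarrow>
        (\<exists>!h. h \<in> Mor C Q U \<and> Comp C B h q = g))"

definition short_exact ::
    "('o, 'm) precat \<Rightarrow> 'o \<Rightarrow> 'm \<Rightarrow> 'o \<Rightarrow> 'm \<Rightarrow> 'o \<Rightarrow> bool" where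
  "short_exact C A f S g B \<longleftrightarrow>
     f \<in> Mor C A S \<and> g \<in> Mor C S B \<and> is_kernel C S B g A f \<and> is_cokernel C A S f B g"

definition is_epi :: "('o, 'm) precat \<Rightarrow> 'o \<Rightarrow> 'o \<Rightarrow> 'm \<Rightarrow> bool" where
  "is_epi C A B e \<longleftrightarrow>
     e \<in> Mor C A B \<and>
     (\<forall>U\<in>Obj C. \<forall>g\<in>Mor C B U. \<forall>h\<in>Mor C B U. Comp C A g e = Comp C A h e \<longrightarrow> g = h)"

definition projective :: "('o, 'm) precat \<Rightarrow> 'o \<Rightarrow> bool" where
  "projective C P \<longleftrightarrow>
     P \<in> Obj C \<and>
     (\<forall>A\<in>Obj C. \<forall>B\<in>Obj C. \<forall>e f. is_epi C A B e \<and> f \<in> Mor C P B \<longrightarrow>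
        (\<exists>g\<in>Mor C P A. Comp C P e g = f))"

definition Proj :: "('o, 'm) precat \<Rightarrow> ('o, 'm) precat" where
  "Proj C = C\<lparr>Obj := {P. projective C P}\<rparr>"


section \<open>Grothendieck groups\<close>

text \<open>The abelian group generated by symbols \<open>[A]\<close> for \<open>A \<in> Ob\<close> subject to
  \<open>[S] = [A] + [B]\<close> for all \<open>(A, S, B) \<in> T\<close>.\<close>

definition K0_relations :: "'o set \<Rightarrow> ('o \<times> 'o \<times> 'o) set \<Rightarrow> ('o \<Rightarrow>\<^sub>0 int) set" where
  "K0_relations Ob T =
     generate (free_Abelian_group Ob) {frag_of S - frag_of A - frag_of B | A S B. (A, S, B) \<in> T}"

definition K0_group :: "'o set \<Rightarrow> ('o \<times> 'o \<times> 'o) set \<Rightarrow> ('o \<Rightarrow>\<^sub>0 int) set monoid" where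
  "K0_group Ob T = free_Abelian_group Ob Mod K0_relations Ob T"

definition K0_class :: "'o set \<Rightarrow> ('o \<times> 'o \<times> 'o) set \<Rightarrow> 'o \<Rightarrow> ('o \<Rightarrow>\<^sub>0 int) set" where
  "K0_class Ob T A = K0_relations Ob T #>\<^bsub>free_Abelian_group Ob\<^esub> frag_of A"

definition direct_sum_triples :: "('o, 'm) precat \<Rightarrow> ('o \<times> 'o \<times> 'o) set" where
  "direct_sum_triples C =
     {(A, S, B). A \<in> Obj C \<and> S \<in> Obj C \<and> B \<in> Obj C \<and> is_direct_sum C A B S}"

definition exact_triples :: "('o, 'm) precat \<Rightarrow> ('o \<times> 'o \<times> 'o) set" where
  "exact_triples C =
     {(A, S, B). A \<in> Obj C \<and> S \<in> Obj C \<and> B \<in> Obj C \<and> (\<exists>f g. short_exact C A f S g B)}"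

definition K0_add :: "('o, 'm) precat \<Rightarrow> ('o \<Rightarrow>\<^sub>0 int) set monoid" where
  "K0_add C = K0_group (Obj C) (direct_sum_triples C)"

definition cls_add :: "('o, 'm) precat \<Rightarrow> 'o \<Rightarrow> ('o \<Rightarrow>\<^sub>0 int) set" where
  "cls_add C = K0_class (Obj C) (direct_sum_triples C)"

definition K0_ab :: "('o, 'm) precat \<Rightarrow> ('o \<Rightarrow>\<^sub>0 int) set monoid" where
  "K0_ab C = K0_group (Obj C) (exact_triples C)"

definition cls_ab :: "('o, 'm) precat \<Rightarrow> 'o \<Rightarrow> ('o \<Rightarrow>\<^sub>0 int) set" where
  "cls_ab C = K0_class (Obj C) (exact_triples C)"

text \<open>The value at \<open>x\<close> of the homomorphism \<open>K0_add C \<rightarrow> G\<close> with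
  \<open>[A] \<mapsto> \<phi> A\<close>, for \<open>\<phi>\<close> additive on direct sums.\<close>

definition K0_add_induced ::
    "('o, 'm) precat \<Rightarrow> 'g monoid \<Rightarrow> ('o \<Rightarrow> 'g) \<Rightarrow> ('o \<Rightarrow>\<^sub>0 int) set \<Rightarrow> 'g" where
  "K0_add_induced C G \<phi> x =
     (THE y. \<exists>h\<in>hom (K0_add C) G. (\<forall>A\<in>Obj C. h (cls_add C A) = \<phi> A) \<and> y = h x)"


section \<open>Finitely presented functors\<close>

record ('o, 'm, 'v) ab_functor =
  fobj :: "'o \<Rightarrow> 'v monoid"
  fmap :: "'o \<Rightarrow> 'o \<Rightarrow> 'm \<Rightarrow> 'v \<Rightarrow> 'v"

definition additive_functor :: "('o, 'm) precat \<Rightarrow> ('o, 'm, 'v) ab_functor \<Rightarrow> bool" where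
  "additive_functor C F \<longleftrightarrow>
     (\<forall>U\<in>Obj C. comm_group (fobj F U)) \<and>
     (\<forall>U\<in>Obj C. \<forall>V\<in>Obj C. \<forall>f\<in>Mor C U V. fmap F U V f \<in> hom (fobj F U) (fobj F V)) \<and>
     (\<forall>U\<in>Obj C. \<forall>x\<in>carrier (fobj F U). fmap F U U (IdMor C U) x = x) \<and>
     (\<forall>U\<in>Obj C. \<forall>V\<in>Obj C. \<forall>W\<in>Obj C. \<forall>f\<in>Mor C U V. \<forall>g\<in>Mor C V W.
        \<forall>x\<in>carrier (fobj F U). fmap F U W (Comp C U g f) x = fmap F V W g (fmap F U V f x)) \<and>
     (\<forall>U\<in>Obj C. \<forall>V\<in>Obj C. \<forall>f\<in>Mor C U V. \<forall>g\<in>Mor C U V. \<forall>x\<in>carrier (fobj F U).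
        fmap F U V (f \<otimes>\<^bsub>Hom C U V\<^esub> g) x = fmap F U V f x \<otimes>\<^bsub>fobj F V\<^esub> fmap F U V g x)"

definition nat_trans ::
    "('o, 'm) precat \<Rightarrow> ('o, 'm, 'v) ab_functor \<Rightarrow> ('o, 'm, 'w) ab_functor \<Rightarrow>
     ('o \<Rightarrow> 'v \<Rightarrow> 'w) set" where
  "nat_trans C F G =
     {\<eta>. \<eta> \<in> extensional (Obj C) \<and>
        (\<forall>U\<in>Obj C. \<eta> U \<in> hom (fobj F U) (fobj G U) \<inter> extensional (carrier (fobj F U))) \<and>
        (\<forall>U\<in>Obj C. \<forall>V\<in>Obj C. \<forall>f\<in>Mor C U V. \<forall>x\<in>carrier (fobj F U).
           \<eta> V (fmap F U V f x) = fmap G U V f (\<eta> U x))}"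

definition hom_functor :: "('o, 'm) precat \<Rightarrow> 'o \<Rightarrow> ('o, 'm, 'm) ab_functor" where
  "hom_functor C M = \<lparr>fobj = Hom C M, fmap = (\<lambda>U V f h. Comp C M f h)\<rparr>"

text \<open>\<open>\<alpha> : M \<rightarrow> N\<close> presents \<open>G\<close>, i.e. there is an exact sequence
  \<open>Hom(N,-) \<rightarrow> Hom(M,-) \<rightarrow> G \<rightarrow> 0\<close> of functors to abelian groups whose
  first map is precomposition with \<open>\<alpha>\<close>.\<close>

definition presents ::
    "('o, 'm) precat \<Rightarrow> 'o \<Rightarrow> 'o \<Rightarrow> 'm \<Rightarrow> ('o, 'm, 'v) ab_functor \<Rightarrow> bool" where
  "presents C M N \<alpha> G \<longleftrightarrow>
     M \<in> Obj C \<and> N \<in> Obj C \<and> \<alpha> \<in> Mor C M N \<and>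
     (\<exists>\<pi>\<in>nat_trans C (hom_functor C M) G. \<forall>U\<in>Obj C.
        \<pi> U ` Mor C M U = carrier (fobj G U) \<and>
        kernel (Hom C M U) (fobj G U) (\<pi> U) = (\<lambda>h. Comp C M h \<alpha>) ` Mor C N U)"

text \<open>The category \<open>C-mod\<close> of finitely presented functors. The values of the functors are
  taken in abelian groups on the type \<open>'m set\<close>, which contains the quotient groups
  \<open>Hom(M,U) / Hom(\<alpha>,U)(Hom(N,U))\<close>; hence every finitely presented functor is isomorphic to
  an object of this small category.\<close>

definition fp_functors ::
    "('o, 'm) precat \<Rightarrow> (('o, 'm, 'm set) ab_functor, 'o \<Rightarrow> 'm set \<Rightarrow> 'm set) precat" where
  "fp_functors C =
     \<lparr>Obj = {G. additive_functor C G \<and> (\<exists>M N \<alpha>. presents C M N \<alpha> G)},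
      Hom = (\<lambda>F G.
        \<lparr>carrier = nat_trans C F G,
         monoid.mult = (\<lambda>\<eta> \<theta>. \<lambda>U\<in>Obj C. \<lambda>x\<in>carrier (fobj F U). \<eta> U x \<otimes>\<^bsub>fobj G U\<^esub> \<theta> U x),
         one = (\<lambda>U\<in>Obj C. \<lambda>x\<in>carrier (fobj F U). \<one>\<^bsub>fobj G U\<^esub>)\<rparr>),
      IdMor = (\<lambda>F. \<lambda>U\<in>Obj C. \<lambda>x\<in>carrier (fobj F U). x),
      Comp = (\<lambda>F \<theta> \<eta>. \<lambda>U\<in>Obj C. compose (carrier (fobj F U)) (\<theta> U) (\<eta> U))\<rparr>"


section \<open>Finitely presented modules\<close>

text \<open>The record type of modules inherits from rings the fields \<open>mult\<close> and \<open>one\<close>, which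
  have no meaning for modules.\<close>

definition module_hom ::
    "('a, 'b) ring_scheme \<Rightarrow> ('a, 'm) module \<Rightarrow> ('a, 'n) module \<Rightarrow> ('m \<Rightarrow> 'n) set" where
  "module_hom R M N =
     {h. h \<in> carrier M \<rightarrow>\<^sub>E carrier N \<and>
        (\<forall>x\<in>carrier M. \<forall>y\<in>carrier M. h (x \<oplus>\<^bsub>M\<^esub> y) = h x \<oplus>\<^bsub>N\<^esub> h y) \<and>
        (\<forall>r\<in>carrier R. \<forall>x\<in>carrier M. h (r \<odot>\<^bsub>M\<^esub> x) = r \<odot>\<^bsub>N\<^esub> h x)}"

definition module_iso ::
    "('a, 'b) ring_scheme \<Rightarrow> ('a, 'm) module \<Rightarrow> ('a, 'n) module \<Rightarrow> bool" where
  "module_iso R M N \<longleftrightarrow> (\<exists>h\<in>module_hom R M N. bij_betw h (carrier M) (carrier N))"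

definition regular_module :: "('a, 'b) ring_scheme \<Rightarrow> ('a, 'a) module" where
  "regular_module R =
     \<lparr>carrier = carrier R, monoid.mult = monoid.mult R, one = one R,
      ring.zero = ring.zero R, ring.add = ring.add R, smult = monoid.mult R\<rparr>"

definition quotient_module :: "('a, 'b) ring_scheme \<Rightarrow> 'a set \<Rightarrow> ('a, 'a set) module" where
  "quotient_module R I =
     \<lparr>carrier = carrier (R Quot I), monoid.mult = monoid.mult (R Quot I), one = one (R Quot I),
      ring.zero = ring.zero (R Quot I), ring.add = ring.add (R Quot I),
      smult = (\<lambda>r x. (I +>\<^bsub>R\<^esub> r) \<otimes>\<^bsub>R Quot I\<^esub> x)\<rparr>"

definition module_sum2 :: "('a, 'm) module \<Rightarrow> ('a, 'n) module \<Rightarrow> ('a, 'm \<times> 'n) module" where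
  "module_sum2 M N =
     \<lparr>carrier = carrier M \<times> carrier N, monoid.mult = undefined, one = undefined,
      ring.zero = (\<zero>\<^bsub>M\<^esub>, \<zero>\<^bsub>N\<^esub>),
      ring.add = (\<lambda>(x, y) (x', y'). (x \<oplus>\<^bsub>M\<^esub> x', y \<oplus>\<^bsub>N\<^esub> y')),
      smult = (\<lambda>r (x, y). (r \<odot>\<^bsub>M\<^esub> x, r \<odot>\<^bsub>N\<^esub> y))\<rparr>"

definition module_sum :: "'i set \<Rightarrow> ('i \<Rightarrow> ('a, 'm) module) \<Rightarrow> ('a, 'i \<Rightarrow> 'm) module" where
  "module_sum I D =
     \<lparr>carrier = {x \<in> \<Pi>\<^sub>E i\<in>I. carrier (D i). finite {i \<in> I. x i \<noteq> \<zero>\<^bsub>D i\<^esub>}},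
      monoid.mult = undefined, one = undefined,
      ring.zero = (\<lambda>i\<in>I. \<zero>\<^bsub>D i\<^esub>),
      ring.add = (\<lambda>x y. \<lambda>i\<in>I. x i \<oplus>\<^bsub>D i\<^esub> y i),
      smult = (\<lambda>r x. \<lambda>i\<in>I. r \<odot>\<^bsub>D i\<^esub> x i)\<rparr>"

definition free_module :: "('a, 'b) ring_scheme \<Rightarrow> nat \<Rightarrow> ('a, nat \<Rightarrow> 'a) module" where
  "free_module R n = module_sum {..<n} (\<lambda>_. regular_module R)"

definition finitely_presented :: "('a, 'b) ring_scheme \<Rightarrow> ('a, 'm) module \<Rightarrow> bool" where
  "finitely_presented R M \<longleftrightarrow>
     module R M \<and>
     (\<exists>m n. \<exists>f\<in>module_hom R (free_module R m) (free_module R n).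
        \<exists>g\<in>module_hom R (free_module R n) M.
          g ` carrier (free_module R n) = carrier M \<and>
          f ` carrier (free_module R m) = {x \<in> carrier (free_module R n). g x = \<zero>\<^bsub>M\<^esub>})"

text \<open>The small category of finitely presented modules: the carriers are taken in the type of
  sets of functions \<open>nat \<Rightarrow> 'a\<close>, which contains all quotients of the free modules
  \<open>free_module R n\<close>; hence every finitely presented module is isomorphic to an object.\<close>

type_synonym 'a fp_univ = "(nat \<Rightarrow> 'a) set"

definition Rmod ::
    "('a, 'b) ring_scheme \<Rightarrow> (('a, 'a fp_univ) module, 'a fp_univ \<Rightarrow> 'a fp_univ) precat" where
  "Rmod R =
     \<lparr>Obj = {M. finitely_presented R M},
      Hom = (\<lambda>M N.
        \<lparr>carrier = module_hom R M N,
         monoid.mult = (\<lambda>f g. \<lambda>x\<in>carrier M. f x \<oplus>\<^bsub>N\<^esub> g x),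
         one = (\<lambda>x\<in>carrier M. \<zero>\<^bsub>N\<^esub>)\<rparr>),
      IdMor = (\<lambda>M. \<lambda>x\<in>carrier M. x),
      Comp = (\<lambda>M g f. compose (carrier M) g f)\<rparr>"


section \<open>The invariants of modules and of finitely presented functors\<close>

definition torsion_index :: "('a, 'b) ring_scheme \<Rightarrow> ('a set \<times> nat) set" where
  "torsion_index R = mSpec R \<times> {1..}"

text \<open>\<open>M\<close> is isomorphic to the direct sum of the projective module \<open>P\<close> and of
  \<open>m \<pp> l\<close> copies of \<open>R / \<pp>\<^sup>l\<close> for all \<open>\<pp>\<close> and \<open>l \<ge> 1\<close>.\<close>

definition decomposes ::
    "('a, 'b) ring_scheme \<Rightarrow> ('a, 'a fp_univ) module \<Rightarrow> ('a, 'a fp_univ) module \<Rightarrow>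
     ('a set \<Rightarrow> nat \<Rightarrow> nat) \<Rightarrow> bool" where
  "decomposes R M P m \<longleftrightarrow>
     P \<in> Obj (Proj (Rmod R)) \<and>
     finite {(\<pp>, l) \<in> torsion_index R. m \<pp> l \<noteq> 0} \<and>
     module_iso R M
       (module_sum2 P
         (module_sum {(\<pp>, l, i). (\<pp>, l) \<in> torsion_index R \<and> i < m \<pp> l}
           (\<lambda>(\<pp>, l, i). quotient_module R (\<pp> [^]\<^bsub>ideals_set R\<^esub> l))))"

definition pr_module ::
    "('a, 'b) ring_scheme \<Rightarrow> ('a, 'a fp_univ) module \<Rightarrow> (('a, 'a fp_univ) module \<Rightarrow>\<^sub>0 int) set" where
  "pr_module R M = (THE c. \<exists>P m. decomposes R M P m \<and> c = cls_add (Proj (Rmod R)) P)"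

definition mult_module ::
    "('a, 'b) ring_scheme \<Rightarrow> 'a set \<Rightarrow> nat \<Rightarrow> ('a, 'a fp_univ) module \<Rightarrow> int" where
  "mult_module R \<pp> l M = int (THE k. \<exists>P m. decomposes R M P m \<and> k = m \<pp> l)"

definition pr_K0 ::
    "('a, 'b) ring_scheme \<Rightarrow> (('a, 'a fp_univ) module \<Rightarrow>\<^sub>0 int) set \<Rightarrow>
     (('a, 'a fp_univ) module \<Rightarrow>\<^sub>0 int) set" where
  "pr_K0 R = K0_add_induced (Rmod R) (K0_add (Proj (Rmod R))) (pr_module R)"

definition mult_K0 ::
    "('a, 'b) ring_scheme \<Rightarrow> 'a set \<Rightarrow> nat \<Rightarrow> (('a, 'a fp_univ) module \<Rightarrow>\<^sub>0 int) set \<Rightarrow> int" where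
  "mult_K0 R \<pp> l = K0_add_induced (Rmod R) integer_group (mult_module R \<pp> l)"

type_synonym 'a fp_functor =
  "(('a, 'a fp_univ) module, 'a fp_univ \<Rightarrow> 'a fp_univ, ('a fp_univ \<Rightarrow> 'a fp_univ) set) ab_functor"

text \<open>The left module class \<open>[M] - [N] + [coker \<alpha>]\<close>. The definite description expresses that
  it does not depend on the presentation \<open>\<alpha>\<close>.\<close>

definition lmc ::
    "('a, 'b) ring_scheme \<Rightarrow> 'a fp_functor \<Rightarrow> (('a, 'a fp_univ) module \<Rightarrow>\<^sub>0 int) set" where
  "lmc R G =
     (THE c. \<exists>M N \<alpha> Q q. presents (Rmod R) M N \<alpha> G \<and> is_cokernel (Rmod R) M N \<alpha> Q q \<and>
        c = cls_add (Rmod R) M \<otimes>\<^bsub>K0_add (Rmod R)\<^esub> inv\<^bsub>K0_add (Rmod R)\<^esub> cls_add (Rmod R) N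
              \<otimes>\<^bsub>K0_add (Rmod R)\<^esub> cls_add (Rmod R) Q)"

definition pr_functor ::
    "('a, 'b) ring_scheme \<Rightarrow> 'a fp_functor \<Rightarrow> (('a, 'a fp_univ) module \<Rightarrow>\<^sub>0 int) set" where
  "pr_functor R G = pr_K0 R (lmc R G)"

definition mult_functor ::
    "('a, 'b) ring_scheme \<Rightarrow> 'a set \<Rightarrow> nat \<Rightarrow> 'a fp_functor \<Rightarrow> int" where
  "mult_functor R \<pp> l G = mult_K0 R \<pp> l (lmc R G)"

end

theory Submission
  imports Defs
begin

text \<open>For every additive category \<open>C\<close> with cokernels, \<open>lmc\<close> is additive on short exact sequences of
  finitely presented functors (horseshoe lemma), and the resolution
  \<open>0 \<rightarrow> Hom(Q,-) \<rightarrow> Hom(N,-) \<rightarrow> Hom(M,-) \<rightarrow> G \<rightarrow> 0\<close> with \<open>Q = coker \<alpha>\<close> shows that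
  \<open>[M] \<mapsto> [Hom(M,-)]\<close> is inverse to it, so \<open>K\<^sub>0(C-mod) \<cong> K\<^sub>0(C)\<close>. For modules over a Dedekind domain
  the structure theorem turns \<open>K\<^sub>0(C)\<close> into the invariants. Its existence part is local at the maximal
  ideals: an element of maximal order in the localized torsion generates a direct summand
  \<open>R / P\<^sup>l\<close>, and a torsion-free module satisfies the dual basis property after multiplication with
  an element outside \<open>P\<close>. For uniqueness, the number of summands \<open>R / P\<^sup>j\<close> with \<open>j \<ge> l\<close> is a
  dimension over \<open>R / P\<close>, computed from the elements of \<open>P\<^sup>l\<^sup>-\<^sup>1 M\<close> annihilated by \<open>P\<close>.\<close>

section \<open>Grothendieck groups\<close>

text \<open>The cokernel enters \<open>lmc\<close> because the kernel of Hom(N,-) -> Hom(M,-) is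
  again representable, by coker \<alpha>. Hence cokernels in C are what makes classes of functors
  computable from classes of objects. The obstacle is that exactness in C-mod is defined by
  universal properties inside that category, while the horseshoe argument chases elements of the
  groups G(U). The two notions are matched by testing on representables; surjectivity is the
  delicate part, because the image of a map has to be recognised as finitely presented before the
  universal property can be applied to it. On the module side no localized module occurs. Working at
  P means allowing a factor outside P in every equation; such a factor is invertible modulo every
  power of P, and this is how local statements descend to R. Objects have carriers in one fixed
  type. Quotients are therefore built on the type of the module itself, and sums are carried back
  along the fibres of a free cover.\<close>

locale grothendieck =
  fixes Ob :: "'o set" and T :: "('o \<times> 'o \<times> 'o) set"
  assumes T_sub: "T \<subseteq> Ob \<times> Ob \<times> Ob"
begin

abbreviation "FA \<equiv> free_Abelian_group Ob"
abbreviation "KG \<equiv> K0_group Ob T"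
abbreviation "cls \<equiv> K0_class Ob T"

lemma relators_sub: "{frag_of S - frag_of A - frag_of B | A S B. (A, S, B) \<in> T} \<subseteq> carrier FA"
proof -
  have "Poly_Mapping.keys (frag_of S - frag_of A - frag_of B) \<subseteq> Ob" if "(A, S, B) \<in> T" for A S B
  proof -
    have "A \<in> Ob" "S \<in> Ob" "B \<in> Ob" using that T_sub by auto
    then show ?thesis
      using keys_diff[of "frag_of S - frag_of A" "frag_of B"] keys_diff[of "frag_of S" "frag_of A"]
      by auto
  qed
  then show ?thesis by auto
qed

lemma K0_relations_subgroup: "subgroup (K0_relations Ob T) FA"
  unfolding K0_relations_def
  by (rule group.generate_is_subgroup[OF group_free_Abelian_group relators_sub])

lemma K0_relations_normal: "K0_relations Ob T \<lhd> FA"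
  using comm_group.normal_iff_subgroup[OF abelian_free_Abelian_group] K0_relations_subgroup by blast

lemma K0_comm_group: "comm_group KG"
  unfolding K0_group_def
  by (rule comm_group.abelian_FactGroup[OF abelian_free_Abelian_group K0_relations_subgroup])

sublocale K: comm_group KG by (rule K0_comm_group)

abbreviation "proj x \<equiv> K0_relations Ob T #>\<^bsub>FA\<^esub> x"

lemma proj_hom: "proj \<in> hom FA KG"
  unfolding K0_group_def by (rule normal.r_coset_hom_Mod[OF K0_relations_normal])

lemma proj_group_hom: "group_hom FA KG proj"
  by (simp add: group_hom_def group_hom_axioms_def proj_hom)

lemma cls_closed [simp]: "A \<in> Ob \<Longrightarrow> cls A \<in> carrier KG"
  unfolding K0_class_def using hom_in_carrier[OF proj_hom, of "frag_of A"] by simp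

lemma cls_sum:
  assumes "(A, S, B) \<in> T"
  shows "cls S = cls A \<otimes>\<^bsub>KG\<^esub> cls B"
proof -
  have ob: "A \<in> Ob" "S \<in> Ob" "B \<in> Ob" using assms T_sub by auto
  have "frag_of S - frag_of A - frag_of B \<in> K0_relations Ob T"
    unfolding K0_relations_def using assms by (auto intro!: generate.incl)
  then have "proj (frag_of S - frag_of A - frag_of B) = K0_relations Ob T"
    using subgroup.rcos_const[OF K0_relations_subgroup group_free_Abelian_group] by blast
  moreover have "frag_of A + frag_of B \<in> carrier FA" "frag_of S - frag_of A - frag_of B \<in> carrier FA"
    using relators_sub assms ob keys_add[of "frag_of A" "frag_of B"] by (auto simp: subset_iff)
  moreover have "frag_of S = (frag_of S - frag_of A - frag_of B) \<otimes>\<^bsub>FA\<^esub> (frag_of A + frag_of B)"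
    by simp
  ultimately have "proj (frag_of S) = K0_relations Ob T \<otimes>\<^bsub>KG\<^esub> proj (frag_of A + frag_of B)"
    using hom_mult[OF proj_hom] by metis
  also have "\<dots> = proj (frag_of A + frag_of B)"
  proof -
    have "K0_relations Ob T = \<one>\<^bsub>KG\<^esub>" by (simp add: K0_group_def)
    then show ?thesis
      using hom_in_carrier[OF proj_hom] \<open>frag_of A + frag_of B \<in> carrier FA\<close> K.l_one by metis
  qed
  also have "\<dots> = proj (frag_of A) \<otimes>\<^bsub>KG\<^esub> proj (frag_of B)"
    using hom_mult[OF proj_hom, of "frag_of A" "frag_of B"] ob by simp
  finally show ?thesis by (simp add: K0_class_def)
qed

lemma carrier_KG: "carrier KG = proj ` carrier FA"
  by (simp add: K0_group_def carrier_FactGroup)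

text \<open>The classes generate the quotient, so differences reach everything. The unit is a
  separate case because it is no difference of classes when there are no objects.\<close>

lemma KG_induct [consumes 1, case_names cls diff one]:
  assumes x: "x \<in> carrier KG"
    and cl: "\<And>A. A \<in> Ob \<Longrightarrow> P (cls A)"
    and di: "\<And>x y. x \<in> carrier KG \<Longrightarrow> y \<in> carrier KG \<Longrightarrow> P x \<Longrightarrow> P y \<Longrightarrow> P (x \<otimes>\<^bsub>KG\<^esub> inv\<^bsub>KG\<^esub> y)"
    and one: "P \<one>\<^bsub>KG\<^esub>"
  shows "P x"
proof -
  obtain u where u: "x = proj u" "Poly_Mapping.keys u \<subseteq> Ob" using x by (auto simp: carrier_KG)
  interpret p: group_hom FA KG proj by (rule proj_group_hom)
  have "P (proj u)"
  proof (rule free_Abelian_group_induct[OF u(2)])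
    show "P (proj 0)" using one p.hom_one by simp
  next
    fix a b assume ab: "Poly_Mapping.keys a \<subseteq> Ob" "Poly_Mapping.keys b \<subseteq> Ob" "P (proj a)" "P (proj b)"
    have "a - b = a \<otimes>\<^bsub>FA\<^esub> inv\<^bsub>FA\<^esub> b" using ab by simp
    moreover have "proj (a \<otimes>\<^bsub>FA\<^esub> inv\<^bsub>FA\<^esub> b) = proj a \<otimes>\<^bsub>KG\<^esub> inv\<^bsub>KG\<^esub> proj b"
      using ab p.hom_mult[of a "inv\<^bsub>FA\<^esub> b"] p.hom_inv[of b] p.G.inv_closed[of b]
      by (simp del: inv_free_Abelian_group mult_free_Abelian_group)
    ultimately show "P (proj (a - b))"
      using di[OF p.hom_closed p.hom_closed, of a b] ab by simp
  next
    fix A assume "A \<in> Ob"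
    then show "P (proj (frag_of A))" using cl by (simp add: K0_class_def)
  qed
  then show ?thesis using u by simp
qed

text \<open>Existence half of the universal property: \<phi> extends freely to the free abelian
  group, and additivity on \<open>T\<close> puts every relator into the kernel.\<close>

lemma hom_from_cls:
  assumes H: "comm_group H" and f: "\<And>A. A \<in> Ob \<Longrightarrow> \<phi> A \<in> carrier H"
    and add: "\<And>A S B. (A, S, B) \<in> T \<Longrightarrow> \<phi> S = \<phi> A \<otimes>\<^bsub>H\<^esub> \<phi> B"
  obtains h where "h \<in> hom KG H" "\<And>A. A \<in> Ob \<Longrightarrow> h (cls A) = \<phi> A"
proof -
  interpret H: comm_group H by fact
  obtain g where g: "g \<in> hom FA H" "\<And>A. A \<in> Ob \<Longrightarrow> g (frag_of A) = \<phi> A"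
    using H.free_Abelian_group_universal[of \<phi> Ob] f by auto
  interpret g: group_hom FA H g by (simp add: group_hom_def group_hom_axioms_def g)
  have "K0_relations Ob T \<subseteq> kernel FA H g"
    unfolding K0_relations_def
  proof (rule group.generate_subgroup_incl[OF group_free_Abelian_group _ g.subgroup_kernel], safe)
    fix A S B assume t: "(A, S, B) \<in> T"
    then have ob: "A \<in> Ob" "S \<in> Ob" "B \<in> Ob" using T_sub by auto
    have car: "frag_of S - frag_of A - frag_of B \<in> carrier FA" using relators_sub t by blast
    \<comment> \<open>Adding [A] + [B] to the relator gives [S] in the free group. Comparing images
      shows that the image of the relator is absorbed by \<open>\<phi> S\<close>, hence
      trivial.\<close>
    have "g ((frag_of S - frag_of A - frag_of B) \<otimes>\<^bsub>FA\<^esub> (frag_of A \<otimes>\<^bsub>FA\<^esub> frag_of B)) = g (frag_of S)"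
      by simp
    moreover have "g ((frag_of S - frag_of A - frag_of B) \<otimes>\<^bsub>FA\<^esub> (frag_of A \<otimes>\<^bsub>FA\<^esub> frag_of B))
        = g (frag_of S - frag_of A - frag_of B) \<otimes>\<^bsub>H\<^esub> (g (frag_of A) \<otimes>\<^bsub>H\<^esub> g (frag_of B))"
    proof -
      have "frag_of A \<in> carrier FA" "frag_of B \<in> carrier FA" using ob by simp_all
      then show ?thesis
        using car g.hom_mult group.is_monoid[OF group_free_Abelian_group] monoid.m_closed by metis
    qed
    ultimately have "g (frag_of S - frag_of A - frag_of B) \<otimes>\<^bsub>H\<^esub> \<phi> S = \<phi> S"
      using g(2) ob add[OF t] by simp
    then have "g (frag_of S - frag_of A - frag_of B) = \<one>\<^bsub>H\<^esub>"
      using H.r_cancel_one f ob g.hom_closed car by metis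
    then show "frag_of S - frag_of A - frag_of B \<in> kernel FA H g"
      using car by (simp add: kernel_def)
  qed
  then obtain h where h: "h \<in> hom KG H" "\<And>x. x \<in> carrier FA \<Longrightarrow> h (proj x) = g x"
    using g.FactGroup_universal_kernel[OF K0_relations_normal] unfolding K0_group_def by blast
  show ?thesis
    by (rule that[OF h(1)]) (use h(2) g(2) in \<open>auto simp: K0_class_def\<close>)
qed

lemma hom_unique:
  assumes H: "group H" and h: "h \<in> hom KG H" "h' \<in> hom KG H"
    and eq: "\<And>A. A \<in> Ob \<Longrightarrow> h (cls A) = h' (cls A)" and x: "x \<in> carrier KG"
  shows "h x = h' x"
proof -
  interpret a: group_hom KG H h using H h by (simp add: group_hom_def group_hom_axioms_def)
  interpret b: group_hom KG H h' using H h by (simp add: group_hom_def group_hom_axioms_def)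
  from x show ?thesis
    by (induction x rule: KG_induct) (auto simp: eq)
qed

text \<open>Once sums exist, differences of classes are closed under subtraction: ([A] - [B]) -
  ([A'] - [B']) = [A + B'] - [B + A'].\<close>

lemma KG_diff:
  assumes sum: "\<And>A B. A \<in> Ob \<Longrightarrow> B \<in> Ob \<Longrightarrow> \<exists>S. (A, S, B) \<in> T"
    and ne: "Ob \<noteq> {}"
    and x: "x \<in> carrier KG"
  shows "\<exists>A\<in>Ob. \<exists>B\<in>Ob. x = cls A \<otimes>\<^bsub>KG\<^esub> inv\<^bsub>KG\<^esub> cls B"
  using x
proof (induction x rule: KG_induct)
  case (cls A)
  \<comment> \<open>[A] is written as [A + A] - [A], which works without a zero object.\<close>
  obtain S where S: "(A, S, A) \<in> T" using sum cls by blast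
  then have "S \<in> Ob" using T_sub by auto
  then have "cls A = cls S \<otimes>\<^bsub>KG\<^esub> inv\<^bsub>KG\<^esub> cls A"
    using cls_sum[OF S] cls by (simp add: K.m_assoc)
  then show ?case using \<open>S \<in> Ob\<close> cls by blast
next
  case (diff x y)
  then obtain A B A' B' where ab: "A \<in> Ob" "B \<in> Ob" "A' \<in> Ob" "B' \<in> Ob"
    "x = cls A \<otimes>\<^bsub>KG\<^esub> inv\<^bsub>KG\<^esub> cls B" "y = cls A' \<otimes>\<^bsub>KG\<^esub> inv\<^bsub>KG\<^esub> cls B'" by blast
  obtain S S' where s: "(A, S, B') \<in> T" "(B, S', A') \<in> T" using sum ab by blast
  then have "S \<in> Ob" "S' \<in> Ob" using T_sub by auto
  moreover have "x \<otimes>\<^bsub>KG\<^esub> inv\<^bsub>KG\<^esub> y = cls S \<otimes>\<^bsub>KG\<^esub> inv\<^bsub>KG\<^esub> cls S'"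
    using cls_sum[OF s(1)] cls_sum[OF s(2)] ab by (simp add: K.inv_mult_group K.m_ac)
  ultimately show ?case by blast
next
  case one
  obtain A where "A \<in> Ob" using ne by blast
  then show ?case by (intro bexI[of _ A]) auto
qed

end

section \<open>Additive categories with cokernels\<close>

text \<open>Cokernels are required because they turn into kernels of maps between representable
  functors. Every law carries the membership of its objects as premises, since nothing is known
  about \<open>C\<close> outside \<open>Obj C\<close>.\<close>

locale additive_category =
  fixes C :: "('o, 'm) precat"
  assumes hom_group: "\<lbrakk>A \<in> Obj C; B \<in> Obj C\<rbrakk> \<Longrightarrow> comm_group (Hom C A B)"
    and id_closed0: "A \<in> Obj C \<Longrightarrow> IdMor C A \<in> Mor C A A"
    and comp_closed0: "\<lbrakk>A \<in> Obj C; B \<in> Obj C; D \<in> Obj C; f \<in> Mor C A B; g \<in> Mor C B D\<rbrakk>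
      \<Longrightarrow> Comp C A g f \<in> Mor C A D"
    and comp_assoc0: "\<lbrakk>A \<in> Obj C; B \<in> Obj C; D \<in> Obj C; E \<in> Obj C;
        f \<in> Mor C A B; g \<in> Mor C B D; h \<in> Mor C D E\<rbrakk>
      \<Longrightarrow> Comp C A (Comp C B h g) f = Comp C A h (Comp C A g f)"
    and id_left0: "\<lbrakk>A \<in> Obj C; B \<in> Obj C; f \<in> Mor C A B\<rbrakk> \<Longrightarrow> Comp C A (IdMor C B) f = f"
    and id_right0: "\<lbrakk>A \<in> Obj C; B \<in> Obj C; f \<in> Mor C A B\<rbrakk> \<Longrightarrow> Comp C A f (IdMor C A) = f"
    and comp_add_left0: "\<lbrakk>A \<in> Obj C; B \<in> Obj C; D \<in> Obj C; f \<in> Mor C A B; g \<in> Mor C B D; g' \<in> Mor C B D\<rbrakk>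
      \<Longrightarrow> Comp C A (g \<otimes>\<^bsub>Hom C B D\<^esub> g') f = Comp C A g f \<otimes>\<^bsub>Hom C A D\<^esub> Comp C A g' f"
    and comp_add_right0: "\<lbrakk>A \<in> Obj C; B \<in> Obj C; D \<in> Obj C; f \<in> Mor C A B; f' \<in> Mor C A B; g \<in> Mor C B D\<rbrakk>
      \<Longrightarrow> Comp C A g (f \<otimes>\<^bsub>Hom C A B\<^esub> f') = Comp C A g f \<otimes>\<^bsub>Hom C A D\<^esub> Comp C A g f'"
    and direct_sum_ex: "\<lbrakk>A \<in> Obj C; B \<in> Obj C\<rbrakk> \<Longrightarrow> \<exists>S\<in>Obj C. is_direct_sum C A B S"
    and zero_obj_ex: "\<exists>Z\<in>Obj C. IdMor C Z = ZeroMor C Z Z"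
    and cokernel_ex: "\<lbrakk>A \<in> Obj C; B \<in> Obj C; f \<in> Mor C A B\<rbrakk> \<Longrightarrow> \<exists>Q q. is_cokernel C A B f Q q"
begin

text \<open>Composition annotated with the objects involved. With \<open>B\<close> and \<open>D\<close> visible in the
  term, the laws below are conditional rewrite rules without extra variables in the premises.\<close>

definition cmp :: "'o \<Rightarrow> 'o \<Rightarrow> 'o \<Rightarrow> 'm \<Rightarrow> 'm \<Rightarrow> 'm" where
  "cmp A B D g f = Comp C A g f"

abbreviation "Ob \<equiv> Obj C"
abbreviation "ad A B f g \<equiv> f \<otimes>\<^bsub>Hom C A B\<^esub> g"
abbreviation "neg A B f \<equiv> inv\<^bsub>Hom C A B\<^esub> f"
abbreviation "ze A B \<equiv> \<one>\<^bsub>Hom C A B\<^esub>"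
abbreviation "idm A \<equiv> IdMor C A"

section \<open>Calculus of morphisms\<close>

lemma id_closed [simp]: "A \<in> Ob \<Longrightarrow> idm A \<in> Mor C A A" by (rule id_closed0)

lemma cmp_closed [simp]:
  "\<lbrakk>A \<in> Ob; B \<in> Ob; D \<in> Ob; f \<in> Mor C A B; g \<in> Mor C B D\<rbrakk> \<Longrightarrow> cmp A B D g f \<in> Mor C A D"
  unfolding cmp_def by (rule comp_closed0)

lemma cmp_assoc:
  "\<lbrakk>A \<in> Ob; B \<in> Ob; D \<in> Ob; E \<in> Ob; f \<in> Mor C A B; g \<in> Mor C B D; h \<in> Mor C D E\<rbrakk>
    \<Longrightarrow> cmp A B E (cmp B D E h g) f = cmp A D E h (cmp A B D g f)"
  unfolding cmp_def by (rule comp_assoc0)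

lemma cmp_id_left [simp]: "\<lbrakk>A \<in> Ob; B \<in> Ob; f \<in> Mor C A B\<rbrakk> \<Longrightarrow> cmp A B B (idm B) f = f"
  unfolding cmp_def by (rule id_left0)

lemma cmp_id_right [simp]: "\<lbrakk>A \<in> Ob; B \<in> Ob; f \<in> Mor C A B\<rbrakk> \<Longrightarrow> cmp A A B f (idm A) = f"
  unfolding cmp_def by (rule id_right0)

lemma cmp_add_left:
  "\<lbrakk>A \<in> Ob; B \<in> Ob; D \<in> Ob; f \<in> Mor C A B; g \<in> Mor C B D; g' \<in> Mor C B D\<rbrakk>
    \<Longrightarrow> cmp A B D (ad B D g g') f = ad A D (cmp A B D g f) (cmp A B D g' f)"
  unfolding cmp_def by (rule comp_add_left0)

lemma cmp_add_right:
  "\<lbrakk>A \<in> Ob; B \<in> Ob; D \<in> Ob; f \<in> Mor C A B; f' \<in> Mor C A B; g \<in> Mor C B D\<rbrakk>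
    \<Longrightarrow> cmp A B D g (ad A B f f') = ad A D (cmp A B D g f) (cmp A B D g f')"
  unfolding cmp_def by (rule comp_add_right0)

lemma hom_group': "A \<in> Ob \<Longrightarrow> B \<in> Ob \<Longrightarrow> group (Hom C A B)"
  using hom_group comm_group.axioms(2) by blast

lemma ad_closed [simp]: "\<lbrakk>A \<in> Ob; B \<in> Ob; f \<in> Mor C A B; g \<in> Mor C A B\<rbrakk> \<Longrightarrow> ad A B f g \<in> Mor C A B"
  using hom_group' group.is_monoid monoid.m_closed by metis
lemma neg_closed [simp]: "\<lbrakk>A \<in> Ob; B \<in> Ob; f \<in> Mor C A B\<rbrakk> \<Longrightarrow> neg A B f \<in> Mor C A B"
  using hom_group' group.inv_closed by metis
lemma ze_closed [simp]: "\<lbrakk>A \<in> Ob; B \<in> Ob\<rbrakk> \<Longrightarrow> ze A B \<in> Mor C A B"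
  using hom_group' group.is_monoid monoid.one_closed by metis
lemma ad_ze [simp]: "\<lbrakk>A \<in> Ob; B \<in> Ob; f \<in> Mor C A B\<rbrakk> \<Longrightarrow> ad A B f (ze A B) = f"
  using hom_group' group.is_monoid monoid.r_one by metis
lemma ze_ad [simp]: "\<lbrakk>A \<in> Ob; B \<in> Ob; f \<in> Mor C A B\<rbrakk> \<Longrightarrow> ad A B (ze A B) f = f"
  using hom_group' group.is_monoid monoid.l_one by metis
lemma ad_neg [simp]: "\<lbrakk>A \<in> Ob; B \<in> Ob; f \<in> Mor C A B\<rbrakk> \<Longrightarrow> ad A B f (neg A B f) = ze A B"
  using hom_group' group.r_inv by metis
lemma neg_ad [simp]: "\<lbrakk>A \<in> Ob; B \<in> Ob; f \<in> Mor C A B\<rbrakk> \<Longrightarrow> ad A B (neg A B f) f = ze A B"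
  using hom_group' group.l_inv by metis
lemma neg_neg [simp]: "\<lbrakk>A \<in> Ob; B \<in> Ob; f \<in> Mor C A B\<rbrakk> \<Longrightarrow> neg A B (neg A B f) = f"
  using hom_group' group.inv_inv by metis
lemma ad_comm: "\<lbrakk>A \<in> Ob; B \<in> Ob; f \<in> Mor C A B; g \<in> Mor C A B\<rbrakk> \<Longrightarrow> ad A B f g = ad A B g f"
  using hom_group comm_group.axioms(1) comm_monoid.m_comm by metis
lemma ad_assoc: "\<lbrakk>A \<in> Ob; B \<in> Ob; f \<in> Mor C A B; g \<in> Mor C A B; h \<in> Mor C A B\<rbrakk>
    \<Longrightarrow> ad A B (ad A B f g) h = ad A B f (ad A B g h)"
  using hom_group' group.is_monoid monoid.m_assoc by metis
lemma ad_eq_iff: "\<lbrakk>A \<in> Ob; B \<in> Ob; f \<in> Mor C A B; g \<in> Mor C A B; h \<in> Mor C A B\<rbrakk>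
    \<Longrightarrow> f = ad A B h (neg A B g) \<longleftrightarrow> ad A B f g = h"
  using hom_group' group.inv_solve_right by metis
lemma ad_self: "\<lbrakk>A \<in> Ob; B \<in> Ob; f \<in> Mor C A B; ad A B f f = f\<rbrakk> \<Longrightarrow> f = ze A B"
  using hom_group' group.l_cancel_one' ze_closed by metis
lemma ad_neg_zero: "\<lbrakk>A \<in> Ob; B \<in> Ob; f \<in> Mor C A B; g \<in> Mor C A B\<rbrakk>
    \<Longrightarrow> ad A B f (neg A B g) = ze A B \<longleftrightarrow> f = g"
  using ad_eq_iff[of A B "ze A B" g f] by auto

lemma cmp_ze_left [simp]: "\<lbrakk>A \<in> Ob; B \<in> Ob; D \<in> Ob; f \<in> Mor C A B\<rbrakk> \<Longrightarrow> cmp A B D (ze B D) f = ze A D"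
  by (rule ad_self) (simp_all flip: cmp_add_left)
lemma cmp_ze_right [simp]: "\<lbrakk>A \<in> Ob; B \<in> Ob; D \<in> Ob; g \<in> Mor C B D\<rbrakk> \<Longrightarrow> cmp A B D g (ze A B) = ze A D"
  by (rule ad_self) (simp_all flip: cmp_add_right)
lemma cmp_neg_left: "\<lbrakk>A \<in> Ob; B \<in> Ob; D \<in> Ob; f \<in> Mor C A B; g \<in> Mor C B D\<rbrakk>
    \<Longrightarrow> cmp A B D (neg B D g) f = neg A D (cmp A B D g f)"
  using ad_eq_iff[of A D "cmp A B D (neg B D g) f" "cmp A B D g f" "ze A D"]
  by (simp flip: cmp_add_left)
lemma cmp_neg_right: "\<lbrakk>A \<in> Ob; B \<in> Ob; D \<in> Ob; f \<in> Mor C A B; g \<in> Mor C B D\<rbrakk>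
    \<Longrightarrow> cmp A B D g (neg A B f) = neg A D (cmp A B D g f)"
  using ad_eq_iff[of A D "cmp A B D g (neg A B f)" "cmp A B D g f" "ze A D"]
  by (simp flip: cmp_add_right)

lemmas cmp_rules = cmp_assoc cmp_add_left cmp_add_right cmp_neg_left cmp_neg_right

section \<open>Cokernels and coproducts\<close>

lemma cokernelE:
  assumes "is_cokernel C A B f Q q" "A \<in> Ob" "B \<in> Ob" "f \<in> Mor C A B"
  shows "Q \<in> Ob" "q \<in> Mor C B Q" "cmp A B Q q f = ze A Q"
    "\<And>U g. \<lbrakk>U \<in> Ob; g \<in> Mor C B U; cmp A B U g f = ze A U\<rbrakk> \<Longrightarrow> \<exists>h\<in>Mor C Q U. cmp B Q U h q = g"
    "\<And>U h h'. \<lbrakk>U \<in> Ob; h \<in> Mor C Q U; h' \<in> Mor C Q U; cmp B Q U h q = cmp B Q U h' q\<rbrakk> \<Longrightarrow> h = h'"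
proof -
  show *: "Q \<in> Ob" "q \<in> Mor C B Q" "cmp A B Q q f = ze A Q"
    using assms(1) unfolding is_cokernel_def cmp_def by auto
  show "\<exists>h\<in>Mor C Q U. cmp B Q U h q = g"
    if "U \<in> Ob" "g \<in> Mor C B U" "cmp A B U g f = ze A U" for U g
    using assms(1) that unfolding is_cokernel_def cmp_def by blast
  show "h = h'" if u: "U \<in> Ob" and h: "h \<in> Mor C Q U" "h' \<in> Mor C Q U" 
    and eq: "cmp B Q U h q = cmp B Q U h' q" for U h h'
  proof -
    have "cmp A B U (cmp B Q U h q) f = ze A U"
      using u h * assms by (simp add: cmp_assoc)
    moreover have "cmp B Q U h q \<in> Mor C B U" using u h * assms by simp
    ultimately have "\<exists>!k. k \<in> Mor C Q U \<and> cmp B Q U k q = cmp B Q U h q"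
      using assms(1) u unfolding is_cokernel_def cmp_def by blast
    then show ?thesis using h eq by metis
  qed
qed

lemma cokernelI:
  assumes "Q \<in> Ob" "q \<in> Mor C B Q" "cmp A B Q q f = ze A Q"
    "\<And>U g. \<lbrakk>U \<in> Ob; g \<in> Mor C B U; cmp A B U g f = ze A U\<rbrakk> \<Longrightarrow> \<exists>h\<in>Mor C Q U. cmp B Q U h q = g"
    "\<And>U h h'. \<lbrakk>U \<in> Ob; h \<in> Mor C Q U; h' \<in> Mor C Q U; cmp B Q U h q = cmp B Q U h' q\<rbrakk> \<Longrightarrow> h = h'"
  shows "is_cokernel C A B f Q q"
  using assms unfolding is_cokernel_def cmp_def by (metis (no_types, lifting))

text \<open>A direct sum seen only through its injections: morphisms out of \<open>S\<close> are
  pairs of morphisms. Maps out of an object are all that presentations and cokernels involve, so the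
  chases below never mention projections.\<close>

definition coprod :: "'o \<Rightarrow> 'o \<Rightarrow> 'o \<Rightarrow> 'm \<Rightarrow> 'm \<Rightarrow> bool" where
  "coprod S A B i j \<longleftrightarrow> S \<in> Ob \<and> A \<in> Ob \<and> B \<in> Ob \<and> i \<in> Mor C A S \<and> j \<in> Mor C B S \<and>
     (\<forall>U\<in>Ob. \<forall>a\<in>Mor C A U. \<forall>b\<in>Mor C B U. \<exists>h\<in>Mor C S U. cmp A S U h i = a \<and> cmp B S U h j = b) \<and>
     (\<forall>U\<in>Ob. \<forall>h\<in>Mor C S U. \<forall>h'\<in>Mor C S U.
        cmp A S U h i = cmp A S U h' i \<and> cmp B S U h j = cmp B S U h' j \<longrightarrow> h = h')"

lemma coprodE:
  assumes "coprod S A B i j"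
  shows "S \<in> Ob" "A \<in> Ob" "B \<in> Ob" "i \<in> Mor C A S" "j \<in> Mor C B S"
    "\<And>U a b. \<lbrakk>U \<in> Ob; a \<in> Mor C A U; b \<in> Mor C B U\<rbrakk>
      \<Longrightarrow> \<exists>h\<in>Mor C S U. cmp A S U h i = a \<and> cmp B S U h j = b"
    "\<And>U h h'. \<lbrakk>U \<in> Ob; h \<in> Mor C S U; h' \<in> Mor C S U; cmp A S U h i = cmp A S U h' i;
      cmp B S U h j = cmp B S U h' j\<rbrakk> \<Longrightarrow> h = h'"
  using assms unfolding coprod_def by blast+

lemma coprod_commute: "coprod S A B i j \<Longrightarrow> coprod S B A j i"
proof -
  assume "coprod S A B i j"
  note c = coprodE[OF this]
  show ?thesis
    unfolding coprod_def
  proof (intro conjI ballI impI)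
    fix U a b assume "U \<in> Ob" "a \<in> Mor C B U" "b \<in> Mor C A U"
    then show "\<exists>h\<in>Mor C S U. cmp B S U h j = a \<and> cmp A S U h i = b"
      using c(6)[of U b a] by blast
  next
    fix U h h' assume "U \<in> Ob" "h \<in> Mor C S U" "h' \<in> Mor C S U"
      "cmp B S U h j = cmp B S U h' j \<and> cmp A S U h i = cmp A S U h' i"
    then show "h = h'" using c(7)[of U h h'] by blast
  qed (use c in auto)
qed

lemma direct_sum_projections:
  assumes "is_direct_sum C A B S" "A \<in> Ob" "B \<in> Ob" "S \<in> Ob"
  obtains i j p q where "i \<in> Mor C A S" "j \<in> Mor C B S" "p \<in> Mor C S A" "q \<in> Mor C S B"
    "cmp A S A p i = idm A" "cmp B S B q j = idm B" "cmp A S B q i = ze A B" "cmp B S A p j = ze B A"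
    "ad S S (cmp S A S i p) (cmp S B S j q) = idm S"
  using assms(1) unfolding is_direct_sum_def cmp_def by blast

lemma direct_sum_coprod:
  assumes "is_direct_sum C A B S" and ob: "A \<in> Ob" "B \<in> Ob" "S \<in> Ob"
  obtains i j where "coprod S A B i j"
proof -
  obtain i j p q where d: "i \<in> Mor C A S" "j \<in> Mor C B S" "p \<in> Mor C S A" "q \<in> Mor C S B"
    "cmp A S A p i = idm A" "cmp B S B q j = idm B" "cmp A S B q i = ze A B" "cmp B S A p j = ze B A"
    "ad S S (cmp S A S i p) (cmp S B S j q) = idm S"
    using direct_sum_projections[OF assms] .
  have "\<exists>h\<in>Mor C S U. cmp A S U h i = a \<and> cmp B S U h j = b"
    if "U \<in> Ob" "a \<in> Mor C A U" "b \<in> Mor C B U" for U a b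
    by (rule bexI[of _ "ad S U (cmp S A U a p) (cmp S B U b q)"]) (use that ob d in \<open>auto simp: cmp_rules\<close>)
  moreover have "h = h'" if u: "U \<in> Ob" "h \<in> Mor C S U" "h' \<in> Mor C S U"
    "cmp A S U h i = cmp A S U h' i" "cmp B S U h j = cmp B S U h' j" for U h h'
  proof -
    have *: "k = ad S U (cmp S A U (cmp A S U k i) p) (cmp S B U (cmp B S U k j) q)"
      if "k \<in> Mor C S U" for k
    proof -
      have "k = cmp S S U k (idm S)" using that u ob by simp
      also have "\<dots> = cmp S S U k (ad S S (cmp S A S i p) (cmp S B S j q))" using d by simp
      also have "\<dots> = ad S U (cmp S A U (cmp A S U k i) p) (cmp S B U (cmp B S U k j) q)"
        using that u ob d(1-4) by (simp add: cmp_rules)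
      finally show ?thesis .
    qed
    show ?thesis using *[OF u(2)] *[OF u(3)] u by simp
  qed
  ultimately have "coprod S A B i j" using ob d unfolding coprod_def by blast
  then show ?thesis using that by blast
qed

text \<open>The projections are the morphisms with components (1, 0) and (0, 1), and the identity of
  \<open>S\<close> is recognised by its restrictions to \<open>A\<close> and
  \<open>B\<close>.\<close>

lemma coprod_direct_sum:
  assumes "coprod S A B i j"
  shows "is_direct_sum C A B S"
proof -
  note c = coprodE[OF assms]
  obtain p where p: "p \<in> Mor C S A" "cmp A S A p i = idm A" "cmp B S A p j = ze B A"
    using c(6)[of A "idm A" "ze B A"] c(1-5) by auto
  obtain q where q: "q \<in> Mor C S B" "cmp A S B q i = ze A B" "cmp B S B q j = idm B"
    using c(6)[of B "ze A B" "idm B"] c(1-5) by auto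
  have "ad S S (cmp S A S i p) (cmp S B S j q) = idm S"
    by (rule c(7)[of S]) (use c(1-5) p q in \<open>simp_all add: cmp_rules\<close>)
  then show ?thesis using p q c(1-5) unfolding is_direct_sum_def cmp_def by blast
qed

lemma coprod_ex:
  assumes "A \<in> Ob" "B \<in> Ob"
  obtains S i j where "coprod S A B i j"
  using direct_sum_ex[OF assms] direct_sum_coprod assms by metis

text \<open>The matrix with 1 on the diagonal and \<open>u\<close> below it is an automorphism of
  \<open>S\<close>. It serves to change generators and relations of a functor while the objects, and
  so the classes, stay fixed.\<close>

lemma coprod_shear:
  assumes "coprod S A B i j" and u: "u \<in> Mor C A B"
  shows "coprod S A B (ad A S i (cmp A B S j u)) j"
proof -
  note c = coprodE[OF assms(1)]
  have 1: "cmp A S U h (ad A S i (cmp A B S j u)) = ad A U (cmp A S U h i) (cmp A B U (cmp B S U h j) u)"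
    if "U \<in> Ob" "h \<in> Mor C S U" for U h
    using c(1-5) u that by (simp add: cmp_rules)
  show ?thesis
    unfolding coprod_def
  proof (intro conjI ballI impI)
    fix U a b assume U: "U \<in> Ob" "a \<in> Mor C A U" "b \<in> Mor C B U"
    \<comment> \<open>Subtracting b u from the first component undoes the contribution that the
      shear adds.\<close>
    obtain h where h: "h \<in> Mor C S U" "cmp A S U h i = ad A U a (neg A U (cmp A B U b u))" "cmp B S U h j = b"
      using c(6)[of U "ad A U a (neg A U (cmp A B U b u))" b] U u c(1-5) by auto
    then show "\<exists>h\<in>Mor C S U. cmp A S U h (ad A S i (cmp A B S j u)) = a \<and> cmp B S U h j = b"
      by (intro bexI[of _ h]) (use U u c(1-5) in \<open>auto simp: 1 ad_assoc\<close>)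
  next
    fix U h h' assume U: "U \<in> Ob" "h \<in> Mor C S U" "h' \<in> Mor C S U"
      "cmp A S U h (ad A S i (cmp A B S j u)) = cmp A S U h' (ad A S i (cmp A B S j u)) \<and> cmp B S U h j = cmp B S U h' j"
    then have "ad A U (cmp A S U h i) (cmp A B U (cmp B S U h j) u) =
      ad A U (cmp A S U h' i) (cmp A B U (cmp B S U h j) u)" using 1[OF U(1,2)] 1[OF U(1,3)] by metis
    then have "cmp A S U h i = cmp A S U h' i"
      using U u c(1-5) hom_group'[of A U] group.right_cancel[of "Hom C A U"] by simp
    then show "h = h'" using c(7) U by blast
  qed (use c(1-5) u in auto)
qed

section \<open>Classes of objects in the additive Grothendieck group\<close>

lemma triples_sub: "direct_sum_triples C \<subseteq> Ob \<times> Ob \<times> Ob"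
  unfolding direct_sum_triples_def by auto

sublocale K: grothendieck "Obj C" "direct_sum_triples C"
  by unfold_locales (rule triples_sub)

lemma K0_add_eq: "K0_add C = K.KG" and cls_add_eq: "cls_add C = K.cls"
  by (simp_all add: K0_add_def cls_add_def fun_eq_iff)

lemma cls_coprod:
  assumes "coprod S A B i j"
  shows "K.cls S = K.cls A \<otimes>\<^bsub>K.KG\<^esub> K.cls B"
  by (rule K.cls_sum)
    (use coprodE(1-3)[OF assms] coprod_direct_sum[OF assms] in \<open>simp add: direct_sum_triples_def\<close>)

text \<open>\<open>Z\<close> is the coproduct of two copies of itself, so its class is
  idempotent.\<close>

lemma cls_zero:
  assumes "Z \<in> Ob" "idm Z = ze Z Z"
  shows "K.cls Z = \<one>\<^bsub>K.KG\<^esub>"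
proof -
  have "coprod Z Z Z (idm Z) (idm Z)"
  proof -
    have z: "h = ze Z U" if "U \<in> Ob" "h \<in> Mor C Z U" for U h
      using cmp_id_right[of Z U h] cmp_ze_right[of Z Z U h] assms that by simp
    show ?thesis
      unfolding coprod_def
    proof (intro conjI ballI impI)
      fix U a b assume "U \<in> Ob" "a \<in> Mor C Z U" "b \<in> Mor C Z U"
      then show "\<exists>h\<in>Mor C Z U. cmp Z Z U h (idm Z) = a \<and> cmp Z Z U h (idm Z) = b"
        using z assms cmp_id_right by metis
    qed (use assms z in auto)
  qed
  from cls_coprod[OF this] show ?thesis
    using K.K.l_cancel_one' K.cls_closed[OF assms(1)] by metis
qed

text \<open>The relations speak of isomorphism only through direct sums; an isomorphic copy
  \<open>B\<close> of \<open>A\<close> is therefore read as a direct sum of \<open>A\<close> and a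
  zero object.\<close>

lemma cls_iso:
  assumes ob: "A \<in> Ob" "B \<in> Ob" and f: "f \<in> Mor C A B" "g \<in> Mor C B A"
    and fg: "cmp A B A g f = idm A" "cmp B A B f g = idm B"
  shows "K.cls A = K.cls B"
proof -
  obtain Z where Z: "Z \<in> Ob" "idm Z = ze Z Z" using zero_obj_ex by blast
  have "is_direct_sum C A Z B"
    unfolding is_direct_sum_def
  proof (intro bexI conjI)
    show "Comp C A g f = idm A" "Comp C Z (ze B Z) (ze Z B) = idm Z"
      "Comp C A (ze B Z) f = ze A Z" "Comp C Z g (ze Z B) = ze Z A"
      "ad B B (Comp C B f g) (Comp C B (ze Z B) (ze B Z)) = idm B"
      using fg ob f Z cmp_ze_left[of Z B Z "ze Z B"] cmp_ze_left[of A B Z f] cmp_ze_right[of Z B A g]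
        cmp_ze_left[of B Z B "ze B Z"] by (simp_all add: cmp_def)
  qed (use ob f Z in auto)
  then have "K.cls B = K.cls A \<otimes>\<^bsub>K.KG\<^esub> K.cls Z"
    using ob Z by (intro K.cls_sum) (simp add: direct_sum_triples_def)
  then show ?thesis using cls_zero[OF Z] ob by simp
qed

section \<open>Euler classes of morphisms\<close>

lemma cls_cokernel_unique:
  assumes ob: "A \<in> Ob" "B \<in> Ob" and f: "f \<in> Mor C A B"
    and q: "is_cokernel C A B f Q q" "is_cokernel C A B f Q' q'"
  shows "K.cls Q = K.cls Q'"
proof -
  note c = cokernelE[OF q(1) ob f] and c' = cokernelE[OF q(2) ob f]
  obtain h where h: "h \<in> Mor C Q Q'" "cmp B Q Q' h q = q'" using c(4)[of Q' q'] c' by auto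
  obtain h' where h': "h' \<in> Mor C Q' Q" "cmp B Q' Q h' q' = q" using c'(4)[of Q q] c by auto
  have "cmp Q Q' Q h' h = idm Q"
    by (rule c(5)[of Q]) (use c(1,2) c'(1,2) h h' ob f in \<open>simp_all add: cmp_assoc\<close>)
  moreover have "cmp Q' Q Q' h h' = idm Q'"
    by (rule c'(5)[of Q']) (use c(1,2) c'(1,2) h h' ob f in \<open>simp_all add: cmp_assoc\<close>)
  ultimately show ?thesis using cls_iso c(1) c'(1) h h' by blast
qed

text \<open>The left module class as a function of the presenting morphism alone. Which cokernel is
  selected does not matter, because isomorphic objects have equal classes
  (\<open>euler_eq\<close>).\<close>

definition euler :: "'o \<Rightarrow> 'o \<Rightarrow> 'm \<Rightarrow> ('o \<Rightarrow>\<^sub>0 int) set" where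
  "euler M N \<alpha> = K.cls M \<otimes>\<^bsub>K.KG\<^esub> inv\<^bsub>K.KG\<^esub> K.cls N \<otimes>\<^bsub>K.KG\<^esub>
     K.cls (SOME Q. \<exists>q. is_cokernel C M N \<alpha> Q q)"

lemma euler_eq:
  assumes ob: "M \<in> Ob" "N \<in> Ob" and f: "\<alpha> \<in> Mor C M N" and q: "is_cokernel C M N \<alpha> Q q"
  shows "euler M N \<alpha> = K.cls M \<otimes>\<^bsub>K.KG\<^esub> inv\<^bsub>K.KG\<^esub> K.cls N \<otimes>\<^bsub>K.KG\<^esub> K.cls Q"
proof -
  have "\<exists>q. is_cokernel C M N \<alpha> (SOME Q. \<exists>q. is_cokernel C M N \<alpha> Q q) q"
    by (rule someI[of "\<lambda>Q. \<exists>q. is_cokernel C M N \<alpha> Q q"]) (use q in blast)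
  then show ?thesis unfolding euler_def using cls_cokernel_unique[OF ob f] q by metis
qed

lemma euler_closed [simp]:
  assumes "M \<in> Ob" "N \<in> Ob" "\<alpha> \<in> Mor C M N"
  shows "euler M N \<alpha> \<in> carrier K.KG"
proof -
  obtain Q q where q: "is_cokernel C M N \<alpha> Q q" using cokernel_ex assms by blast
  show ?thesis using euler_eq[OF assms q] cokernelE(1)[OF q assms] assms by simp
qed

text \<open>Enlarging the target by \<open>Y\<close> enlarges the cokernel by \<open>Y\<close> as
  well; the two contributions have opposite signs and cancel.\<close>

lemma euler_inject:
  assumes M: "M \<in> Ob" "\<alpha> \<in> Mor C M N" and c: "coprod W N Y i j"
  shows "euler M W (cmp M N W i \<alpha>) = euler M N \<alpha>"
proof -
  note w = coprodE[OF c]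
  obtain Q \<beta> where q: "is_cokernel C M N \<alpha> Q \<beta>" using cokernel_ex[OF M(1) w(2) M(2)] by blast
  note k = cokernelE[OF q M(1) w(2) M(2)]
  obtain V i' j' where c': "coprod V Q Y i' j'" using coprod_ex k(1) w(3) by blast
  note v = coprodE[OF c']
  \<comment> \<open>\<open>b\<close> is the direct sum of \<beta> and the identity of
    \<open>Y\<close>, the expected cokernel map.\<close>
  obtain b where b: "b \<in> Mor C W V" "cmp N W V b i = cmp N Q V i' \<beta>" "cmp Y W V b j = j'"
    using w(6)[of V "cmp N Q V i' \<beta>" j'] v(1-5) k(1,2) w(1-5) by auto
  have bi: "cmp N W U (cmp W V U h b) i = cmp N Q U (cmp Q V U h i') \<beta>"
    and bj: "cmp Y W U (cmp W V U h b) j = cmp Y V U h j'"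
    if "U \<in> Ob" "h \<in> Mor C V U" for U h
    using that v(1-5) w(1-5) k(1,2) b by (simp_all add: cmp_rules)
  have "is_cokernel C M W (cmp M N W i \<alpha>) V b"
  proof (rule cokernelI)
    show "V \<in> Ob" "b \<in> Mor C W V" using v b by auto
    have "cmp M W V b (cmp M N W i \<alpha>) = cmp M N V (cmp N W V b i) \<alpha>"
      using M v(1-5) w(1-5) b(1) by (simp add: cmp_rules)
    also have "\<dots> = cmp M Q V i' (cmp M N Q \<beta> \<alpha>)"
      using M v(1-5) w(1-5) b(2) k(1,2) by (simp add: cmp_rules)
    also have "\<dots> = ze M V" using k(1-3) M v(1-5) by simp
    finally show "cmp M W V b (cmp M N W i \<alpha>) = ze M V" .
  next
    fix U g assume U: "U \<in> Ob" "g \<in> Mor C W U" "cmp M W U g (cmp M N W i \<alpha>) = ze M U"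
    then have "cmp M N U (cmp N W U g i) \<alpha> = ze M U" using M w(1-5) by (simp add: cmp_rules)
    then obtain h where h: "h \<in> Mor C Q U" "cmp N Q U h \<beta> = cmp N W U g i"
      using k(4)[of U "cmp N W U g i"] U w(1-5) by auto
    obtain t where t: "t \<in> Mor C V U" "cmp Q V U t i' = h" "cmp Y V U t j' = cmp Y W U g j"
      using v(6)[of U h "cmp Y W U g j"] U w(1-5) h by auto
    have "cmp W V U t b = g"
      by (rule w(7)[of U]) (use U t b(1) h v(1) w(1) in \<open>simp_all add: bi bj\<close>)
    then show "\<exists>h\<in>Mor C V U. cmp W V U h b = g" using t by blast
  next
    fix U h h' assume U: "U \<in> Ob" "h \<in> Mor C V U" "h' \<in> Mor C V U" "cmp W V U h b = cmp W V U h' b"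
    have "cmp Q V U h i' = cmp Q V U h' i'"
      by (rule k(5)[of U]) (use U v(1-5) bi[OF U(1,2)] bi[OF U(1,3)] in simp_all)
    moreover have "cmp Y V U h j' = cmp Y V U h' j'"
      using U bj[OF U(1,2)] bj[OF U(1,3)] by simp
    ultimately show "h = h'" using v(7) U by blast
  qed
  from euler_eq[OF M(1) w(1) _ this] euler_eq[OF M(1) w(2) M(2) q] cls_coprod[OF c] cls_coprod[OF c']
  show ?thesis
    using M w(1-5) k(1) v(1) by (simp add: K.K.inv_mult K.K.m_ac)
qed

text \<open>Inside N + N' the morphism (\<alpha>, \<alpha>') arises from \<alpha> by a shear along
  \<open>c\<close> and from \<alpha>' by a shear along \<open>c'\<close>. Both Euler classes thus
  agree with that of this common morphism.\<close>

lemma euler_same_image: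
  assumes ob: "M \<in> Ob" "N \<in> Ob" "N' \<in> Ob" and f: "\<alpha> \<in> Mor C M N" "\<alpha>' \<in> Mor C M N'"
    and c: "c \<in> Mor C N N'" "cmp M N N' c \<alpha> = \<alpha>'" and c': "c' \<in> Mor C N' N" "cmp M N' N c' \<alpha>' = \<alpha>"
  shows "euler M N \<alpha> = euler M N' \<alpha>'"
proof -
  obtain W i j where w: "coprod W N N' i j" using coprod_ex ob by blast
  note w' = coprodE[OF w]
  have "cmp M N W (ad N W i (cmp N N' W j c)) \<alpha> = ad M W (cmp M N W i \<alpha>) (cmp M N' W j \<alpha>')"
    using w'(1-5) ob f c by (simp add: cmp_rules)
  moreover have "cmp M N' W (ad N' W j (cmp N' N W i c')) \<alpha>' = ad M W (cmp M N' W j \<alpha>') (cmp M N W i \<alpha>)"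
    using w'(1-5) ob f c' by (simp add: cmp_rules)
  moreover have "\<dots> = ad M W (cmp M N W i \<alpha>) (cmp M N' W j \<alpha>')"
    using w'(1-5) ob f by (intro ad_comm) auto
  ultimately show ?thesis
    using euler_inject[OF ob(1) f(1) coprod_shear[OF w c(1)]]
      euler_inject[OF ob(1) f(2) coprod_shear[OF coprod_commute[OF w] c'(1)]] by simp
qed

text \<open>Adding an identity to \<alpha> does not change the cokernel, while [Y] occurs once in
  the source and once in the target.\<close>

lemma euler_sum_id:
  assumes s: "coprod S M Y i j" and s': "coprod S' N Y i' j'" and f: "\<alpha> \<in> Mor C M N"
    and A: "A \<in> Mor C S S'" "cmp M S S' A i = cmp M N S' i' \<alpha>" "cmp Y S S' A j = j'"
  shows "euler S S' A = euler M N \<alpha>"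
proof -
  note c = coprodE[OF s] and c' = coprodE[OF s']
  obtain Q \<beta> where q: "is_cokernel C M N \<alpha> Q \<beta>" using cokernel_ex[OF c(2) c'(2) f] by blast
  note k = cokernelE[OF q c(2) c'(2) f]
  \<comment> \<open>The cokernel map has to vanish on the summand \<open>Y\<close>, because the
    identity of \<open>Y\<close> hits all of it.\<close>
  obtain b where b: "b \<in> Mor C S' Q" "cmp N S' Q b i' = \<beta>" "cmp Y S' Q b j' = ze Y Q"
    using c'(6)[of Q \<beta> "ze Y Q"] k(1,2) c'(1-5) by auto
  have Ai: "cmp M S U (cmp S S' U g A) i = cmp M N U (cmp N S' U g i') \<alpha>"
    and Aj: "cmp Y S U (cmp S S' U g A) j = cmp Y S' U g j'" if "U \<in> Ob" "g \<in> Mor C S' U" for U g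
    using that c(1-5) c'(1-5) f A by (simp_all add: cmp_rules)
  have "is_cokernel C S S' A Q b"
  proof (rule cokernelI)
    show "cmp S S' Q b A = ze S Q"
      by (rule c(7)[of Q]) (use Ai Aj b k(1-3) c(1-5) c'(1-5) A in simp_all)
  next
    fix U g assume U: "U \<in> Ob" "g \<in> Mor C S' U" "cmp S S' U g A = ze S U"
    then have 1: "cmp M N U (cmp N S' U g i') \<alpha> = ze M U" "cmp Y S' U g j' = ze Y U"
      using Ai[OF U(1,2)] Aj[OF U(1,2)] c(1-5) by simp_all
    then obtain h where h: "h \<in> Mor C Q U" "cmp N Q U h \<beta> = cmp N S' U g i'"
      using k(4)[of U "cmp N S' U g i'"] U c'(1-5) by auto
    have "cmp S' Q U h b = g"
      by (rule c'(7)[of U]) (use U h b 1 k(1) c'(1-5) in \<open>simp_all add: cmp_rules\<close>)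
    then show "\<exists>h\<in>Mor C Q U. cmp S' Q U h b = g" using h by blast
  next
    fix U h h' assume U: "U \<in> Ob" "h \<in> Mor C Q U" "h' \<in> Mor C Q U" "cmp S' Q U h b = cmp S' Q U h' b"
    have "cmp N Q U x \<beta> = cmp N S' U (cmp S' Q U x b) i'" if "x \<in> Mor C Q U" for x
      using that U b k(1,2) c'(1-5) by (simp add: cmp_rules)
    then show "h = h'" using k(5)[OF U(1-3)] U by simp
  qed (use b k in auto)
  from euler_eq[OF c(1) c'(1) A(1) this] euler_eq[OF c(2) c'(2) f q] cls_coprod[OF s] cls_coprod[OF s']
  show ?thesis
    using c(1-5) c'(1-5) k(1) by (simp add: K.K.inv_mult K.K.m_ac)
qed

end

section \<open>Additive functors and their presentations\<close>

context additive_category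
begin

section \<open>Values and actions of additive functors\<close>

lemma fobj_group: "additive_functor C G \<Longrightarrow> U \<in> Ob \<Longrightarrow> comm_group (fobj G U)"
  unfolding additive_functor_def by blast

lemma fobj_group': "additive_functor C G \<Longrightarrow> U \<in> Ob \<Longrightarrow> group (fobj G U)"
  using fobj_group comm_group.axioms(2) by blast

lemma act_group_hom:
  "\<lbrakk>additive_functor C G; U \<in> Ob; V \<in> Ob; f \<in> Mor C U V\<rbrakk>
    \<Longrightarrow> group_hom (fobj G U) (fobj G V) (fmap G U V f)"
  by (simp add: group_hom_def group_hom_axioms_def fobj_group') (auto simp: additive_functor_def)

lemma fobj_one [simp]: "additive_functor C G \<Longrightarrow> U \<in> Ob \<Longrightarrow> \<one>\<^bsub>fobj G U\<^esub> \<in> carrier (fobj G U)"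
  using fobj_group' group.is_monoid monoid.one_closed by metis
lemma fobj_mult [simp]: "\<lbrakk>additive_functor C G; U \<in> Ob; x \<in> carrier (fobj G U); y \<in> carrier (fobj G U)\<rbrakk>
    \<Longrightarrow> x \<otimes>\<^bsub>fobj G U\<^esub> y \<in> carrier (fobj G U)"
  using fobj_group' group.is_monoid monoid.m_closed by metis
lemma fobj_inv [simp]: "\<lbrakk>additive_functor C G; U \<in> Ob; x \<in> carrier (fobj G U)\<rbrakk>
    \<Longrightarrow> inv\<^bsub>fobj G U\<^esub> x \<in> carrier (fobj G U)"
  using fobj_group' group.inv_closed by metis
lemma fobj_l_one [simp]: "\<lbrakk>additive_functor C G; U \<in> Ob; x \<in> carrier (fobj G U)\<rbrakk>
    \<Longrightarrow> \<one>\<^bsub>fobj G U\<^esub> \<otimes>\<^bsub>fobj G U\<^esub> x = x"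
  using fobj_group' group.is_monoid monoid.l_one by metis
lemma fobj_r_one [simp]: "\<lbrakk>additive_functor C G; U \<in> Ob; x \<in> carrier (fobj G U)\<rbrakk>
    \<Longrightarrow> x \<otimes>\<^bsub>fobj G U\<^esub> \<one>\<^bsub>fobj G U\<^esub> = x"
  using fobj_group' group.is_monoid monoid.r_one by metis
lemma fobj_r_inv [simp]: "\<lbrakk>additive_functor C G; U \<in> Ob; x \<in> carrier (fobj G U)\<rbrakk>
    \<Longrightarrow> x \<otimes>\<^bsub>fobj G U\<^esub> inv\<^bsub>fobj G U\<^esub> x = \<one>\<^bsub>fobj G U\<^esub>"
  using fobj_group' group.r_inv by metis
lemma fobj_l_inv [simp]: "\<lbrakk>additive_functor C G; U \<in> Ob; x \<in> carrier (fobj G U)\<rbrakk>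
    \<Longrightarrow> inv\<^bsub>fobj G U\<^esub> x \<otimes>\<^bsub>fobj G U\<^esub> x = \<one>\<^bsub>fobj G U\<^esub>"
  using fobj_group' group.l_inv by metis
lemma fobj_comm: "\<lbrakk>additive_functor C G; U \<in> Ob; x \<in> carrier (fobj G U); y \<in> carrier (fobj G U)\<rbrakk>
    \<Longrightarrow> x \<otimes>\<^bsub>fobj G U\<^esub> y = y \<otimes>\<^bsub>fobj G U\<^esub> x"
  using fobj_group comm_group.axioms(1) comm_monoid.m_comm by metis
lemma fobj_assoc: "\<lbrakk>additive_functor C G; U \<in> Ob; x \<in> carrier (fobj G U); y \<in> carrier (fobj G U);
    z \<in> carrier (fobj G U)\<rbrakk> \<Longrightarrow> x \<otimes>\<^bsub>fobj G U\<^esub> y \<otimes>\<^bsub>fobj G U\<^esub> z = x \<otimes>\<^bsub>fobj G U\<^esub> (y \<otimes>\<^bsub>fobj G U\<^esub> z)"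
  using fobj_group' group.is_monoid monoid.m_assoc by metis
lemma fobj_eq_iff: "\<lbrakk>additive_functor C G; U \<in> Ob; x \<in> carrier (fobj G U); y \<in> carrier (fobj G U)\<rbrakk>
    \<Longrightarrow> x \<otimes>\<^bsub>fobj G U\<^esub> inv\<^bsub>fobj G U\<^esub> y = \<one>\<^bsub>fobj G U\<^esub> \<longleftrightarrow> x = y"
  using fobj_group' group.inv_solve_right'[of "fobj G U" "\<one>\<^bsub>fobj G U\<^esub>" x y] by auto

lemma act_closed [simp]:
  "\<lbrakk>additive_functor C G; U \<in> Ob; V \<in> Ob; f \<in> Mor C U V; x \<in> carrier (fobj G U)\<rbrakk>
    \<Longrightarrow> fmap G U V f x \<in> carrier (fobj G V)"
  using act_group_hom group_hom.hom_closed by metis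
lemma act_mult:
  "\<lbrakk>additive_functor C G; U \<in> Ob; V \<in> Ob; f \<in> Mor C U V; x \<in> carrier (fobj G U); y \<in> carrier (fobj G U)\<rbrakk>
    \<Longrightarrow> fmap G U V f (x \<otimes>\<^bsub>fobj G U\<^esub> y) = fmap G U V f x \<otimes>\<^bsub>fobj G V\<^esub> fmap G U V f y"
  using act_group_hom group_hom.hom_mult by metis
lemma act_one [simp]:
  "\<lbrakk>additive_functor C G; U \<in> Ob; V \<in> Ob; f \<in> Mor C U V\<rbrakk> \<Longrightarrow> fmap G U V f \<one>\<^bsub>fobj G U\<^esub> = \<one>\<^bsub>fobj G V\<^esub>"
  using act_group_hom group_hom.hom_one by metis
lemma act_inv:
  "\<lbrakk>additive_functor C G; U \<in> Ob; V \<in> Ob; f \<in> Mor C U V; x \<in> carrier (fobj G U)\<rbrakk>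
    \<Longrightarrow> fmap G U V f (inv\<^bsub>fobj G U\<^esub> x) = inv\<^bsub>fobj G V\<^esub> (fmap G U V f x)"
  using act_group_hom group_hom.hom_inv by metis
lemma act_id [simp]:
  "\<lbrakk>additive_functor C G; U \<in> Ob; x \<in> carrier (fobj G U)\<rbrakk> \<Longrightarrow> fmap G U U (idm U) x = x"
  unfolding additive_functor_def by blast
lemma act_cmp:
  "\<lbrakk>additive_functor C G; U \<in> Ob; V \<in> Ob; W \<in> Ob; f \<in> Mor C U V; g \<in> Mor C V W; x \<in> carrier (fobj G U)\<rbrakk>
    \<Longrightarrow> fmap G U W (cmp U V W g f) x = fmap G V W g (fmap G U V f x)"
  unfolding additive_functor_def cmp_def by blast
lemma act_ad:
  "\<lbrakk>additive_functor C G; U \<in> Ob; V \<in> Ob; f \<in> Mor C U V; g \<in> Mor C U V; x \<in> carrier (fobj G U)\<rbrakk>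
    \<Longrightarrow> fmap G U V (ad U V f g) x = fmap G U V f x \<otimes>\<^bsub>fobj G V\<^esub> fmap G U V g x"
  unfolding additive_functor_def by blast
lemma act_ze [simp]:
  assumes "additive_functor C G" "U \<in> Ob" "V \<in> Ob" "x \<in> carrier (fobj G U)"
  shows "fmap G U V (ze U V) x = \<one>\<^bsub>fobj G V\<^esub>"
proof -
  have "fmap G U V (ze U V) x \<otimes>\<^bsub>fobj G V\<^esub> fmap G U V (ze U V) x = fmap G U V (ze U V) x"
    using assms by (simp flip: act_ad)
  then show ?thesis using group.l_cancel_one[OF fobj_group'[OF assms(1,3)]] assms by simp
qed
lemma act_neg:
  assumes "additive_functor C G" "U \<in> Ob" "V \<in> Ob" "f \<in> Mor C U V" "x \<in> carrier (fobj G U)"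
  shows "fmap G U V (neg U V f) x = inv\<^bsub>fobj G V\<^esub> fmap G U V f x"
proof -
  have "fmap G U V (neg U V f) x \<otimes>\<^bsub>fobj G V\<^esub> fmap G U V f x = \<one>\<^bsub>fobj G V\<^esub>"
    using assms by (simp flip: act_ad)
  then show ?thesis using group.inv_equality[OF fobj_group'[OF assms(1,3)]] assms by simp
qed

lemmas act_rules = act_mult act_inv act_cmp act_ad act_neg

lemma hom_functor_additive:
  assumes "M \<in> Ob"
  shows "additive_functor C (hom_functor C M)"
  unfolding additive_functor_def hom_functor_def ab_functor.simps
proof (intro conjI ballI)
  show "comm_group (Hom C M U)" if "U \<in> Ob" for U using hom_group that assms by blast
next
  fix U V f assume "U \<in> Ob" "V \<in> Ob" "f \<in> Mor C U V"
  then show "Comp C M f \<in> hom (Hom C M U) (Hom C M V)"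
    using assms comp_closed0 comp_add_right0 by (intro homI) blast+
next
  show "Comp C M (idm U) x = x" if "U \<in> Ob" "x \<in> Mor C M U" for U x
    using that assms id_left0 by blast
next
  show "Comp C M (Comp C U g f) x = Comp C M g (Comp C M f x)"
    if "U \<in> Ob" "V \<in> Ob" "W \<in> Ob" "f \<in> Mor C U V" "g \<in> Mor C V W" "x \<in> Mor C M U" for U V W f g x
    using that assms comp_assoc0 by blast
next
  show "Comp C M (ad U V f g) x = ad M V (Comp C M f x) (Comp C M g x)"
    if "U \<in> Ob" "V \<in> Ob" "f \<in> Mor C U V" "g \<in> Mor C U V" "x \<in> Mor C M U" for U V f g x
    using that assms comp_add_left0 by blast
qed

text \<open>Presentations in Yoneda form: the epimorphism \<open>Hom(M,-) \<rightarrow> G\<close> is given by an element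
  \<open>x\<close> of \<open>G(M)\<close>.\<close>

definition pres :: "('o, 'm, 'v) ab_functor \<Rightarrow> 'v \<Rightarrow> 'o \<Rightarrow> 'o \<Rightarrow> 'm \<Rightarrow> bool" where
  "pres G x M N \<alpha> \<longleftrightarrow> M \<in> Ob \<and> N \<in> Ob \<and> \<alpha> \<in> Mor C M N \<and> x \<in> carrier (fobj G M) \<and>
     (\<forall>U\<in>Ob. \<forall>y\<in>carrier (fobj G U). \<exists>h\<in>Mor C M U. fmap G M U h x = y) \<and>
     (\<forall>U\<in>Ob. \<forall>h\<in>Mor C M U. fmap G M U h x = \<one>\<^bsub>fobj G U\<^esub> \<longleftrightarrow> (\<exists>k\<in>Mor C N U. h = cmp M N U k \<alpha>))"

lemma presE:
  assumes "pres G x M N \<alpha>"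
  shows "M \<in> Ob" "N \<in> Ob" "\<alpha> \<in> Mor C M N" "x \<in> carrier (fobj G M)"
    "\<And>U y. \<lbrakk>U \<in> Ob; y \<in> carrier (fobj G U)\<rbrakk> \<Longrightarrow> \<exists>h\<in>Mor C M U. fmap G M U h x = y"
    "\<And>U h. \<lbrakk>U \<in> Ob; h \<in> Mor C M U\<rbrakk> \<Longrightarrow> fmap G M U h x = \<one>\<^bsub>fobj G U\<^esub> \<longleftrightarrow> (\<exists>k\<in>Mor C N U. h = cmp M N U k \<alpha>)"
  using assms unfolding pres_def by blast+

lemma pres_rel:
  assumes "pres G x M N \<alpha>"
  shows "fmap G M N \<alpha> x = \<one>\<^bsub>fobj G N\<^esub>"
proof -
  note p = presE[OF assms]
  have "\<exists>k\<in>Mor C N N. \<alpha> = cmp M N N k \<alpha>" using p(1-3) by (intro bexI[of _ "idm N"]) auto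
  then show ?thesis using p(6)[OF p(2,3)] by blast
qed

lemma nat_transE:
  assumes "\<eta> \<in> nat_trans C F G" "U \<in> Ob"
  shows "\<And>x. x \<in> carrier (fobj F U) \<Longrightarrow> \<eta> U x \<in> carrier (fobj G U)"
    "\<And>x y. \<lbrakk>x \<in> carrier (fobj F U); y \<in> carrier (fobj F U)\<rbrakk>
      \<Longrightarrow> \<eta> U (x \<otimes>\<^bsub>fobj F U\<^esub> y) = \<eta> U x \<otimes>\<^bsub>fobj G U\<^esub> \<eta> U y"
    "\<And>V f x. \<lbrakk>V \<in> Ob; f \<in> Mor C U V; x \<in> carrier (fobj F U)\<rbrakk>
      \<Longrightarrow> \<eta> V (fmap F U V f x) = fmap G U V f (\<eta> U x)"
  using assms unfolding nat_trans_def hom_def by fastforce+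

lemma nat_trans_one:
  assumes "\<eta> \<in> nat_trans C F G" "U \<in> Ob" "additive_functor C F" "additive_functor C G"
  shows "\<eta> U \<one>\<^bsub>fobj F U\<^esub> = \<one>\<^bsub>fobj G U\<^esub>"
proof -
  have "\<eta> U \<in> hom (fobj F U) (fobj G U)" using assms unfolding nat_trans_def by blast
  then show ?thesis using fobj_group' assms hom_one by metis
qed

lemma nat_trans_inv:
  assumes "\<eta> \<in> nat_trans C F G" "U \<in> Ob" "additive_functor C F" "additive_functor C G"
    "x \<in> carrier (fobj F U)"
  shows "\<eta> U (inv\<^bsub>fobj F U\<^esub> x) = inv\<^bsub>fobj G U\<^esub> \<eta> U x"
proof -
  have "\<eta> U \<in> hom (fobj F U) (fobj G U)" using assms unfolding nat_trans_def by blast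
  then have "group_hom (fobj F U) (fobj G U) (\<eta> U)"
    using fobj_group'[OF assms(3,2)] fobj_group'[OF assms(4,2)]
    by (simp add: group_hom_def group_hom_axioms_def)
  then show ?thesis using assms(5) by (rule group_hom.hom_inv)
qed

lemma nat_transI:
  assumes "\<And>U x. U \<in> Ob \<Longrightarrow> x \<in> carrier (fobj F U) \<Longrightarrow> \<eta> U x \<in> carrier (fobj G U)"
    "\<And>U x y. \<lbrakk>U \<in> Ob; x \<in> carrier (fobj F U); y \<in> carrier (fobj F U)\<rbrakk>
      \<Longrightarrow> \<eta> U (x \<otimes>\<^bsub>fobj F U\<^esub> y) = \<eta> U x \<otimes>\<^bsub>fobj G U\<^esub> \<eta> U y"
    "\<And>U V f x. \<lbrakk>U \<in> Ob; V \<in> Ob; f \<in> Mor C U V; x \<in> carrier (fobj F U)\<rbrakk>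
      \<Longrightarrow> \<eta> V (fmap F U V f x) = fmap G U V f (\<eta> U x)"
    and F: "additive_functor C F"
  shows "(\<lambda>U\<in>Ob. \<lambda>x\<in>carrier (fobj F U). \<eta> U x) \<in> nat_trans C F G"
  unfolding nat_trans_def hom_def using assms(1-3) F by auto

lemma yoneda:
  assumes \<pi>: "\<pi> \<in> nat_trans C (hom_functor C M) G" and U: "M \<in> Ob" "U \<in> Ob" "h \<in> Mor C M U"
  shows "\<pi> U h = fmap G M U h (\<pi> M (idm M))"
proof -
  have "\<pi> U (fmap (hom_functor C M) M U h (idm M)) = fmap G M U h (\<pi> M (idm M))"
    by (rule nat_transE(3)[OF \<pi> U(1,2,3)]) (use U in \<open>simp add: hom_functor_def\<close>)
  moreover have "fmap (hom_functor C M) M U h (idm M) = h"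
    using U id_right0 by (simp add: hom_functor_def)
  ultimately show ?thesis by simp
qed

text \<open>By Yoneda the epimorphism is evaluation at the image of the identity of
  \<open>M\<close>, and naturality makes every element of G(M) a possible choice.\<close>

lemma presents_iff:
  assumes G: "additive_functor C G"
  shows "presents C M N \<alpha> G \<longleftrightarrow> (\<exists>x. pres G x M N \<alpha>)"
proof
  assume "presents C M N \<alpha> G"
  then obtain \<pi> where mn: "M \<in> Ob" "N \<in> Ob" "\<alpha> \<in> Mor C M N" and \<pi>: "\<pi> \<in> nat_trans C (hom_functor C M) G"
    and ex: "\<And>U. U \<in> Ob \<Longrightarrow> \<pi> U ` Mor C M U = carrier (fobj G U)"
      "\<And>U. U \<in> Ob \<Longrightarrow> kernel (Hom C M U) (fobj G U) (\<pi> U) = (\<lambda>h. Comp C M h \<alpha>) ` Mor C N U"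
    unfolding presents_def by blast
  note y = yoneda[OF \<pi> mn(1)]
  have "pres G (\<pi> M (idm M)) M N \<alpha>"
    unfolding pres_def
  proof (intro conjI ballI)
    show "\<pi> M (idm M) \<in> carrier (fobj G M)" using ex(1)[OF mn(1)] id_closed[OF mn(1)] by blast
  next
    fix U z assume "U \<in> Ob" "z \<in> carrier (fobj G U)"
    then show "\<exists>h\<in>Mor C M U. fmap G M U h (\<pi> M (idm M)) = z" using ex(1) y by (metis imageE)
  next
    fix U h assume U: "U \<in> Ob" "h \<in> Mor C M U"
    have "fmap G M U h (\<pi> M (idm M)) = \<one>\<^bsub>fobj G U\<^esub> \<longleftrightarrow> h \<in> kernel (Hom C M U) (fobj G U) (\<pi> U)"
      using U y unfolding kernel_def by auto
    also have "\<dots> \<longleftrightarrow> (\<exists>k\<in>Mor C N U. h = cmp M N U k \<alpha>)" using ex(2)[OF U(1)] unfolding cmp_def by auto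
    finally show "fmap G M U h (\<pi> M (idm M)) = \<one>\<^bsub>fobj G U\<^esub> \<longleftrightarrow> (\<exists>k\<in>Mor C N U. h = cmp M N U k \<alpha>)" .
  qed (use mn in auto)
  then show "\<exists>x. pres G x M N \<alpha>" by blast
next
  assume "\<exists>x. pres G x M N \<alpha>"
  then obtain x where p: "pres G x M N \<alpha>" by blast
  note p' = presE[OF p]
  let ?\<pi> = "\<lambda>U\<in>Ob. \<lambda>h\<in>carrier (fobj (hom_functor C M) U). fmap G M U h x"
  have "?\<pi> \<in> nat_trans C (hom_functor C M) G"
    by (rule nat_transI[OF _ _ _ hom_functor_additive[OF p'(1)]])
      (use G p'(1-4) act_cmp[OF G p'(1), unfolded cmp_def] in \<open>simp_all add: hom_functor_def act_ad\<close>)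
  moreover have "?\<pi> U ` Mor C M U = carrier (fobj G U)" if "U \<in> Ob" for U
    using that p'(1-4) p'(5)[OF that] act_closed[OF G] by (force simp: hom_functor_def)
  moreover have "kernel (Hom C M U) (fobj G U) (?\<pi> U) = (\<lambda>h. Comp C M h \<alpha>) ` Mor C N U" if U: "U \<in> Ob" for U
  proof -
    have "kernel (Hom C M U) (fobj G U) (?\<pi> U) = {h \<in> Mor C M U. fmap G M U h x = \<one>\<^bsub>fobj G U\<^esub>}"
      using U by (auto simp: kernel_def hom_functor_def)
    also have "\<dots> = {h \<in> Mor C M U. \<exists>k\<in>Mor C N U. h = cmp M N U k \<alpha>}" using p'(6)[OF U] by blast
    also have "\<dots> = (\<lambda>h. Comp C M h \<alpha>) ` Mor C N U"
      using cmp_closed[OF p'(1,2) U p'(3)] unfolding cmp_def by auto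
    finally show ?thesis .
  qed
  ultimately show "presents C M N \<alpha> G" unfolding presents_def using p'(1-3) by blast
qed

lemma pres_add:
  assumes G: "additive_functor C G" and p: "pres G x M N \<alpha>" and Y: "Y \<in> Ob" and c: "coprod S M Y i j"
  obtains S' A where "pres G (fmap G M S i x) S S' A" "euler S S' A = euler M N \<alpha>"
proof -
  note p' = presE[OF p] and s = coprodE[OF c]
  obtain S' i' j' where c': "coprod S' N Y i' j'" using coprod_ex p'(2) Y by blast
  note s' = coprodE[OF c']
  obtain A where A: "A \<in> Mor C S S'" "cmp M S S' A i = cmp M N S' i' \<alpha>" "cmp Y S S' A j = j'"
    using s(6)[of S' "cmp M N S' i' \<alpha>" j'] s'(1-5) p'(1-3) by auto
  have Ai: "cmp M S U (cmp S S' U g A) i = cmp M N U (cmp N S' U g i') \<alpha>"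
    and Aj: "cmp Y S U (cmp S S' U g A) j = cmp Y S' U g j'" if "U \<in> Ob" "g \<in> Mor C S' U" for U g
    using that s(1-5) s'(1-5) p'(1-3) A by (simp_all add: cmp_rules)
  have "pres G (fmap G M S i x) S S' A"
    unfolding pres_def
  proof (intro conjI ballI)
    fix U y assume U: "U \<in> Ob" "y \<in> carrier (fobj G U)"
    obtain h where h: "h \<in> Mor C M U" "fmap G M U h x = y" using p'(5)[OF U] by blast
    obtain k where k: "k \<in> Mor C S U" "cmp M S U k i = h"
      using s(6)[of U h "ze Y U"] U h s(3) by auto
    then show "\<exists>h\<in>Mor C S U. fmap G S U h (fmap G M S i x) = y"
      using h s(1-5) p'(1-4) U G act_cmp[of G M S U i k x] by (intro bexI[of _ k]) auto
  next
    fix U h assume U: "U \<in> Ob" "h \<in> Mor C S U"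
    have "fmap G S U h (fmap G M S i x) = \<one>\<^bsub>fobj G U\<^esub> \<longleftrightarrow> (\<exists>k\<in>Mor C N U. cmp M S U h i = cmp M N U k \<alpha>)"
      using p'(6)[of U "cmp M S U h i"] U s(1-5) p'(1-4) G by (simp add: act_cmp)
    also have "\<dots> \<longleftrightarrow> (\<exists>k\<in>Mor C S' U. h = cmp S S' U k A)"
    proof
      assume "\<exists>k\<in>Mor C N U. cmp M S U h i = cmp M N U k \<alpha>"
      then obtain k where k: "k \<in> Mor C N U" "cmp M S U h i = cmp M N U k \<alpha>" by blast
      obtain t where t: "t \<in> Mor C S' U" "cmp N S' U t i' = k" "cmp Y S' U t j' = cmp Y S U h j"
        using s'(6)[of U k "cmp Y S U h j"] U k s(1-5) by auto
      have "h = cmp S S' U t A"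
        by (rule s(7)[of U]) (use U t k s(1) s'(1) A(1) in \<open>simp_all add: Ai Aj\<close>)
      then show "\<exists>k\<in>Mor C S' U. h = cmp S S' U k A" using t by blast
    next
      assume "\<exists>k\<in>Mor C S' U. h = cmp S S' U k A"
      then obtain k where k: "k \<in> Mor C S' U" "h = cmp S S' U k A" by blast
      then show "\<exists>k\<in>Mor C N U. cmp M S U h i = cmp M N U k \<alpha>"
        using Ai[OF U(1) k(1)] U s'(1-5) by (intro bexI[of _ "cmp N S' U k i'"]) auto
    qed
    finally show "fmap G S U h (fmap G M S i x) = \<one>\<^bsub>fobj G U\<^esub> \<longleftrightarrow> (\<exists>k\<in>Mor C S' U. h = cmp S S' U k A)" .
  qed (use s(1-5) s'(1-5) A p'(1-4) G in simp_all)
  then show ?thesis using that euler_sum_id[OF c c' p'(3) A] by blast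
qed

text \<open>Both presentations are compared with presentations whose generator is
  \<open>(x, x') \<in> G(M \<oplus> M')\<close>; shearing \<open>M \<oplus> M'\<close> turns this generator into \<open>(x, 0)\<close> or \<open>(0, x')\<close>.\<close>

lemma euler_independent:
  assumes G: "additive_functor C G" and p: "pres G x M N \<alpha>" and p': "pres G x' M' N' \<alpha>'"
  shows "euler M N \<alpha> = euler M' N' \<alpha>'"
proof -
  note a = presE[OF p] and b = presE[OF p']
  obtain u where u: "u \<in> Mor C M M'" "fmap G M M' u x = x'" using a(5)[OF b(1,4)] by blast
  obtain u' where u': "u' \<in> Mor C M' M" "fmap G M' M u' x' = x" using b(5)[OF a(1,4)] by blast
  obtain S i j where c: "coprod S M M' i j" using coprod_ex a(1) b(1) by blast
  note s = coprodE[OF c]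
  define w where "w = fmap G M S i x \<otimes>\<^bsub>fobj G S\<^esub> fmap G M' S j x'"
  have w1: "fmap G M S (ad M S i (cmp M M' S j u)) x = w"
    using a(1-4) b(1-4) u s(1-5) G by (simp add: act_rules w_def)
  have w2: "fmap G M' S (ad M' S j (cmp M' M S i u')) x' = w"
    using a(1-4) b(1-4) u' s(1-5) G fobj_comm[OF G s(1), of "fmap G M S i x" "fmap G M' S j x'"]
    by (simp add: act_rules w_def)
  obtain S1 A1 where 1: "pres G w S S1 A1" "euler S S1 A1 = euler M N \<alpha>"
    using pres_add[OF G p b(1) coprod_shear[OF c u(1)]] w1 by metis
  obtain S2 A2 where 2: "pres G w S S2 A2" "euler S S2 A2 = euler M' N' \<alpha>'"
    using pres_add[OF G p' a(1) coprod_shear[OF coprod_commute[OF c] u'(1)]] w2 by metis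
  note e1 = presE[OF 1(1)] and e2 = presE[OF 2(1)]
  \<comment> \<open>Both morphisms present \<open>G\<close> on the same generator \<open>w\<close>.
    Each of them annihilates \<open>w\<close>, so each factors through the other.\<close>
  obtain k where k: "k \<in> Mor C S1 S2" "A2 = cmp S S1 S2 k A1"
    using pres_rel[OF 2(1)] e1(6)[OF e2(2,3)] by blast
  obtain k' where k': "k' \<in> Mor C S2 S1" "A1 = cmp S S2 S1 k' A2"
    using pres_rel[OF 1(1)] e2(6)[OF e1(2,3)] by blast
  show ?thesis
    using euler_same_image[OF e1(1,2) e2(2) e1(3) e2(3) k(1) k(2)[symmetric] k'(1) k'(2)[symmetric]]
      1(2) 2(2) by simp
qed

text \<open>Exactness of the sequences of values in abelian groups, where elements can be chased.
  Its agreement with \<open>short_exact\<close> in the functor category is shown further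
  below.\<close>

definition pt_exact where
  "pt_exact F \<phi> G \<psi> H \<longleftrightarrow> \<phi> \<in> nat_trans C F G \<and> \<psi> \<in> nat_trans C G H \<and>
     (\<forall>U\<in>Ob. (\<forall>x\<in>carrier (fobj F U). \<phi> U x = \<one>\<^bsub>fobj G U\<^esub> \<longrightarrow> x = \<one>\<^bsub>fobj F U\<^esub>) \<and>
        (\<forall>y\<in>carrier (fobj G U). \<psi> U y = \<one>\<^bsub>fobj H U\<^esub> \<longleftrightarrow> (\<exists>x\<in>carrier (fobj F U). \<phi> U x = y)) \<and>
        (\<forall>z\<in>carrier (fobj H U). \<exists>y\<in>carrier (fobj G U). \<psi> U y = z))"

lemma pt_exactE:
  assumes "pt_exact F \<phi> G \<psi> H"
  shows "\<phi> \<in> nat_trans C F G" "\<psi> \<in> nat_trans C G H"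
    "\<And>U x. \<lbrakk>U \<in> Ob; x \<in> carrier (fobj F U); \<phi> U x = \<one>\<^bsub>fobj G U\<^esub>\<rbrakk> \<Longrightarrow> x = \<one>\<^bsub>fobj F U\<^esub>"
    "\<And>U y. \<lbrakk>U \<in> Ob; y \<in> carrier (fobj G U)\<rbrakk>
      \<Longrightarrow> \<psi> U y = \<one>\<^bsub>fobj H U\<^esub> \<longleftrightarrow> (\<exists>x\<in>carrier (fobj F U). \<phi> U x = y)"
    "\<And>U z. \<lbrakk>U \<in> Ob; z \<in> carrier (fobj H U)\<rbrakk> \<Longrightarrow> \<exists>y\<in>carrier (fobj G U). \<psi> U y = z"
  using assms unfolding pt_exact_def by blast+

end

section \<open>Additivity of the Euler class on exact sequences\<close>

context additive_category
begin

text \<open>Horseshoe lemma. The relations of \<open>G\<close> are triangular with the relations of \<open>F\<close> and \<open>H\<close> on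
  the diagonal, and so is the map onto the cokernel; \<open>v\<close> and \<open>t\<close> are the off-diagonal entries.\<close>

lemma horseshoe:
  assumes F: "additive_functor C F" and G: "additive_functor C G" and H: "additive_functor C H"
    and ex: "pt_exact F \<phi> G \<psi> H" and pF: "pres F x M N \<alpha>" and pH: "pres H z M2 N2 \<alpha>2"
  obtains w S S' A where "pres G w S S' A" "euler S S' A = euler M N \<alpha> \<otimes>\<^bsub>K.KG\<^esub> euler M2 N2 \<alpha>2"
proof -
  note e = pt_exactE[OF ex]
  note a = presE[OF pF] and b = presE[OF pH]
  note nf = nat_transE[OF e(1)] and ng = nat_transE[OF e(2)]
  note n1 = nat_trans_one[OF e(1) _ F G] nat_trans_one[OF e(2) _ G H]
  have comp0: "\<psi> U (\<phi> U y) = \<one>\<^bsub>fobj H U\<^esub>" if "U \<in> Ob" "y \<in> carrier (fobj F U)" for U y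
    using e(4)[of U "\<phi> U y"] nf(1) that by blast
  have inj: "y = \<one>\<^bsub>fobj F U\<^esub>" if "U \<in> Ob" "y \<in> carrier (fobj F U)" "\<phi> U y = \<one>\<^bsub>fobj G U\<^esub>" for U y
    using e(3) that by blast
  obtain y where y: "y \<in> carrier (fobj G M2)" "\<psi> M2 y = z" using e(5)[OF b(1,4)] by blast
  \<comment> \<open>The lift \<open>y\<close> of the generator of \<open>H\<close> need not satisfy
    the relation \<open>\<alpha>2\<close>. The defect lies in the image of \<open>F\<close> and is
    written there as a multiple \<open>v\<close> of the generator \<open>x\<close>.\<close>
  have "\<psi> N2 (fmap G M2 N2 \<alpha>2 y) = \<one>\<^bsub>fobj H N2\<^esub>"
    using ng(3)[OF b(1,2,3) y(1)] y(2) pres_rel[OF pH] by simp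
  then obtain w where w: "w \<in> carrier (fobj F N2)" "\<phi> N2 w = fmap G M2 N2 \<alpha>2 y"
    using e(4)[of N2 "fmap G M2 N2 \<alpha>2 y"] b(1-3) y G by auto
  obtain v where v: "v \<in> Mor C M N2" "fmap F M N2 v x = w" using a(5)[OF b(2) w(1)] by blast
  obtain S i j where c: "coprod S M M2 i j" using coprod_ex a(1) b(1) by blast
  note s = coprodE[OF c]
  obtain S' i' j' where c': "coprod S' N N2 i' j'" using coprod_ex a(2) b(2) by blast
  note s' = coprodE[OF c']
  obtain Q \<beta> where q: "is_cokernel C M N \<alpha> Q \<beta>" using cokernel_ex[OF a(1-3)] by blast
  obtain Q2 \<beta>2 where q2: "is_cokernel C M2 N2 \<alpha>2 Q2 \<beta>2" using cokernel_ex[OF b(1-3)] by blast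
  note k = cokernelE[OF q a(1-3)] and k2 = cokernelE[OF q2 b(1-3)]
  obtain V i'' j'' where c'': "coprod V Q Q2 i'' j''" using coprod_ex k(1) k2(1) by blast
  note s'' = coprodE[OF c'']
  note obs [simp] = a(1-4) b(1-4) s(1-5) s'(1-5) s''(1-5) k(1-2) k2(1-2) v(1) w(1) y(1) F G H
  \<comment> \<open>The entry -v compensates the defect of the lift \<open>y\<close>, so that the
    combined generator satisfies these relations.\<close>
  obtain A where A: "A \<in> Mor C S S'"
      "cmp M S S' A i = ad M S' (cmp M N S' i' \<alpha>) (neg M S' (cmp M N2 S' j' v))"
      "cmp M2 S S' A j = cmp M2 N2 S' j' \<alpha>2"
    using s(6)[of S' "ad M S' (cmp M N S' i' \<alpha>) (neg M S' (cmp M N2 S' j' v))" "cmp M2 N2 S' j' \<alpha>2"]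
    by auto
  note A(1) [simp]
  have Ai: "cmp M S U (cmp S S' U g A) i
        = ad M U (cmp M N U (cmp N S' U g i') \<alpha>) (neg M U (cmp M N2 U (cmp N2 S' U g j') v))"
    and Aj: "cmp M2 S U (cmp S S' U g A) j = cmp M2 N2 U (cmp N2 S' U g j') \<alpha>2"
    if "U \<in> Ob" "g \<in> Mor C S' U" for U g
    using that A by (simp_all add: cmp_rules)
  \<comment> \<open>Since \<open>\<beta>2\<close> after \<open>\<alpha>2\<close> is zero, the defect
    dies in F(Q2). Hence \<open>\<beta>2\<close> after \<open>v\<close> is a relation of
    \<open>F\<close> and factors through \<alpha>; the factor \<open>t\<close> corrects the cokernel
    map in the same way as \<open>v\<close> corrects the relations.\<close>
  have "fmap F N2 Q2 \<beta>2 w = \<one>\<^bsub>fobj F Q2\<^esub>"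
  proof (rule inj)
    have "\<phi> Q2 (fmap F N2 Q2 \<beta>2 w) = fmap G M2 Q2 (cmp M2 N2 Q2 \<beta>2 \<alpha>2) y"
      using nf(3)[OF b(2) k2(1,2) w(1)] w(2) G y(1) by (simp add: act_cmp)
    then show "\<phi> Q2 (fmap F N2 Q2 \<beta>2 w) = \<one>\<^bsub>fobj G Q2\<^esub>" using k2(3) G y(1) by simp
  qed (use F w(1) in auto)
  then have "fmap F M Q2 (cmp M N2 Q2 \<beta>2 v) x = \<one>\<^bsub>fobj F Q2\<^esub>"
    using F a(4) v by (simp add: act_cmp)
  then obtain t where t: "t \<in> Mor C N Q2" "cmp M N2 Q2 \<beta>2 v = cmp M N Q2 t \<alpha>"
    using a(6)[of Q2 "cmp M N2 Q2 \<beta>2 v"] by auto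
  obtain B where B: "B \<in> Mor C S' V"
      "cmp N S' V B i' = ad N V (cmp N Q V i'' \<beta>) (cmp N Q2 V j'' t)"
      "cmp N2 S' V B j' = cmp N2 Q2 V j'' \<beta>2"
    using s'(6)[of V "ad N V (cmp N Q V i'' \<beta>) (cmp N Q2 V j'' t)" "cmp N2 Q2 V j'' \<beta>2"] t(1)
    by auto
  note B(1) [simp] t(1) [simp]
  have Bi: "cmp N S' U (cmp S' V U g B) i'
        = ad N U (cmp N Q U (cmp Q V U g i'') \<beta>) (cmp N Q2 U (cmp Q2 V U g j'') t)"
    and Bj: "cmp N2 S' U (cmp S' V U g B) j' = cmp N2 Q2 U (cmp Q2 V U g j'') \<beta>2"
    if "U \<in> Ob" "g \<in> Mor C V U" for U g
    using that B t(1) by (simp_all add: cmp_rules)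
  have cok: "is_cokernel C S S' A V B"
  proof (rule cokernelI)
    have "cmp M S V (cmp S S' V B A) i = ze M V"
    proof -
      have "cmp M N V (cmp N S' V B i') \<alpha> = cmp M Q2 V j'' (cmp M N Q2 t \<alpha>)"
        using t(1) B(2) k(3) by (simp add: cmp_rules)
      moreover have "cmp M N2 V (cmp N2 S' V B j') v = cmp M Q2 V j'' (cmp M N Q2 t \<alpha>)"
        using t B(3) by (simp add: cmp_rules)
      ultimately show ?thesis using Ai[of V B] B(1) t by simp
    qed
    moreover have "cmp M2 S V (cmp S S' V B A) j = ze M2 V"
      using Aj[of V B] B k2(3) by (simp add: cmp_rules)
    ultimately show "cmp S S' V B A = ze S V"
      by - (rule s(7)[of V], simp_all)
  next
    fix U g assume U: "U \<in> Ob" "g \<in> Mor C S' U" "cmp S S' U g A = ze S U"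
    have "cmp M2 N2 U (cmp N2 S' U g j') \<alpha>2 = ze M2 U"
      using Aj[OF U(1,2)] U by simp
    then obtain d where d: "d \<in> Mor C Q2 U" "cmp N2 Q2 U d \<beta>2 = cmp N2 S' U g j'"
      using k2(4)[of U "cmp N2 S' U g j'"] U by auto
    have "ad M U (cmp M N U (cmp N S' U g i') \<alpha>) (neg M U (cmp M N2 U (cmp N2 S' U g j') v)) = ze M U"
      using Ai[OF U(1,2)] U by simp
    then have "cmp M N U (cmp N S' U g i') \<alpha> = cmp M N2 U (cmp N2 Q2 U d \<beta>2) v"
      using U d(2) by (simp add: ad_neg_zero)
    also have "\<dots> = cmp M N U (cmp N Q2 U d t) \<alpha>" using U d(1) t by (simp add: cmp_assoc)
    finally have "cmp M N U (ad N U (cmp N S' U g i') (neg N U (cmp N Q2 U d t))) \<alpha> = ze M U"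
      using U d(1) t(1) by (simp add: cmp_add_left cmp_neg_left)
    then obtain d' where d': "d' \<in> Mor C Q U"
        "cmp N Q U d' \<beta> = ad N U (cmp N S' U g i') (neg N U (cmp N Q2 U d t))"
      using k(4)[of U "ad N U (cmp N S' U g i') (neg N U (cmp N Q2 U d t))"] U d(1) t(1) by auto
    obtain m where m: "m \<in> Mor C V U" "cmp Q V U m i'' = d'" "cmp Q2 V U m j'' = d"
      using s''(6)[OF U(1) d'(1) d(1)] by blast
    have "cmp S' V U m B = g"
    proof (rule s'(7)[OF U(1)])
      show "cmp N S' U (cmp S' V U m B) i' = cmp N S' U g i'"
        using Bi[OF U(1) m(1)] m d' U d(1) t(1) by (simp add: ad_assoc)
      show "cmp N2 S' U (cmp S' V U m B) j' = cmp N2 S' U g j'"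
        using Bj[OF U(1) m(1)] m d(2) by simp
    qed (use U m B in auto)
    then show "\<exists>h\<in>Mor C V U. cmp S' V U h B = g" using m by blast
  next
    fix U h h' assume U: "U \<in> Ob" "h \<in> Mor C V U" "h' \<in> Mor C V U" "cmp S' V U h B = cmp S' V U h' B"
    have 2: "cmp Q2 V U h j'' = cmp Q2 V U h' j''"
      by (rule k2(5)[OF U(1)]) (use U Bj[OF U(1,2)] Bj[OF U(1,3)] in simp_all)
    have "ad N U (cmp N Q U (cmp Q V U h i'') \<beta>) (cmp N Q2 U (cmp Q2 V U h j'') t) =
          ad N U (cmp N Q U (cmp Q V U h' i'') \<beta>) (cmp N Q2 U (cmp Q2 V U h j'') t)"
      using Bi[OF U(1,2)] Bi[OF U(1,3)] U(4) 2 by simp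
    then have "cmp N Q U (cmp Q V U h i'') \<beta> = cmp N Q U (cmp Q V U h' i'') \<beta>"
      using U t(1) hom_group'[of N U] group.right_cancel[of "Hom C N U"] by simp
    then have "cmp Q V U h i'' = cmp Q V U h' i''"
      by - (rule k(5)[OF U(1)], use U in simp_all)
    then show "h = h'" using s''(7)[OF U(1-3)] 2 by blast
  qed (use B in auto)
  \<comment> \<open>The generator of \<open>G\<close> combines the image of the generator of
    \<open>F\<close> with the lift of the generator of \<open>H\<close>.\<close>
  define g where "g = fmap G M S i (\<phi> M x) \<otimes>\<^bsub>fobj G S\<^esub> fmap G M2 S j y"
  have px: "\<phi> M x \<in> carrier (fobj G M)" using nf(1) a by blast
  have g: "g \<in> carrier (fobj G S)" using G px y(1) by (simp add: g_def)
  have act: "fmap G S U h g = \<phi> U (fmap F M U (cmp M S U h i) x) \<otimes>\<^bsub>fobj G U\<^esub> fmap G M2 U (cmp M2 S U h j) y"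
    if "U \<in> Ob" "h \<in> Mor C S U" for U h
    using that G px y(1) a(4) by (simp add: g_def act_mult act_cmp nf(3))
  have psi_act: "\<psi> U (fmap G S U h g) = fmap H M2 U (cmp M2 S U h j) z"
    if "U \<in> Ob" "h \<in> Mor C S U" for U h
    using that F G H px y a(4) b(4) by (simp add: act nf(1) ng(2) ng(3) comp0)
  have "pres G g S S' A"
    unfolding pres_def
  proof (intro conjI ballI)
    fix U u assume U: "U \<in> Ob" "u \<in> carrier (fobj G U)"
    have pu: "\<psi> U u \<in> carrier (fobj H U)" using ng(1) U by blast
    obtain r where r: "r \<in> Mor C M2 U" "fmap H M2 U r z = \<psi> U u" using b(5)[OF U(1) pu] by blast
    have ry: "fmap G M2 U r y \<in> carrier (fobj G U)" using r U G y by simp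
    \<comment> \<open>\<open>u\<close> and a suitable multiple of \<open>y\<close> agree in
      \<open>H\<close>, so their difference comes from \<open>F\<close> and is a multiple of
      \<open>x\<close>.\<close>
    have "\<psi> U (u \<otimes>\<^bsub>fobj G U\<^esub> inv\<^bsub>fobj G U\<^esub> (fmap G M2 U r y)) = \<one>\<^bsub>fobj H U\<^esub>"
      using U pu ry r y G H nat_trans_inv[OF e(2) U(1) G H ry] by (simp add: ng)
    then obtain l where l: "l \<in> carrier (fobj F U)" "\<phi> U l = u \<otimes>\<^bsub>fobj G U\<^esub> inv\<^bsub>fobj G U\<^esub> (fmap G M2 U r y)"
      using e(4)[of U "u \<otimes>\<^bsub>fobj G U\<^esub> inv\<^bsub>fobj G U\<^esub> (fmap G M2 U r y)"] U G ry by auto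
    obtain o' where o: "o' \<in> Mor C M U" "fmap F M U o' x = l" using a(5)[OF U(1) l(1)] by blast
    obtain h where h: "h \<in> Mor C S U" "cmp M S U h i = o'" "cmp M2 S U h j = r"
      using s(6)[OF U(1) o(1) r(1)] by blast
    have "fmap G S U h g = u"
      using act[OF U(1) h(1)] h o l U G ry by (simp add: fobj_assoc)
    then show "\<exists>h\<in>Mor C S U. fmap G S U h g = u" using h(1) by blast
  next
    fix U h assume U: "U \<in> Ob" "h \<in> Mor C S U"
    show "fmap G S U h g = \<one>\<^bsub>fobj G U\<^esub> \<longleftrightarrow> (\<exists>k\<in>Mor C S' U. h = cmp S S' U k A)"
    proof
      assume 1: "fmap G S U h g = \<one>\<^bsub>fobj G U\<^esub>"
      then have "fmap H M2 U (cmp M2 S U h j) z = \<one>\<^bsub>fobj H U\<^esub>" using psi_act[OF U] n1(2) U by simp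
      then obtain r where r: "r \<in> Mor C N2 U" "cmp M2 S U h j = cmp M2 N2 U r \<alpha>2"
        using b(6)[of U "cmp M2 S U h j"] U by auto
      have "fmap G M2 U (cmp M2 S U h j) y = \<phi> U (fmap F M U (cmp M N2 U r v) x)"
        using r U F G y w v a(4) by (simp add: act_cmp nf(3))
      then have "\<phi> U (fmap F M U (ad M U (cmp M S U h i) (cmp M N2 U r v)) x) = \<one>\<^bsub>fobj G U\<^esub>"
        using 1 act[OF U] U F a(4) r(1) by (simp add: act_ad nf(2))
      then have "fmap F M U (ad M U (cmp M S U h i) (cmp M N2 U r v)) x = \<one>\<^bsub>fobj F U\<^esub>"
        by - (rule inj, use U r in simp_all)
      then obtain d where d: "d \<in> Mor C N U" "ad M U (cmp M S U h i) (cmp M N2 U r v) = cmp M N U d \<alpha>"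
        using a(6)[of U "ad M U (cmp M S U h i) (cmp M N2 U r v)"] U r(1) by auto
      obtain m where m: "m \<in> Mor C S' U" "cmp N S' U m i' = d" "cmp N2 S' U m j' = r"
        using s'(6)[OF U(1) d(1) r(1)] by blast
      have "h = cmp S S' U m A"
      proof (rule s(7)[OF U(1)])
        have "cmp M S U h i = ad M U (cmp M N U d \<alpha>) (neg M U (cmp M N2 U r v))"
          by (rule ad_eq_iff[THEN iffD2, OF _ _ _ _ _ d(2)]) (use U r(1) d(1) in simp_all)
        then show "cmp M S U h i = cmp M S U (cmp S S' U m A) i"
          using Ai[OF U(1) m(1)] m by simp
        show "cmp M2 S U h j = cmp M2 S U (cmp S S' U m A) j"
          using Aj[OF U(1) m(1)] m r by simp
      qed (use U m A in auto)
      then show "\<exists>k\<in>Mor C S' U. h = cmp S S' U k A" using m by blast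
    next
      have "fmap G S S' A g = \<one>\<^bsub>fobj G S'\<^esub>"
      proof -
        have "fmap F M S' (cmp M N S' i' \<alpha>) x = \<one>\<^bsub>fobj F S'\<^esub>"
          using F a(4) pres_rel[OF pF] by (simp add: act_cmp)
        then have "fmap F M S' (cmp M S S' A i) x = inv\<^bsub>fobj F S'\<^esub> fmap F N2 S' j' w"
          using F a(4) A(2) v(2) w(1) by (simp add: act_ad act_neg act_cmp)
        then have "\<phi> S' (fmap F M S' (cmp M S S' A i) x) = inv\<^bsub>fobj G S'\<^esub> fmap G N2 S' j' (\<phi> N2 w)"
          using nat_trans_inv[OF e(1) s'(1) F G, of "fmap F N2 S' j' w"] F w(1) by (simp add: nf(3))
        moreover have "fmap G M2 S' (cmp M2 S S' A j) y = fmap G N2 S' j' (\<phi> N2 w)"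
          using G y A(3) w(2) by (simp add: act_cmp)
        moreover have "fmap G N2 S' j' (\<phi> N2 w) \<in> carrier (fobj G S')" using G w(1) by (simp add: nf(1))
        ultimately show ?thesis using act[OF s'(1) A(1)] G s'(1) by simp
      qed
      moreover assume "\<exists>k\<in>Mor C S' U. h = cmp S S' U k A"
      ultimately show "fmap G S U h g = \<one>\<^bsub>fobj G U\<^esub>"
        using U A(1) G g by (auto simp: act_cmp)
    qed
  qed (use A g in auto)
  moreover have "euler S S' A = euler M N \<alpha> \<otimes>\<^bsub>K.KG\<^esub> euler M2 N2 \<alpha>2"
    using euler_eq[OF s(1) s'(1) A(1) cok] euler_eq[OF a(1-3) q] euler_eq[OF b(1-3) q2]
      cls_coprod[OF c] cls_coprod[OF c'] cls_coprod[OF c'']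
    by (simp add: K.K.inv_mult K.K.m_ac)
  ultimately show ?thesis using that by blast
qed

end

section \<open>The category of finitely presented functors\<close>

context additive_category
begin

section \<open>Morphisms of finitely presented functors and representable functors\<close>

abbreviation "Fp \<equiv> fp_functors C"

lemma fp_obj_additive: "G \<in> Obj Fp \<Longrightarrow> additive_functor C G"
  by (simp add: fp_functors_def)

lemma fp_obj_pres:
  assumes "G \<in> Obj Fp"
  obtains x M N \<alpha> where "pres G x M N \<alpha>"
  using assms presents_iff[of G] unfolding fp_functors_def by auto

lemma fp_objI: "additive_functor C G \<Longrightarrow> pres G x M N \<alpha> \<Longrightarrow> G \<in> Obj Fp"
  using presents_iff[of G] unfolding fp_functors_def by auto

lemma fp_Mor [simp]: "Mor Fp F G = nat_trans C F G"
  by (simp add: fp_functors_def)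

lemma fp_Comp_apply [simp]:
  "U \<in> Ob \<Longrightarrow> x \<in> carrier (fobj F U) \<Longrightarrow> Comp Fp F \<theta> \<eta> U x = \<theta> U (\<eta> U x)"
  by (simp add: fp_functors_def compose_def)

lemma fp_Zero_apply [simp]:
  "U \<in> Ob \<Longrightarrow> x \<in> carrier (fobj F U) \<Longrightarrow> ZeroMor Fp F G U x = \<one>\<^bsub>fobj G U\<^esub>"
  by (simp add: fp_functors_def)

lemma fp_Id_apply [simp]: "U \<in> Ob \<Longrightarrow> x \<in> carrier (fobj F U) \<Longrightarrow> IdMor Fp F U x = x"
  by (simp add: fp_functors_def)

lemma nat_trans_eqI:
  assumes "\<eta> \<in> nat_trans C F G" "\<theta> \<in> nat_trans C F G"
    and "\<And>U x. U \<in> Ob \<Longrightarrow> x \<in> carrier (fobj F U) \<Longrightarrow> \<eta> U x = \<theta> U x"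
  shows "\<eta> = \<theta>"
proof (rule extensionalityI[of _ Ob])
  show "\<eta> \<in> extensional Ob" "\<theta> \<in> extensional Ob" using assms unfolding nat_trans_def by auto
  fix U assume U: "U \<in> Ob"
  show "\<eta> U = \<theta> U"
    by (rule extensionalityI[of _ "carrier (fobj F U)"]) (use U assms in \<open>auto simp: nat_trans_def\<close>)
qed

lemma fp_Comp_closed:
  assumes "\<eta> \<in> nat_trans C F G" "\<theta> \<in> nat_trans C G H" "additive_functor C F"
  shows "Comp Fp F \<theta> \<eta> \<in> nat_trans C F H"
proof -
  have "(\<lambda>U\<in>Ob. \<lambda>x\<in>carrier (fobj F U). \<theta> U (\<eta> U x)) \<in> nat_trans C F H"
    by (rule nat_transI) (use assms in \<open>auto simp: nat_transE[OF assms(1)] nat_transE[OF assms(2)]\<close>)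
  then show ?thesis by (simp add: fp_functors_def compose_def)
qed

lemma fp_Zero_closed [simp]:
  assumes "additive_functor C F" "additive_functor C G"
  shows "ZeroMor Fp F G \<in> nat_trans C F G"
proof -
  have "(\<lambda>U\<in>Ob. \<lambda>x\<in>carrier (fobj F U). \<one>\<^bsub>fobj G U\<^esub>) \<in> nat_trans C F G"
    by (rule nat_transI) (use assms in auto)
  then show ?thesis by (simp add: fp_functors_def)
qed

lemma fp_Id_closed [simp]: "additive_functor C F \<Longrightarrow> IdMor Fp F \<in> nat_trans C F F"
  using nat_transI[of F "\<lambda>U x. x" F] by (simp add: fp_functors_def)

lemma ad_left_comm: "\<lbrakk>A \<in> Ob; B \<in> Ob; f \<in> Mor C A B; g \<in> Mor C A B; h \<in> Mor C A B\<rbrakk>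
    \<Longrightarrow> ad A B f (ad A B g h) = ad A B g (ad A B f h)"
  using ad_assoc[of A B f g h] ad_assoc[of A B g f h] ad_comm[of A B f g] by simp

text \<open>The representable functor \<open>Hom(M,-)\<close>, moved to the type of values of the objects of
  \<open>fp_functors C\<close>.\<close>

definition rep :: "'o \<Rightarrow> ('o, 'm, 'm set) ab_functor" where
  "rep M = \<lparr>fobj = (\<lambda>U. \<lparr>carrier = (\<lambda>h. {h}) ` Mor C M U,
       monoid.mult = (\<lambda>x y. {ad M U (the_elem x) (the_elem y)}), one = {ze M U}\<rparr>),
     fmap = (\<lambda>U V f x. {cmp M U V f (the_elem x)})\<rparr>"

lemma rep_simps [simp]:
  "carrier (fobj (rep M) U) = (\<lambda>h. {h}) ` Mor C M U"
  "{h} \<otimes>\<^bsub>fobj (rep M) U\<^esub> {h'} = {ad M U h h'}"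
  "\<one>\<^bsub>fobj (rep M) U\<^esub> = {ze M U}"
  "fmap (rep M) U V f {h} = {cmp M U V f h}"
  by (simp_all add: rep_def)

lemma rep_additive [simp]:
  assumes M [simp]: "M \<in> Ob"
  shows "additive_functor C (rep M)"
  unfolding additive_functor_def
proof (intro conjI ballI)
  fix U assume [simp]: "U \<in> Ob"
  show "comm_group (fobj (rep M) U)"
  proof (rule comm_groupI)
    fix x assume "x \<in> carrier (fobj (rep M) U)"
    then obtain h where "h \<in> Mor C M U" "x = {h}" by auto
    then show "\<exists>y\<in>carrier (fobj (rep M) U). y \<otimes>\<^bsub>fobj (rep M) U\<^esub> x = \<one>\<^bsub>fobj (rep M) U\<^esub>"
      by (intro bexI[of _ "{neg M U h}"]) auto
  qed (auto simp: ad_assoc ad_comm ad_left_comm)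
next
  fix U V f assume "U \<in> Ob" "V \<in> Ob" "f \<in> Mor C U V"
  then show "fmap (rep M) U V f \<in> hom (fobj (rep M) U) (fobj (rep M) V)"
    by (intro homI) (auto simp: cmp_add_right)
next
  fix U V W f g x assume "U \<in> Ob" "V \<in> Ob" "W \<in> Ob" "f \<in> Mor C U V" "g \<in> Mor C V W"
    "x \<in> carrier (fobj (rep M) U)"
  moreover have "Comp C U g f = cmp U V W g f" by (simp add: cmp_def)
  ultimately show "fmap (rep M) U W (Comp C U g f) x = fmap (rep M) V W g (fmap (rep M) U V f x)"
    by (auto simp: cmp_assoc)
qed (auto simp: cmp_add_left)

text \<open>A representable functor needs no relations, and the morphism to a zero object encodes
  exactly that.\<close>

lemma rep_pres_zero:
  assumes M: "M \<in> Ob" and Z: "Z \<in> Ob" "idm Z = ze Z Z"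
  shows "pres (rep M) {idm M} M Z (ze M Z)"
proof -
  have "h = ze M U \<longleftrightarrow> (\<exists>k\<in>Mor C Z U. h = cmp M Z U k (ze M Z))" if "U \<in> Ob" for U h
  proof -
    have "cmp M Z U k (ze M Z) = ze M U" if "k \<in> Mor C Z U" for k
      using that \<open>U \<in> Ob\<close> M Z by simp
    then show ?thesis using ze_closed[OF Z(1) that] by metis
  qed
  then show ?thesis
    unfolding pres_def using M Z(1) by auto
qed

lemma rep_fp [simp]: "M \<in> Ob \<Longrightarrow> rep M \<in> Obj Fp"
  using zero_obj_ex rep_pres_zero fp_objI rep_additive by metis

text \<open>The transformation from Hom(M,-) to \<open>G\<close> that corresponds to
  \<open>x\<close> under Yoneda's lemma.\<close>

definition ev :: "'o \<Rightarrow> ('o, 'm, 'v) ab_functor \<Rightarrow> 'v \<Rightarrow> 'o \<Rightarrow> 'm set \<Rightarrow> 'v" where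
  "ev M G x = (\<lambda>U\<in>Ob. \<lambda>y\<in>carrier (fobj (rep M) U). fmap G M U (the_elem y) x)"

lemma ev_apply [simp]: "U \<in> Ob \<Longrightarrow> h \<in> Mor C M U \<Longrightarrow> ev M G x U {h} = fmap G M U h x"
  by (simp add: ev_def)

lemma ev_closed [simp]:
  assumes "additive_functor C G" "M \<in> Ob" "x \<in> carrier (fobj G M)"
  shows "ev M G x \<in> nat_trans C (rep M) G"
  unfolding ev_def by (rule nat_transI) (use assms in \<open>auto simp: act_ad act_cmp\<close>)

text \<open>The image of \<open>G\<close> in \<open>H\<close> is \<open>G\<close> modulo the image
  of \<open>F\<close>. Beyond the relations \<alpha> of \<open>G\<close> it suffices to kill the
  image of the generator of \<open>F\<close>, which is the multiple \<open>c\<close> of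
  \<open>x\<close>. The combined relation morphism therefore has the components \<alpha> and
  \<open>c\<close>.\<close>

lemma image_functor_pres:
  assumes F: "additive_functor C F" and G: "additive_functor C G" and H: "additive_functor C H"
    and f: "f \<in> nat_trans C F G" and g: "g \<in> nat_trans C G H"
    and ex: "\<And>U y. \<lbrakk>U \<in> Ob; y \<in> carrier (fobj G U)\<rbrakk>
      \<Longrightarrow> g U y = \<one>\<^bsub>fobj H U\<^esub> \<longleftrightarrow> (\<exists>x\<in>carrier (fobj F U). f U x = y)"
    and I: "\<And>U. U \<in> Ob \<Longrightarrow> fobj I U = (fobj H U)\<lparr>carrier := g U ` carrier (fobj G U)\<rparr>" "fmap I = fmap H"
    and pF: "pres F x' M' N' \<alpha>'" and pG: "pres G x M N \<alpha>"
  shows "\<exists>S A. pres I (g M x) M S A"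
proof -
  note a = presE[OF pG] and b = presE[OF pF]
  note nf = nat_transE[OF f] and ng = nat_transE[OF g]
  have "f M' x' \<in> carrier (fobj G M')" using nf(1) b by blast
  then obtain c where c: "c \<in> Mor C M M'" "fmap G M M' c x = f M' x'" using a(5) b(1) by blast
  obtain S i j where s: "coprod S N M' i j" using coprod_ex a(2) b(1) by blast
  note s' = coprodE[OF s]
  note [simp] = a(1-4) b(1-4) s'(1-5) c(1) F G H
  define A where "A = ad M S (cmp M N S i \<alpha>) (cmp M M' S j c)"
  have A [simp]: "A \<in> Mor C M S" by (simp add: A_def)
  have kA: "cmp M S U k A = ad M U (cmp M N U (cmp N S U k i) \<alpha>) (cmp M M' U (cmp M' S U k j) c)"
    if "U \<in> Ob" "k \<in> Mor C S U" for U k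
    using that by (simp add: A_def cmp_rules)
  have "pres I (g M x) M S A"
    unfolding pres_def
  proof (intro conjI ballI)
    show "g M x \<in> carrier (fobj I M)" by (simp add: I)
  next
    fix U z assume U: "U \<in> Ob" "z \<in> carrier (fobj I U)"
    then obtain y where y: "y \<in> carrier (fobj G U)" "z = g U y" by (auto simp: I)
    obtain h where h: "h \<in> Mor C M U" "fmap G M U h x = y" using a(5) U(1) y(1) by blast
    then show "\<exists>h\<in>Mor C M U. fmap I M U h (g M x) = z"
      using ng(3)[of M U h x] U y by (intro bexI[of _ h]) (auto simp: I)
  next
    fix U h assume U: "U \<in> Ob" "h \<in> Mor C M U"
    have "fmap I M U h (g M x) = \<one>\<^bsub>fobj I U\<^esub> \<longleftrightarrow> (\<exists>y\<in>carrier (fobj F U). f U y = fmap G M U h x)"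
      using ng(3)[of M U h x] ex[of U "fmap G M U h x"] U by (simp add: I)
    also have "\<dots> \<longleftrightarrow> (\<exists>d\<in>Mor C M' U. fmap G M U (cmp M M' U d c) x = fmap G M U h x)"
    proof -
      have *: "f U (fmap F M' U d x') = fmap G M U (cmp M M' U d c) x" if "d \<in> Mor C M' U" for d
        using that U c(2) by (simp add: act_cmp nf(3))
      show ?thesis
      proof
        assume "\<exists>y\<in>carrier (fobj F U). f U y = fmap G M U h x"
        then show "\<exists>d\<in>Mor C M' U. fmap G M U (cmp M M' U d c) x = fmap G M U h x"
          using * b(5)[OF U(1)] by metis
      next
        assume "\<exists>d\<in>Mor C M' U. fmap G M U (cmp M M' U d c) x = fmap G M U h x"
        then show "\<exists>y\<in>carrier (fobj F U). f U y = fmap G M U h x"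
          using * act_closed[OF F b(1) U(1) _ b(4)] by metis
      qed
    qed
    also have "\<dots> \<longleftrightarrow> (\<exists>d\<in>Mor C M' U. \<exists>k\<in>Mor C N U. ad M U h (neg M U (cmp M M' U d c)) = cmp M N U k \<alpha>)"
    proof (rule bex_cong[OF refl])
      fix d assume d: "d \<in> Mor C M' U"
      have "fmap G M U (cmp M M' U d c) x = fmap G M U h x \<longleftrightarrow>
        fmap G M U (ad M U h (neg M U (cmp M M' U d c))) x = \<one>\<^bsub>fobj G U\<^esub>"
        using U d by (simp add: act_ad act_neg fobj_eq_iff) metis
      also have "\<dots> \<longleftrightarrow> (\<exists>k\<in>Mor C N U. ad M U h (neg M U (cmp M M' U d c)) = cmp M N U k \<alpha>)"
        using a(6) U d by simp
      finally show "fmap G M U (cmp M M' U d c) x = fmap G M U h x \<longleftrightarrow>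
        (\<exists>k\<in>Mor C N U. ad M U h (neg M U (cmp M M' U d c)) = cmp M N U k \<alpha>)" .
    qed
    also have "\<dots> \<longleftrightarrow> (\<exists>k\<in>Mor C S U. h = cmp M S U k A)"
    proof
      assume "\<exists>d\<in>Mor C M' U. \<exists>k\<in>Mor C N U. ad M U h (neg M U (cmp M M' U d c)) = cmp M N U k \<alpha>"
      then obtain d k where dk: "d \<in> Mor C M' U" "k \<in> Mor C N U"
        "ad M U h (neg M U (cmp M M' U d c)) = cmp M N U k \<alpha>" by blast
      obtain m where m: "m \<in> Mor C S U" "cmp N S U m i = k" "cmp M' S U m j = d"
        using s'(6)[OF U(1) dk(2,1)] by blast
      have "ad M U (cmp M N U k \<alpha>) (cmp M M' U d c) = h"
        using dk U by (simp add: ad_assoc flip: dk(3))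
      then have "h = cmp M S U m A" using kA[OF U(1) m(1)] m by simp
      then show "\<exists>k\<in>Mor C S U. h = cmp M S U k A" using m(1) by blast
    next
      assume "\<exists>k\<in>Mor C S U. h = cmp M S U k A"
      then obtain k where k: "k \<in> Mor C S U" "h = cmp M S U k A" by blast
      have "ad M U h (neg M U (cmp M M' U (cmp M' S U k j) c)) = cmp M N U (cmp N S U k i) \<alpha>"
        using kA[OF U(1) k(1)] k U by (simp add: ad_assoc)
      then show "\<exists>d\<in>Mor C M' U. \<exists>k\<in>Mor C N U. ad M U h (neg M U (cmp M M' U d c)) = cmp M N U k \<alpha>"
        using k(1) U s'(1-5) a(2) b(1) cmp_closed by blast
    qed
    finally show "fmap I M U h (g M x) = \<one>\<^bsub>fobj I U\<^esub> \<longleftrightarrow> (\<exists>k\<in>Mor C S U. h = cmp M S U k A)" .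
  qed simp_all
  then show ?thesis by blast
qed

lemma image_subfunctor_additive:
  assumes G: "additive_functor C G" and H: "additive_functor C H" and g: "g \<in> nat_trans C G H"
    and I: "\<And>U. U \<in> Ob \<Longrightarrow> fobj I U = (fobj H U)\<lparr>carrier := g U ` carrier (fobj G U)\<rparr>" "fmap I = fmap H"
  shows "additive_functor C I"
proof -
  note ng = nat_transE[OF g]
  have sub: "x \<in> carrier (fobj I U) \<Longrightarrow> x \<in> carrier (fobj H U)" if "U \<in> Ob" for U x
    using that ng(1) by (auto simp: I)
  show ?thesis
    unfolding additive_functor_def
  proof (intro conjI ballI)
    fix U assume U: "U \<in> Ob"
    have "group_hom (fobj G U) (fobj H U) (g U)"
      using fobj_group'[OF G U] fobj_group'[OF H U] g U
      by (simp add: group_hom_def group_hom_axioms_def) (auto simp: nat_trans_def)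
    then have "subgroup (g U ` carrier (fobj G U)) (fobj H U)" by (rule group_hom.img_is_subgroup)
    then show "comm_group (fobj I U)"
      using group.subgroup_imp_group[OF fobj_group'[OF H U]] sub[OF U] fobj_comm[OF H U]
      by (intro group.group_comm_groupI) (simp_all add: I(1)[OF U])
  next
    fix U V f assume U: "U \<in> Ob" "V \<in> Ob" "f \<in> Mor C U V"
    show "fmap I U V f \<in> hom (fobj I U) (fobj I V)"
    proof (rule homI)
      fix x assume "x \<in> carrier (fobj I U)"
      then obtain y where "y \<in> carrier (fobj G U)" "x = g U y" using U by (auto simp: I)
      then show "fmap I U V f x \<in> carrier (fobj I V)"
        using ng(3)[OF U(1) U(2,3), of y] U G by (auto simp: I simp flip: ng(3))
    next
      fix x y assume "x \<in> carrier (fobj I U)" "y \<in> carrier (fobj I U)"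
      then show "fmap I U V f (x \<otimes>\<^bsub>fobj I U\<^esub> y) = fmap I U V f x \<otimes>\<^bsub>fobj I V\<^esub> fmap I U V f y"
        using sub[OF U(1)] act_mult[OF H U] U by (simp add: I)
    qed
  next
    fix U x assume "U \<in> Ob" "x \<in> carrier (fobj I U)"
    then show "fmap I U U (idm U) x = x" using sub H by (simp add: I(2))
  next
    fix U V W f g x assume "U \<in> Ob" "V \<in> Ob" "W \<in> Ob" "f \<in> Mor C U V" "g \<in> Mor C V W"
      "x \<in> carrier (fobj I U)"
    then show "fmap I U W (Comp C U g f) x = fmap I V W g (fmap I U V f x)"
      using sub act_cmp[OF H, of U V W f g x] by (simp add: I(2) cmp_def)
  next
    fix U V f g x assume "U \<in> Ob" "V \<in> Ob" "f \<in> Mor C U V" "g \<in> Mor C U V" "x \<in> carrier (fobj I U)"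
    then show "fmap I U V (ad U V f g) x = fmap I U V f x \<otimes>\<^bsub>fobj I V\<^esub> fmap I U V g x"
      using sub act_ad[OF H, of U V f g x] by (simp add: I)
  qed
qed

text \<open>Exactness at \<open>F\<close> and \<open>G\<close> is tested on representable functors. For the surjectivity of
  \<open>g\<close>, its image is finitely presented, and the universal property of the cokernel provides a
  section of the inclusion of the image into \<open>H\<close>.\<close>

lemma short_exact_pt_exact:
  assumes ob: "F \<in> Obj Fp" "G \<in> Obj Fp" "H \<in> Obj Fp" and se: "short_exact Fp F f G g H"
  shows "pt_exact F f G g H"
proof -
  note [simp] = ob[THEN fp_obj_additive]
  have f [simp]: "f \<in> nat_trans C F G" and g [simp]: "g \<in> nat_trans C G H"
    and ker: "is_kernel Fp G H g F f" and cok: "is_cokernel Fp F G f H g"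
    using se by (auto simp: short_exact_def)
  note nf = nat_transE[OF f] and ng = nat_transE[OF g]
  note [simp] = fp_Comp_closed[OF _ f] fp_Comp_closed[OF _ g]
  have gf0: "g U (f U x) = \<one>\<^bsub>fobj H U\<^esub>" if "U \<in> Ob" "x \<in> carrier (fobj F U)" for U x
  proof -
    have "Comp Fp F g f U x = ZeroMor Fp F H U x" using ker by (simp add: is_kernel_def)
    then show ?thesis using that by simp
  qed
  have ker_ex: "\<exists>!h. h \<in> nat_trans C (rep U) F \<and> Comp Fp (rep U) f h = t"
    if U: "U \<in> Ob" and t: "t \<in> nat_trans C (rep U) G"
      and 0: "\<And>V h. V \<in> Ob \<Longrightarrow> h \<in> Mor C U V \<Longrightarrow> g V (t V {h}) = \<one>\<^bsub>fobj H V\<^esub>" for U t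
  proof -
    have "Comp Fp (rep U) g t = ZeroMor Fp (rep U) H"
      by (rule nat_trans_eqI[of _ "rep U" H]) (use U t 0 in auto)
    then show ?thesis using ker U t unfolding is_kernel_def by simp
  qed
  have inj: "x = \<one>\<^bsub>fobj F U\<^esub>" if U: "U \<in> Ob" and x: "x \<in> carrier (fobj F U)" "f U x = \<one>\<^bsub>fobj G U\<^esub>" for U x
  proof -
    have "Comp Fp (rep U) f (ev U F x') = ZeroMor Fp (rep U) G"
      if "x' \<in> carrier (fobj F U)" "f U x' = \<one>\<^bsub>fobj G U\<^esub>" for x'
      by (rule nat_trans_eqI[of _ "rep U" G]) (use U that in \<open>auto simp: nf\<close>)
    moreover have "f U \<one>\<^bsub>fobj F U\<^esub> = \<one>\<^bsub>fobj G U\<^esub>" using nat_trans_one[OF f U] by simp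
    \<comment> \<open>Both transformations lift the zero transformation from Hom(U,-) through
      \<open>f\<close>, and lifts to a kernel are unique.\<close>
    ultimately have eq: "ev U F x = ev U F \<one>\<^bsub>fobj F U\<^esub>"
      using ker_ex[of U "ZeroMor Fp (rep U) G"] U x nat_trans_one[OF g] by (metis (no_types, lifting)
        ev_closed fobj_one fp_Zero_apply fp_Zero_closed fp_obj_additive image_eqI ob(1,2,3) rep_additive rep_simps(1))
    have "ev U F x U {idm U} = ev U F \<one>\<^bsub>fobj F U\<^esub> U {idm U}" using eq by simp
    then show ?thesis using U x by simp
  qed
  have ex: "g U y = \<one>\<^bsub>fobj H U\<^esub> \<longleftrightarrow> (\<exists>x\<in>carrier (fobj F U). f U x = y)"
    if U: "U \<in> Ob" and y: "y \<in> carrier (fobj G U)" for U y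
  proof
    assume 0: "g U y = \<one>\<^bsub>fobj H U\<^esub>"
    then obtain h where h: "h \<in> nat_trans C (rep U) F" "Comp Fp (rep U) f h = ev U G y"
      using ker_ex[OF U, of "ev U G y"] U y by (auto simp: ng)
    have "Comp Fp (rep U) f h U {idm U} = y" using h U y by simp
    moreover have "{idm U} \<in> carrier (fobj (rep U) U)" using U by simp
    ultimately show "\<exists>x\<in>carrier (fobj F U). f U x = y"
      using U nat_transE(1)[OF h(1) U] by (intro bexI[of _ "h U {idm U}"]) auto
  next
    assume "\<exists>x\<in>carrier (fobj F U). f U x = y"
    then show "g U y = \<one>\<^bsub>fobj H U\<^esub>" using gf0 U by blast
  qed
  have surj: "\<exists>y\<in>carrier (fobj G U). g U y = z" if U: "U \<in> Ob" and z: "z \<in> carrier (fobj H U)" for U z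
  proof -
    define I where "I = \<lparr>fobj = (\<lambda>U. (fobj H U)\<lparr>carrier := g U ` carrier (fobj G U)\<rparr>), fmap = fmap H\<rparr>"
    have I: "\<And>U. fobj I U = (fobj H U)\<lparr>carrier := g U ` carrier (fobj G U)\<rparr>" "fmap I = fmap H"
      by (simp_all add: I_def)
    have Ia [simp]: "additive_functor C I" by (rule image_subfunctor_additive[OF _ _ g]) (simp_all add: I)
    obtain x M N \<alpha> where pG: "pres G x M N \<alpha>" using fp_obj_pres[OF ob(2)] .
    obtain x' M' N' \<alpha>' where pF: "pres F x' M' N' \<alpha>'" using fp_obj_pres[OF ob(1)] .
    obtain S A where "pres I (g M x) M S A"
      using image_functor_pres[OF _ _ _ f g ex I pF pG] by auto
    then have Ifp: "I \<in> Obj Fp" using fp_objI by simp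
    have gI: "g \<in> nat_trans C G I" using g by (auto simp: nat_trans_def I hom_def)
    \<comment> \<open>With its target restricted to the image \<open>I\<close>, \<open>g\<close>
      still annihilates \<open>f\<close>, so it factors through the cokernel \<open>H\<close> by
      some \<open>h\<close> with values in \<open>I\<close>.\<close>
    have "Comp Fp F g f = ZeroMor Fp F I"
      by (rule nat_trans_eqI[of _ F I]) (use gI fp_Comp_closed[OF f gI] in \<open>auto simp: gf0 I(1)\<close>)
    then obtain h where h: "h \<in> nat_trans C H I" "Comp Fp G h g = g"
      using cok Ifp gI unfolding is_cokernel_def fp_Mor by blast
    have hH [simp]: "h \<in> nat_trans C H H"
    proof -
      have "h V \<in> hom (fobj H V) (fobj H V)" if "V \<in> Ob" for V
      proof (rule homI)
        fix x assume "x \<in> carrier (fobj H V)"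
        then have "h V x \<in> g V ` carrier (fobj G V)" using nat_transE(1)[OF h(1) that] by (simp add: I)
        then show "h V x \<in> carrier (fobj H V)" using ng(1)[OF that] by (metis imageE)
      qed (use nat_transE(2)[OF h(1) that] in \<open>simp add: I\<close>)
      then show ?thesis using h(1) unfolding nat_trans_def by (auto simp: I)
    qed
    \<comment> \<open>Read as an endomorphism of \<open>H\<close>, \<open>h\<close> fixes
      \<open>g\<close>, and so does the identity; uniqueness of factorizations identifies them.
      Every element of H(U) then lies in the image.\<close>
    have "h = IdMor Fp H"
    proof -
      have "Comp Fp G (IdMor Fp H) g = g"
        by (rule nat_trans_eqI[of _ G H]) (auto simp: ng fp_Comp_closed[OF g])
      moreover have "Comp Fp F g f = ZeroMor Fp F H" using cok unfolding is_cokernel_def by simp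
      ultimately show ?thesis using cok ob(3) h(2) unfolding is_cokernel_def
        by (metis fp_Id_closed fp_Mor fp_obj_additive g hH)
    qed
    then have "z \<in> carrier (fobj I U)" using nat_transE(1)[OF h(1) U z] U z by simp
    then show ?thesis by (auto simp: I)
  qed
  show ?thesis
    unfolding pt_exact_def
    by (intro conjI ballI impI; (rule f | rule g | (rule inj; assumption) | (rule ex; assumption) | (rule surj; assumption)))
qed

text \<open>Lifts are chosen element by element. They are natural because injectivity of
  \<open>f\<close> leaves no choice for the kernel, and because \<open>t\<close> is constant on the
  fibres of \<open>g\<close> for the cokernel.\<close>

lemma pt_exact_short_exact:
  assumes ob: "F \<in> Obj Fp" "G \<in> Obj Fp" "H \<in> Obj Fp" and ex: "pt_exact F f G g H"
  shows "short_exact Fp F f G g H"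
proof -
  note [simp] = ob[THEN fp_obj_additive]
  note e = pt_exactE[OF ex]
  note [simp] = e(1,2) fp_Comp_closed[OF _ e(1)] fp_Comp_closed[OF _ e(2)]
    fp_Comp_closed[OF e(1)] fp_Comp_closed[OF e(2)]
  note nf = nat_transE[OF e(1)] and ng = nat_transE[OF e(2)]
  have f_inj: "x = y" if U: "U \<in> Ob" "x \<in> carrier (fobj F U)" "y \<in> carrier (fobj F U)" "f U x = f U y" for U x y
  proof -
    have "f U (x \<otimes>\<^bsub>fobj F U\<^esub> inv\<^bsub>fobj F U\<^esub> y) = \<one>\<^bsub>fobj G U\<^esub>"
      using U nf(1) by (simp add: nf(2) nat_trans_inv[OF e(1)])
    then have "x \<otimes>\<^bsub>fobj F U\<^esub> inv\<^bsub>fobj F U\<^esub> y = \<one>\<^bsub>fobj F U\<^esub>" using U by (intro e(3)) simp_all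
    then show ?thesis using U by (simp add: fobj_eq_iff)
  qed
  have zero: "Comp Fp F g f = ZeroMor Fp F H"
    by (rule nat_trans_eqI[of _ F H]) (use nf(1) e(4) in auto)
  have "is_kernel Fp G H g F f"
    unfolding is_kernel_def
  proof (intro conjI ballI impI)
    fix W t assume W: "W \<in> Obj Fp" and t: "t \<in> Mor Fp W G" and 0: "Comp Fp W g t = ZeroMor Fp W H"
    note [simp] = fp_obj_additive[OF W]
    have t': "t \<in> nat_trans C W G" using t by simp
    note nt = nat_transE[OF t']
    have "\<exists>x\<in>carrier (fobj F U). f U x = t U y" if "U \<in> Ob" "y \<in> carrier (fobj W U)" for U y
      using e(4)[of U "t U y"] nt(1) that fp_Comp_apply[of U y W g t] 0 by simp
    then obtain s where s: "\<And>U y. U \<in> Ob \<Longrightarrow> y \<in> carrier (fobj W U) \<Longrightarrow> s U y \<in> carrier (fobj F U) \<and> f U (s U y) = t U y"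
      by metis
    define h where "h = (\<lambda>U\<in>Ob. \<lambda>y\<in>carrier (fobj W U). s U y)"
    have h: "h \<in> nat_trans C W F"
      unfolding h_def
    proof (rule nat_transI)
      fix U x y assume "U \<in> Ob" "x \<in> carrier (fobj W U)" "y \<in> carrier (fobj W U)"
      then show "s U (x \<otimes>\<^bsub>fobj W U\<^esub> y) = s U x \<otimes>\<^bsub>fobj F U\<^esub> s U y"
        by - (rule f_inj[of U], use s in \<open>simp_all add: nf(2) nt(2)\<close>)
    next
      fix U V k x assume "U \<in> Ob" "V \<in> Ob" "k \<in> Mor C U V" "x \<in> carrier (fobj W U)"
      then show "s V (fmap W U V k x) = fmap F U V k (s U x)"
        by - (rule f_inj[of V], use s in \<open>simp_all add: nf(3) nt(3)\<close>)
    qed (use s in auto)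
    show "\<exists>!h. h \<in> Mor Fp W F \<and> Comp Fp W f h = t"
    proof (rule ex1I[of _ h])
      have "Comp Fp W f h = t"
        by (rule nat_trans_eqI[of _ W G]) (use h t' s in \<open>auto simp: h_def\<close>)
      then show "h \<in> Mor Fp W F \<and> Comp Fp W f h = t" using h by simp
    next
      fix h' assume h': "h' \<in> Mor Fp W F \<and> Comp Fp W f h' = t"
      show "h' = h"
      proof (rule nat_trans_eqI[of _ W F])
        fix U x assume U: "U \<in> Ob" "x \<in> carrier (fobj W U)"
        have "f U (h' U x) = t U x" using h' U fp_Comp_apply[of U x W f h'] by simp
        then show "h' U x = h U x"
          by - (rule f_inj[of U], use U h' s nat_transE(1)[of h' W F] in \<open>auto simp: h_def\<close>)
      qed (use h h' in auto)
    qed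
  qed (use ob zero in auto)
  moreover have "is_cokernel Fp F G f H g"
    unfolding is_cokernel_def
  proof (intro conjI ballI impI)
    fix W t assume W: "W \<in> Obj Fp" and t: "t \<in> Mor Fp G W" and 0: "Comp Fp F t f = ZeroMor Fp F W"
    note [simp] = fp_obj_additive[OF W]
    have t': "t \<in> nat_trans C G W" using t by simp
    note nt = nat_transE[OF t']
    have t_eq: "t U y = t U y'" if U: "U \<in> Ob" "y \<in> carrier (fobj G U)" "y' \<in> carrier (fobj G U)" "g U y = g U y'" for U y y'
    proof -
      have "g U (y \<otimes>\<^bsub>fobj G U\<^esub> inv\<^bsub>fobj G U\<^esub> y') = \<one>\<^bsub>fobj H U\<^esub>"
        using U ng(1) by (simp add: ng(2) nat_trans_inv[OF e(2)])
      then obtain x where x: "x \<in> carrier (fobj F U)" "f U x = y \<otimes>\<^bsub>fobj G U\<^esub> inv\<^bsub>fobj G U\<^esub> y'"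
        using e(4)[OF U(1)] U by auto
      have "t U (y \<otimes>\<^bsub>fobj G U\<^esub> inv\<^bsub>fobj G U\<^esub> y') = \<one>\<^bsub>fobj W U\<^esub>"
        using x U fp_Comp_apply[of U x F t f] 0 by simp
      then show ?thesis
        using U nt(1) by (simp add: nt(2) nat_trans_inv[OF t'] fobj_eq_iff)
    qed
    obtain s where s: "\<And>U z. U \<in> Ob \<Longrightarrow> z \<in> carrier (fobj H U) \<Longrightarrow> s U z \<in> carrier (fobj G U) \<and> g U (s U z) = z"
      using e(5) by metis
    define h where "h = (\<lambda>U\<in>Ob. \<lambda>z\<in>carrier (fobj H U). t U (s U z))"
    have h: "h \<in> nat_trans C H W"
      unfolding h_def
    proof (rule nat_transI)
      fix U x y assume U: "U \<in> Ob" "x \<in> carrier (fobj H U)" "y \<in> carrier (fobj H U)"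
      have "t U (s U (x \<otimes>\<^bsub>fobj H U\<^esub> y)) = t U (s U x \<otimes>\<^bsub>fobj G U\<^esub> s U y)"
        by (rule t_eq) (use U s in \<open>simp_all add: ng(2)\<close>)
      then show "t U (s U (x \<otimes>\<^bsub>fobj H U\<^esub> y)) = t U (s U x) \<otimes>\<^bsub>fobj W U\<^esub> t U (s U y)"
        using U s by (simp add: nt(2))
    next
      fix U V k x assume U: "U \<in> Ob" "V \<in> Ob" "k \<in> Mor C U V" "x \<in> carrier (fobj H U)"
      have "t V (s V (fmap H U V k x)) = t V (fmap G U V k (s U x))"
        by (rule t_eq) (use U s in \<open>simp_all add: ng(3)\<close>)
      then show "t V (s V (fmap H U V k x)) = fmap W U V k (t U (s U x))"
        using U s by (simp add: nt(3))
    qed (use s nt(1) in auto)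
    have hg: "h U (g U y) = t U y" if "U \<in> Ob" "y \<in> carrier (fobj G U)" for U y
      using t_eq[of U "s U (g U y)" y] s[of U "g U y"] that ng(1) by (simp add: h_def)
    show "\<exists>!h. h \<in> Mor Fp H W \<and> Comp Fp G h g = t"
    proof (rule ex1I[of _ h])
      have "Comp Fp G h g = t"
        by (rule nat_trans_eqI[of _ G W]) (use h t' in \<open>auto simp: hg\<close>)
      then show "h \<in> Mor Fp H W \<and> Comp Fp G h g = t" using h by simp
    next
      fix h' assume h': "h' \<in> Mor Fp H W \<and> Comp Fp G h' g = t"
      show "h' = h"
      proof (rule nat_trans_eqI[of _ H W])
        fix U z assume U: "U \<in> Ob" "z \<in> carrier (fobj H U)"
        obtain y where y: "y \<in> carrier (fobj G U)" "g U y = z" using e(5)[OF U] by blast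
        then show "h' U z = h U z" using h' U hg[of U y] fp_Comp_apply[of U y G h' g] by simp
      qed (use h h' in auto)
    qed
  qed (use ob zero in auto)
  ultimately show ?thesis unfolding short_exact_def by simp
qed

section \<open>The Grothendieck group of the functor category\<close>

lemma exact_triples_sub: "exact_triples Fp \<subseteq> Obj Fp \<times> Obj Fp \<times> Obj Fp"
  unfolding exact_triples_def by auto

sublocale E: grothendieck "Obj (fp_functors C)" "exact_triples (fp_functors C)"
  by unfold_locales (rule exact_triples_sub)

lemma K0_ab_eq: "K0_ab Fp = E.KG" and cls_ab_eq: "cls_ab Fp = E.cls"
  by (simp_all add: K0_ab_def cls_ab_def fun_eq_iff)

lemma cls_pt_exact:
  assumes "F \<in> Obj Fp" "G \<in> Obj Fp" "H \<in> Obj Fp" "pt_exact F f G g H"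
  shows "E.cls G = E.cls F \<otimes>\<^bsub>E.KG\<^esub> E.cls H"
  by (rule E.cls_sum) (use assms pt_exact_short_exact[OF assms] in \<open>auto simp: exact_triples_def\<close>)

text \<open>Precomposition with the projection \<open>p\<close> and then with the injection
  \<open>j\<close> is a split exact sequence from Hom(A,-) over Hom(S,-) to Hom(B,-).\<close>

lemma rep_direct_sum:
  assumes "is_direct_sum C A B S" "A \<in> Ob" "B \<in> Ob" "S \<in> Ob"
  shows "E.cls (rep S) = E.cls (rep A) \<otimes>\<^bsub>E.KG\<^esub> E.cls (rep B)"
proof -
  obtain i j p q where d: "i \<in> Mor C A S" "j \<in> Mor C B S" "p \<in> Mor C S A" "q \<in> Mor C S B"
    "cmp A S A p i = idm A" "cmp B S B q j = idm B" "cmp A S B q i = ze A B" "cmp B S A p j = ze B A"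
    "ad S S (cmp S A S i p) (cmp S B S j q) = idm S"
    using direct_sum_projections[OF assms] .
  note [simp] = assms(2-4) d(1-4)
  have eqI: "h = cmp S A U (cmp A S U h i) p" if U: "U \<in> Ob" "h \<in> Mor C S U" and 0: "cmp B S U h j = ze B U" for U h
  proof -
    have "h = cmp S S U h (ad S S (cmp S A S i p) (cmp S B S j q))" using U d(9) by simp
    also have "\<dots> = ad S U (cmp S A U (cmp A S U h i) p) (cmp S B U (cmp B S U h j) q)"
      using U by (simp add: cmp_rules)
    finally show ?thesis using 0 U by simp
  qed
  have pi: "cmp A S U (cmp S A U a p) i = a" if "U \<in> Ob" "a \<in> Mor C A U" for U a
    using that d(5) by (simp add: cmp_assoc)
  have pj: "cmp B S U (cmp S A U a p) j = ze B U" if "U \<in> Ob" "a \<in> Mor C A U" for U a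
    using that d(8) by (simp add: cmp_assoc)
  have qj: "cmp B S U (cmp S B U a q) j = a" if "U \<in> Ob" "a \<in> Mor C B U" for U a
    using that d(6) by (simp add: cmp_assoc)
  have "pt_exact (rep A) (ev A (rep S) {p}) (rep S) (ev S (rep B) {j}) (rep B)"
    unfolding pt_exact_def
  proof (intro conjI ballI impI)
    fix U x assume U: "U \<in> Ob" "x \<in> carrier (fobj (rep A) U)" "ev A (rep S) {p} U x = \<one>\<^bsub>fobj (rep S) U\<^esub>"
    then obtain a where a: "a \<in> Mor C A U" "x = {a}" "cmp S A U a p = ze S U" by auto
    then show "x = \<one>\<^bsub>fobj (rep A) U\<^esub>" using pi[OF U(1) a(1)] U by simp
  next
    fix U y assume U: "U \<in> Ob" "y \<in> carrier (fobj (rep S) U)"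
    then obtain h where h: "h \<in> Mor C S U" "y = {h}" by auto
    have "cmp B S U h j = ze B U \<longleftrightarrow> (\<exists>a\<in>Mor C A U. cmp S A U a p = h)"
      using eqI[OF U(1) h(1)] pj[OF U(1)] cmp_closed[OF assms(2,4) U(1) d(1) h(1)] by metis
    then show "ev S (rep B) {j} U y = \<one>\<^bsub>fobj (rep B) U\<^esub> \<longleftrightarrow> (\<exists>x\<in>carrier (fobj (rep A) U). ev A (rep S) {p} U x = y)"
      using U h by auto
  next
    fix U z assume U: "U \<in> Ob" "z \<in> carrier (fobj (rep B) U)"
    then obtain b where b: "b \<in> Mor C B U" "z = {b}" by auto
    then show "\<exists>y\<in>carrier (fobj (rep S) U). ev S (rep B) {j} U y = z"
      using U qj[OF U(1) b(1)] by (intro bexI[of _ "{cmp S B U b q}"]) auto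
  qed auto
  then show ?thesis by (intro cls_pt_exact) auto
qed

text \<open>The resolution is cut at \<open>L\<close>, the image of Hom(N,-) in Hom(M,-), into two
  short exact sequences. This requires \<open>L\<close> itself to be finitely presented, and \<beta>
  presents it.\<close>

lemma cls_resolution:
  assumes G: "G \<in> Obj Fp" and p: "pres G x M N \<alpha>" and q: "is_cokernel C M N \<alpha> Q \<beta>"
  shows "E.cls G = E.cls (rep M) \<otimes>\<^bsub>E.KG\<^esub> inv\<^bsub>E.KG\<^esub> E.cls (rep N) \<otimes>\<^bsub>E.KG\<^esub> E.cls (rep Q)"
proof -
  note a = presE[OF p]
  note k = cokernelE[OF q a(1-3)]
  note Ga [simp] = fp_obj_additive[OF G]
  note [simp] = a(1-4) k(1,2) G
  define L where "L = \<lparr>fobj = (\<lambda>U. (fobj (rep M) U)\<lparr>carrier := ev N (rep M) {\<alpha>} U ` carrier (fobj (rep N) U)\<rparr>),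
    fmap = fmap (rep M)\<rparr>"
  have L: "\<And>U. fobj L U = (fobj (rep M) U)\<lparr>carrier := ev N (rep M) {\<alpha>} U ` carrier (fobj (rep N) U)\<rparr>"
    "fmap L = fmap (rep M)" by (simp_all add: L_def)
  have e\<alpha>: "ev N (rep M) {\<alpha>} \<in> nat_trans C (rep N) (rep M)" by simp
  have La [simp]: "additive_functor C L"
    by (rule image_subfunctor_additive[OF _ _ e\<alpha>]) (simp_all add: L)
  have Lc: "y \<in> carrier (fobj L U) \<longleftrightarrow> (\<exists>k\<in>Mor C N U. y = {cmp M N U k \<alpha>})" if "U \<in> Ob" for U y
    using that by (simp add: L image_image cong: image_cong_simp) blast
  \<comment> \<open>\<open>L\<close> is generated by \<alpha>. The morphisms out of \<open>N\<close>
    that annihilate \<alpha> are those that factor through its cokernel \<beta>.\<close>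
  have "pres L {\<alpha>} N Q \<beta>"
    unfolding pres_def
  proof (intro conjI ballI)
    have "\<exists>k\<in>Mor C N N. {\<alpha>} = {cmp M N N k \<alpha>}" by (rule bexI[of _ "idm N"]) simp_all
    then show "{\<alpha>} \<in> carrier (fobj L N)" using Lc[OF a(2)] by blast
  next
    fix U y assume "U \<in> Ob" "y \<in> carrier (fobj L U)"
    then show "\<exists>h\<in>Mor C N U. fmap L N U h {\<alpha>} = y" using Lc by (auto simp: L(2))
  next
    fix U h assume U: "U \<in> Ob" "h \<in> Mor C N U"
    have "cmp M N U h \<alpha> = ze M U \<longleftrightarrow> (\<exists>k\<in>Mor C Q U. h = cmp N Q U k \<beta>)"
    proof
      assume "cmp M N U h \<alpha> = ze M U"
      then show "\<exists>k\<in>Mor C Q U. h = cmp N Q U k \<beta>" using k(4)[OF U] by blast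
    next
      assume "\<exists>k\<in>Mor C Q U. h = cmp N Q U k \<beta>"
      then show "cmp M N U h \<alpha> = ze M U" using k(3) U by (auto simp: cmp_assoc)
    qed
    then show "fmap L N U h {\<alpha>} = \<one>\<^bsub>fobj L U\<^esub> \<longleftrightarrow> (\<exists>k\<in>Mor C Q U. h = cmp N Q U k \<beta>)"
      by (simp add: L)
  qed simp_all
  then have Lfp [simp]: "L \<in> Obj Fp" using fp_objI by simp
  have "pt_exact L (\<lambda>U\<in>Ob. \<lambda>y\<in>carrier (fobj L U). y) (rep M) (ev M G x) G"
    unfolding pt_exact_def
  proof (intro conjI ballI impI)
    show "(\<lambda>U\<in>Ob. \<lambda>y\<in>carrier (fobj L U). y) \<in> nat_trans C L (rep M)"
      by (rule nat_transI) (auto simp: L)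
  next
    fix U y assume U: "U \<in> Ob" "y \<in> carrier (fobj (rep M) U)"
    then obtain h where h: "h \<in> Mor C M U" "y = {h}" by auto
    have "(\<exists>k\<in>Mor C N U. h = cmp M N U k \<alpha>) \<longleftrightarrow> {h} \<in> carrier (fobj L U)" using Lc U by simp
    then show "ev M G x U y = \<one>\<^bsub>fobj G U\<^esub> \<longleftrightarrow>
        (\<exists>x\<in>carrier (fobj L U). (\<lambda>U\<in>Ob. \<lambda>y\<in>carrier (fobj L U). y) U x = y)"
      using a(6)[OF U(1) h(1)] U h by auto
  next
    fix U z assume U: "U \<in> Ob" "z \<in> carrier (fobj G U)"
    obtain h where "h \<in> Mor C M U" "fmap G M U h x = z" using a(5)[OF U] by blast
    then show "\<exists>y\<in>carrier (fobj (rep M) U). ev M G x U y = z"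
      using U by (intro bexI[of _ "{h}"]) auto
  qed (auto simp: L)
  then have 1: "E.cls (rep M) = E.cls L \<otimes>\<^bsub>E.KG\<^esub> E.cls G" by (intro cls_pt_exact) auto
  have "pt_exact (rep Q) (ev Q (rep N) {\<beta>}) (rep N) (ev N (rep M) {\<alpha>}) L"
    unfolding pt_exact_def
  proof (intro conjI ballI impI)
    show "ev N (rep M) {\<alpha>} \<in> nat_trans C (rep N) L"
      using e\<alpha> by (auto simp: nat_trans_def L hom_def)
  next
    fix U y assume U: "U \<in> Ob" "y \<in> carrier (fobj (rep Q) U)" "ev Q (rep N) {\<beta>} U y = \<one>\<^bsub>fobj (rep N) U\<^esub>"
    then obtain h where h: "h \<in> Mor C Q U" "y = {h}" "cmp N Q U h \<beta> = ze N U" by auto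
    have "h = ze Q U" by (rule k(5)[OF U(1)]) (use h U in simp_all)
    then show "y = \<one>\<^bsub>fobj (rep Q) U\<^esub>" using h by simp
  next
    fix U y assume U: "U \<in> Ob" "y \<in> carrier (fobj (rep N) U)"
    then obtain h where h: "h \<in> Mor C N U" "y = {h}" by auto
    have "cmp M N U h \<alpha> = ze M U \<longleftrightarrow> (\<exists>d\<in>Mor C Q U. cmp N Q U d \<beta> = h)"
    proof
      assume "cmp M N U h \<alpha> = ze M U"
      then show "\<exists>d\<in>Mor C Q U. cmp N Q U d \<beta> = h" using k(4)[OF U(1) h(1)] by blast
    next
      assume "\<exists>d\<in>Mor C Q U. cmp N Q U d \<beta> = h"
      then show "cmp M N U h \<alpha> = ze M U" using k(3) U by (auto simp: cmp_assoc)
    qed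
    then show "ev N (rep M) {\<alpha>} U y = \<one>\<^bsub>fobj L U\<^esub> \<longleftrightarrow> (\<exists>x\<in>carrier (fobj (rep Q) U). ev Q (rep N) {\<beta>} U x = y)"
      using U h by (auto simp: L)
  next
    fix U z assume U: "U \<in> Ob" "z \<in> carrier (fobj L U)"
    then show "\<exists>y\<in>carrier (fobj (rep N) U). ev N (rep M) {\<alpha>} U y = z" by (auto simp: L)
  qed simp
  then have 2: "E.cls (rep N) = E.cls (rep Q) \<otimes>\<^bsub>E.KG\<^esub> E.cls L" by (intro cls_pt_exact) auto
  have [simp]: "E.cls G \<in> carrier E.KG" "E.cls L \<in> carrier E.KG" "E.cls (rep Q) \<in> carrier E.KG" by simp_all
  have "E.cls G = E.cls L \<otimes>\<^bsub>E.KG\<^esub> E.cls G \<otimes>\<^bsub>E.KG\<^esub> E.cls (rep Q) \<otimes>\<^bsub>E.KG\<^esub> inv\<^bsub>E.KG\<^esub> (E.cls (rep Q) \<otimes>\<^bsub>E.KG\<^esub> E.cls L)"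
    by (subst E.K.inv_solve_right) (simp_all add: E.K.m_ac)
  moreover have "a \<otimes>\<^bsub>E.KG\<^esub> b \<otimes>\<^bsub>E.KG\<^esub> c = a \<otimes>\<^bsub>E.KG\<^esub> c \<otimes>\<^bsub>E.KG\<^esub> b"
    if "a \<in> carrier E.KG" "b \<in> carrier E.KG" "c \<in> carrier E.KG" for a b c
    using that by (simp add: E.K.m_ac)
  ultimately show ?thesis unfolding 1 2 by simp
qed

text \<open>The description of \<open>lmc\<close> for an arbitrary category; for modules both unfold
  to the same term.\<close>

definition lmc_class :: "('o, 'm, 'm set) ab_functor \<Rightarrow> ('o \<Rightarrow>\<^sub>0 int) set" where
  "lmc_class G = (THE c. \<exists>M N \<alpha> Q q. presents C M N \<alpha> G \<and> is_cokernel C M N \<alpha> Q q \<and>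
     c = cls_add C M \<otimes>\<^bsub>K0_add C\<^esub> inv\<^bsub>K0_add C\<^esub> cls_add C N \<otimes>\<^bsub>K0_add C\<^esub> cls_add C Q)"

lemma lmc_class_eq:
  assumes G: "additive_functor C G" and p: "pres G x M N \<alpha>"
  shows "lmc_class G = euler M N \<alpha>"
  unfolding lmc_class_def K0_add_eq cls_add_eq
proof (rule the_equality)
  note a = presE[OF p]
  obtain Q q where q: "is_cokernel C M N \<alpha> Q q" using cokernel_ex[OF a(1-3)] by blast
  then show "\<exists>M' N' \<alpha>' Q q. presents C M' N' \<alpha>' G \<and> is_cokernel C M' N' \<alpha>' Q q \<and>
     euler M N \<alpha> = K.cls M' \<otimes>\<^bsub>K.KG\<^esub> inv\<^bsub>K.KG\<^esub> K.cls N' \<otimes>\<^bsub>K.KG\<^esub> K.cls Q"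
    using euler_eq[OF a(1-3) q] p presents_iff[OF G] by blast
next
  fix c assume "\<exists>M' N' \<alpha>' Q q. presents C M' N' \<alpha>' G \<and> is_cokernel C M' N' \<alpha>' Q q \<and>
     c = K.cls M' \<otimes>\<^bsub>K.KG\<^esub> inv\<^bsub>K.KG\<^esub> K.cls N' \<otimes>\<^bsub>K.KG\<^esub> K.cls Q"
  then obtain M' N' \<alpha>' Q q x' where p': "pres G x' M' N' \<alpha>'" and q: "is_cokernel C M' N' \<alpha>' Q q"
    and c: "c = K.cls M' \<otimes>\<^bsub>K.KG\<^esub> inv\<^bsub>K.KG\<^esub> K.cls N' \<otimes>\<^bsub>K.KG\<^esub> K.cls Q"
    using presents_iff[OF G] by blast
  show "c = euler M N \<alpha>"
    using c euler_eq[OF presE(1-3)[OF p'] q] euler_independent[OF G p p'] by simp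
qed

theorem K0_fp_functors_iso:
  obtains \<Lambda> where "\<Lambda> \<in> iso (K0_ab Fp) (K0_add C)"
    "\<And>G. G \<in> Obj Fp \<Longrightarrow> \<Lambda> (cls_ab Fp G) = lmc_class G"
proof -
  obtain \<Lambda> where \<Lambda>: "\<Lambda> \<in> hom E.KG K.KG" "\<And>G. G \<in> Obj Fp \<Longrightarrow> \<Lambda> (E.cls G) = lmc_class G"
  proof (rule E.hom_from_cls[OF K.K0_comm_group, of lmc_class])
    fix G assume G: "G \<in> Obj Fp"
    obtain x M N \<alpha> where p: "pres G x M N \<alpha>" using fp_obj_pres[OF G] .
    show "lmc_class G \<in> carrier K.KG"
      using lmc_class_eq[OF fp_obj_additive[OF G] p] presE(1-3)[OF p] by simp
  next
    fix F G H assume "(F, G, H) \<in> exact_triples Fp"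
    then obtain f g where ob: "F \<in> Obj Fp" "G \<in> Obj Fp" "H \<in> Obj Fp" and se: "short_exact Fp F f G g H"
      by (auto simp: exact_triples_def)
    note ad = ob[THEN fp_obj_additive]
    obtain x M N \<alpha> where p: "pres F x M N \<alpha>" using fp_obj_pres[OF ob(1)] .
    obtain z M2 N2 \<alpha>2 where p2: "pres H z M2 N2 \<alpha>2" using fp_obj_pres[OF ob(3)] .
    obtain w S S' A where "pres G w S S' A" "euler S S' A = euler M N \<alpha> \<otimes>\<^bsub>K.KG\<^esub> euler M2 N2 \<alpha>2"
      using horseshoe[OF ad short_exact_pt_exact[OF ob se] p p2] .
    then show "lmc_class G = lmc_class F \<otimes>\<^bsub>K.KG\<^esub> lmc_class H"
      using lmc_class_eq[OF ad(1) p] lmc_class_eq[OF ad(3) p2] lmc_class_eq[OF ad(2)] by simp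
  qed blast
  obtain \<mu> where \<mu>: "\<mu> \<in> hom K.KG E.KG" "\<And>M. M \<in> Ob \<Longrightarrow> \<mu> (K.cls M) = E.cls (rep M)"
  proof (rule K.hom_from_cls[OF E.K0_comm_group, of "\<lambda>M. E.cls (rep M)"])
    show "E.cls (rep S) = E.cls (rep A) \<otimes>\<^bsub>E.KG\<^esub> E.cls (rep B)"
      if "(A, S, B) \<in> direct_sum_triples C" for A S B
      using that rep_direct_sum by (simp add: direct_sum_triples_def)
  qed auto
  interpret l: group_hom E.KG K.KG \<Lambda> by unfold_locales (rule \<Lambda>)
  interpret m: group_hom K.KG E.KG \<mu> by unfold_locales (rule \<mu>)
  have lm: "\<Lambda> (\<mu> x) = x" if "x \<in> carrier K.KG" for x
  proof -
    have "\<Lambda> (\<mu> (K.cls M)) = K.cls M" if M: "M \<in> Ob" for M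
    proof -
      obtain Z where Z: "Z \<in> Ob" "idm Z = ze Z Z" using zero_obj_ex by blast
      have z: "h = ze Z U" if "U \<in> Ob" "h \<in> Mor C Z U" for U h
        using cmp_id_right[of Z U h] cmp_ze_right[of Z Z U h] Z that by simp
      \<comment> \<open>Any morphism into a zero object has that object as its cokernel, so the
        presentation of Hom(M,-) by \<open>M\<close> -> \<open>Z\<close> has Euler class
        [M].\<close>
      have "is_cokernel C M Z (ze M Z) Z (idm Z)"
      proof (rule cokernelI)
        fix U g assume "U \<in> Ob" "g \<in> Mor C Z U"
        then show "\<exists>h\<in>Mor C Z U. cmp Z Z U h (idm Z) = g" using Z(1) by (intro bexI[of _ g]) auto
      qed (use Z(1) M z in auto)
      from euler_eq[OF M Z(1) _ this] have "euler M Z (ze M Z) = K.cls M"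
        using M Z cls_zero[OF Z] by simp
      then show ?thesis
        using \<mu>(2)[OF M] \<Lambda>(2)[OF rep_fp[OF M]] lmc_class_eq[OF rep_additive[OF M] rep_pres_zero[OF M Z]]
        by simp
    qed
    then show ?thesis
      using K.hom_unique[OF K.K.is_group, of "\<Lambda> \<circ> \<mu>" "\<lambda>x. x"] that hom_compose[OF \<mu>(1) \<Lambda>(1)]
      by (auto simp: hom_def)
  qed
  have ml: "\<mu> (\<Lambda> x) = x" if "x \<in> carrier E.KG" for x
  proof -
    have "\<mu> (\<Lambda> (E.cls G)) = E.cls G" if G: "G \<in> Obj Fp" for G
    proof -
      obtain x M N \<alpha> where p: "pres G x M N \<alpha>" using fp_obj_pres[OF G] .
      note a = presE[OF p]
      obtain Q \<beta> where q: "is_cokernel C M N \<alpha> Q \<beta>" using cokernel_ex[OF a(1-3)] by blast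
      have Q: "Q \<in> Ob" using cokernelE(1)[OF q a(1-3)] .
      have "\<Lambda> (E.cls G) = K.cls M \<otimes>\<^bsub>K.KG\<^esub> inv\<^bsub>K.KG\<^esub> K.cls N \<otimes>\<^bsub>K.KG\<^esub> K.cls Q"
        using \<Lambda>(2)[OF G] lmc_class_eq[OF fp_obj_additive[OF G] p] euler_eq[OF a(1-3) q] by simp
      then show ?thesis using \<mu>(2) a(1,2) Q cls_resolution[OF G p q] by simp
    qed
    then show ?thesis
      using E.hom_unique[OF E.K.is_group, of "\<mu> \<circ> \<Lambda>" "\<lambda>x. x"] that hom_compose[OF \<Lambda>(1) \<mu>(1)]
      by (auto simp: hom_def)
  qed
  have "bij_betw \<Lambda> (carrier E.KG) (carrier K.KG)"
    by (rule bij_betw_byWitness[of _ \<mu>]) (use lm ml in auto)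
  then have "\<Lambda> \<in> iso E.KG K.KG" using \<Lambda>(1) by (simp add: iso_def)
  then show ?thesis using that \<Lambda>(2) by (simp add: K0_ab_eq cls_ab_eq K0_add_eq)
qed

end

section \<open>Modules\<close>

context abelian_group
begin

lemma minus_minus_diff: "x \<in> carrier G \<Longrightarrow> y \<in> carrier G \<Longrightarrow> \<ominus> (x \<ominus> y) = y \<ominus> x"
  by (simp add: a_minus_def minus_add a_comm)

lemma add_diff_cancel: "x \<in> carrier G \<Longrightarrow> y \<in> carrier G \<Longrightarrow> x \<oplus> y \<ominus> x = y"
  by (simp add: a_minus_def a_comm[of x y] a_assoc r_neg)

lemma diff_trans: "x \<in> carrier G \<Longrightarrow> y \<in> carrier G \<Longrightarrow> z \<in> carrier G \<Longrightarrow> (z \<ominus> x) \<oplus> (x \<ominus> y) = z \<ominus> y"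
  by (simp add: a_minus_def a_assoc r_neg1)

lemma diff_eq_zero: "x \<in> carrier G \<Longrightarrow> y \<in> carrier G \<Longrightarrow> x \<ominus> y = \<zero> \<longleftrightarrow> x = y"
  using minus_unique[of x "\<ominus> y"] minus_equality[of x "\<ominus> y"] by (auto simp: a_minus_def r_neg)

lemma diff_zero: "x \<in> carrier G \<Longrightarrow> x \<ominus> \<zero> = x"
  using add_diff_cancel[of \<zero> x] by simp

lemma diff_add_diff: "\<lbrakk>x \<in> carrier G; y \<in> carrier G; z \<in> carrier G; w \<in> carrier G\<rbrakk>
    \<Longrightarrow> (x \<oplus> y) \<ominus> (z \<oplus> w) = (x \<ominus> z) \<oplus> (y \<ominus> w)"
  by (simp add: a_minus_def minus_add a_ac)

end

lemma module_hom_closed: "h \<in> module_hom R M N \<Longrightarrow> x \<in> carrier M \<Longrightarrow> h x \<in> carrier N"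
  unfolding module_hom_def by auto

lemma module_hom_add: "\<lbrakk>h \<in> module_hom R M N; x \<in> carrier M; y \<in> carrier M\<rbrakk>
    \<Longrightarrow> h (x \<oplus>\<^bsub>M\<^esub> y) = h x \<oplus>\<^bsub>N\<^esub> h y"
  unfolding module_hom_def by auto

lemma module_hom_smult: "\<lbrakk>h \<in> module_hom R M N; r \<in> carrier R; x \<in> carrier M\<rbrakk>
    \<Longrightarrow> h (r \<odot>\<^bsub>M\<^esub> x) = r \<odot>\<^bsub>N\<^esub> h x"
  unfolding module_hom_def by auto

lemma module_hom_zero:
  assumes "h \<in> module_hom R M N" "module R M" "module R N"
  shows "h \<zero>\<^bsub>M\<^esub> = \<zero>\<^bsub>N\<^esub>"
proof -
  interpret M: module R M by fact
  interpret N: module R N by fact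
  have "h (\<zero>\<^bsub>R\<^esub> \<odot>\<^bsub>M\<^esub> \<zero>\<^bsub>M\<^esub>) = \<zero>\<^bsub>R\<^esub> \<odot>\<^bsub>N\<^esub> h \<zero>\<^bsub>M\<^esub>" by (rule module_hom_smult[OF assms(1)]) simp_all
  then show ?thesis using module_hom_closed[OF assms(1)] by simp
qed

lemma module_hom_neg:
  assumes "h \<in> module_hom R M N" "module R M" "module R N" "x \<in> carrier M"
  shows "h (\<ominus>\<^bsub>M\<^esub> x) = \<ominus>\<^bsub>N\<^esub> h x"
proof -
  interpret M: module R M by fact
  interpret N: module R N by fact
  have "h ((\<ominus>\<^bsub>R\<^esub> \<one>\<^bsub>R\<^esub>) \<odot>\<^bsub>M\<^esub> x) = (\<ominus>\<^bsub>R\<^esub> \<one>\<^bsub>R\<^esub>) \<odot>\<^bsub>N\<^esub> h x" by (rule module_hom_smult[OF assms(1)]) (simp_all add: assms)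
  then show ?thesis using module_hom_closed[OF assms(1)] assms(4) by (simp add: M.smult_l_minus N.smult_l_minus)
qed

lemma module_homI:
  assumes "\<And>x. x \<in> carrier M \<Longrightarrow> h x \<in> carrier N"
    and "\<And>x y. x \<in> carrier M \<Longrightarrow> y \<in> carrier M \<Longrightarrow> h (x \<oplus>\<^bsub>M\<^esub> y) = h x \<oplus>\<^bsub>N\<^esub> h y"
    and "\<And>r x. r \<in> carrier R \<Longrightarrow> x \<in> carrier M \<Longrightarrow> h (r \<odot>\<^bsub>M\<^esub> x) = r \<odot>\<^bsub>N\<^esub> h x"
    and M: "module R M"
  shows "(\<lambda>x\<in>carrier M. h x) \<in> module_hom R M N"
proof -
  interpret M: module R M by fact
  show ?thesis unfolding module_hom_def using assms(1-3) by auto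
qed

lemma module_hom_eqI:
  "\<lbrakk>f \<in> module_hom R M N; g \<in> module_hom R M N; \<And>x. x \<in> carrier M \<Longrightarrow> f x = g x\<rbrakk> \<Longrightarrow> f = g"
  by (rule extensionalityI[of _ "carrier M"]) (auto simp: module_hom_def PiE_def)

lemma module_hom_compose:
  "\<lbrakk>f \<in> module_hom R M N; g \<in> module_hom R N L; module R M\<rbrakk> \<Longrightarrow> compose (carrier M) g f \<in> module_hom R M L"
  unfolding compose_def by (rule module_homI) (auto simp: module_hom_closed module_hom_add module_hom_smult)

lemma module_isoI:
  assumes f: "f \<in> module_hom R M N" and g: "\<And>y. y \<in> carrier N \<Longrightarrow> g y \<in> carrier M"
    and "\<And>x. x \<in> carrier M \<Longrightarrow> g (f x) = x" "\<And>y. y \<in> carrier N \<Longrightarrow> f (g y) = y"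
  shows "module_iso R M N"
proof -
  have "bij_betw f (carrier M) (carrier N)"
    by (rule bij_betw_byWitness[of _ g]) (use assms module_hom_closed[OF f] in auto)
  then show ?thesis unfolding module_iso_def using f by blast
qed

lemma module_isoI':
  assumes "\<And>x. x \<in> carrier M \<Longrightarrow> h x \<in> carrier N"
    and "\<And>x y. x \<in> carrier M \<Longrightarrow> y \<in> carrier M \<Longrightarrow> h (x \<oplus>\<^bsub>M\<^esub> y) = h x \<oplus>\<^bsub>N\<^esub> h y"
    and "\<And>r x. r \<in> carrier R \<Longrightarrow> x \<in> carrier M \<Longrightarrow> h (r \<odot>\<^bsub>M\<^esub> x) = r \<odot>\<^bsub>N\<^esub> h x"
    and "\<And>y. y \<in> carrier N \<Longrightarrow> g y \<in> carrier M"
    and "\<And>x. x \<in> carrier M \<Longrightarrow> g (h x) = x" "\<And>y. y \<in> carrier N \<Longrightarrow> h (g y) = y"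
    and M: "module R M"
  shows "module_iso R M N"
  by (rule module_isoI[OF module_homI[where h=h], where g=g]) (use assms in auto)

lemma module_isoE:
  assumes "module_iso R M N" "module R M"
  obtains f g where "f \<in> module_hom R M N" "g \<in> module_hom R N M"
    "\<forall>x\<in>carrier M. g (f x) = x" "\<forall>y\<in>carrier N. f (g y) = y"
proof -
  interpret M: module R M by fact
  obtain f where f: "f \<in> module_hom R M N" and b: "bij_betw f (carrier M) (carrier N)"
    using assms unfolding module_iso_def by blast
  define g where "g = (\<lambda>y\<in>carrier N. inv_into (carrier M) f y)"
  have gf: "g (f x) = x" if "x \<in> carrier M" for x
    using b that module_hom_closed[OF f] by (simp add: g_def bij_betw_def)
  have fg: "f (g y) = y" and gc: "g y \<in> carrier M" if "y \<in> carrier N" for y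
    using b that by (auto simp: g_def bij_betw_def f_inv_into_f inv_into_into)
  have "g \<in> module_hom R N M"
    unfolding module_hom_def
  proof (intro CollectI conjI ballI)
    show "g \<in> carrier N \<rightarrow>\<^sub>E carrier M" using gc by (auto simp: g_def)
  next
    fix x y assume "x \<in> carrier N" "y \<in> carrier N"
    then show "g (x \<oplus>\<^bsub>N\<^esub> y) = g x \<oplus>\<^bsub>M\<^esub> g y"
      using gf[of "g x \<oplus>\<^bsub>M\<^esub> g y"] module_hom_add[OF f, of "g x" "g y"] fg gc by simp
  next
    fix r x assume "r \<in> carrier R" "x \<in> carrier N"
    then show "g (r \<odot>\<^bsub>N\<^esub> x) = r \<odot>\<^bsub>M\<^esub> g x"
      using gf[of "r \<odot>\<^bsub>M\<^esub> g x"] module_hom_smult[OF f, of r "g x"] fg gc by simp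
  qed
  then show ?thesis using that f gf fg by blast
qed

lemma module_iso_refl:
  assumes "module R M"
  shows "module_iso R M M"
  by (rule module_isoI'[of M "\<lambda>x. x" M _ "\<lambda>x. x"]) (use assms in auto)

lemma module_iso_sym:
  assumes "module_iso R M N" "module R M"
  shows "module_iso R N M"
proof -
  obtain f g where "f \<in> module_hom R M N" "g \<in> module_hom R N M"
    "\<forall>x\<in>carrier M. g (f x) = x" "\<forall>y\<in>carrier N. f (g y) = y"
    using module_isoE[OF assms] .
  then show ?thesis by (intro module_isoI[of g R N M f]) (auto simp: module_hom_closed)
qed

lemma module_iso_trans:
  assumes "module_iso R M N" "module_iso R N L" "module R M" "module R N"
  shows "module_iso R M L"
proof -
  obtain f g where a: "f \<in> module_hom R M N" "g \<in> module_hom R N M"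
    "\<forall>x\<in>carrier M. g (f x) = x" "\<forall>y\<in>carrier N. f (g y) = y"
    using module_isoE[OF assms(1,3)] .
  obtain f' g' where b: "f' \<in> module_hom R N L" "g' \<in> module_hom R L N"
    "\<forall>x\<in>carrier N. g' (f' x) = x" "\<forall>y\<in>carrier L. f' (g' y) = y"
    using module_isoE[OF assms(2,4)] .
  show ?thesis
    by (rule module_isoI'[of M "\<lambda>x. f' (f x)" L _ "\<lambda>y. g (g' y)"])
      (use assms(3) in \<open>auto simp: a(3,4) b(3,4) module_hom_closed[OF a(1)] module_hom_closed[OF b(1)]
        module_hom_closed[OF a(2)] module_hom_closed[OF b(2)] module_hom_add[OF a(1)] module_hom_add[OF b(1)]
        module_hom_smult[OF a(1)] module_hom_smult[OF b(1)]\<close>)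
qed

text \<open>The module structure transported along a map \<open>f\<close> whose fibres are the classes of a
  congruence; depending on \<open>f\<close> it is an isomorphic copy or a quotient of \<open>M\<close>.\<close>

definition image_module :: "('m \<Rightarrow> 'n) \<Rightarrow> ('a, 'm) module \<Rightarrow> ('a, 'n) module" where
  "image_module f M = \<lparr>carrier = f ` carrier M, monoid.mult = undefined, one = undefined,
     ring.zero = f \<zero>\<^bsub>M\<^esub>,
     ring.add = (\<lambda>x y. f (inv_into (carrier M) f x \<oplus>\<^bsub>M\<^esub> inv_into (carrier M) f y)),
     smult = (\<lambda>r x. f (r \<odot>\<^bsub>M\<^esub> inv_into (carrier M) f x))\<rparr>"

lemma image_module:
  assumes M: "module R M"
    and add: "\<And>x x' y y'. \<lbrakk>x \<in> carrier M; x' \<in> carrier M; y \<in> carrier M; y' \<in> carrier M; f x = f x'; f y = f y'\<rbrakk>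
      \<Longrightarrow> f (x \<oplus>\<^bsub>M\<^esub> y) = f (x' \<oplus>\<^bsub>M\<^esub> y')"
    and smult: "\<And>r x x'. \<lbrakk>r \<in> carrier R; x \<in> carrier M; x' \<in> carrier M; f x = f x'\<rbrakk>
      \<Longrightarrow> f (r \<odot>\<^bsub>M\<^esub> x) = f (r \<odot>\<^bsub>M\<^esub> x')"
  shows "module R (image_module f M)"
    and "(\<lambda>x\<in>carrier M. f x) \<in> module_hom R M (image_module f M)"
proof -
  interpret M: module R M by fact
  let ?Q = "image_module f M"
  have c: "carrier ?Q = f ` carrier M" and z: "\<zero>\<^bsub>?Q\<^esub> = f \<zero>\<^bsub>M\<^esub>" by (simp_all add: image_module_def)
  have i: "inv_into (carrier M) f (f x) \<in> carrier M" "f (inv_into (carrier M) f (f x)) = f x"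
    if "x \<in> carrier M" for x using that by (auto simp: inv_into_into f_inv_into_f)
  have a: "f x \<oplus>\<^bsub>?Q\<^esub> f y = f (x \<oplus>\<^bsub>M\<^esub> y)" if "x \<in> carrier M" "y \<in> carrier M" for x y
    using that i by (simp add: image_module_def) (rule add, auto)
  have s: "r \<odot>\<^bsub>?Q\<^esub> f x = f (r \<odot>\<^bsub>M\<^esub> x)" if "r \<in> carrier R" "x \<in> carrier M" for r x
    using that i by (simp add: image_module_def) (rule smult, auto)
  show "module R ?Q"
  proof (rule moduleI)
    show "cring R" by (rule M.R.is_cring)
    show "abelian_group ?Q"
    proof (rule abelian_groupI)
      fix x assume "x \<in> carrier ?Q"
      then obtain y where "y \<in> carrier M" "x = f y" by (auto simp: c)
      then show "\<exists>y\<in>carrier ?Q. y \<oplus>\<^bsub>?Q\<^esub> x = \<zero>\<^bsub>?Q\<^esub>"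
        by (intro bexI[of _ "f (\<ominus>\<^bsub>M\<^esub> y)"]) (auto simp: c z a M.l_neg)
    next
      fix x y assume "x \<in> carrier ?Q" "y \<in> carrier ?Q"
      then show "x \<oplus>\<^bsub>?Q\<^esub> y = y \<oplus>\<^bsub>?Q\<^esub> x" by (auto simp: c a intro!: arg_cong[of _ _ f] M.a_comm)
    qed (auto simp: c z a M.a_assoc)
  qed (auto simp: c a s M.smult_l_distr M.smult_r_distr M.smult_assoc1)
  show "(\<lambda>x\<in>carrier M. f x) \<in> module_hom R M ?Q"
    by (rule module_homI) (auto simp: c a s M)
qed

lemma carrier_image_module [simp]: "carrier (image_module f M) = f ` carrier M"
  by (simp add: image_module_def)

lemma zero_image_module [simp]: "\<zero>\<^bsub>image_module f M\<^esub> = f \<zero>\<^bsub>M\<^esub>"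
  by (simp add: image_module_def)

lemma transport_module:
  assumes M: "module R M" and inj: "inj_on f (carrier M)"
  shows "module R (image_module f M)" "module_iso R M (image_module f M)"
proof -
  show "module R (image_module f M)"
    by (rule image_module[OF M]) (auto dest: inj_onD[OF inj])
  have h: "(\<lambda>x\<in>carrier M. f x) \<in> module_hom R M (image_module f M)"
    by (rule image_module[OF M]) (auto dest: inj_onD[OF inj])
  show "module_iso R M (image_module f M)"
    by (rule module_isoI[OF h, of "inv_into (carrier M) f"]) (use inj in \<open>auto simp: inv_into_into f_inv_into_f\<close>)
qed

section \<open>Submodules, images and quotients\<close>

lemma (in module) submoduleI':
  assumes "H \<subseteq> carrier M" "\<zero>\<^bsub>M\<^esub> \<in> H" "\<And>x y. x \<in> H \<Longrightarrow> y \<in> H \<Longrightarrow> x \<oplus>\<^bsub>M\<^esub> y \<in> H"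
    "\<And>r x. r \<in> carrier R \<Longrightarrow> x \<in> H \<Longrightarrow> r \<odot>\<^bsub>M\<^esub> x \<in> H"
  shows "submodule H R M"
proof (rule submoduleI)
  fix x assume x: "x \<in> H"
  then have "\<ominus>\<^bsub>M\<^esub> x = (\<ominus>\<^bsub>R\<^esub> \<one>\<^bsub>R\<^esub>) \<odot>\<^bsub>M\<^esub> x" using assms(1) by (subst smult_l_minus) auto
  then show "\<ominus>\<^bsub>M\<^esub> x \<in> H" using assms(4)[OF _ x] by simp
qed (use assms in auto)

lemma submodule_zero: "submodule H R M \<Longrightarrow> \<zero>\<^bsub>M\<^esub> \<in> H"
  using subgroup.one_closed[of H "add_monoid M"] by (simp add: submodule_def)

lemma (in module) submodule_minus:
  assumes "submodule H R M" "x \<in> H" "y \<in> H"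
  shows "x \<ominus>\<^bsub>M\<^esub> y \<in> H"
  using submoduleE[OF assms(1)] assms(2,3) by (simp add: a_minus_def)

lemma (in module) submodule_diff_cancel:
  assumes "submodule H R M" "x \<oplus>\<^bsub>M\<^esub> y \<in> H" "x \<in> H" "y \<in> carrier M"
  shows "y \<in> H"
proof -
  have x: "x \<in> carrier M" using submoduleE(1)[OF assms(1)] assms(3) by auto
  have "x \<oplus>\<^bsub>M\<^esub> y \<ominus>\<^bsub>M\<^esub> x = y" using x assms(4) by (rule M.add_diff_cancel)
  then show ?thesis using submodule_minus[OF assms(1,2,3)] by simp
qed

lemma (in module) submodule_restrict:
  assumes N: "submodule N R M"
  shows "submodule H R (M\<lparr>carrier := N\<rparr>) \<longleftrightarrow> submodule H R M \<and> H \<subseteq> N"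
proof -
  interpret N: module R "M\<lparr>carrier := N\<rparr>" by (rule submodule.submodule_is_module[OF N module_axioms])
  show ?thesis
  proof
    assume H: "submodule H R (M\<lparr>carrier := N\<rparr>)"
    note e = N.submoduleE[OF H] submodule_zero[OF H]
    show "submodule H R M \<and> H \<subseteq> N"
      using e submoduleE(1)[OF N] by (auto intro!: submoduleI')
  next
    assume H: "submodule H R M \<and> H \<subseteq> N"
    then show "submodule H R (M\<lparr>carrier := N\<rparr>)"
      using submoduleE[of H] submodule_zero[of H] by (auto intro!: N.submoduleI')
  qed
qed

lemma kernel_submodule:
  assumes "module R M" "module R N" "h \<in> module_hom R M N"
  shows "submodule {x \<in> carrier M. h x = \<zero>\<^bsub>N\<^esub>} R M"
proof -
  interpret M: module R M by fact
  interpret N: module R N by fact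
  show ?thesis
    by (rule M.submoduleI') (auto simp: module_hom_zero[OF assms(3,1,2)] module_hom_add[OF assms(3)] module_hom_smult[OF assms(3)])
qed

lemma image_submodule:
  assumes M: "module R M" and N: "module R N" and h: "h \<in> module_hom R M N" and H: "submodule H R M"
  shows "submodule (h ` H) R N"
proof -
  interpret M: module R M by fact
  interpret N: module R N by fact
  note e = M.submoduleE[OF H] submodule_zero[OF H]
  show ?thesis
  proof (rule N.submoduleI')
    show "h ` H \<subseteq> carrier N" using e(1) module_hom_closed[OF h] by auto
    show "\<zero>\<^bsub>N\<^esub> \<in> h ` H" using e module_hom_zero[OF h M N] by (metis imageI)
  next
    fix x y assume "x \<in> h ` H" "y \<in> h ` H"
    then obtain a b where "a \<in> H" "b \<in> H" "x = h a" "y = h b" by auto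
    then show "x \<oplus>\<^bsub>N\<^esub> y \<in> h ` H" using module_hom_add[OF h, of a b] e by (metis imageI subsetD)
  next
    fix r x assume "r \<in> carrier R" "x \<in> h ` H"
    then obtain a where "a \<in> H" "x = h a" by auto
    then show "r \<odot>\<^bsub>N\<^esub> x \<in> h ` H" using module_hom_smult[OF h, of r a] e \<open>r \<in> carrier R\<close> by (metis imageI subsetD)
  qed
qed

lemma preimage_submodule:
  assumes M: "module R M" and N: "module R N" and h: "h \<in> module_hom R M N" and H: "submodule H R N"
  shows "submodule {x \<in> carrier M. h x \<in> H} R M"
proof -
  interpret M: module R M by fact
  interpret N: module R N by fact
  note e = N.submoduleE[OF H] submodule_zero[OF H]
  show ?thesis
    by (rule M.submoduleI') (auto simp: module_hom_zero[OF h M N] module_hom_add[OF h] module_hom_smult[OF h] e)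
qed

text \<open>The quotient is realised on the carrier type of \<open>M\<close> by choosing one
  representative of each coset. A type of cosets would leave the fixed universe of carriers, so
  cokernels would not be objects.\<close>

lemma quotient_module_ex:
  fixes M :: "('a, 'm) module"
  assumes M: "module R M" and N: "submodule N R M"
  obtains Q :: "('a, 'm) module" and q where "module R Q" "q \<in> module_hom R M Q" "q ` carrier M = carrier Q"
    "\<And>x. x \<in> carrier M \<Longrightarrow> q x = \<zero>\<^bsub>Q\<^esub> \<longleftrightarrow> x \<in> N"
proof -
  interpret M: module R M by fact
  note e = M.submoduleE[OF N] submodule_zero[OF N]
  define f where "f x = (SOME y. y \<in> carrier M \<and> y \<ominus>\<^bsub>M\<^esub> x \<in> N)" for x
  have f: "f x \<in> carrier M \<and> f x \<ominus>\<^bsub>M\<^esub> x \<in> N" if "x \<in> carrier M" for x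
    unfolding f_def by (rule someI[of _ x]) (use that e in \<open>simp add: a_minus_def M.r_neg\<close>)
  have f_eq: "f x = f y \<longleftrightarrow> x \<ominus>\<^bsub>M\<^esub> y \<in> N" if xy: "x \<in> carrier M" "y \<in> carrier M" for x y
  proof
    assume eq: "f x = f y"
    have "x \<ominus>\<^bsub>M\<^esub> y = (f x \<ominus>\<^bsub>M\<^esub> y) \<ominus>\<^bsub>M\<^esub> (f x \<ominus>\<^bsub>M\<^esub> x)"
      using xy f[of x] M.diff_trans[of "f x" y x] by (simp add: a_minus_def[of M "f x \<ominus>\<^bsub>M\<^esub> y"] M.minus_minus_diff M.a_comm)
    then show "x \<ominus>\<^bsub>M\<^esub> y \<in> N" using f xy eq M.submodule_minus[OF N] by metis
  next
    assume d: "x \<ominus>\<^bsub>M\<^esub> y \<in> N"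
    \<comment> \<open>The representative is chosen by a predicate that depends on the coset only, so
      congruent elements receive the same representative.\<close>
    have "z \<ominus>\<^bsub>M\<^esub> x \<in> N \<longleftrightarrow> z \<ominus>\<^bsub>M\<^esub> y \<in> N" if z: "z \<in> carrier M" for z
    proof -
      have 1: "z \<ominus>\<^bsub>M\<^esub> y = (z \<ominus>\<^bsub>M\<^esub> x) \<oplus>\<^bsub>M\<^esub> (x \<ominus>\<^bsub>M\<^esub> y)"
        using z xy by (simp add: M.diff_trans)
      have 2: "z \<ominus>\<^bsub>M\<^esub> x = (z \<ominus>\<^bsub>M\<^esub> y) \<ominus>\<^bsub>M\<^esub> (x \<ominus>\<^bsub>M\<^esub> y)"
        using z xy by (simp add: a_minus_def[of M "z \<ominus>\<^bsub>M\<^esub> y"] M.minus_minus_diff M.diff_trans)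
      show ?thesis using 1 2 d e(5) M.submodule_minus[OF N] by metis
    qed
    then have "(\<lambda>z. z \<in> carrier M \<and> z \<ominus>\<^bsub>M\<^esub> x \<in> N) = (\<lambda>z. z \<in> carrier M \<and> z \<ominus>\<^bsub>M\<^esub> y \<in> N)" by auto
    then show "f x = f y" unfolding f_def by simp
  qed
  have 1: "f (x \<oplus>\<^bsub>M\<^esub> y) = f (x' \<oplus>\<^bsub>M\<^esub> y')"
    if xy: "x \<in> carrier M" "x' \<in> carrier M" "y \<in> carrier M" "y' \<in> carrier M" "f x = f x'" "f y = f y'" for x x' y y'
  proof -
    have "(x \<oplus>\<^bsub>M\<^esub> y) \<ominus>\<^bsub>M\<^esub> (x' \<oplus>\<^bsub>M\<^esub> y') = (x \<ominus>\<^bsub>M\<^esub> x') \<oplus>\<^bsub>M\<^esub> (y \<ominus>\<^bsub>M\<^esub> y')"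
      using xy by (simp add: M.diff_add_diff)
    then show ?thesis using xy f_eq e(5) by simp
  qed
  have 2: "f (r \<odot>\<^bsub>M\<^esub> x) = f (r \<odot>\<^bsub>M\<^esub> x')"
    if xy: "r \<in> carrier R" "x \<in> carrier M" "x' \<in> carrier M" "f x = f x'" for r x x'
  proof -
    have "r \<odot>\<^bsub>M\<^esub> x \<ominus>\<^bsub>M\<^esub> r \<odot>\<^bsub>M\<^esub> x' = r \<odot>\<^bsub>M\<^esub> (x \<ominus>\<^bsub>M\<^esub> x')"
      using xy by (simp add: a_minus_def M.smult_r_distr M.smult_r_minus)
    then show ?thesis using xy f_eq e(4) by simp
  qed
  show ?thesis
  proof (rule that)
    show "module R (image_module f M)" "(\<lambda>x\<in>carrier M. f x) \<in> module_hom R M (image_module f M)"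
      by (rule image_module[OF M]; rule 1 2; assumption)+
    show "(\<lambda>x\<in>carrier M. f x) ` carrier M = carrier (image_module f M)" by simp
    show "(\<lambda>x\<in>carrier M. f x) x = \<zero>\<^bsub>image_module f M\<^esub> \<longleftrightarrow> x \<in> N" if "x \<in> carrier M" for x
      using that f_eq[of x "\<zero>\<^bsub>M\<^esub>"] by (simp add: M.diff_zero)
  qed
qed

lemma module_hom_factor:
  assumes M: "module R M" and Q: "module R Q" and U: "module R U"
    and q: "q \<in> module_hom R M Q" "q ` carrier M = carrier Q" and g: "g \<in> module_hom R M U"
    and ker: "\<And>x. x \<in> carrier M \<Longrightarrow> q x = \<zero>\<^bsub>Q\<^esub> \<Longrightarrow> g x = \<zero>\<^bsub>U\<^esub>"
  obtains h where "h \<in> module_hom R Q U" "\<And>x. x \<in> carrier M \<Longrightarrow> h (q x) = g x"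
proof -
  interpret M: module R M by fact
  interpret Q: module R Q by fact
  interpret U: module R U by fact
  have eq: "g x = g y" if xy: "x \<in> carrier M" "y \<in> carrier M" "q x = q y" for x y
  proof -
    have "q (x \<oplus>\<^bsub>M\<^esub> \<ominus>\<^bsub>M\<^esub> y) = \<zero>\<^bsub>Q\<^esub>"
      using xy module_hom_closed[OF q(1)] by (simp add: module_hom_add[OF q(1)] module_hom_neg[OF q(1) M Q] Q.r_neg)
    then have "g x \<oplus>\<^bsub>U\<^esub> \<ominus>\<^bsub>U\<^esub> g y = \<zero>\<^bsub>U\<^esub>"
      using ker[of "x \<oplus>\<^bsub>M\<^esub> \<ominus>\<^bsub>M\<^esub> y"] xy by (simp add: module_hom_add[OF g] module_hom_neg[OF g M U])
    then show ?thesis using xy module_hom_closed[OF g] U.diff_eq_zero[of "g x" "g y"] by (simp add: a_minus_def)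
  qed
  define s where "s = inv_into (carrier M) q"
  have s: "s z \<in> carrier M \<and> q (s z) = z" if "z \<in> carrier Q" for z
    using that q(2) by (auto simp: s_def inv_into_into f_inv_into_f)
  have h: "(\<lambda>z\<in>carrier Q. g (s z)) \<in> module_hom R Q U"
  proof (rule module_homI[OF _ _ _ Q])
    fix x y assume xy: "x \<in> carrier Q" "y \<in> carrier Q"
    have "g (s (x \<oplus>\<^bsub>Q\<^esub> y)) = g (s x \<oplus>\<^bsub>M\<^esub> s y)"
      by (rule eq) (use xy s in \<open>auto simp: module_hom_add[OF q(1)]\<close>)
    then show "g (s (x \<oplus>\<^bsub>Q\<^esub> y)) = g (s x) \<oplus>\<^bsub>U\<^esub> g (s y)" using xy s by (simp add: module_hom_add[OF g])
  next
    fix r x assume xy: "r \<in> carrier R" "x \<in> carrier Q"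
    have "g (s (r \<odot>\<^bsub>Q\<^esub> x)) = g (r \<odot>\<^bsub>M\<^esub> s x)"
      by (rule eq) (use xy s in \<open>auto simp: module_hom_smult[OF q(1)]\<close>)
    then show "g (s (r \<odot>\<^bsub>Q\<^esub> x)) = r \<odot>\<^bsub>U\<^esub> g (s x)" using xy s by (simp add: module_hom_smult[OF g])
  qed (use s module_hom_closed[OF g] in auto)
  have "(\<lambda>z\<in>carrier Q. g (s z)) (q x) = g x" if "x \<in> carrier M" for x
    using eq[of "s (q x)" x] s[of "q x"] module_hom_closed[OF q(1) that] that by simp
  then show ?thesis using that[OF h] by blast
qed

subsection \<open>Direct sums\<close>

lemma module_sum2_simps [simp]:
  "carrier (module_sum2 M N) = carrier M \<times> carrier N"
  "\<zero>\<^bsub>module_sum2 M N\<^esub> = (\<zero>\<^bsub>M\<^esub>, \<zero>\<^bsub>N\<^esub>)"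
  "(x, y) \<oplus>\<^bsub>module_sum2 M N\<^esub> (x', y') = (x \<oplus>\<^bsub>M\<^esub> x', y \<oplus>\<^bsub>N\<^esub> y')"
  "r \<odot>\<^bsub>module_sum2 M N\<^esub> (x, y) = (r \<odot>\<^bsub>M\<^esub> x, r \<odot>\<^bsub>N\<^esub> y)"
  by (simp_all add: module_sum2_def)

lemma module_sum2:
  assumes "module R M" "module R N"
  shows "module R (module_sum2 M N)"
proof -
  interpret M: module R M by fact
  interpret N: module R N by fact
  show ?thesis
  proof (rule moduleI)
    show "abelian_group (module_sum2 M N)"
    proof (rule abelian_groupI)
      fix x assume "x \<in> carrier (module_sum2 M N)"
      then show "\<exists>y\<in>carrier (module_sum2 M N). y \<oplus>\<^bsub>module_sum2 M N\<^esub> x = \<zero>\<^bsub>module_sum2 M N\<^esub>"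
        by (intro bexI[of _ "(\<ominus>\<^bsub>M\<^esub> fst x, \<ominus>\<^bsub>N\<^esub> snd x)"]) (auto simp: M.l_neg N.l_neg)
    qed (auto simp: M.a_ac N.a_ac)
  qed (auto simp: M.smult_l_distr M.smult_r_distr M.smult_assoc1 N.smult_l_distr N.smult_r_distr N.smult_assoc1 M.R.is_cring)
qed

lemma module_sum2_cong:
  assumes "module_iso R M M'" "module_iso R N N'" "module R M" "module R N"
  shows "module_iso R (module_sum2 M N) (module_sum2 M' N')"
proof -
  obtain f g where a: "f \<in> module_hom R M M'" "g \<in> module_hom R M' M"
    "\<forall>x\<in>carrier M. g (f x) = x" "\<forall>y\<in>carrier M'. f (g y) = y"
    using module_isoE[OF assms(1,3)] .
  obtain f' g' where b: "f' \<in> module_hom R N N'" "g' \<in> module_hom R N' N"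
    "\<forall>x\<in>carrier N. g' (f' x) = x" "\<forall>y\<in>carrier N'. f' (g' y) = y"
    using module_isoE[OF assms(2,4)] .
  show ?thesis
    by (rule module_isoI'[of _ "\<lambda>(x, y). (f x, f' y)" _ _ "\<lambda>(x, y). (g x, g' y)"])
      (use module_sum2[OF assms(3,4)] in \<open>auto simp: a(3,4) b(3,4) module_hom_closed[OF a(1)] module_hom_closed[OF b(1)]
        module_hom_closed[OF a(2)] module_hom_closed[OF b(2)] module_hom_add[OF a(1)] module_hom_add[OF b(1)]
        module_hom_smult[OF a(1)] module_hom_smult[OF b(1)]\<close>)
qed

lemma module_sum2_assoc:
  assumes "module R L" "module R M" "module R N"
  shows "module_iso R (module_sum2 (module_sum2 L M) N) (module_sum2 L (module_sum2 M N))"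
  by (rule module_isoI'[of _ "\<lambda>((x, y), z). (x, y, z)" _ _ "\<lambda>(x, y, z). ((x, y), z)"])
    (use module_sum2[OF module_sum2[OF assms(1,2)] assms(3)] in auto)


lemma module_sum2_zero:
  assumes M: "module R M" and Z: "module R Z" "carrier Z = {\<zero>\<^bsub>Z\<^esub>}"
  shows "module_iso R M (module_sum2 M Z)"
proof -
  interpret Z: module R Z by fact
  show ?thesis
    by (rule module_isoI'[of _ "\<lambda>x. (x, \<zero>\<^bsub>Z\<^esub>)" _ _ fst]) (use assms in auto)
qed

lemma module_sum_simps [simp]:
  "carrier (module_sum I D) = {x \<in> \<Pi>\<^sub>E i\<in>I. carrier (D i). finite {i \<in> I. x i \<noteq> \<zero>\<^bsub>D i\<^esub>}}"
  "\<zero>\<^bsub>module_sum I D\<^esub> = (\<lambda>i\<in>I. \<zero>\<^bsub>D i\<^esub>)"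
  "x \<oplus>\<^bsub>module_sum I D\<^esub> y = (\<lambda>i\<in>I. x i \<oplus>\<^bsub>D i\<^esub> y i)"
  "r \<odot>\<^bsub>module_sum I D\<^esub> x = (\<lambda>i\<in>I. r \<odot>\<^bsub>D i\<^esub> x i)"
  by (simp_all add: module_sum_def)

lemma module_sum:
  assumes R: "cring R" and D: "\<And>i. i \<in> I \<Longrightarrow> module R (D i)"
  shows "module R (module_sum I D)"
proof -
  have ag: "abelian_group (D i)" if "i \<in> I" for i using D[OF that] by (simp add: module_def)
  have z: "\<zero>\<^bsub>D i\<^esub> \<oplus>\<^bsub>D i\<^esub> \<zero>\<^bsub>D i\<^esub> = \<zero>\<^bsub>D i\<^esub>" "\<zero>\<^bsub>D i\<^esub> \<in> carrier (D i)" if "i \<in> I" for i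
    using ag[OF that] by (simp_all add: abelian_group.axioms abelian_monoid.zero_closed abelian_monoid.l_zero)
  note cl = abelian_monoid.a_closed[OF abelian_group.axioms(1)[OF ag]]
  have add_cl: "x \<oplus>\<^bsub>module_sum I D\<^esub> y \<in> carrier (module_sum I D)"
    if x: "x \<in> carrier (module_sum I D)" and y: "y \<in> carrier (module_sum I D)" for x y
  proof -
    have "{i \<in> I. x i \<oplus>\<^bsub>D i\<^esub> y i \<noteq> \<zero>\<^bsub>D i\<^esub>} \<subseteq> {i \<in> I. x i \<noteq> \<zero>\<^bsub>D i\<^esub>} \<union> {i \<in> I. y i \<noteq> \<zero>\<^bsub>D i\<^esub>}"
      using z by auto
    then have "finite {i \<in> I. x i \<oplus>\<^bsub>D i\<^esub> y i \<noteq> \<zero>\<^bsub>D i\<^esub>}" by (rule finite_subset) (use x y in simp)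
    then show ?thesis using x y cl by (auto simp: PiE_iff cong: conj_cong)
  qed
  have smult_cl: "r \<odot>\<^bsub>module_sum I D\<^esub> x \<in> carrier (module_sum I D)"
    if r: "r \<in> carrier R" and x: "x \<in> carrier (module_sum I D)" for r x
  proof -
    have "{i \<in> I. r \<odot>\<^bsub>D i\<^esub> x i \<noteq> \<zero>\<^bsub>D i\<^esub>} \<subseteq> {i \<in> I. x i \<noteq> \<zero>\<^bsub>D i\<^esub>}"
      using module.smult_r_null[OF D] r by auto
    then have "finite {i \<in> I. r \<odot>\<^bsub>D i\<^esub> x i \<noteq> \<zero>\<^bsub>D i\<^esub>}" by (rule finite_subset) (use x in simp)
    then show ?thesis using x r module.smult_closed[OF D] by (auto simp: PiE_iff cong: conj_cong)
  qed
  have mem: "x i \<in> carrier (D i)" if "x \<in> carrier (module_sum I D)" "i \<in> I" for x i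
    using that by auto
  show ?thesis
  proof (rule moduleI[OF R])
    show "abelian_group (module_sum I D)"
    proof (rule abelian_groupI)
      fix x assume x: "x \<in> carrier (module_sum I D)"
      have "(\<ominus>\<^bsub>R\<^esub> \<one>\<^bsub>R\<^esub>) \<odot>\<^bsub>module_sum I D\<^esub> x \<in> carrier (module_sum I D)"
        by (rule smult_cl[OF _ x]) (use R in \<open>simp add: cring.cring_simprules\<close>)
      moreover have "(\<ominus>\<^bsub>R\<^esub> \<one>\<^bsub>R\<^esub>) \<odot>\<^bsub>module_sum I D\<^esub> x \<oplus>\<^bsub>module_sum I D\<^esub> x = \<zero>\<^bsub>module_sum I D\<^esub>"
      proof -
        have "(\<ominus>\<^bsub>R\<^esub> \<one>\<^bsub>R\<^esub>) \<odot>\<^bsub>D i\<^esub> x i \<oplus>\<^bsub>D i\<^esub> x i = \<zero>\<^bsub>D i\<^esub>" if "i \<in> I" for i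
        proof -
          interpret Di: module R "D i" by (rule D[OF that])
          show ?thesis using mem[OF x that] by (simp add: Di.smult_l_minus Di.l_neg)
        qed
        then show ?thesis by (auto intro: restrict_ext)
      qed
      ultimately show "\<exists>y\<in>carrier (module_sum I D). y \<oplus>\<^bsub>module_sum I D\<^esub> x = \<zero>\<^bsub>module_sum I D\<^esub>" by blast
    next
      fix x y assume "x \<in> carrier (module_sum I D)" "y \<in> carrier (module_sum I D)"
      then show "x \<oplus>\<^bsub>module_sum I D\<^esub> y = y \<oplus>\<^bsub>module_sum I D\<^esub> x"
        by (auto intro!: restrict_ext abelian_monoid.a_comm[OF abelian_group.axioms(1)[OF ag]] intro: PiE_mem)
    next
      fix x y w assume "x \<in> carrier (module_sum I D)" "y \<in> carrier (module_sum I D)" "w \<in> carrier (module_sum I D)"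
      then show "x \<oplus>\<^bsub>module_sum I D\<^esub> y \<oplus>\<^bsub>module_sum I D\<^esub> w = x \<oplus>\<^bsub>module_sum I D\<^esub> (y \<oplus>\<^bsub>module_sum I D\<^esub> w)"
        by (auto intro!: restrict_ext abelian_monoid.a_assoc[OF abelian_group.axioms(1)[OF ag]] intro: PiE_mem)
    next
      fix x assume x: "x \<in> carrier (module_sum I D)"
      have "\<zero>\<^bsub>module_sum I D\<^esub> \<oplus>\<^bsub>module_sum I D\<^esub> x = (\<lambda>i\<in>I. x i)"
        using x by (auto intro!: restrict_ext abelian_monoid.l_zero[OF abelian_group.axioms(1)[OF ag]] intro: PiE_mem)
      also have "\<dots> = x" using x by (auto simp: PiE_iff extensional_restrict)
      finally show "\<zero>\<^bsub>module_sum I D\<^esub> \<oplus>\<^bsub>module_sum I D\<^esub> x = x" .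
    next
      show "\<zero>\<^bsub>module_sum I D\<^esub> \<in> carrier (module_sum I D)" using z by auto
    qed (use add_cl in blast)
  next
    fix x assume x: "x \<in> carrier (module_sum I D)"
    have "\<one>\<^bsub>R\<^esub> \<odot>\<^bsub>module_sum I D\<^esub> x = (\<lambda>i\<in>I. x i)"
      using x by (auto intro!: restrict_ext module.smult_one[OF D] intro: PiE_mem)
    also have "\<dots> = x" using x by (auto simp: PiE_iff extensional_restrict)
    finally show "\<one>\<^bsub>R\<^esub> \<odot>\<^bsub>module_sum I D\<^esub> x = x" .
  next
    fix a b x assume "a \<in> carrier R" "b \<in> carrier R" "x \<in> carrier (module_sum I D)"
    then show "(a \<oplus>\<^bsub>R\<^esub> b) \<odot>\<^bsub>module_sum I D\<^esub> x = a \<odot>\<^bsub>module_sum I D\<^esub> x \<oplus>\<^bsub>module_sum I D\<^esub> b \<odot>\<^bsub>module_sum I D\<^esub> x"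
      by (auto intro!: restrict_ext module.smult_l_distr[OF D] intro: PiE_mem)
  next
    fix a b x assume "a \<in> carrier R" "b \<in> carrier R" "x \<in> carrier (module_sum I D)"
    then show "(a \<otimes>\<^bsub>R\<^esub> b) \<odot>\<^bsub>module_sum I D\<^esub> x = a \<odot>\<^bsub>module_sum I D\<^esub> (b \<odot>\<^bsub>module_sum I D\<^esub> x)"
      by (auto intro!: restrict_ext module.smult_assoc1[OF D] intro: PiE_mem)
  next
    fix a x y assume "a \<in> carrier R" "x \<in> carrier (module_sum I D)" "y \<in> carrier (module_sum I D)"
    then show "a \<odot>\<^bsub>module_sum I D\<^esub> (x \<oplus>\<^bsub>module_sum I D\<^esub> y) = a \<odot>\<^bsub>module_sum I D\<^esub> x \<oplus>\<^bsub>module_sum I D\<^esub> a \<odot>\<^bsub>module_sum I D\<^esub> y"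
      by (auto intro!: restrict_ext module.smult_r_distr[OF D] intro: PiE_mem)
  qed (use smult_cl in blast)
qed

text \<open>The two halves of \<open>J\<close> are given by reindexing maps, because later the
  copies belonging to a second summand are numbered after those of the first.\<close>

lemma module_sum_disjoint:
  assumes R: "cring R" and fin: "finite I1" "finite I2" and inj: "inj_on a I1" "inj_on b I2"
    and dis: "a ` I1 \<inter> b ` I2 = {}" and J: "J = a ` I1 \<union> b ` I2" and D: "\<And>j. j \<in> J \<Longrightarrow> module R (D j)"
  shows "module_iso R (module_sum J D)
    (module_sum2 (module_sum I1 (\<lambda>i. D (a i))) (module_sum I2 (\<lambda>i. D (b i))))"
proof (rule module_isoI')
  have finJ: "finite J" using fin J by simp
  let ?h = "\<lambda>x. (\<lambda>i\<in>I1. x (a i), \<lambda>i\<in>I2. x (b i))"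
  let ?g = "\<lambda>(y, z). \<lambda>j\<in>J. if j \<in> a ` I1 then y (inv_into I1 a j) else z (inv_into I2 b j)"
  show "?h x \<in> carrier (module_sum2 (module_sum I1 (\<lambda>i. D (a i))) (module_sum I2 (\<lambda>i. D (b i))))"
    if "x \<in> carrier (module_sum J D)" for x
    using that fin J by (auto simp: PiE_iff)
  show "?h (x \<oplus>\<^bsub>module_sum J D\<^esub> y) = ?h x \<oplus>\<^bsub>module_sum2 (module_sum I1 (\<lambda>i. D (a i))) (module_sum I2 (\<lambda>i. D (b i)))\<^esub> ?h y" for x y
    using J by (auto intro!: restrict_ext)
  show "?h (r \<odot>\<^bsub>module_sum J D\<^esub> x) = r \<odot>\<^bsub>module_sum2 (module_sum I1 (\<lambda>i. D (a i))) (module_sum I2 (\<lambda>i. D (b i)))\<^esub> ?h x" for r x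
    using J by (auto intro!: restrict_ext)
  show "module R (module_sum J D)" by (rule module_sum[OF R D])
  show "?g w \<in> carrier (module_sum J D)"
    if "w \<in> carrier (module_sum2 (module_sum I1 (\<lambda>i. D (a i))) (module_sum I2 (\<lambda>i. D (b i))))" for w
    using that finJ inj J by (auto simp: PiE_iff)
  show "?g (?h x) = x" if x: "x \<in> carrier (module_sum J D)" for x
  proof
    fix j
    show "?g (?h x) j = x j"
    proof (cases "j \<in> J")
      case True
      then show ?thesis using J inj by (auto simp: inv_into_into f_inv_into_f)
    next
      case False
      then show ?thesis using x by (auto simp: PiE_iff extensional_def)
    qed
  qed
  show "?h (?g w) = w"
    if w: "w \<in> carrier (module_sum2 (module_sum I1 (\<lambda>i. D (a i))) (module_sum I2 (\<lambda>i. D (b i))))" for w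
  proof -
    obtain y z where w': "w = (y, z)" by (cases w)
    have "(\<lambda>i\<in>I1. ?g (y, z) (a i)) = y"
    proof
      fix i
      show "(\<lambda>i\<in>I1. ?g (y, z) (a i)) i = y i"
        using w w' J inj by (cases "i \<in> I1") (auto simp: PiE_iff extensional_def)
    qed
    moreover have "(\<lambda>i\<in>I2. ?g (y, z) (b i)) = z"
    proof
      fix i
      have "i \<in> I2 \<Longrightarrow> b i \<notin> a ` I1" using dis by auto
      then show "(\<lambda>i\<in>I2. ?g (y, z) (b i)) i = z i"
        using w w' J inj by (cases "i \<in> I2") (auto simp: PiE_iff extensional_def)
    qed
    ultimately show ?thesis using w' by simp
  qed
qed

lemma module_sum_singleton:
  assumes "module R M"
  shows "module_iso R (module_sum {i} (\<lambda>_. M)) M"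
proof (rule module_isoI'[of _ "\<lambda>x. x i" _ _ "\<lambda>y. \<lambda>j\<in>{i}. y"])
  show "module R (module_sum {i} (\<lambda>_. M))"
    using assms by (intro module_sum) (auto simp: module_def)
qed (auto simp: PiE_iff extensional_def fun_eq_iff)

lemma module_sum_insert:
  assumes R: "cring R" and fin: "finite I" "i \<notin> I" and D: "\<And>j. j \<in> insert i I \<Longrightarrow> module R (D j)"
  shows "module_iso R (module_sum (insert i I) D) (module_sum2 (module_sum I D) (D i))"
proof (rule module_iso_trans)
  show "module_iso R (module_sum (insert i I) D) (module_sum2 (module_sum I D) (module_sum {i} (\<lambda>_. D i)))"
    using module_sum_disjoint[OF R fin(1), of "{i}" "\<lambda>x. x" "\<lambda>_. i" "insert i I" D] fin D by simp
  have m: "module R (module_sum {i} (\<lambda>_. D i))" "module R (module_sum I D)"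
    using D by (auto intro!: module_sum[OF R])
  then show "module R (module_sum2 (module_sum I D) (module_sum {i} (\<lambda>_. D i)))"
    by (intro module_sum2)
  show "module_iso R (module_sum2 (module_sum I D) (module_sum {i} (\<lambda>_. D i))) (module_sum2 (module_sum I D) (D i))"
    using m D by (intro module_sum2_cong module_iso_refl module_sum_singleton) auto
  show "module R (module_sum (insert i I) D)" using D by (intro module_sum[OF R])
qed

subsection \<open>Finitely generated modules\<close>

text \<open>Generation by closure: a property that is stable under the module operations holds
  everywhere once it holds on \<open>Xs\<close>. Coordinates are introduced only where they are
  needed, in \<open>generators_lincomb\<close>.\<close>

definition generates :: "('a, 'b) ring_scheme \<Rightarrow> ('a, 'm) module \<Rightarrow> 'm set \<Rightarrow> bool" where
  "generates R M Xs \<longleftrightarrow> Xs \<subseteq> carrier M \<and> (\<forall>H. submodule H R M \<longrightarrow> Xs \<subseteq> H \<longrightarrow> carrier M \<subseteq> H)"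

definition fin_gen :: "('a, 'b) ring_scheme \<Rightarrow> ('a, 'm) module \<Rightarrow> bool" where
  "fin_gen R M \<longleftrightarrow> (\<exists>Xs. finite Xs \<and> generates R M Xs)"

lemma generatesD:
  assumes "generates R M Xs"
  shows "Xs \<subseteq> carrier M" "\<And>H. submodule H R M \<Longrightarrow> Xs \<subseteq> H \<Longrightarrow> carrier M \<subseteq> H"
  using assms unfolding generates_def by simp_all

lemma fin_genE:
  assumes "fin_gen R M"
  obtains Xs where "finite Xs" "generates R M Xs"
  using assms unfolding fin_gen_def by blast

lemma fin_gen_image:
  assumes M: "module R M" and N: "module R N" and h: "h \<in> module_hom R M N" "h ` carrier M = carrier N"
    and fg: "fin_gen R M"
  shows "fin_gen R N"
proof -
  obtain Xs where Xs0: "finite Xs" "generates R M Xs"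
    using fin_genE[OF fg] .
  note Xs = Xs0(1) generatesD[OF Xs0(2)]
  have "carrier N \<subseteq> H" if H: "submodule H R N" "h ` Xs \<subseteq> H" for H
  proof -
    have "carrier M \<subseteq> {x \<in> carrier M. h x \<in> H}"
      by (rule Xs(3)[OF preimage_submodule[OF M N h(1) H(1)]]) (use Xs(2) H(2) in auto)
    then show ?thesis by (auto simp flip: h(2))
  qed
  then show ?thesis unfolding fin_gen_def generates_def
    using Xs(1,2) module_hom_closed[OF h(1)] by (intro exI[of _ "h ` Xs"]) auto
qed

lemma fin_gen_iso:
  assumes "module_iso R M N" "module R M" "module R N" "fin_gen R M"
  shows "fin_gen R N"
  using assms fin_gen_image[OF assms(2,3)] unfolding module_iso_def bij_betw_def by blast

lemma fin_gen_sum2: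
  assumes M: "module R M" and N: "module R N" and "fin_gen R M" "fin_gen R N"
  shows "fin_gen R (module_sum2 M N)"
proof -
  interpret M: module R M by fact
  interpret N: module R N by fact
  interpret S: module R "module_sum2 M N" by (rule module_sum2[OF M N])
  obtain Xs where Xs0: "finite Xs" "generates R M Xs"
    using fin_genE[OF assms(3)] .
  note Xs = Xs0(1) generatesD[OF Xs0(2)]
  obtain Y where Y0: "finite Y" "generates R N Y"
    using fin_genE[OF assms(4)] .
  note Y = Y0(1) generatesD[OF Y0(2)]
  let ?i = "\<lambda>x\<in>carrier M. (x, \<zero>\<^bsub>N\<^esub>)" and ?j = "\<lambda>y\<in>carrier N. (\<zero>\<^bsub>M\<^esub>, y)"
  have i: "?i \<in> module_hom R M (module_sum2 M N)" by (rule module_homI) (auto simp: M)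
  have j: "?j \<in> module_hom R N (module_sum2 M N)" by (rule module_homI) (auto simp: N)
  have "carrier (module_sum2 M N) \<subseteq> H" if H: "submodule H R (module_sum2 M N)" "?i ` Xs \<union> ?j ` Y \<subseteq> H" for H
  proof -
    have "carrier M \<subseteq> {x \<in> carrier M. ?i x \<in> H}"
      by (rule Xs(3)[OF preimage_submodule[OF M S.module_axioms i H(1)]]) (use Xs(2) H(2) in auto)
    moreover have "carrier N \<subseteq> {x \<in> carrier N. ?j x \<in> H}"
      by (rule Y(3)[OF preimage_submodule[OF N S.module_axioms j H(1)]]) (use Y(2) H(2) in auto)
    ultimately have "(x, y) \<in> H" if "x \<in> carrier M" "y \<in> carrier N" for x y
      using that S.submoduleE(5)[OF H(1), of "(x, \<zero>\<^bsub>N\<^esub>)" "(\<zero>\<^bsub>M\<^esub>, y)"] by (auto simp: subset_iff)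
    then show ?thesis by auto
  qed
  then show ?thesis unfolding fin_gen_def generates_def
    using Xs(1,2) Y(1,2) by (intro exI[of _ "?i ` Xs \<union> ?j ` Y"]) auto
qed

lemma fin_gen_trivial:
  assumes "carrier M = {\<zero>\<^bsub>M\<^esub>}"
  shows "fin_gen R M"
  unfolding fin_gen_def generates_def using assms submodule_zero[of _ R M] by (intro exI[of _ "{}"]) auto

lemma fin_gen_sum:
  assumes R: "cring R" and "finite I" "\<And>i. i \<in> I \<Longrightarrow> module R (D i)" "\<And>i. i \<in> I \<Longrightarrow> fin_gen R (D i)"
  shows "fin_gen R (module_sum I D)"
  using assms(2-4)
proof (induction I rule: finite_induct)
  case empty
  show ?case by (rule fin_gen_trivial) auto
next
  case (insert i I)
  have m: "module R (module_sum I D)" "module R (module_sum (insert i I) D)"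
    using insert.prems by (auto intro!: module_sum[OF R])
  have "fin_gen R (module_sum2 (module_sum I D) (D i))"
    using insert m by (intro fin_gen_sum2) auto
  then show ?case
    using fin_gen_iso[OF module_iso_sym[OF module_sum_insert[OF R insert.hyps(1,2)]]] insert.prems m
    by (auto intro!: module_sum2)
qed

lemma regular_module_simps [simp]:
  "carrier (regular_module R) = carrier R" "\<zero>\<^bsub>regular_module R\<^esub> = \<zero>\<^bsub>R\<^esub>"
  "x \<oplus>\<^bsub>regular_module R\<^esub> y = x \<oplus>\<^bsub>R\<^esub> y" "r \<odot>\<^bsub>regular_module R\<^esub> x = r \<otimes>\<^bsub>R\<^esub> x"
  by (simp_all add: regular_module_def)

context cring
begin

lemma idealI':
  assumes "J \<subseteq> carrier R" "\<zero> \<in> J" "\<And>x y. x \<in> J \<Longrightarrow> y \<in> J \<Longrightarrow> x \<oplus> y \<in> J"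
    "\<And>r x. r \<in> carrier R \<Longrightarrow> x \<in> J \<Longrightarrow> r \<otimes> x \<in> J"
  shows "ideal J R"
proof (rule idealI)
  show "ring R" by (rule ring_axioms)
  show "subgroup J (add_monoid R)"
  proof (rule add.subgroupI)
    fix a assume a: "a \<in> J"
    then have "\<ominus> a = (\<ominus> \<one>) \<otimes> a" using assms(1) by (simp add: l_minus subset_iff)
    then show "\<ominus> a \<in> J" using assms(4)[OF _ a] by simp
  qed (use assms in auto)
  show "x \<otimes> a \<in> J" if "a \<in> J" "x \<in> carrier R" for a x using assms(4) that by simp
  show "a \<otimes> x \<in> J" if "a \<in> J" "x \<in> carrier R" for a x
    using assms(1) assms(4)[OF that(2,1)] that m_comm[of a x] by auto
qed

lemma regular_module: "module R (regular_module R)"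
proof (rule moduleI)
  show "abelian_group (regular_module R)"
  proof (rule abelian_groupI)
    fix x assume "x \<in> carrier (regular_module R)"
    then show "\<exists>y\<in>carrier (regular_module R). y \<oplus>\<^bsub>regular_module R\<^esub> x = \<zero>\<^bsub>regular_module R\<^esub>"
      by (intro bexI[of _ "\<ominus> x"]) (auto simp: l_neg)
  qed (auto simp: a_ac)
qed (auto simp: l_distr r_distr m_assoc is_cring)

lemma ideal_iff_submodule: "ideal H R \<longleftrightarrow> submodule H R (regular_module R)"
proof
  interpret M: module R "regular_module R" by (rule regular_module)
  assume "ideal H R"
  then interpret H: ideal H R .
  show "submodule H R (regular_module R)" by (rule M.submoduleI') (use H.I_l_closed H.Icarr in auto)
next
  interpret M: module R "regular_module R" by (rule regular_module)
  assume H: "submodule H R (regular_module R)"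
  show "ideal H R"
    by (rule idealI') (use M.submoduleE[OF H] submodule_zero[OF H] in auto)
qed

lemma smult_hom:
  assumes M: "module R M" and r: "r \<in> carrier R"
  shows "(\<lambda>x\<in>carrier M. r \<odot>\<^bsub>M\<^esub> x) \<in> module_hom R M M"
proof -
  interpret M: module R M by fact
  show ?thesis
    by (rule module_homI[OF _ _ _ M]) (use r in \<open>auto simp: M.smult_r_distr m_comm simp flip: M.smult_assoc1\<close>)
qed

lemma fin_gen_regular: "fin_gen R (regular_module R)"
proof -
  interpret M: module R "regular_module R" by (rule regular_module)
  have "carrier R \<subseteq> H" if "submodule H R (regular_module R)" "\<one> \<in> H" for H
    using M.submoduleE(4)[OF that(1) _ that(2)] by auto
  then show ?thesis unfolding fin_gen_def generates_def by (intro exI[of _ "{\<one>}"]) auto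
qed

lemma free_module: "module R (free_module R n)" and fin_gen_free: "fin_gen R (free_module R n)"
  unfolding free_module_def
  by (auto intro!: module_sum fin_gen_sum is_cring regular_module fin_gen_regular)

lemma carrier_free_module: "carrier (free_module R n) = ({..<n} \<rightarrow>\<^sub>E carrier R)"
  by (auto simp: free_module_def)

end

text \<open>Combinations run over an initial segment of the natural numbers, matching the
  coordinates of \<open>free_module R n\<close>.\<close>

primrec lincomb :: "('a, 'm) module \<Rightarrow> (nat \<Rightarrow> 'a) \<Rightarrow> (nat \<Rightarrow> 'm) \<Rightarrow> nat \<Rightarrow> 'm" where
  "lincomb M a x 0 = \<zero>\<^bsub>M\<^esub>"
| "lincomb M a x (Suc n) = lincomb M a x n \<oplus>\<^bsub>M\<^esub> a n \<odot>\<^bsub>M\<^esub> x n"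

locale rmod = module R M for R :: "('a, 'b) ring_scheme" (structure) and M :: "('a, 'm) module"

context rmod
begin

lemma lincomb_closed [simp]:
  "(\<And>i. i < n \<Longrightarrow> a i \<in> carrier R) \<Longrightarrow> (\<And>i. i < n \<Longrightarrow> x i \<in> carrier M) \<Longrightarrow> lincomb M a x n \<in> carrier M"
  by (induction n) auto

lemma lincomb_cong:
  "(\<And>i. i < n \<Longrightarrow> a i = b i) \<Longrightarrow> (\<And>i. i < n \<Longrightarrow> x i = y i) \<Longrightarrow> lincomb M a x n = lincomb M b y n"
  by (induction n) auto

lemma lincomb_add:
  "(\<And>i. i < n \<Longrightarrow> a i \<in> carrier R) \<Longrightarrow> (\<And>i. i < n \<Longrightarrow> b i \<in> carrier R) \<Longrightarrow> (\<And>i. i < n \<Longrightarrow> x i \<in> carrier M)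
    \<Longrightarrow> lincomb M (\<lambda>i. a i \<oplus> b i) x n = lincomb M a x n \<oplus>\<^bsub>M\<^esub> lincomb M b x n"
proof (induction n)
  case (Suc n)
  then have "lincomb M (\<lambda>i. a i \<oplus> b i) x n = lincomb M a x n \<oplus>\<^bsub>M\<^esub> lincomb M b x n"
    "lincomb M a x n \<in> carrier M" "lincomb M b x n \<in> carrier M"
    "a n \<in> carrier R" "b n \<in> carrier R" "x n \<in> carrier M" by simp_all
  then show ?case by (simp add: smult_l_distr M.a_ac)
qed simp

lemma lincomb_smult:
  "r \<in> carrier R \<Longrightarrow> (\<And>i. i < n \<Longrightarrow> a i \<in> carrier R) \<Longrightarrow> (\<And>i. i < n \<Longrightarrow> x i \<in> carrier M)
    \<Longrightarrow> lincomb M (\<lambda>i. r \<otimes> a i) x n = r \<odot>\<^bsub>M\<^esub> lincomb M a x n"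
proof (induction n)
  case (Suc n)
  then have "lincomb M (\<lambda>i. r \<otimes> a i) x n = r \<odot>\<^bsub>M\<^esub> lincomb M a x n"
    "lincomb M a x n \<in> carrier M" "a n \<in> carrier R" "x n \<in> carrier M" "r \<in> carrier R" by simp_all
  then show ?case by (simp add: smult_r_distr smult_assoc1)
qed simp

lemma lincomb_unit:
  "(\<And>i. i < n \<Longrightarrow> x i \<in> carrier M) \<Longrightarrow> lincomb M (\<lambda>i. if i = j then \<one> else \<zero>) x n = (if j < n then x j else \<zero>\<^bsub>M\<^esub>)"
  by (induction n) (auto simp: less_Suc_eq)

lemma lincomb_submodule:
  assumes "submodule H R M" "\<And>i. i < n \<Longrightarrow> a i \<in> carrier R" "\<And>i. i < n \<Longrightarrow> x i \<in> H"
  shows "lincomb M a x n \<in> H"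
  using assms(2,3) by (induction n) (auto intro: submoduleE[OF assms(1)] submodule_zero[OF assms(1)])

lemma lincomb_hom:
  assumes "\<And>i. i < n \<Longrightarrow> x i \<in> carrier M"
  shows "(\<lambda>a\<in>carrier (free_module R n). lincomb M a x n) \<in> module_hom R (free_module R n) M"
proof (rule module_homI[OF _ _ _ R.free_module])
  fix a b assume "a \<in> carrier (free_module R n)" "b \<in> carrier (free_module R n)"
  moreover from this have "lincomb M (a \<oplus>\<^bsub>free_module R n\<^esub> b) x n = lincomb M (\<lambda>i. a i \<oplus> b i) x n"
    by (intro lincomb_cong) (auto simp: free_module_def)
  ultimately show "lincomb M (a \<oplus>\<^bsub>free_module R n\<^esub> b) x n = lincomb M a x n \<oplus>\<^bsub>M\<^esub> lincomb M b x n"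
    using assms by (simp add: lincomb_add R.carrier_free_module PiE_iff)
next
  fix r a assume "r \<in> carrier R" "a \<in> carrier (free_module R n)"
  moreover from this have "lincomb M (r \<odot>\<^bsub>free_module R n\<^esub> a) x n = lincomb M (\<lambda>i. r \<otimes> a i) x n"
    by (intro lincomb_cong) (auto simp: free_module_def)
  ultimately show "lincomb M (r \<odot>\<^bsub>free_module R n\<^esub> a) x n = r \<odot>\<^bsub>M\<^esub> lincomb M a x n"
    using assms by (simp add: lincomb_smult R.carrier_free_module PiE_iff)
qed (use assms in \<open>auto simp: R.carrier_free_module PiE_iff\<close>)

text \<open>The combinations form the image of a homomorphism from the free module. This image is a
  submodule, and the unit vectors put the generators into it.\<close>

lemma generators_lincomb:
  assumes gen: "generates R M (x ` {..<n})" and y: "y \<in> carrier M"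
  obtains a where "a \<in> carrier (free_module R n)" "y = lincomb M a x n"
proof -
  let ?g = "\<lambda>a\<in>carrier (free_module R n). lincomb M a x n"
  have x: "x i \<in> carrier M" if "i < n" for i using generatesD(1)[OF gen] that by auto
  have g: "?g \<in> module_hom R (free_module R n) M" by (rule lincomb_hom[OF x])
  interpret F: module R "free_module R n" by (rule R.free_module)
  have "submodule (?g ` carrier (free_module R n)) R M"
    by (rule image_submodule[OF F.module_axioms module_axioms g F.carrier_is_submodule])
  moreover have "x j \<in> ?g ` carrier (free_module R n)" if j: "j < n" for j
  proof -
    let ?e = "\<lambda>i\<in>{..<n}. if i = j then \<one> else \<zero>"
    have e: "?e \<in> carrier (free_module R n)" by (auto simp: R.carrier_free_module)
    have "lincomb M ?e x n = lincomb M (\<lambda>i. if i = j then \<one> else \<zero>) x n" by (rule lincomb_cong) auto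
    also have "\<dots> = x j" using lincomb_unit[of n x j] x j by simp
    finally have "?g ?e = x j" using e by simp
    then show ?thesis using e by (intro image_eqI[of _ ?g ?e]) auto
  qed
  ultimately have "carrier M \<subseteq> ?g ` carrier (free_module R n)" by (intro generatesD(2)[OF gen]) auto
  then show ?thesis using y that by auto
qed

lemma fin_gen_enum:
  assumes "fin_gen R M"
  obtains n and x :: "nat \<Rightarrow> 'm" where "generates R M (x ` {..<n})"
proof -
  obtain Xs where Xs0: "finite Xs" "generates R M Xs"
    using fin_genE[OF assms] .
  note Xs = Xs0(1) generatesD[OF Xs0(2)]
  obtain n and x :: "nat \<Rightarrow> 'm" where "Xs = x ` {i. i < n}" "inj_on x {i. i < n}"
    using finite_imp_nat_seg_image_inj_on[OF Xs(1)] by blast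
  then have "Xs = x ` {..<n}" by (simp add: lessThan_def)
  then show ?thesis using Xs0(2) that[of x n] by simp
qed

lemma fin_gen_free_surj:
  assumes "fin_gen R M"
  obtains n g where "g \<in> module_hom R (free_module R n) M" "g ` carrier (free_module R n) = carrier M"
proof -
  obtain n and x :: "nat \<Rightarrow> 'm" where gen: "generates R M (x ` {..<n})"
    using fin_gen_enum[OF assms] .
  have x: "x i \<in> carrier M" if "i < n" for i using generatesD(1)[OF gen] that by auto
  let ?g = "\<lambda>a\<in>carrier (free_module R n). lincomb M a x n"
  have g: "?g \<in> module_hom R (free_module R n) M" by (rule lincomb_hom[OF x])
  have "y \<in> ?g ` carrier (free_module R n)" if y: "y \<in> carrier M" for y
  proof -
    obtain a where "a \<in> carrier (free_module R n)" "y = lincomb M a x n" using generators_lincomb[OF gen y] .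
    then show ?thesis by auto
  qed
  then have "?g ` carrier (free_module R n) = carrier M" using module_hom_closed[OF g] by blast
  then show ?thesis using that g by blast
qed

definition spn :: "'m set \<Rightarrow> 'm set" where
  "spn Xs = \<Inter>{H. submodule H R M \<and> Xs \<subseteq> H}"

lemma spn_submodule: "Xs \<subseteq> carrier M \<Longrightarrow> submodule (spn Xs) R M"
proof (rule submoduleI')
  assume Xs: "Xs \<subseteq> carrier M"
  then show "spn Xs \<subseteq> carrier M" unfolding spn_def using carrier_is_submodule by blast
qed (auto simp: spn_def intro: submodule_zero submoduleE)

lemma spn_incl: "Xs \<subseteq> spn Xs" unfolding spn_def by blast

lemma spn_least: "submodule H R M \<Longrightarrow> Xs \<subseteq> H \<Longrightarrow> spn Xs \<subseteq> H" unfolding spn_def by blast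

lemma add_submodule:
  assumes H: "submodule H R M" and K: "submodule K R M"
  shows "submodule {y. \<exists>h\<in>H. \<exists>k\<in>K. y = h \<oplus>\<^bsub>M\<^esub> k} R M"
proof -
  note h = submoduleE[OF H] submodule_zero[OF H] and k = submoduleE[OF K] submodule_zero[OF K]
  note [simp] = subsetD[OF h(1)] subsetD[OF k(1)]
  show ?thesis
  proof (rule submoduleI')
    show "\<zero>\<^bsub>M\<^esub> \<in> {y. \<exists>h\<in>H. \<exists>k\<in>K. y = h \<oplus>\<^bsub>M\<^esub> k}" using h k by force
  next
    fix x y assume "x \<in> {y. \<exists>h\<in>H. \<exists>k\<in>K. y = h \<oplus>\<^bsub>M\<^esub> k}" "y \<in> {y. \<exists>h\<in>H. \<exists>k\<in>K. y = h \<oplus>\<^bsub>M\<^esub> k}"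
    then obtain a b a' b' where ab: "a \<in> H" "b \<in> K" "a' \<in> H" "b' \<in> K" "x = a \<oplus>\<^bsub>M\<^esub> b" "y = a' \<oplus>\<^bsub>M\<^esub> b'" by auto
    then have "x \<oplus>\<^bsub>M\<^esub> y = (a \<oplus>\<^bsub>M\<^esub> a') \<oplus>\<^bsub>M\<^esub> (b \<oplus>\<^bsub>M\<^esub> b')" by (simp add: M.a_ac)
    then show "x \<oplus>\<^bsub>M\<^esub> y \<in> {y. \<exists>h\<in>H. \<exists>k\<in>K. y = h \<oplus>\<^bsub>M\<^esub> k}" using ab h(5) k(5) by blast
  next
    fix r x assume "r \<in> carrier R" "x \<in> {y. \<exists>h\<in>H. \<exists>k\<in>K. y = h \<oplus>\<^bsub>M\<^esub> k}"
    then obtain a b where ab: "a \<in> H" "b \<in> K" "x = a \<oplus>\<^bsub>M\<^esub> b" by auto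
    then have "r \<odot>\<^bsub>M\<^esub> x = r \<odot>\<^bsub>M\<^esub> a \<oplus>\<^bsub>M\<^esub> r \<odot>\<^bsub>M\<^esub> b" using \<open>r \<in> carrier R\<close> by (simp add: smult_r_distr)
    then show "r \<odot>\<^bsub>M\<^esub> x \<in> {y. \<exists>h\<in>H. \<exists>k\<in>K. y = h \<oplus>\<^bsub>M\<^esub> k}" using ab h(4) k(4) \<open>r \<in> carrier R\<close> by blast
  qed auto
qed

lemma cyclic_submodule:
  assumes x: "x \<in> carrier M"
  shows "submodule {y. \<exists>r\<in>carrier R. y = r \<odot>\<^bsub>M\<^esub> x} R M"
proof (rule submoduleI')
  show "\<zero>\<^bsub>M\<^esub> \<in> {y. \<exists>r\<in>carrier R. y = r \<odot>\<^bsub>M\<^esub> x}" using x by (auto intro!: bexI[of _ \<zero>])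
next
  fix y z assume "y \<in> {y. \<exists>r\<in>carrier R. y = r \<odot>\<^bsub>M\<^esub> x}" "z \<in> {y. \<exists>r\<in>carrier R. y = r \<odot>\<^bsub>M\<^esub> x}"
  then obtain r s where "r \<in> carrier R" "s \<in> carrier R" "y = r \<odot>\<^bsub>M\<^esub> x" "z = s \<odot>\<^bsub>M\<^esub> x" by auto
  then show "y \<oplus>\<^bsub>M\<^esub> z \<in> {y. \<exists>r\<in>carrier R. y = r \<odot>\<^bsub>M\<^esub> x}"
    using x by (auto intro!: bexI[of _ "r \<oplus> s"] simp: smult_l_distr)
next
  fix s y assume "s \<in> carrier R" "y \<in> {y. \<exists>r\<in>carrier R. y = r \<odot>\<^bsub>M\<^esub> x}"
  then obtain r where "r \<in> carrier R" "y = r \<odot>\<^bsub>M\<^esub> x" by auto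
  then show "s \<odot>\<^bsub>M\<^esub> y \<in> {y. \<exists>r\<in>carrier R. y = r \<odot>\<^bsub>M\<^esub> x}"
    using x \<open>s \<in> carrier R\<close> by (auto intro!: bexI[of _ "s \<otimes> r"] simp: smult_assoc1)
qed (use x in auto)

lemma spn_insert:
  assumes x: "x \<in> carrier M" "Xs \<subseteq> carrier M" and y: "y \<in> spn (insert x Xs)"
  obtains r z where "r \<in> carrier R" "z \<in> spn Xs" "y = r \<odot>\<^bsub>M\<^esub> x \<oplus>\<^bsub>M\<^esub> z"
proof -
  let ?H = "{y. \<exists>h\<in>{y. \<exists>r\<in>carrier R. y = r \<odot>\<^bsub>M\<^esub> x}. \<exists>k\<in>spn Xs. y = h \<oplus>\<^bsub>M\<^esub> k}"
  have H: "submodule ?H R M" by (rule add_submodule[OF cyclic_submodule[OF x(1)] spn_submodule[OF x(2)]])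
  note s = submodule_zero[OF spn_submodule[OF x(2)]] submoduleE(1)[OF spn_submodule[OF x(2)]]
  have "x \<in> ?H"
    using x s by (auto intro!: exI[of _ x] bexI[of _ \<one>] bexI[of _ "\<zero>\<^bsub>M\<^esub>"])
  moreover have "Xs \<subseteq> ?H"
  proof
    fix z assume z: "z \<in> Xs"
    then have "z \<in> spn Xs" "\<zero> \<odot>\<^bsub>M\<^esub> x \<oplus>\<^bsub>M\<^esub> z = z" using spn_incl x by auto
    then show "z \<in> ?H" using R.zero_closed by (metis (mono_tags, lifting) mem_Collect_eq)
  qed
  ultimately have "y \<in> ?H" using spn_least[OF H, of "insert x Xs"] y by blast
  then show ?thesis using that by blast
qed

end

section \<open>Finiteness over noetherian rings\<close>

locale noetherian_cring = noetherian_ring R + cring R for R (structure)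

sublocale noetherian_domain \<subseteq> noetherian_cring ..

context noetherian_cring
begin

text \<open>Induction on the generators, as in a basis theorem. The coefficients of \<open>x\<close>
  that occur in \<open>N\<close> form an ideal \<open>J N\<close>. Lifts of its finitely many
  generators, together with generators of the part of \<open>N\<close> inside the span of the
  remaining vectors, generate \<open>N\<close>.\<close>

lemma submodule_fin_gen_aux:
  assumes M: "module R M"
  shows "finite Xs \<Longrightarrow> Xs \<subseteq> carrier M \<Longrightarrow> submodule N R M \<Longrightarrow> N \<subseteq> rmod.spn R M Xs
    \<Longrightarrow> \<exists>Y. finite Y \<and> Y \<subseteq> N \<and> (\<forall>H. submodule H R M \<longrightarrow> Y \<subseteq> H \<longrightarrow> N \<subseteq> H)"
proof (induction Xs arbitrary: N rule: finite_induct)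
  case empty
  interpret M: rmod R M by (rule rmod.intro) fact
  have "submodule {\<zero>\<^bsub>M\<^esub>} R M" by (rule M.submoduleI') auto
  then have "M.spn {} \<subseteq> {\<zero>\<^bsub>M\<^esub>}" by (rule M.spn_least) simp
  then show ?case using empty submodule_zero[of _ R M] by (intro exI[of _ "{}"]) blast
next
  case (insert x Xs)
  interpret M: rmod R M by (rule rmod.intro) fact
  have x: "x \<in> carrier M" and Xc: "Xs \<subseteq> carrier M" using insert.prems by auto
  note S = M.spn_submodule[OF Xc]
  note s = M.submoduleE[OF S] submodule_zero[OF S]
  define J where "J H = {r \<in> carrier R. \<exists>z\<in>M.spn Xs. r \<odot>\<^bsub>M\<^esub> x \<oplus>\<^bsub>M\<^esub> z \<in> H}" for H
  have J: "ideal (J H) R" if H: "submodule H R M" for H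
  proof (rule idealI')
    note h = M.submoduleE[OF H] submodule_zero[OF H]
    show "\<zero> \<in> J H" unfolding J_def using s h x by (auto intro!: bexI[of _ "\<zero>\<^bsub>M\<^esub>"])
  next
    fix r t assume "r \<in> J H" "t \<in> J H"
    then obtain z w where z: "r \<in> carrier R" "t \<in> carrier R" "z \<in> M.spn Xs" "w \<in> M.spn Xs"
      "r \<odot>\<^bsub>M\<^esub> x \<oplus>\<^bsub>M\<^esub> z \<in> H" "t \<odot>\<^bsub>M\<^esub> x \<oplus>\<^bsub>M\<^esub> w \<in> H" by (auto simp: J_def)
    have "(r \<oplus> t) \<odot>\<^bsub>M\<^esub> x \<oplus>\<^bsub>M\<^esub> (z \<oplus>\<^bsub>M\<^esub> w) = (r \<odot>\<^bsub>M\<^esub> x \<oplus>\<^bsub>M\<^esub> z) \<oplus>\<^bsub>M\<^esub> (t \<odot>\<^bsub>M\<^esub> x \<oplus>\<^bsub>M\<^esub> w)"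
      using z x s(1) by (simp add: M.smult_l_distr M.a_ac subset_iff)
    then have "(r \<oplus> t) \<odot>\<^bsub>M\<^esub> x \<oplus>\<^bsub>M\<^esub> (z \<oplus>\<^bsub>M\<^esub> w) \<in> H" using M.submoduleE(5)[OF H] z by simp
    then show "r \<oplus> t \<in> J H" using z s(5) by (auto simp: J_def)
  next
    fix a r assume a: "a \<in> carrier R" and "r \<in> J H"
    then obtain z where z: "r \<in> carrier R" "z \<in> M.spn Xs" "r \<odot>\<^bsub>M\<^esub> x \<oplus>\<^bsub>M\<^esub> z \<in> H" by (auto simp: J_def)
    have "(a \<otimes> r) \<odot>\<^bsub>M\<^esub> x \<oplus>\<^bsub>M\<^esub> a \<odot>\<^bsub>M\<^esub> z = a \<odot>\<^bsub>M\<^esub> (r \<odot>\<^bsub>M\<^esub> x \<oplus>\<^bsub>M\<^esub> z)"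
      using z x s(1) a by (simp add: M.smult_r_distr M.smult_assoc1 subset_iff)
    then have "(a \<otimes> r) \<odot>\<^bsub>M\<^esub> x \<oplus>\<^bsub>M\<^esub> a \<odot>\<^bsub>M\<^esub> z \<in> H" using M.submoduleE(4)[OF H a] z by simp
    then show "a \<otimes> r \<in> J H" using z a s(4) by (auto simp: J_def)
  qed (auto simp: J_def)
  note n = M.submoduleE[OF insert.prems(2)]
  obtain A where A: "A \<subseteq> carrier R" "finite A" "J N = Idl A"
    using finetely_gen[OF J[OF insert.prems(2)]] by blast
  have "A \<subseteq> J N" using A genideal_self by simp
  then have "\<forall>a\<in>A. \<exists>z\<in>M.spn Xs. a \<odot>\<^bsub>M\<^esub> x \<oplus>\<^bsub>M\<^esub> z \<in> N" by (auto simp: J_def)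
  then obtain z where z: "\<And>a. a \<in> A \<Longrightarrow> z a \<in> M.spn Xs \<and> a \<odot>\<^bsub>M\<^esub> x \<oplus>\<^bsub>M\<^esub> z a \<in> N" by metis
  have "submodule (N \<inter> M.spn Xs) R M"
    by (rule M.submoduleI') (use n s submodule_zero[OF insert.prems(2)] in auto)
  then obtain Y where Y: "finite Y" "Y \<subseteq> N \<inter> M.spn Xs"
      "\<forall>H. submodule H R M \<longrightarrow> Y \<subseteq> H \<longrightarrow> N \<inter> M.spn Xs \<subseteq> H"
    using insert.IH[OF Xc, of "N \<inter> M.spn Xs"] by auto
  let ?Y = "(\<lambda>a. a \<odot>\<^bsub>M\<^esub> x \<oplus>\<^bsub>M\<^esub> z a) ` A \<union> Y"
  have "N \<subseteq> H" if H: "submodule H R M" "?Y \<subseteq> H" for H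
  proof
    fix y assume y: "y \<in> N"
    then obtain r w where r: "r \<in> carrier R" "w \<in> M.spn Xs" "y = r \<odot>\<^bsub>M\<^esub> x \<oplus>\<^bsub>M\<^esub> w"
      using M.spn_insert[OF x Xc, of y] insert.prems(3) by blast
    \<comment> \<open>Intersecting with \<open>N\<close> makes the comparison element r x + w' lie
      in \<open>N\<close> too, so that the difference from \<open>y\<close> falls under the
      induction hypothesis.\<close>
    have HN: "submodule (H \<inter> N) R M"
      by (rule M.submoduleI') (use n M.submoduleE[OF H(1)] submodule_zero[OF insert.prems(2)] submodule_zero[OF H(1)] in auto)
    have "A \<subseteq> J (H \<inter> N)" using z H(2) A(1) by (fastforce simp: J_def image_subset_iff)
    then have "J N \<subseteq> J (H \<inter> N)" using genideal_minimal[OF J[OF HN]] A(3) by simp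
    moreover have "r \<in> J N" using r y by (auto simp: J_def)
    ultimately obtain w' where w': "w' \<in> M.spn Xs" "r \<odot>\<^bsub>M\<^esub> x \<oplus>\<^bsub>M\<^esub> w' \<in> H \<inter> N" by (auto simp: J_def)
    have c: "r \<odot>\<^bsub>M\<^esub> x \<in> carrier M" "w \<in> carrier M" "w' \<in> carrier M" using r x w' s(1) by auto
    have eq: "y \<ominus>\<^bsub>M\<^esub> (r \<odot>\<^bsub>M\<^esub> x \<oplus>\<^bsub>M\<^esub> w') = w \<ominus>\<^bsub>M\<^esub> w'"
      using c r(3) M.diff_add_diff[of "r \<odot>\<^bsub>M\<^esub> x" w "r \<odot>\<^bsub>M\<^esub> x" w'] by (simp add: M.diff_eq_zero)
    have "w \<ominus>\<^bsub>M\<^esub> w' \<in> N \<inter> M.spn Xs"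
      using M.submodule_minus[OF insert.prems(2) y, of "r \<odot>\<^bsub>M\<^esub> x \<oplus>\<^bsub>M\<^esub> w'"] eq w'
        M.submodule_minus[OF S r(2) w'(1)] by simp
    then have "w \<ominus>\<^bsub>M\<^esub> w' \<in> H" using Y(3) H by auto
    moreover have "y = (r \<odot>\<^bsub>M\<^esub> x \<oplus>\<^bsub>M\<^esub> w') \<oplus>\<^bsub>M\<^esub> (w \<ominus>\<^bsub>M\<^esub> w')"
      using c r(3) by (simp add: a_minus_def M.a_assoc M.r_neg M.a_comm[of w "\<ominus>\<^bsub>M\<^esub> w'"] M.r_neg2)
    ultimately show "y \<in> H" using M.submoduleE(5)[OF H(1), of "r \<odot>\<^bsub>M\<^esub> x \<oplus>\<^bsub>M\<^esub> w'"] w'(2) by blast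
  qed
  then show ?case using Y A(2) z by (intro exI[of _ ?Y]) auto
qed

lemma submodule_generators:
  assumes M: "module R M" "fin_gen R M" and N: "submodule N R M"
  obtains Y where "finite Y" "Y \<subseteq> N" "\<forall>H. submodule H R M \<longrightarrow> Y \<subseteq> H \<longrightarrow> N \<subseteq> H"
proof -
  interpret M: rmod R M by (rule rmod.intro) fact
  obtain Xs where Xs0: "finite Xs" "generates R M Xs"
    using fin_genE[OF M(2)] .
  note Xs = Xs0(1) generatesD[OF Xs0(2)]
  have "N \<subseteq> M.spn Xs"
    using Xs(3)[OF M.spn_submodule[OF Xs(2)] M.spn_incl] M.submoduleE(1)[OF N] by blast
  then show ?thesis using submodule_fin_gen_aux[OF M(1) Xs(1,2) N] that by blast
qed

lemma submodule_fin_gen: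
  assumes M: "module R M" "fin_gen R M" and N: "submodule N R M"
  shows "fin_gen R (M\<lparr>carrier := N\<rparr>)"
proof -
  interpret M: rmod R M by (rule rmod.intro) fact
  obtain Y where "finite Y" "Y \<subseteq> N" "\<forall>H. submodule H R M \<longrightarrow> Y \<subseteq> H \<longrightarrow> N \<subseteq> H"
    using submodule_generators[OF assms] .
  then show ?thesis unfolding fin_gen_def generates_def M.submodule_restrict[OF N] by (intro exI[of _ Y]) auto
qed

text \<open>The union of a chain is a submodule, hence finitely generated, and finitely many
  generators already lie in one member. So the chain has a greatest element and Zorn's lemma
  applies.\<close>

lemma submodule_maximal:
  assumes M: "module R M" "fin_gen R M" and ne: "A \<in> Fam" and S: "\<And>H. H \<in> Fam \<Longrightarrow> submodule H R M"
  obtains H where "H \<in> Fam" "\<And>K. K \<in> Fam \<Longrightarrow> H \<subseteq> K \<Longrightarrow> K = H"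
proof -
  interpret M: rmod R M by (rule rmod.intro) fact
  have "\<exists>H\<in>Fam. \<forall>K\<in>Fam. H \<subseteq> K \<longrightarrow> K = H"
  proof (rule subset_Zorn_nonempty)
    show "Fam \<noteq> {}" using ne by blast
  next
    fix c assume c: "c \<noteq> {}" "subset.chain Fam c"
    have sub: "submodule H R M" if "H \<in> c" for H using c(2) S that by (auto simp: subset_chain_def)
    have U: "submodule (\<Union>c) R M"
    proof (rule M.submoduleI')
      show "\<Union>c \<subseteq> carrier M" using M.submoduleE(1)[OF sub] by blast
      show "\<zero>\<^bsub>M\<^esub> \<in> \<Union>c" using c(1) submodule_zero[OF sub] by blast
    next
      fix x y assume "x \<in> \<Union>c" "y \<in> \<Union>c"
      then obtain H K where "H \<in> c" "K \<in> c" "x \<in> H" "y \<in> K" by blast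
      moreover from this have "H \<subseteq> K \<or> K \<subseteq> H" using c(2) by (auto simp: subset_chain_def)
      ultimately show "x \<oplus>\<^bsub>M\<^esub> y \<in> \<Union>c" using M.submoduleE(5)[OF sub] by blast
    next
      fix r x assume "r \<in> carrier R" "x \<in> \<Union>c"
      then show "r \<odot>\<^bsub>M\<^esub> x \<in> \<Union>c" using M.submoduleE(4)[OF sub] by blast
    qed
    obtain Y where Y: "finite Y" "Y \<subseteq> \<Union>c" "\<forall>H. submodule H R M \<longrightarrow> Y \<subseteq> H \<longrightarrow> \<Union>c \<subseteq> H"
      using submodule_generators[OF M U] .
    have "\<exists>H\<in>c. Y \<subseteq> H" using Y(1,2)
    proof (induction Y rule: finite_induct)
      case empty
      then show ?case using c(1) by blast
    next
      case (insert y Y)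
      then obtain H K where "H \<in> c" "Y \<subseteq> H" "K \<in> c" "y \<in> K" by auto
      moreover from this have "H \<subseteq> K \<or> K \<subseteq> H" using c(2) by (auto simp: subset_chain_def)
      ultimately show ?case by blast
    qed
    then obtain H where "H \<in> c" "Y \<subseteq> H" by blast
    then have "\<Union>c = H" using Y(3) sub by blast
    then show "\<Union>c \<in> Fam" using \<open>H \<in> c\<close> c(2) by (auto simp: subset_chain_def)
  qed
  then show ?thesis using that by blast
qed

text \<open>Over a noetherian ring the kernel of a free cover is itself finitely generated, which
  supplies the relations.\<close>

lemma finitely_presented_iff: "finitely_presented R M \<longleftrightarrow> module R M \<and> fin_gen R M"
proof
  assume "finitely_presented R M"
  then show "module R M \<and> fin_gen R M"
    unfolding finitely_presented_def using fin_gen_image[OF free_module _ _ _ fin_gen_free] by blast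
next
  assume M: "module R M \<and> fin_gen R M"
  then interpret M: rmod R M by (simp add: rmod.intro)
  obtain n g where g: "g \<in> module_hom R (free_module R n) M" "g ` carrier (free_module R n) = carrier M"
    using M.fin_gen_free_surj M by blast
  let ?F = "free_module R n"
  let ?K = "{x \<in> carrier ?F. g x = \<zero>\<^bsub>M\<^esub>}"
  interpret F: module R ?F by (rule free_module)
  have K: "submodule ?K R ?F" by (rule kernel_submodule[OF F.module_axioms M.module_axioms g(1)])
  interpret K: rmod R "?F\<lparr>carrier := ?K\<rparr>"
    by (rule rmod.intro, rule submodule.submodule_is_module[OF K F.module_axioms])
  obtain m f where f: "f \<in> module_hom R (free_module R m) (?F\<lparr>carrier := ?K\<rparr>)"
    and f_im: "f ` carrier (free_module R m) = carrier (?F\<lparr>carrier := ?K\<rparr>)"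
    using K.fin_gen_free_surj[OF submodule_fin_gen[OF F.module_axioms fin_gen_free K]] .
  have "f \<in> module_hom R (free_module R m) ?F" using f(1) unfolding module_hom_def by auto
  then show "finitely_presented R M"
    unfolding finitely_presented_def using M f_im[simplified] g by blast
qed

text \<open>An element is renamed to its fibre under a free cover. Fibres are sets of coordinate
  functions and so belong to \<open>fp_univ\<close>; surjectivity of the cover keeps the renaming
  injective.\<close>

lemma transport_Rmod:
  assumes M: "module R M" "fin_gen R M"
  obtains M' where "M' \<in> Obj (Rmod R)" "module_iso R M M'"
proof -
  interpret M: rmod R M by (rule rmod.intro) fact
  obtain n g where g: "g \<in> module_hom R (free_module R n) M" "g ` carrier (free_module R n) = carrier M"
    using M.fin_gen_free_surj[OF M(2)] .
  let ?f = "\<lambda>x. {v \<in> carrier (free_module R n). g v = x}"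
  have "inj_on ?f (carrier M)"
  proof (rule inj_onI)
    fix x y assume x: "x \<in> carrier M" and eq: "?f x = ?f y"
    have "x \<in> g ` carrier (free_module R n)" using g(2) x by simp
    then obtain v where "v \<in> carrier (free_module R n)" "g v = x" by blast
    then have "v \<in> ?f y" using eq by blast
    then show "x = y" using \<open>g v = x\<close> by simp
  qed
  note t = transport_module[OF M(1) this]
  have "fin_gen R (image_module ?f M)" by (rule fin_gen_iso[OF t(2) M(1) t(1) M(2)])
  then show ?thesis
    using that[of "image_module ?f M"] t by (simp add: Rmod_def finitely_presented_iff)
qed

end

section \<open>Projective objects\<close>

context additive_category
begin

lemma projectiveD:
  assumes "projective C P" "A \<in> Ob" "B \<in> Ob" "is_epi C A B e" "f \<in> Mor C P B"
  shows "\<exists>g\<in>Mor C P A. cmp P A B e g = f"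
  using assms unfolding projective_def cmp_def by blast

lemma projective_coprod:
  assumes P: "projective C P" "projective C Q" and c: "coprod S P Q i j"
  shows "projective C S"
  unfolding projective_def
proof (intro conjI ballI allI impI)
  note s = coprodE[OF c]
  show "S \<in> Obj C" by (rule s(1))
  fix A B e f assume AB: "A \<in> Ob" "B \<in> Ob" and ef: "is_epi C A B e \<and> f \<in> Mor C S B"
  then have e: "e \<in> Mor C A B" by (simp add: is_epi_def)
  obtain g where g: "g \<in> Mor C P A" "cmp P A B e g = cmp P S B f i"
    using projectiveD[OF P(1) AB, of e "cmp P S B f i"] ef s(1-5) AB by auto
  obtain h where h: "h \<in> Mor C Q A" "cmp Q A B e h = cmp Q S B f j"
    using projectiveD[OF P(2) AB, of e "cmp Q S B f j"] ef s(1-5) AB by auto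
  obtain k where k: "k \<in> Mor C S A" "cmp P S A k i = g" "cmp Q S A k j = h"
    using s(6)[OF AB(1) g(1) h(1)] by blast
  have "cmp S A B e k = f"
    by (rule s(7)[OF AB(2)]) (use AB s(1-5) e k g h ef in \<open>simp_all add: cmp_assoc\<close>)
  then show "\<exists>g\<in>Mor C S A. Comp C S e g = f" using k(1) unfolding cmp_def by blast
qed

lemma projective_zero:
  assumes Z: "Z \<in> Ob" "idm Z = ze Z Z"
  shows "projective C Z"
  unfolding projective_def
proof (intro conjI ballI allI impI)
  fix A B e f assume AB: "A \<in> Ob" "B \<in> Ob" and ef: "is_epi C A B e \<and> f \<in> Mor C Z B"
  then have e: "e \<in> Mor C A B" by (simp add: is_epi_def)
  have "f = ze Z B" using cmp_id_right[of Z B f] cmp_ze_right[of Z Z B f] Z AB ef by simp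
  then have "cmp Z A B e (ze Z A) = f" using e AB Z by simp
  then show "\<exists>g\<in>Mor C Z A. Comp C Z e g = f" using AB Z unfolding cmp_def by auto
qed (rule Z)

lemma Obj_Proj [simp]: "Obj (Proj C) = {P. projective C P}"
  by (simp add: Proj_def)

lemma is_direct_sum_Proj [simp]: "is_direct_sum (Proj C) = is_direct_sum C"
  by (simp add: fun_eq_iff is_direct_sum_def Proj_def)

lemma projective_obj: "projective C P \<Longrightarrow> P \<in> Ob" by (simp add: projective_def)

lemma Proj_triples_sub: "direct_sum_triples (Proj C) \<subseteq> {P. projective C P} \<times> {P. projective C P} \<times> {P. projective C P}"
  unfolding direct_sum_triples_def by auto

sublocale KP: grothendieck "{P. projective C P}" "direct_sum_triples (Proj C)"
  by unfold_locales (rule Proj_triples_sub)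

lemma K0_Proj_eq: "K0_add (Proj C) = KP.KG" and cls_Proj_eq: "cls_add (Proj C) = KP.cls"
  by (simp_all add: K0_add_def cls_add_def fun_eq_iff)

lemma clsP_sum:
  assumes "is_direct_sum C P Q S" "projective C P" "projective C Q" "projective C S"
  shows "KP.cls S = KP.cls P \<otimes>\<^bsub>KP.KG\<^esub> KP.cls Q"
  by (rule KP.cls_sum) (use assms in \<open>simp add: direct_sum_triples_def\<close>)

lemma is_direct_sum_zero:
  assumes ob: "A \<in> Ob" "B \<in> Ob" and f: "f \<in> Mor C A B" "g \<in> Mor C B A"
    and fg: "cmp A B A g f = idm A" "cmp B A B f g = idm B" and Z: "Z \<in> Ob" "idm Z = ze Z Z"
  shows "is_direct_sum C A Z B"
  unfolding is_direct_sum_def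
proof (intro bexI conjI)
  show "Comp C A g f = idm A" "Comp C Z (ze B Z) (ze Z B) = idm Z"
    "Comp C A (ze B Z) f = ze A Z" "Comp C Z g (ze Z B) = ze Z A"
    "ad B B (Comp C B f g) (Comp C B (ze Z B) (ze B Z)) = idm B"
    using fg ob f Z cmp_ze_left[of Z B Z "ze Z B"] cmp_ze_left[of A B Z f] cmp_ze_right[of Z B A g]
      cmp_ze_left[of B Z B "ze B Z"] by (simp_all add: cmp_def)
qed (use ob f Z in auto)

lemma clsP_iso:
  assumes P: "projective C P" "projective C Q" and f: "f \<in> Mor C P Q" "g \<in> Mor C Q P"
    and fg: "cmp P Q P g f = idm P" "cmp Q P Q f g = idm Q"
  shows "KP.cls P = KP.cls Q"
proof -
  obtain Z where Z: "Z \<in> Ob" "idm Z = ze Z Z" using zero_obj_ex by blast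
  note pz = projective_zero[OF Z]
  have "is_direct_sum C Z Z Z"
    using is_direct_sum_zero[OF Z(1) Z(1), of "idm Z" "idm Z" Z] Z by simp
  then have "KP.cls Z = KP.cls Z \<otimes>\<^bsub>KP.KG\<^esub> KP.cls Z" using pz by (intro clsP_sum)
  then have "KP.cls Z = \<one>\<^bsub>KP.KG\<^esub>" using KP.K.l_cancel_one' KP.cls_closed[of Z] pz by auto
  moreover have "is_direct_sum C P Z Q"
    using is_direct_sum_zero[OF projective_obj[OF P(1)] projective_obj[OF P(2)] f fg Z] .
  ultimately show ?thesis using clsP_sum[of P Z Q] P pz by simp
qed

text \<open>It moves an equality of classes of projectives into the Grothendieck group of all
  objects, even where it does not come from an isomorphism.\<close>

lemma Proj_inclusion_hom:
  obtains \<iota> where "\<iota> \<in> hom KP.KG K.KG" "\<And>P. projective C P \<Longrightarrow> \<iota> (KP.cls P) = K.cls P"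
proof (rule KP.hom_from_cls[OF K.K0_comm_group, of K.cls])
  show "K.cls S = K.cls A \<otimes>\<^bsub>K.KG\<^esub> K.cls B" if "(A, S, B) \<in> direct_sum_triples (Proj C)" for A S B
    using that by (intro K.cls_sum) (auto simp: direct_sum_triples_def projective_obj)
qed (auto simp: projective_obj)

lemma KP_diff:
  assumes "x \<in> carrier KP.KG"
  shows "\<exists>P Q. projective C P \<and> projective C Q \<and> x = KP.cls P \<otimes>\<^bsub>KP.KG\<^esub> inv\<^bsub>KP.KG\<^esub> KP.cls Q"
proof -
  have "\<exists>S. (P, S, Q) \<in> direct_sum_triples (Proj C)" if PQ: "projective C P" "projective C Q" for P Q
  proof -
    obtain S i j where c: "coprod S P Q i j" using coprod_ex PQ projective_obj by blast
    then show ?thesis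
      using projective_coprod[OF PQ c] coprod_direct_sum[OF c] PQ by (auto simp: direct_sum_triples_def)
  qed
  moreover have "{P. projective C P} \<noteq> {}" using zero_obj_ex projective_zero by blast
  ultimately show ?thesis using KP.KG_diff[OF _ _ assms] by auto
qed

lemma K_diff:
  assumes "x \<in> carrier K.KG"
  shows "\<exists>A\<in>Ob. \<exists>B\<in>Ob. x = K.cls A \<otimes>\<^bsub>K.KG\<^esub> inv\<^bsub>K.KG\<^esub> K.cls B"
proof (rule K.KG_diff[OF _ _ assms])
  fix A B assume "A \<in> Ob" "B \<in> Ob"
  then show "\<exists>S. (A, S, B) \<in> direct_sum_triples C"
    using direct_sum_ex[of A B] by (auto simp: direct_sum_triples_def)
qed (use zero_obj_ex in blast)

end

section \<open>The category of finitely presented modules\<close>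

context noetherian_cring
begin

abbreviation "RM \<equiv> Rmod R"

lemma Obj_Rmod: "M \<in> Obj RM \<longleftrightarrow> module R M \<and> fin_gen R M"
  by (simp add: Rmod_def finitely_presented_iff)

lemma Rmod_module: "M \<in> Obj RM \<Longrightarrow> module R M" by (simp add: Obj_Rmod)

lemma Mor_Rmod [simp]: "Mor RM A B = module_hom R A B"
  by (simp add: Rmod_def)

lemma Rmod_add [simp]: "f \<otimes>\<^bsub>Hom RM A B\<^esub> g = (\<lambda>x\<in>carrier A. f x \<oplus>\<^bsub>B\<^esub> g x)"
  by (simp add: Rmod_def)

lemma Rmod_zero [simp]: "ZeroMor RM A B = (\<lambda>x\<in>carrier A. \<zero>\<^bsub>B\<^esub>)"
  by (simp add: Rmod_def)

lemma Rmod_Id [simp]: "IdMor RM A = (\<lambda>x\<in>carrier A. x)"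
  by (simp add: Rmod_def)

lemma Rmod_Comp [simp]: "Comp RM A g f = (\<lambda>x\<in>carrier A. g (f x))"
  by (simp add: Rmod_def compose_def)

lemma module_hom_add_closed:
  assumes A: "module R A" and B: "module R B" and f: "f \<in> module_hom R A B" and g: "g \<in> module_hom R A B"
  shows "(\<lambda>x\<in>carrier A. f x \<oplus>\<^bsub>B\<^esub> g x) \<in> module_hom R A B"
proof -
  interpret B: module R B by fact
  show ?thesis
    by (rule module_homI[OF _ _ _ A])
      (simp_all add: module_hom_closed[OF f] module_hom_closed[OF g] module_hom_add[OF f] module_hom_add[OF g]
        module_hom_smult[OF f] module_hom_smult[OF g] B.smult_r_distr B.a_ac)
qed

lemma module_hom_zero_closed:
  assumes A: "module R A" and B: "module R B"
  shows "(\<lambda>x\<in>carrier A. \<zero>\<^bsub>B\<^esub>) \<in> module_hom R A B"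
proof -
  interpret B: module R B by fact
  show ?thesis by (rule module_homI[OF _ _ _ A]) auto
qed

lemma module_hom_comp_closed:
  assumes A: "module R A" and f: "f \<in> module_hom R A B" and g: "g \<in> module_hom R B D"
  shows "(\<lambda>x\<in>carrier A. g (f x)) \<in> module_hom R A D"
  using module_hom_compose[OF f g A] by (simp add: compose_def)

lemma module_hom_id: "module R A \<Longrightarrow> (\<lambda>x\<in>carrier A. x) \<in> module_hom R A A"
  by (rule module_homI) auto

text \<open>Collapsing the regular module by a constant map gives a zero module on the required
  carrier type.\<close>

lemma zero_module_ex: "\<exists>Z\<in>Obj RM. carrier Z = {\<zero>\<^bsub>Z\<^esub>}"
proof -
  let ?Z = "image_module (\<lambda>_. {}) (regular_module R) :: ('a, 'a fp_univ) module"
  have Z: "module R ?Z" by (rule image_module[OF regular_module]) simp_all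
  have c: "carrier ?Z = {\<zero>\<^bsub>?Z\<^esub>}" using zero_closed by (auto simp: image_iff)
  show ?thesis by (rule bexI[of _ ?Z]) (use Z c fin_gen_trivial[OF c] in \<open>simp_all add: Obj_Rmod\<close>)
qed

text \<open>The pair module lives on another type and is no object of the category; this equivalence
  lets module computations decide about categorical direct sums.\<close>

lemma direct_sum_iff:
  assumes A: "module R A" and B: "module R B" and S: "module R S"
  shows "is_direct_sum RM A B S \<longleftrightarrow> module_iso R S (module_sum2 A B)"
proof
  interpret A: module R A by fact
  interpret B: module R B by fact
  interpret S: module R S by fact
  assume "is_direct_sum RM A B S"
  then obtain i j p q where h: "i \<in> module_hom R A S" "j \<in> module_hom R B S" "p \<in> module_hom R S A" "q \<in> module_hom R S B"
    and eq: "(\<lambda>x\<in>carrier A. p (i x)) = (\<lambda>x\<in>carrier A. x)" "(\<lambda>x\<in>carrier B. q (j x)) = (\<lambda>x\<in>carrier B. x)"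
      "(\<lambda>x\<in>carrier A. q (i x)) = (\<lambda>x\<in>carrier A. \<zero>\<^bsub>B\<^esub>)" "(\<lambda>x\<in>carrier B. p (j x)) = (\<lambda>x\<in>carrier B. \<zero>\<^bsub>A\<^esub>)"
      "(\<lambda>x\<in>carrier S. (\<lambda>x\<in>carrier S. i (p x)) x \<oplus>\<^bsub>S\<^esub> (\<lambda>x\<in>carrier S. j (q x)) x) = (\<lambda>x\<in>carrier S. x)"
    unfolding is_direct_sum_def by auto
  note hc = module_hom_closed[OF h(1)] module_hom_closed[OF h(2)] module_hom_closed[OF h(3)] module_hom_closed[OF h(4)]
  note ha = module_hom_add[OF h(1)] module_hom_add[OF h(2)] module_hom_add[OF h(3)] module_hom_add[OF h(4)]
  note hs = module_hom_smult[OF h(1)] module_hom_smult[OF h(2)] module_hom_smult[OF h(3)] module_hom_smult[OF h(4)]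
  have e: "p (i x) = x" "q (i x) = \<zero>\<^bsub>B\<^esub>" if "x \<in> carrier A" for x
    using fun_cong[OF eq(1), of x] fun_cong[OF eq(3), of x] that by auto
  have e': "q (j x) = x" "p (j x) = \<zero>\<^bsub>A\<^esub>" if "x \<in> carrier B" for x
    using fun_cong[OF eq(2), of x] fun_cong[OF eq(4), of x] that by auto
  have e'': "i (p x) \<oplus>\<^bsub>S\<^esub> j (q x) = x" if "x \<in> carrier S" for x
    using fun_cong[OF eq(5), of x] that by auto
  show "module_iso R S (module_sum2 A B)"
    by (rule module_isoI'[of _ "\<lambda>x. (p x, q x)" _ _ "\<lambda>(a, b). i a \<oplus>\<^bsub>S\<^esub> j b"])
      (auto simp: hc ha hs e e' e'' S)
next
  interpret A: module R A by fact
  interpret B: module R B by fact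
  interpret S: module R S by fact
  assume "module_iso R S (module_sum2 A B)"
  then obtain f g where fg: "f \<in> module_hom R S (module_sum2 A B)" "g \<in> module_hom R (module_sum2 A B) S"
    "\<forall>x\<in>carrier S. g (f x) = x" "\<forall>y\<in>carrier (module_sum2 A B). f (g y) = y"
    using module_isoE[OF _ S] by metis
  note fc = module_hom_closed[OF fg(1)] and gc = module_hom_closed[OF fg(2)]
  have fc': "fst (f x) \<in> carrier A" "snd (f x) \<in> carrier B" if "x \<in> carrier S" for x
    using fc[OF that] by auto
  have fa: "f (x \<oplus>\<^bsub>S\<^esub> y) = (fst (f x) \<oplus>\<^bsub>A\<^esub> fst (f y), snd (f x) \<oplus>\<^bsub>B\<^esub> snd (f y))"
    if "x \<in> carrier S" "y \<in> carrier S" for x y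
    using module_hom_add[OF fg(1) that] by (cases "f x"; cases "f y") simp
  have fs: "f (r \<odot>\<^bsub>S\<^esub> x) = (r \<odot>\<^bsub>A\<^esub> fst (f x), r \<odot>\<^bsub>B\<^esub> snd (f x))"
    if "r \<in> carrier R" "x \<in> carrier S" for r x
    using module_hom_smult[OF fg(1) that] by (cases "f x") simp
  have i: "(\<lambda>a\<in>carrier A. g (a, \<zero>\<^bsub>B\<^esub>)) \<in> module_hom R A S"
  proof (rule module_homI[OF _ _ _ A])
    show "g (x \<oplus>\<^bsub>A\<^esub> y, \<zero>\<^bsub>B\<^esub>) = g (x, \<zero>\<^bsub>B\<^esub>) \<oplus>\<^bsub>S\<^esub> g (y, \<zero>\<^bsub>B\<^esub>)" if "x \<in> carrier A" "y \<in> carrier A" for x y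
      using module_hom_add[OF fg(2), of "(x, \<zero>\<^bsub>B\<^esub>)" "(y, \<zero>\<^bsub>B\<^esub>)"] that by simp
    show "g (r \<odot>\<^bsub>A\<^esub> x, \<zero>\<^bsub>B\<^esub>) = r \<odot>\<^bsub>S\<^esub> g (x, \<zero>\<^bsub>B\<^esub>)" if "r \<in> carrier R" "x \<in> carrier A" for r x
      using module_hom_smult[OF fg(2), of r "(x, \<zero>\<^bsub>B\<^esub>)"] that by simp
  qed (use gc in auto)
  have j: "(\<lambda>b\<in>carrier B. g (\<zero>\<^bsub>A\<^esub>, b)) \<in> module_hom R B S"
  proof (rule module_homI[OF _ _ _ B])
    show "g (\<zero>\<^bsub>A\<^esub>, x \<oplus>\<^bsub>B\<^esub> y) = g (\<zero>\<^bsub>A\<^esub>, x) \<oplus>\<^bsub>S\<^esub> g (\<zero>\<^bsub>A\<^esub>, y)" if "x \<in> carrier B" "y \<in> carrier B" for x y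
      using module_hom_add[OF fg(2), of "(\<zero>\<^bsub>A\<^esub>, x)" "(\<zero>\<^bsub>A\<^esub>, y)"] that by simp
    show "g (\<zero>\<^bsub>A\<^esub>, r \<odot>\<^bsub>B\<^esub> x) = r \<odot>\<^bsub>S\<^esub> g (\<zero>\<^bsub>A\<^esub>, x)" if "r \<in> carrier R" "x \<in> carrier B" for r x
      using module_hom_smult[OF fg(2), of r "(\<zero>\<^bsub>A\<^esub>, x)"] that by simp
  qed (use gc in auto)
  have p: "(\<lambda>x\<in>carrier S. fst (f x)) \<in> module_hom R S A"
    by (rule module_homI[OF _ _ _ S]) (simp_all add: fa fs fc')
  have q: "(\<lambda>x\<in>carrier S. snd (f x)) \<in> module_hom R S B"
    by (rule module_homI[OF _ _ _ S]) (simp_all add: fa fs fc')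
  have fg1: "f (g (a, b)) = (a, b)" and gc1: "g (a, b) \<in> carrier S" if "a \<in> carrier A" "b \<in> carrier B" for a b
    using fg(4) gc that by auto
  have sum: "g (fst (f x), \<zero>\<^bsub>B\<^esub>) \<oplus>\<^bsub>S\<^esub> g (\<zero>\<^bsub>A\<^esub>, snd (f x)) = x" if x: "x \<in> carrier S" for x
  proof -
    have "g (fst (f x), \<zero>\<^bsub>B\<^esub>) \<oplus>\<^bsub>S\<^esub> g (\<zero>\<^bsub>A\<^esub>, snd (f x)) = g (fst (f x), snd (f x))"
      using module_hom_add[OF fg(2), of "(fst (f x), \<zero>\<^bsub>B\<^esub>)" "(\<zero>\<^bsub>A\<^esub>, snd (f x))"] fc'[OF x] by simp
    then show ?thesis using fg(3) x by simp
  qed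
  show "is_direct_sum RM A B S"
    unfolding is_direct_sum_def
    by (rule bexI[of _ "\<lambda>a\<in>carrier A. g (a, \<zero>\<^bsub>B\<^esub>)"], rule bexI[of _ "\<lambda>b\<in>carrier B. g (\<zero>\<^bsub>A\<^esub>, b)"],
        rule bexI[of _ "\<lambda>x\<in>carrier S. fst (f x)"], rule bexI[of _ "\<lambda>x\<in>carrier S. snd (f x)"])
      (use i j p q in \<open>auto simp: fg1 gc1 fc' sum intro!: restrict_ext\<close>)
qed

text \<open>The cokernel is the quotient by the image. The two added facts on \<open>q\<close> are
  recorded because the universal property does not mention elements; they make epimorphisms
  surjective.\<close>

lemma Rmod_cokernel:
  assumes A: "A \<in> Obj RM" and B: "B \<in> Obj RM" and f: "f \<in> module_hom R A B"
  obtains Q q where "is_cokernel RM A B f Q q" "q ` carrier B = carrier Q"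
    "\<forall>y\<in>carrier B. q y = \<zero>\<^bsub>Q\<^esub> \<longleftrightarrow> y \<in> f ` carrier A"
proof -
  note Am = Rmod_module[OF A] and Bm = Rmod_module[OF B]
  interpret A: module R A by fact
  interpret B: module R B by fact
  have im: "submodule (f ` carrier A) R B"
    by (rule image_submodule[OF Am Bm f A.carrier_is_submodule])
  obtain Q :: "('a, 'a fp_univ) module" and q where Q: "module R Q" and q: "q \<in> module_hom R B Q" "q ` carrier B = carrier Q"
    and ker: "\<And>x. x \<in> carrier B \<Longrightarrow> q x = \<zero>\<^bsub>Q\<^esub> \<longleftrightarrow> x \<in> f ` carrier A"
    using quotient_module_ex[OF Bm im] by blast
  have Qo: "Q \<in> Obj RM" using fin_gen_image[OF Bm Q q] B Q by (simp add: Obj_Rmod)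
  have "is_cokernel RM A B f Q q"
    unfolding is_cokernel_def
  proof (intro conjI ballI impI)
    show "Comp RM A q f = ZeroMor RM A Q"
      using ker module_hom_closed[OF f] by (auto intro!: restrict_ext)
  next
    fix U g assume U: "U \<in> Obj RM" and g: "g \<in> Mor RM B U" and gf: "Comp RM A g f = ZeroMor RM A U"
    note Um = Rmod_module[OF U]
    have g': "g \<in> module_hom R B U" using g by simp
    have "g x = \<zero>\<^bsub>U\<^esub>" if x: "x \<in> carrier B" "q x = \<zero>\<^bsub>Q\<^esub>" for x
    proof -
      obtain a where "a \<in> carrier A" "x = f a" using ker x by auto
      then show ?thesis using fun_cong[OF gf, of a] by simp
    qed
    then obtain h where h: "h \<in> module_hom R Q U" "\<And>x. x \<in> carrier B \<Longrightarrow> h (q x) = g x"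
      using module_hom_factor[OF Bm Q Um q g'] by blast
    show "\<exists>!h. h \<in> Mor RM Q U \<and> Comp RM B h q = g"
    proof (rule ex1I[of _ h])
      have "Comp RM B h q = g"
        by (rule module_hom_eqI[OF _ g']) (use h module_hom_comp_closed[OF Bm q(1) h(1)] in auto)
      then show "h \<in> Mor RM Q U \<and> Comp RM B h q = g" using h by simp
    next
      fix h' assume h': "h' \<in> Mor RM Q U \<and> Comp RM B h' q = g"
      show "h' = h"
      proof (rule module_hom_eqI)
        fix z assume "z \<in> carrier Q"
        then obtain x where "x \<in> carrier B" "z = q x" using q(2) by blast
        then show "h' z = h z" using h(2) fun_cong[OF conjunct2[OF h'], of x] by simp
      qed (use h h' in auto)
    qed
  qed (use Qo q in auto)
  then show ?thesis using that q(2) ker by blast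
qed

lemma Rmod_additive: "additive_category RM"
proof (rule additive_category.intro)
  fix A B assume "A \<in> Obj RM" "B \<in> Obj RM"
  then have A: "module R A" "fin_gen R A" and B: "module R B" "fin_gen R B" by (auto simp: Obj_Rmod)
  interpret A: module R A by fact
  interpret B: module R B by fact
  show "comm_group (Hom RM A B)"
  proof (rule comm_groupI)
    fix f assume "f \<in> carrier (Hom RM A B)"
    then have f: "f \<in> module_hom R A B" by simp
    have "(\<lambda>x\<in>carrier A. \<ominus>\<^bsub>B\<^esub> f x) \<in> module_hom R A B"
      by (rule module_homI[OF _ _ _ A(1)])
        (simp_all add: module_hom_closed[OF f] module_hom_add[OF f] module_hom_smult[OF f] B.minus_add B.smult_r_minus)
    then show "\<exists>g\<in>carrier (Hom RM A B). g \<otimes>\<^bsub>Hom RM A B\<^esub> f = \<one>\<^bsub>Hom RM A B\<^esub>"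
      by (intro bexI[of _ "\<lambda>x\<in>carrier A. \<ominus>\<^bsub>B\<^esub> f x"])
        (auto intro!: restrict_ext simp: module_hom_closed[OF f] B.l_neg)
  next
    fix f assume "f \<in> carrier (Hom RM A B)"
    then have f: "f \<in> module_hom R A B" by simp
    show "\<one>\<^bsub>Hom RM A B\<^esub> \<otimes>\<^bsub>Hom RM A B\<^esub> f = f"
      by (rule module_hom_eqI[OF _ f])
        (use module_hom_add_closed[OF A(1) B(1) module_hom_zero_closed[OF A(1) B(1)] f] in \<open>simp_all add: module_hom_closed[OF f]\<close>)
  qed (use module_hom_add_closed[OF A(1) B(1)] module_hom_zero_closed[OF A(1) B(1)] in
      \<open>auto intro!: restrict_ext simp: module_hom_closed B.a_ac\<close>)
  have "module R (module_sum2 A B)" "fin_gen R (module_sum2 A B)"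
    using A B by (auto intro!: module_sum2 fin_gen_sum2)
  then obtain S where S: "S \<in> Obj RM" "module_iso R (module_sum2 A B) S" using transport_Rmod by blast
  then show "\<exists>S\<in>Obj RM. is_direct_sum RM A B S"
    using direct_sum_iff[OF A(1) B(1)] module_iso_sym[OF S(2) module_sum2[OF A(1) B(1)]] Rmod_module by blast
next
  fix A B f assume "A \<in> Obj RM" "B \<in> Obj RM" "f \<in> Mor RM A B"
  then show "\<exists>Q q. is_cokernel RM A B f Q q"
    using Rmod_cokernel[of A B f "\<exists>Q q. is_cokernel RM A B f Q q"] by (simp, blast)
next
  obtain Z where Z: "Z \<in> Obj RM" "carrier Z = {\<zero>\<^bsub>Z\<^esub>}" using zero_module_ex by blast
  have "IdMor RM Z = ZeroMor RM Z Z"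
    unfolding Rmod_Id Rmod_zero by (rule restrict_ext) (use Z(2) in auto)
  then show "\<exists>Z\<in>Obj RM. IdMor RM Z = ZeroMor RM Z Z" using Z(1) by blast
next
  fix A B D f g assume "A \<in> Obj RM" "f \<in> Mor RM A B" "g \<in> Mor RM B D"
  then show "Comp RM A g f \<in> Mor RM A D" using module_hom_comp_closed[OF Rmod_module, of A f B g D] by simp
next
  fix A B f assume "A \<in> Obj RM" "B \<in> Obj RM" "f \<in> Mor RM A B"
  then have f: "f \<in> module_hom R A B" by simp
  show "Comp RM A (IdMor RM B) f = f" "Comp RM A f (IdMor RM A) = f"
    using f by (auto simp: module_hom_def PiE_def extensional_def fun_eq_iff)
next
  fix A assume "A \<in> Obj RM"
  then show "IdMor RM A \<in> Mor RM A A" using module_hom_id[OF Rmod_module] by simp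
qed (auto intro!: restrict_ext simp: module_hom_closed module_hom_add)

text \<open>The cokernel map of an epimorphism agrees with the zero map after \<open>e\<close>,
  hence is zero, and its kernel is the image of \<open>e\<close>.\<close>

lemma Rmod_epi_surj:
  assumes A: "A \<in> Obj RM" and B: "B \<in> Obj RM" and e: "is_epi RM A B e"
  shows "e ` carrier A = carrier B"
proof -
  have e': "e \<in> module_hom R A B" using e by (simp add: is_epi_def)
  obtain Q q where c: "is_cokernel RM A B e Q q"
    and ker: "\<forall>y\<in>carrier B. q y = \<zero>\<^bsub>Q\<^esub> \<longleftrightarrow> y \<in> e ` carrier A"
    by (rule Rmod_cokernel[OF A B e'])
  have Q: "Q \<in> Obj RM" and q: "q \<in> module_hom R B Q" and qe: "Comp RM A q e = ZeroMor RM A Q"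
    using c by (auto simp: is_cokernel_def)
  let ?z = "ZeroMor RM B Q"
  have "?z \<in> Mor RM B Q" using module_hom_zero_closed[OF Rmod_module[OF B] Rmod_module[OF Q]] by simp
  moreover have "Comp RM A ?z e = ZeroMor RM A Q" using module_hom_closed[OF e'] by (auto intro!: restrict_ext)
  ultimately have "q = ?z" using e Q q qe unfolding is_epi_def by (metis Mor_Rmod)
  then have "carrier B \<subseteq> e ` carrier A" using ker by auto
  then show ?thesis using module_hom_closed[OF e'] by auto
qed

lemma Rmod_surj_epi:
  assumes e: "e \<in> module_hom R A B" "e ` carrier A = carrier B"
  shows "is_epi RM A B e"
  unfolding is_epi_def
proof (intro conjI ballI impI)
  fix U g h assume gh: "g \<in> Mor RM B U" "h \<in> Mor RM B U" and eq: "Comp RM A g e = Comp RM A h e"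
  show "g = h"
  proof (rule module_hom_eqI)
    fix y assume "y \<in> carrier B"
    then obtain x where "x \<in> carrier A" "y = e x" using e(2) by blast
    then show "g y = h y" using fun_cong[OF eq, of x] by simp
  qed (use gh in auto)
qed (use e in simp)

end

text \<open>Finite sums of endomorphisms that factor through \<open>R\<close>. A finitely generated module is
  projective if its identity is such a sum (dual basis lemma).\<close>

inductive fin_rank :: "('a, 'b) ring_scheme \<Rightarrow> ('a, 'm) module \<Rightarrow> ('m \<Rightarrow> 'm) \<Rightarrow> bool"
  for R and M where
  zero: "fin_rank R M (\<lambda>x\<in>carrier M. \<zero>\<^bsub>M\<^esub>)"
| step: "\<lbrakk>fin_rank R M e; \<phi> \<in> module_hom R M (regular_module R); y \<in> carrier M\<rbrakk>
    \<Longrightarrow> fin_rank R M (\<lambda>x\<in>carrier M. \<phi> x \<odot>\<^bsub>M\<^esub> y \<oplus>\<^bsub>M\<^esub> e x)"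

lemma fin_rank_closed:
  assumes M: "module R M" and e: "fin_rank R M e" and x: "x \<in> carrier M"
  shows "e x \<in> carrier M"
proof -
  interpret M: module R M by fact
  show ?thesis using e x
  proof (induction rule: fin_rank.induct)
    case (step e \<phi> y)
    then show ?case using module_hom_closed[OF step.hyps(2)] by simp
  qed simp
qed

lemma fin_rank_add:
  assumes M: "module R M" and e: "fin_rank R M e" and e': "fin_rank R M e'"
  shows "fin_rank R M (\<lambda>x\<in>carrier M. e x \<oplus>\<^bsub>M\<^esub> e' x)"
proof -
  interpret M: module R M by fact
  show ?thesis using e
  proof (induction rule: fin_rank.induct)
    case zero
    have "(\<lambda>x\<in>carrier M. (\<lambda>x\<in>carrier M. \<zero>\<^bsub>M\<^esub>) x \<oplus>\<^bsub>M\<^esub> e' x) = e'"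
    proof
      fix x
      have "e' \<in> extensional (carrier M)" using e' by (cases rule: fin_rank.cases) auto
      then show "(\<lambda>x\<in>carrier M. (\<lambda>x\<in>carrier M. \<zero>\<^bsub>M\<^esub>) x \<oplus>\<^bsub>M\<^esub> e' x) x = e' x"
        using fin_rank_closed[OF M e'] by (auto simp: extensional_def)
    qed
    then show ?case using e' by simp
  next
    case (step e \<phi> y)
    have "(\<lambda>x\<in>carrier M. (\<lambda>x\<in>carrier M. \<phi> x \<odot>\<^bsub>M\<^esub> y \<oplus>\<^bsub>M\<^esub> e x) x \<oplus>\<^bsub>M\<^esub> e' x)
        = (\<lambda>x\<in>carrier M. \<phi> x \<odot>\<^bsub>M\<^esub> y \<oplus>\<^bsub>M\<^esub> (\<lambda>x\<in>carrier M. e x \<oplus>\<^bsub>M\<^esub> e' x) x)"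
      using module_hom_closed[OF step.hyps(2)] step.hyps(3) fin_rank_closed[OF M e'] fin_rank_closed[OF M step.hyps(1)]
      by (auto intro!: restrict_ext simp: M.a_assoc)
    then show ?case using fin_rank.step[OF step.IH step.hyps(2,3)] by (simp only:)
  qed
qed

text \<open>Functionals are pulled back along \<open>f\<close> and vectors are pushed along
  \<open>g\<close>. This moves finite rank from a smaller submodule to \<open>M\<close>.\<close>

lemma fin_rank_transfer:
  assumes M: "module R M" and N: "module R N" and f: "f \<in> module_hom R M N" and g: "g \<in> module_hom R N M"
    and e: "fin_rank R N e"
  shows "fin_rank R M (\<lambda>x\<in>carrier M. g (e (f x)))"
proof -
  interpret M: module R M by fact
  interpret N: module R N by fact
  note fc = module_hom_closed[OF f] and gc = module_hom_closed[OF g]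
  show ?thesis using e
  proof (induction rule: fin_rank.induct)
    case zero
    have "(\<lambda>x\<in>carrier M. g ((\<lambda>x\<in>carrier N. \<zero>\<^bsub>N\<^esub>) (f x))) = (\<lambda>x\<in>carrier M. \<zero>\<^bsub>M\<^esub>)"
      using fc module_hom_zero[OF g N M] by (auto intro!: restrict_ext)
    then show ?case by (simp only: fin_rank.zero)
  next
    case (step e \<phi> y)
    note pc = module_hom_closed[OF step.hyps(2)]
    have "(\<lambda>x\<in>carrier M. \<phi> (f x)) \<in> module_hom R M (regular_module R)"
      by (rule module_homI[OF _ _ _ M])
        (use fc pc in \<open>auto simp: module_hom_add[OF f] module_hom_smult[OF f] module_hom_add[OF step.hyps(2)] module_hom_smult[OF step.hyps(2)]\<close>)
    from fin_rank.step[OF step.IH this gc[OF step.hyps(3)]]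
    show ?case
      by (rule back_subst[of "fin_rank R M"])
        (use fc pc step.hyps(3) fin_rank_closed[OF N step.hyps(1)] in
          \<open>auto intro!: restrict_ext simp: module_hom_add[OF g] module_hom_smult[OF g]\<close>)
  qed
qed

lemma fin_rank_smult:
  assumes M: "module R M" and r: "r \<in> carrier R" and e: "fin_rank R M e"
  shows "fin_rank R M (\<lambda>x\<in>carrier M. r \<odot>\<^bsub>M\<^esub> e x)"
proof -
  interpret M: module R M by fact
  note m = cring.smult_hom[OF M.R.cring_axioms M r]
  have i: "(\<lambda>x\<in>carrier M. x) \<in> module_hom R M M" by (rule module_homI[OF _ _ _ M]) auto
  show ?thesis
    using fin_rank_transfer[OF M M i m e]
    by (rule back_subst[of "fin_rank R M"]) (use fin_rank_closed[OF M e] in \<open>auto intro!: restrict_ext\<close>)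
qed

text \<open>For each rank-one term a single preimage of \<open>f y\<close> is chosen; the functional
  \<phi> then spreads this choice linearly over \<open>M\<close>.\<close>

lemma fin_rank_lift:
  assumes M: "module R M" and A: "module R A" and B: "module R B"
    and e: "e \<in> module_hom R A B" "e ` carrier A = carrier B" and f: "f \<in> module_hom R M B"
    and t: "fin_rank R M t"
  shows "\<exists>g\<in>module_hom R M A. \<forall>x\<in>carrier M. e (g x) = f (t x)"
proof -
  interpret M: module R M by fact
  interpret A: module R A by fact
  interpret B: module R B by fact
  show ?thesis using t
  proof (induction rule: fin_rank.induct)
    case zero
    have "(\<lambda>x\<in>carrier M. \<zero>\<^bsub>A\<^esub>) \<in> module_hom R M A" by (rule module_homI[OF _ _ _ M]) auto
    then show ?case using module_hom_zero[OF e(1) A B] module_hom_zero[OF f M B]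
      by (intro bexI[of _ "\<lambda>x\<in>carrier M. \<zero>\<^bsub>A\<^esub>"]) auto
  next
    case (step t \<phi> y)
    note pc = module_hom_closed[OF step.hyps(2), simplified]
    obtain g where g: "g \<in> module_hom R M A" "\<forall>x\<in>carrier M. e (g x) = f (t x)" using step.IH by blast
    have "f y \<in> e ` carrier A" using e(2) module_hom_closed[OF f step.hyps(3)] by simp
    then obtain a where a: "a \<in> carrier A" "e a = f y" by auto
    note gc = module_hom_closed[OF g(1)]
    have "(\<lambda>x\<in>carrier M. \<phi> x \<odot>\<^bsub>A\<^esub> a \<oplus>\<^bsub>A\<^esub> g x) \<in> module_hom R M A"
      by (rule module_homI[OF _ _ _ M])
        (use pc a gc in \<open>simp_all add: module_hom_add[OF step.hyps(2)] module_hom_smult[OF step.hyps(2)]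
          module_hom_add[OF g(1)] module_hom_smult[OF g(1)] A.smult_l_distr A.smult_r_distr A.smult_assoc1 A.a_ac\<close>)
    then show ?case
      by (rule bexI[rotated])
        (use pc a gc g(2) step.hyps(3) fin_rank_closed[OF M step.hyps(1)] in
          \<open>simp add: module_hom_add[OF e(1)] module_hom_smult[OF e(1)] module_hom_add[OF f] module_hom_smult[OF f]\<close>)
  qed
qed

context noetherian_cring
begin

lemma fin_rank_projective:
  assumes M: "M \<in> Obj RM" and id: "fin_rank R M (\<lambda>x\<in>carrier M. x)"
  shows "projective RM M"
  unfolding projective_def
proof (intro conjI ballI allI impI)
  fix A B e f assume A: "A \<in> Obj RM" and B: "B \<in> Obj RM" and ef: "is_epi RM A B e \<and> f \<in> Mor RM M B"
  then have e: "e \<in> module_hom R A B" "e ` carrier A = carrier B" and f: "f \<in> module_hom R M B"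
    using Rmod_epi_surj[OF A B] by (auto simp: is_epi_def)
  note m = Rmod_module[OF M] Rmod_module[OF A] Rmod_module[OF B]
  obtain g where g: "g \<in> module_hom R M A" "\<forall>x\<in>carrier M. e (g x) = f ((\<lambda>x\<in>carrier M. x) x)"
    using fin_rank_lift[OF m e f id] by blast
  have "Comp RM M e g = f"
    by (rule module_hom_eqI[OF _ f]) (use g module_hom_comp_closed[OF m(1) g(1) e(1)] in auto)
  then show "\<exists>g\<in>Mor RM M A. Comp RM M e g = f" using g(1) by auto
qed (rule M)

end

section \<open>Localization at a maximal ideal\<close>

text \<open>The i-th vector is set to zero rather than removed, so the length of the combination and
  its indexing survive.\<close>

lemma lincomb_split:
  assumes M: "module R M" and i: "i < n" and a: "\<And>j. j < n \<Longrightarrow> a j \<in> carrier R" and x: "\<And>j. j < n \<Longrightarrow> x j \<in> carrier M"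
  shows "lincomb M a x n = lincomb M a (x(i := \<zero>\<^bsub>M\<^esub>)) n \<oplus>\<^bsub>M\<^esub> a i \<odot>\<^bsub>M\<^esub> x i"
proof -
  interpret M: rmod R M by (rule rmod.intro) fact
  show ?thesis using i a x
  proof (induction n)
    case (Suc n)
    have c: "lincomb M a (x(i := \<zero>\<^bsub>M\<^esub>)) n \<in> carrier M" "lincomb M a x n \<in> carrier M"
      "a n \<in> carrier R" "x n \<in> carrier M" "a i \<odot>\<^bsub>M\<^esub> x i \<in> carrier M"
      using Suc.prems by (auto intro!: M.lincomb_closed)
    show ?case
    proof (cases "i = n")
      case True
      have "lincomb M a (x(i := \<zero>\<^bsub>M\<^esub>)) n = lincomb M a x n"
        by (rule M.lincomb_cong) (use True in auto)
      then show ?thesis using True c by (simp add: fun_upd_def)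
    next
      case False
      then have "lincomb M a x n = lincomb M a (x(i := \<zero>\<^bsub>M\<^esub>)) n \<oplus>\<^bsub>M\<^esub> a i \<odot>\<^bsub>M\<^esub> x i"
        using Suc by (simp add: fun_upd_def)
      then show ?thesis using False c by (simp add: M.a_ac fun_upd_def)
    qed
  qed simp
qed

lemma lincomb_smult_right:
  assumes M: "module R M" and b: "b \<in> carrier R" and a: "\<And>j. j < n \<Longrightarrow> c j \<in> carrier R" and x: "\<And>j. j < n \<Longrightarrow> x j \<in> carrier M"
  shows "lincomb M (\<lambda>j. c j \<otimes>\<^bsub>R\<^esub> b) x n = b \<odot>\<^bsub>M\<^esub> lincomb M c x n"
proof -
  interpret M: rmod R M by (rule rmod.intro) fact
  have "lincomb M (\<lambda>j. c j \<otimes>\<^bsub>R\<^esub> b) x n = lincomb M (\<lambda>j. b \<otimes>\<^bsub>R\<^esub> c j) x n"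
    by (rule M.lincomb_cong) (use a b in \<open>auto intro: M.R.m_comm\<close>)
  then show ?thesis using M.lincomb_smult[of b n c x] a b x by simp
qed

text \<open>The condition that \<pi> generates the maximal ideal of the localization at
  \<open>P\<close>, with denominators cleared: each element of \<open>P\<close> becomes a multiple
  of \<pi> after multiplication by some element outside \<open>P\<close>.\<close>

locale unif_prime = noetherian_domain R + P: maximalideal P R for R (structure) and P +
  fixes \<pi>
  assumes unif_mem: "\<pi> \<in> P" and unif_nonzero: "\<pi> \<noteq> \<zero>"
    and unif: "a \<in> P \<Longrightarrow> \<exists>s\<in>carrier R - P. \<exists>c\<in>carrier R. s \<otimes> a = c \<otimes> \<pi>"
begin

lemma unif_carrier [simp]: "\<pi> \<in> carrier R" using unif_mem P.Icarr by blast

sublocale Pp: primeideal P R by (rule maximalideal_prime) unfold_locales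

abbreviation "S \<equiv> carrier R - P"

lemma one_notin [simp]: "\<one> \<notin> P" using P.one_imp_carrier P.I_notcarr by auto

lemma one_S: "\<one> \<in> S" by simp

lemma S_mult: "s \<in> S \<Longrightarrow> t \<in> S \<Longrightarrow> s \<otimes> t \<in> S"
  using Pp.I_prime by auto


lemma pow_closed [simp]: "\<pi> [^] (k::nat) \<in> carrier R" by simp

lemma pow_nonzero: "\<pi> [^] (k::nat) \<noteq> \<zero>"
proof (induction k)
  case (Suc k)
  then show ?case using unif_nonzero integral[of "\<pi> [^] k" \<pi>] by auto
qed simp

text \<open>This is the preimage in \<open>M\<close> of the localization of \<open>K\<close> at
  \<open>P\<close>.\<close>

lemma saturation_submodule:
  assumes M: "module R M" and K: "submodule K R M"
  shows "submodule {x \<in> carrier M. \<exists>s\<in>S. s \<odot>\<^bsub>M\<^esub> x \<in> K} R M"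
proof -
  interpret M: module R M by fact
  note k = M.submoduleE[OF K]
  show ?thesis
  proof (rule M.submoduleI')
    show "\<zero>\<^bsub>M\<^esub> \<in> {x \<in> carrier M. \<exists>s\<in>S. s \<odot>\<^bsub>M\<^esub> x \<in> K}"
      using one_S submodule_zero[OF K] by (auto intro!: bexI[of _ \<one>])
  next
    fix x y assume "x \<in> {x \<in> carrier M. \<exists>s\<in>S. s \<odot>\<^bsub>M\<^esub> x \<in> K}" "y \<in> {x \<in> carrier M. \<exists>s\<in>S. s \<odot>\<^bsub>M\<^esub> x \<in> K}"
    then obtain s t where st: "x \<in> carrier M" "y \<in> carrier M" "s \<in> S" "t \<in> S" "s \<odot>\<^bsub>M\<^esub> x \<in> K" "t \<odot>\<^bsub>M\<^esub> y \<in> K" by blast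
    have car: "s \<in> carrier R" "t \<in> carrier R" using st by auto
    have "(s \<otimes> t) \<odot>\<^bsub>M\<^esub> (x \<oplus>\<^bsub>M\<^esub> y) = t \<odot>\<^bsub>M\<^esub> (s \<odot>\<^bsub>M\<^esub> x) \<oplus>\<^bsub>M\<^esub> s \<odot>\<^bsub>M\<^esub> (t \<odot>\<^bsub>M\<^esub> y)"
      using st(1,2) car by (simp add: M.smult_r_distr m_comm flip: M.smult_assoc1)
    then have "(s \<otimes> t) \<odot>\<^bsub>M\<^esub> (x \<oplus>\<^bsub>M\<^esub> y) \<in> K" using k(5)[OF k(4)[OF car(2) st(5)] k(4)[OF car(1) st(6)]] by simp
    then show "x \<oplus>\<^bsub>M\<^esub> y \<in> {x \<in> carrier M. \<exists>s\<in>S. s \<odot>\<^bsub>M\<^esub> x \<in> K}"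
      using st(1,2) S_mult[OF st(3,4)] M.a_closed by blast
  next
    fix r x assume r: "r \<in> carrier R" and "x \<in> {x \<in> carrier M. \<exists>s\<in>S. s \<odot>\<^bsub>M\<^esub> x \<in> K}"
    then obtain s where s: "x \<in> carrier M" "s \<in> S" "s \<odot>\<^bsub>M\<^esub> x \<in> K" by blast
    have "s \<odot>\<^bsub>M\<^esub> (r \<odot>\<^bsub>M\<^esub> x) = r \<odot>\<^bsub>M\<^esub> (s \<odot>\<^bsub>M\<^esub> x)" using r s(1,2) by (simp add: m_comm flip: M.smult_assoc1)
    then have "s \<odot>\<^bsub>M\<^esub> (r \<odot>\<^bsub>M\<^esub> x) \<in> K" using k(4)[OF r s(3)] by simp
    then show "r \<odot>\<^bsub>M\<^esub> x \<in> {x \<in> carrier M. \<exists>s\<in>S. s \<odot>\<^bsub>M\<^esub> x \<in> K}" using s(1,2) r M.smult_closed by blast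
  qed auto
qed

text \<open>\<open>D l\<close> is the preimage in \<open>R\<close> of the \<open>l\<close>-th power of the maximal ideal of the
  localization; it turns out to be \<open>P\<close> to the power \<open>l\<close>.\<close>

definition D :: "nat \<Rightarrow> 'a set" where
  "D l = {a \<in> carrier R. \<exists>s\<in>S. \<exists>c\<in>carrier R. s \<otimes> a = c \<otimes> \<pi> [^] l}"

lemma D_ideal: "ideal (D l) R"
proof -
  interpret M: rmod R "regular_module R" by (rule rmod.intro) (rule regular_module)
  have "submodule {y. \<exists>r\<in>carrier R. y = r \<odot>\<^bsub>regular_module R\<^esub> \<pi> [^] l} R (regular_module R)"
    by (rule M.cyclic_submodule) simp
  from saturation_submodule[OF regular_module this] show ?thesis
    unfolding ideal_iff_submodule D_def by (rule back_subst[of "\<lambda>K. submodule K R (regular_module R)"]) auto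
qed

lemma D_mult: "a \<in> D k \<Longrightarrow> b \<in> D l \<Longrightarrow> a \<otimes> b \<in> D (k + l)"
proof -
  assume "a \<in> D k" "b \<in> D l"
  then obtain s c t d where st: "a \<in> carrier R" "b \<in> carrier R" "s \<in> S" "t \<in> S" "c \<in> carrier R" "d \<in> carrier R"
    "s \<otimes> a = c \<otimes> \<pi> [^] k" "t \<otimes> b = d \<otimes> \<pi> [^] l" unfolding D_def by blast
  have car: "s \<in> carrier R" "t \<in> carrier R" using st by auto
  have "(s \<otimes> t) \<otimes> (a \<otimes> b) = (s \<otimes> a) \<otimes> (t \<otimes> b)" using st(1,2) car by (simp add: m_ac)
  also have "\<dots> = (c \<otimes> d) \<otimes> \<pi> [^] (k + l)" using st(5-8) by (simp add: m_ac flip: nat_pow_mult)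
  finally show ?thesis
    unfolding D_def using st car S_mult[OF st(3,4)]
    by (intro CollectI conjI bexI[of _ "s \<otimes> t"] bexI[of _ "c \<otimes> d"]) simp_all
qed

lemma D_zero: "D 0 = carrier R"
  unfolding D_def by (auto intro!: bexI[of _ \<one>])

lemma P_sub_D1: "P \<subseteq> D 1"
  unfolding D_def using unif P.Icarr by auto

text \<open>By maximality \<open>P\<close> and \<open>s\<close> generate the unit ideal, so
  \<open>s\<close> is invertible modulo \<open>P\<close>.\<close>

lemma maximal_cancel:
  assumes s: "s \<in> S"
  obtains t q where "t \<in> carrier R" "q \<in> P" "\<one> = t \<otimes> s \<oplus> q"
proof -
  let ?J = "{y. \<exists>t\<in>carrier R. \<exists>q\<in>P. y = t \<otimes> s \<oplus> q}"
  have sc: "s \<in> carrier R" using s by simp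
  have "ideal ?J R"
  proof (rule idealI')
    show "\<zero> \<in> ?J" using sc by (auto intro!: bexI[of _ \<zero>])
  next
    fix x y assume "x \<in> ?J" "y \<in> ?J"
    then obtain t q t' q' where "t \<in> carrier R" "q \<in> P" "t' \<in> carrier R" "q' \<in> P" "x = t \<otimes> s \<oplus> q" "y = t' \<otimes> s \<oplus> q'" by auto
    then show "x \<oplus> y \<in> ?J" using sc P.Icarr
      by (intro CollectI bexI[of _ "t \<oplus> t'"] bexI[of _ "q \<oplus> q'"]) (auto simp: l_distr a_ac)
  next
    fix r x assume "r \<in> carrier R" "x \<in> ?J"
    then obtain t q where "t \<in> carrier R" "q \<in> P" "x = t \<otimes> s \<oplus> q" "r \<in> carrier R" by auto
    then show "r \<otimes> x \<in> ?J" using sc P.Icarr P.I_l_closed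
      by (intro CollectI bexI[of _ "r \<otimes> t"] bexI[of _ "r \<otimes> q"]) (auto simp: r_distr m_assoc)
  qed (use sc P.Icarr in auto)
  moreover have "P \<subseteq> ?J"
  proof
    fix q assume "q \<in> P"
    then show "q \<in> ?J" using sc P.Icarr by (intro CollectI bexI[of _ \<zero>] bexI[of _ q]) auto
  qed
  moreover have "?J \<subseteq> carrier R" using sc P.Icarr by auto
  moreover have "s \<in> ?J" using sc by (intro CollectI bexI[of _ \<one>] bexI[of _ \<zero>]) auto
  ultimately have "?J = carrier R" using P.I_maximal[of ?J] s by (metis (no_types, lifting) DiffE)
  then have "\<one> \<in> ?J" by simp
  then show ?thesis using that by blast
qed

section \<open>Powers of the maximal ideal in terms of the uniformizer\<close>

definition Pw :: "nat \<Rightarrow> 'a set" where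
  "Pw l = P [^]\<^bsub>ideals_set R\<^esub> l"

lemma Pw_0: "Pw 0 = carrier R" by (simp add: Pw_def nat_pow_def ideals_set_def)

lemma Pw_Suc: "Pw (Suc l) = ideal_prod R (Pw l) P" by (simp add: Pw_def nat_pow_def ideals_set_def)

lemma Pw_ideal: "ideal (Pw l) R"
  by (induction l) (simp_all add: Pw_0 Pw_Suc oneideal ideal_prod_is_ideal P.ideal_axioms)

text \<open>Inverses lift to higher powers: inserting 1 = t' s + q' behind the error term
  \<open>q\<close> leaves the smaller error q q'.\<close>

lemma Pw_cancel:
  assumes s: "s \<in> S"
  shows "\<exists>t\<in>carrier R. \<exists>q\<in>Pw l. \<one> = t \<otimes> s \<oplus> q"
proof (induction l)
  case 0
  show ?case using s by (intro bexI[of _ \<zero>] bexI[of _ \<one>]) (auto simp: Pw_0)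
next
  case (Suc l)
  then obtain t q where t: "t \<in> carrier R" "q \<in> Pw l" "\<one> = t \<otimes> s \<oplus> q" by blast
  obtain t' q' where t': "t' \<in> carrier R" "q' \<in> P" "\<one> = t' \<otimes> s \<oplus> q'" using maximal_cancel[OF s] .
  have car: "s \<in> carrier R" "q \<in> carrier R" "q' \<in> carrier R" using s t(2) t'(2) ideal.Icarr[OF Pw_ideal] P.Icarr by auto
  note t(3)
  also have "t \<otimes> s \<oplus> q = t \<otimes> s \<oplus> q \<otimes> \<one>" using car by simp
  also have "\<dots> = t \<otimes> s \<oplus> q \<otimes> (t' \<otimes> s \<oplus> q')" by (rule arg_cong[OF t'(3), of "\<lambda>x. t \<otimes> s \<oplus> q \<otimes> x"])
  also have "\<dots> = (t \<oplus> q \<otimes> t') \<otimes> s \<oplus> q \<otimes> q'" using t(1) t'(1) car by (simp add: r_distr l_distr m_assoc a_assoc)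
  finally show ?case
    using t t' car by (intro bexI[of _ "t \<oplus> q \<otimes> t'"] bexI[of _ "q \<otimes> q'"]) (auto simp: Pw_Suc intro: ideal_prod.prod)
qed

lemma Pw_sub_D: "Pw l \<subseteq> D l"
proof (induction l)
  case (Suc l)
  show ?case
  proof
    fix x assume "x \<in> Pw (Suc l)"
    then show "x \<in> D (Suc l)"
      unfolding Pw_Suc
    proof (induction rule: ideal_prod.induct)
      case (prod i j)
      then show ?case using Suc D_mult[of i l j 1] P_sub_D1 by auto
    next
      case (sum s1 s2)
      then show ?case using additive_subgroup.a_closed[OF ideal.axioms(1)[OF D_ideal]] by simp
    qed
  qed
qed (simp add: D_zero Pw_0)

lemma pow_Pw: "\<pi> [^] l \<in> Pw l"
  by (induction l) (auto simp: Pw_0 Pw_Suc intro!: ideal_prod.prod unif_mem)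

text \<open>With 1 = t s + q and \<open>q\<close> in the l-th power, the local relation for s a
  turns into a = (t c) \<pi>^l + q a, in which both terms belong to that power.\<close>

lemma Pw_eq_D: "Pw l = D l"
proof (rule subset_antisym[OF Pw_sub_D subsetI])
  fix a assume "a \<in> D l"
  then obtain s c where s: "a \<in> carrier R" "s \<in> S" "c \<in> carrier R" "s \<otimes> a = c \<otimes> \<pi> [^] l" unfolding D_def by blast
  obtain t q where t: "t \<in> carrier R" "q \<in> Pw l" "\<one> = t \<otimes> s \<oplus> q" using Pw_cancel[OF s(2)] by blast
  note qc = ideal.Icarr[OF Pw_ideal t(2)]
  have "a = \<one> \<otimes> a" using s by simp
  also have "\<dots> = t \<otimes> (s \<otimes> a) \<oplus> q \<otimes> a" unfolding t(3) using s(1,2) t(1) qc by (auto simp: l_distr m_assoc)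
  also have "\<dots> = (t \<otimes> c) \<otimes> \<pi> [^] l \<oplus> q \<otimes> a" using s(3,4) t(1) by (simp add: m_assoc)
  finally have eq: "a = (t \<otimes> c) \<otimes> \<pi> [^] l \<oplus> q \<otimes> a" .
  have "(t \<otimes> c) \<otimes> \<pi> [^] l \<oplus> q \<otimes> a \<in> Pw l"
    using ideal.I_l_closed[OF Pw_ideal pow_Pw, of "t \<otimes> c" l] ideal.I_r_closed[OF Pw_ideal t(2) s(1)] t(1) s(3)
    by (intro additive_subgroup.a_closed[OF ideal.axioms(1)[OF Pw_ideal]]) simp_all
  then show "a \<in> Pw l" unfolding eq[symmetric] .
qed

lemma D_cancel: "s \<in> S \<Longrightarrow> \<exists>t\<in>carrier R. \<exists>q\<in>D l. \<one> = t \<otimes> s \<oplus> q"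
  using Pw_cancel unfolding Pw_eq_D .

lemma D_saturated:
  assumes s: "s \<in> S" and a: "a \<in> carrier R" and sa: "s \<otimes> a \<in> D l"
  shows "a \<in> D l"
proof -
  obtain t c where t: "t \<in> S" "c \<in> carrier R" "t \<otimes> (s \<otimes> a) = c \<otimes> \<pi> [^] l" using sa unfolding D_def by blast
  have "(t \<otimes> s) \<otimes> a = c \<otimes> \<pi> [^] l" using t s a by (auto simp: m_assoc)
  then show ?thesis unfolding D_def using S_mult[OF t(1) s] a t(2) by blast
qed

lemma D_mono:
  assumes "k \<le> l"
  shows "D l \<subseteq> D k"
proof
  fix a assume "a \<in> D l"
  then obtain s c where s: "a \<in> carrier R" "s \<in> S" "c \<in> carrier R" "s \<otimes> a = c \<otimes> \<pi> [^] l" unfolding D_def by blast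
  have "s \<otimes> a = (c \<otimes> \<pi> [^] (l - k)) \<otimes> \<pi> [^] k" using s assms by (simp add: m_assoc nat_pow_mult)
  then show "a \<in> D k" unfolding D_def using s by (intro CollectI conjI bexI[of _ s] bexI[of _ "c \<otimes> \<pi> [^] (l - k)"]) simp_all
qed

text \<open>If \<open>a\<close> were divisible by all powers of the uniformizer in the localization, the ideals
  \<open>J k\<close> would form a strictly increasing chain.\<close>

lemma valuation:
  assumes a: "a \<in> carrier R" "a \<noteq> \<zero>"
  obtains s t j where "s \<in> S" "t \<in> S" "s \<otimes> a = t \<otimes> \<pi> [^] (j::nat)"
proof -
  have "\<exists>k. a \<notin> D k"
  proof (rule ccontr)
    assume "\<nexists>k. a \<notin> D k"
    then have all: "a \<in> D k" for k by blast
    \<comment> \<open>\<open>J k\<close> collects the \<open>b\<close> for which \<pi>^k b is a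
      multiple of \<open>a\<close> in the localization.\<close>
    define J where "J k = {b \<in> carrier R. \<exists>s\<in>S. \<exists>r\<in>carrier R. s \<otimes> (\<pi> [^] (k::nat) \<otimes> b) = r \<otimes> a}" for k
    have J: "ideal (J k) R" for k
    proof -
      interpret M: rmod R "regular_module R" by (rule rmod.intro) (rule regular_module)
      have "submodule {y. \<exists>r\<in>carrier R. y = r \<odot>\<^bsub>regular_module R\<^esub> a} R (regular_module R)"
        by (rule M.cyclic_submodule) (use a in simp)
      from saturation_submodule[OF regular_module preimage_submodule[OF regular_module regular_module smult_hom[OF regular_module pow_closed[of k]] this]]
      show ?thesis
        unfolding ideal_iff_submodule J_def
        by (rule back_subst[of "\<lambda>K. submodule K R (regular_module R)"]) (auto simp: m_lcomm, blast+)
    qed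
    have J_Suc: "J k \<subseteq> J (Suc k)" for k
    proof
      fix x assume "x \<in> J k"
      then obtain s r where 1: "x \<in> carrier R" "s \<in> S" "r \<in> carrier R" "s \<otimes> (\<pi> [^] k \<otimes> x) = r \<otimes> a" unfolding J_def by blast
      have car: "s \<in> carrier R" using 1 by auto
      have "s \<otimes> (\<pi> [^] Suc k \<otimes> x) = \<pi> \<otimes> (s \<otimes> (\<pi> [^] k \<otimes> x))" using 1(1) car by (simp add: m_ac)
      also have "\<dots> = (\<pi> \<otimes> r) \<otimes> a" using 1 a by (simp add: m_assoc)
      finally show "x \<in> J (Suc k)" unfolding J_def using 1
        by (intro CollectI conjI bexI[of _ s] bexI[of _ "\<pi> \<otimes> r"]) simp_all
    qed
    then have J_mono: "J k \<subseteq> J l" if "k \<le> l" for k l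
      using that by (rule lift_Suc_mono_le)
    have "subset.chain {I. ideal I R} (range J)"
      unfolding subset_chain_def using J J_mono by (auto simp: image_iff) (metis linorder_linear subsetD J_mono)
    then obtain k where "\<Union>(range J) = J k" using ideal_chain_is_trivial[of "range J"] by auto
    then have k: "J (Suc k) \<subseteq> J k" by blast
    \<comment> \<open>Up to \<open>s\<close>, the element \<open>c\<close> is the quotient of
      \<open>a\<close> by \<pi>^(k+1). It lies in \<open>J (Suc k)\<close>, but membership in
      \<open>J k\<close> would make an element outside \<open>P\<close> divisible by \<pi>.\<close>
    obtain s c where s: "s \<in> S" "c \<in> carrier R" "s \<otimes> a = c \<otimes> \<pi> [^] Suc k" using all[of "Suc k"] unfolding D_def by blast
    have sc: "s \<in> carrier R" using s by simp
    have "\<one> \<otimes> (\<pi> [^] Suc k \<otimes> c) = s \<otimes> a" using s by (simp add: m_ac)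
    then have "c \<in> J (Suc k)" unfolding J_def using s sc by (intro CollectI conjI bexI[of _ \<one>] bexI[of _ s]) simp_all
    then have "c \<in> J k" using k by blast
    then obtain s' r where 1: "s' \<in> S" "r \<in> carrier R" "s' \<otimes> (\<pi> [^] k \<otimes> c) = r \<otimes> a" unfolding J_def by blast
    have s'c: "s' \<in> carrier R" using 1 by simp
    have "(s' \<otimes> s) \<otimes> a = s' \<otimes> (s \<otimes> a)" using s'c sc a by (simp add: m_assoc)
    also have "\<dots> = \<pi> \<otimes> (s' \<otimes> (\<pi> [^] k \<otimes> c))" using s s'c by (simp add: m_ac)
    also have "\<dots> = (\<pi> \<otimes> r) \<otimes> a" using 1 a by (simp add: m_assoc)
    finally have "s' \<otimes> s = \<pi> \<otimes> r" using m_rcancel[of a "s' \<otimes> s" "\<pi> \<otimes> r"] a s'c sc 1(2) by simp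
    moreover have "\<pi> \<otimes> r \<in> P" using P.I_r_closed[OF unif_mem 1(2)] .
    ultimately show False using S_mult[OF 1(1) s(1)] by simp
  qed
  \<comment> \<open>The first power that fails to divide \<open>a\<close> is one beyond the
    valuation, so the exponent is j = k - 1. The cofactor \<open>c\<close> is outside
    \<open>P\<close>, for otherwise one more \<pi> could be split off.\<close>
  then obtain k where k: "a \<notin> D k" "\<And>j. j < k \<Longrightarrow> a \<in> D j" using exists_least_iff[of "\<lambda>k. a \<notin> D k"] by blast
  have "k \<noteq> 0" using k(1) a D_zero by metis
  then obtain j where j: "k = Suc j" using not0_implies_Suc by blast
  then have "a \<in> D j" using k(2) by simp
  then obtain s c where s: "s \<in> S" "c \<in> carrier R" "s \<otimes> a = c \<otimes> \<pi> [^] j" unfolding D_def by blast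
  have "c \<notin> P"
  proof
    assume "c \<in> P"
    then obtain s' d where d: "s' \<in> S" "d \<in> carrier R" "s' \<otimes> c = d \<otimes> \<pi>" using unif by blast
    have car: "s' \<in> carrier R" "s \<in> carrier R" using d s by auto
    have "(s' \<otimes> s) \<otimes> a = (s' \<otimes> c) \<otimes> \<pi> [^] j" using car a s(2,3) by (simp add: m_assoc)
    also have "\<dots> = d \<otimes> \<pi> [^] k" using d j by (simp add: m_ac)
    finally show False using k(1) S_mult[OF d(1) s(1)] d(2) a unfolding D_def by blast
  qed
  then show ?thesis using that[of s c j] s by simp
qed

lemma valuation_compare:
  assumes a: "a \<in> carrier R" "a \<noteq> \<zero>" and b: "b \<in> carrier R" "b \<noteq> \<zero>"
  shows "\<exists>s\<in>S. (\<exists>c\<in>carrier R. s \<otimes> b = c \<otimes> a) \<or> (\<exists>c\<in>carrier R. s \<otimes> a = c \<otimes> b)"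
proof -
  have *: "\<exists>u\<in>S. \<exists>c\<in>carrier R. u \<otimes> b = c \<otimes> a"
    if "a \<in> carrier R" "b \<in> carrier R" "s \<in> S" "t \<in> S" "s \<otimes> a = t \<otimes> \<pi> [^] (j::nat)"
      "s' \<in> S" "t' \<in> S" "s' \<otimes> b = t' \<otimes> \<pi> [^] (k::nat)" "j \<le> k" for a b s t j s' t' k
  proof -
    have car: "s \<in> carrier R" "t \<in> carrier R" "s' \<in> carrier R" "t' \<in> carrier R" using that by auto
    have "(s' \<otimes> t) \<otimes> b = t \<otimes> (s' \<otimes> b)" using that(2) car by (simp add: m_ac)
    also have "\<dots> = t \<otimes> (t' \<otimes> (\<pi> [^] (k - j) \<otimes> \<pi> [^] j))" using that(8,9) by (simp add: nat_pow_mult)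
    also have "\<dots> = (t' \<otimes> \<pi> [^] (k - j)) \<otimes> (t \<otimes> \<pi> [^] j)" using car by (simp add: m_ac)
    also have "\<dots> = (t' \<otimes> \<pi> [^] (k - j)) \<otimes> (s \<otimes> a)" using that(5) by simp
    also have "\<dots> = (t' \<otimes> \<pi> [^] (k - j) \<otimes> s) \<otimes> a" using car that(1) by (simp add: m_assoc)
    finally show ?thesis using S_mult[OF that(6,4)] car by (intro bexI[of _ "s' \<otimes> t"] bexI[of _ "t' \<otimes> \<pi> [^] (k - j) \<otimes> s"]) auto
  qed
  obtain s t j where 1: "s \<in> S" "t \<in> S" "s \<otimes> a = t \<otimes> \<pi> [^] (j::nat)" using valuation[OF a] .
  obtain s' t' k where 2: "s' \<in> S" "t' \<in> S" "s' \<otimes> b = t' \<otimes> \<pi> [^] (k::nat)" using valuation[OF b] .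
  show ?thesis
    using *[OF a(1) b(1) 1 2] *[OF b(1) a(1) 2 1] nat_le_linear[of j k] by blast
qed

text \<open>The entry of least valuation divides all the others locally, and a product of the
  finitely many denominators serves for all of them at once.\<close>

lemma valuation_family:
  fixes n :: nat
  assumes "\<And>i. i < n \<Longrightarrow> a i \<in> carrier R" "i0 < n" "a i0 \<noteq> \<zero>"
  shows "\<exists>i<n. a i \<noteq> \<zero> \<and> (\<exists>s\<in>S. \<forall>j<n. \<exists>c\<in>carrier R. s \<otimes> a j = c \<otimes> a i)"
  using assms
proof (induction n arbitrary: i0)
  case (Suc n)
  show ?case
  proof (cases "\<exists>i<n. a i \<noteq> \<zero>")
    case False
    then have "i0 = n" using Suc.prems by (metis less_antisym)
    have "\<exists>c\<in>carrier R. \<one> \<otimes> a j = c \<otimes> a n" if "j < Suc n" for j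
    proof (cases "j = n")
      case True
      then show ?thesis using Suc.prems(1) by (intro bexI[of _ \<one>]) auto
    next
      case False
      then have "a j = \<zero>" using \<open>\<not> (\<exists>i<n. a i \<noteq> \<zero>)\<close> that by simp
      then show ?thesis using Suc.prems(1)[of n] by (intro bexI[of _ \<zero>]) auto
    qed
    then show ?thesis using Suc.prems(3) \<open>i0 = n\<close> one_S by blast
  next
    case True
    then obtain i s where i: "i < n" "a i \<noteq> \<zero>" "s \<in> S" "\<forall>j<n. \<exists>c\<in>carrier R. s \<otimes> a j = c \<otimes> a i"
      using Suc.IH Suc.prems(1) by (metis less_SucI)
    have car: "s \<in> carrier R" "a i \<in> carrier R" "a n \<in> carrier R" using i Suc.prems(1) by auto
    show ?thesis
    proof (cases "\<exists>u\<in>S. \<exists>c\<in>carrier R. u \<otimes> a n = c \<otimes> a i")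
      case True
      then obtain u c where u: "u \<in> S" "c \<in> carrier R" "u \<otimes> a n = c \<otimes> a i" by blast
      have uc: "u \<in> carrier R" using u by simp
      have "\<exists>c\<in>carrier R. (s \<otimes> u) \<otimes> a j = c \<otimes> a i" if j: "j < Suc n" for j
      proof (cases "j = n")
        case True
        have "(s \<otimes> u) \<otimes> a n = (s \<otimes> c) \<otimes> a i" using car uc u(2,3) by (simp add: m_assoc)
        then show ?thesis using True car u(2) by (intro bexI[of _ "s \<otimes> c"]) auto
      next
        case False
        then obtain d where d: "d \<in> carrier R" "s \<otimes> a j = d \<otimes> a i" using i(4) j by (metis less_antisym)
        have "(s \<otimes> u) \<otimes> a j = u \<otimes> (s \<otimes> a j)" using car uc Suc.prems(1)[OF j] by (simp add: m_ac)
        also have "\<dots> = (u \<otimes> d) \<otimes> a i" using d car uc by (simp add: m_assoc)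
        finally show ?thesis using d uc by (intro bexI[of _ "u \<otimes> d"]) auto
      qed
      then show ?thesis using i(1,2) S_mult[OF i(3) u(1)] less_SucI by blast
    next
      case False
      have n0: "a n \<noteq> \<zero>"
      proof
        assume "a n = \<zero>"
        then have "\<one> \<otimes> a n = \<zero> \<otimes> a i" using car by simp
        then show False using False one_S by blast
      qed
      obtain u c where u: "u \<in> S" "c \<in> carrier R" "u \<otimes> a i = c \<otimes> a n"
        using False valuation_compare[OF car(2) i(2) car(3) n0] by blast
      have uc: "u \<in> carrier R" using u by simp
      have "\<exists>c\<in>carrier R. (s \<otimes> u) \<otimes> a j = c \<otimes> a n" if j: "j < Suc n" for j
      proof (cases "j = n")
        case True
        then show ?thesis using car uc by (intro bexI[of _ "s \<otimes> u"]) auto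
      next
        case False
        then obtain d where d: "d \<in> carrier R" "s \<otimes> a j = d \<otimes> a i" using i(4) j by (metis less_antisym)
        have "(s \<otimes> u) \<otimes> a j = u \<otimes> (s \<otimes> a j)" using car uc Suc.prems(1)[OF j] by (simp add: m_ac)
        also have "\<dots> = d \<otimes> (u \<otimes> a i)" using d car uc by (simp add: m_ac)
        also have "\<dots> = (d \<otimes> c) \<otimes> a n" using d u car by (simp add: m_assoc)
        finally show ?thesis using d u by (intro bexI[of _ "d \<otimes> c"]) auto
      qed
      then show ?thesis using n0 S_mult[OF i(3) u(1)] by blast
    qed
  qed
qed simp

end

text \<open>The fractions whose numerator lies in \<open>P\<close> form an ideal of the localization; its generator
  gives the uniformizer.\<close>

lemma uniformizer_ex:
  fixes R :: "('a, 'b) ring_scheme" (structure)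
  assumes R: "noetherian_domain R" and P: "maximalideal P R"
    and dvr: "discrete_valuation_ring (localization R (carrier R - P))"
  shows "\<exists>\<pi>. unif_prime R P \<pi>"
proof -
  interpret noetherian_domain R by fact
  interpret P: maximalideal P R by fact
  interpret Pp: primeideal P R by (rule maximalideal_prime) (rule P)
  define S where "S = carrier R - P"
  define L where "L = localization R S"
  interpret L: principal_domain L using dvr by (simp add: L_def S_def discrete_valuation_ring_def)
  have not_field: "\<not> field L" using dvr by (simp add: L_def S_def discrete_valuation_ring_def)
  have one_notin [simp]: "\<one> \<notin> P" using P.one_imp_carrier P.I_notcarr by auto
  have Sc [simp]: "s \<in> carrier R" and S0: "s \<noteq> \<zero>" if "s \<in> S" for s
    using that P.zero_closed by (auto simp: S_def)
  have S1 [simp]: "\<one> \<in> S" by (simp add: S_def)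
  have Sm [simp]: "s \<otimes> t \<in> S" if "s \<in> S" "t \<in> S" for s t
    using that Pp.I_prime by (auto simp: S_def)
  let ?r = "fraction_rel R S" and ?A = "carrier R \<times> S"
  \<comment> \<open>In a domain the factor \<open>u\<close> in the definition of the relation
    cancels, leaving cross multiplication.\<close>
  have rel: "((a, s), (b, t)) \<in> ?r \<longleftrightarrow> a \<otimes> t = b \<otimes> s"
    if "a \<in> carrier R" "s \<in> S" "b \<in> carrier R" "t \<in> S" for a s b t
  proof
    assume "((a, s), (b, t)) \<in> ?r"
    then obtain u where "u \<in> S" "u \<otimes> (a \<otimes> t) = u \<otimes> (b \<otimes> s)" by (auto simp: fraction_rel_def)
    then show "a \<otimes> t = b \<otimes> s" using m_lcancel[of u] S0 that by simp
  next
    assume "a \<otimes> t = b \<otimes> s"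
    then show "((a, s), (b, t)) \<in> ?r" using that S1 by (auto simp: fraction_rel_def)
  qed
  have dom: "?r \<subseteq> ?A \<times> ?A" by (auto simp: fraction_rel_def)
  have eq: "equiv ?A ?r"
  proof (rule equivI)
    show "?r \<subseteq> ?A \<times> ?A" by (rule dom)
    show "refl_on ?A ?r" by (rule refl_onI) (use rel dom in auto)
    show "sym ?r"
    proof (rule symI)
      fix x y assume xy: "(x, y) \<in> ?r"
      obtain a s b t where e: "x = (a, s)" "y = (b, t)" by (cases x; cases y)
      have m: "a \<in> carrier R" "s \<in> S" "b \<in> carrier R" "t \<in> S" using xy dom e by auto
      then show "(y, x) \<in> ?r" using xy rel[of a s b t] rel[of b t a s] e by simp
    qed
    show "trans ?r"
    proof (rule transI)
      fix x y z assume xy: "(x, y) \<in> ?r" and yz: "(y, z) \<in> ?r"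
      obtain a s b t c u where e: "x = (a, s)" "y = (b, t)" "z = (c, u)" by (cases x; cases y; cases z)
      have m: "a \<in> carrier R" "s \<in> S" "b \<in> carrier R" "t \<in> S" "c \<in> carrier R" "u \<in> S" using xy yz dom e by auto
      have 1: "a \<otimes> t = b \<otimes> s" "b \<otimes> u = c \<otimes> t" using xy yz rel m e by auto
      have "t \<otimes> (a \<otimes> u) = u \<otimes> (a \<otimes> t)" using m by (simp add: m_ac)
      also have "\<dots> = s \<otimes> (b \<otimes> u)" unfolding 1(1) using m by (simp add: m_ac)
      also have "\<dots> = t \<otimes> (c \<otimes> s)" unfolding 1(2) using m by (simp add: m_ac)
      finally have "a \<otimes> u = c \<otimes> s" using m_lcancel[of t] S0 m by simp
      then show "(x, z) \<in> ?r" using rel m e by simp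
    qed
  qed
  define fr where "fr a s = ?r `` {(a, s)}" for a s
  have carL: "carrier L = {fr a s | a s. a \<in> carrier R \<and> s \<in> S}"
    by (auto simp: L_def localization_def fr_def quotient_def)
  have frc: "fr a s \<in> carrier L" if "a \<in> carrier R" "s \<in> S" for a s using that by (auto simp: carL)
  have fr_eq: "fr a s = fr b t \<longleftrightarrow> a \<otimes> t = b \<otimes> s" if "a \<in> carrier R" "s \<in> S" "b \<in> carrier R" "t \<in> S" for a s b t
    unfolding fr_def using eq_equiv_class_iff[OF eq, of "(a, s)" "(b, t)"] rel that by simp
  have mult: "fr a s \<otimes>\<^bsub>L\<^esub> fr b t = fr (a \<otimes> b) (s \<otimes> t)"
    if "a \<in> carrier R" "s \<in> S" "b \<in> carrier R" "t \<in> S" for a s b t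
  proof -
    have "congruent2 ?r ?r (\<lambda>p q. ?r `` {(fst p \<otimes> fst q, snd p \<otimes> snd q)})"
    proof (rule congruent2I[OF eq eq])
      fix x y w assume "(x, y) \<in> ?r" and w: "w \<in> ?A"
      moreover obtain a s b t c u where e: "x = (a, s)" "y = (b, t)" "w = (c, u)" by (cases x; cases y; cases w)
      ultimately have m: "a \<in> carrier R" "s \<in> S" "b \<in> carrier R" "t \<in> S" "c \<in> carrier R" "u \<in> S"
        and 1: "a \<otimes> t = b \<otimes> s" using dom rel by auto
      have "(a \<otimes> c) \<otimes> (t \<otimes> u) = (a \<otimes> t) \<otimes> (c \<otimes> u)" using m by (simp add: m_ac)
      also have "\<dots> = (b \<otimes> c) \<otimes> (s \<otimes> u)" unfolding 1 using m by (simp add: m_ac)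
      finally have 2: "fr (a \<otimes> c) (s \<otimes> u) = fr (b \<otimes> c) (t \<otimes> u)" using m by (subst fr_eq) simp_all
      then show "?r `` {(fst x \<otimes> fst w, snd x \<otimes> snd w)} = ?r `` {(fst y \<otimes> fst w, snd y \<otimes> snd w)}"
        using e by (simp add: fr_def)
      show "?r `` {(fst w \<otimes> fst x, snd w \<otimes> snd x)} = ?r `` {(fst w \<otimes> fst y, snd w \<otimes> snd y)}"
        using 2 e m by (simp add: fr_def m_comm[of c] m_comm[of u])
    qed
    from UN_equiv_class2[OF eq eq this, of "(a, s)" "(b, t)"] show ?thesis
      unfolding fr_def L_def localization_def using that by simp
  qed
  have add: "fr a s \<oplus>\<^bsub>L\<^esub> fr b t = fr (a \<otimes> t \<oplus> b \<otimes> s) (s \<otimes> t)"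
    if "a \<in> carrier R" "s \<in> S" "b \<in> carrier R" "t \<in> S" for a s b t
  proof -
    have "congruent2 ?r ?r (\<lambda>p q. ?r `` {(fst p \<otimes> snd q \<oplus> fst q \<otimes> snd p, snd p \<otimes> snd q)})"
    proof (rule congruent2I[OF eq eq])
      fix x y w assume "(x, y) \<in> ?r" and w: "w \<in> ?A"
      moreover obtain a s b t c u where e: "x = (a, s)" "y = (b, t)" "w = (c, u)" by (cases x; cases y; cases w)
      ultimately have m: "a \<in> carrier R" "s \<in> S" "b \<in> carrier R" "t \<in> S" "c \<in> carrier R" "u \<in> S"
        and 1: "a \<otimes> t = b \<otimes> s" using dom rel by auto
      have "(a \<otimes> u \<oplus> c \<otimes> s) \<otimes> (t \<otimes> u) =
        (a \<otimes> t) \<otimes> (u \<otimes> u) \<oplus> c \<otimes> s \<otimes> t \<otimes> u" using m by (simp add: l_distr r_distr m_ac)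
      also have "\<dots> = (b \<otimes> u \<oplus> c \<otimes> t) \<otimes> (s \<otimes> u)"
        unfolding 1 using m by (simp add: l_distr r_distr m_ac)
      finally have 2: "fr (a \<otimes> u \<oplus> c \<otimes> s) (s \<otimes> u) = fr (b \<otimes> u \<oplus> c \<otimes> t) (t \<otimes> u)"
        using m by (subst fr_eq) simp_all
      then show "?r `` {(fst x \<otimes> snd w \<oplus> fst w \<otimes> snd x, snd x \<otimes> snd w)} =
          ?r `` {(fst y \<otimes> snd w \<oplus> fst w \<otimes> snd y, snd y \<otimes> snd w)}"
        using e by (simp add: fr_def)
      have "c \<otimes> s \<oplus> a \<otimes> u = a \<otimes> u \<oplus> c \<otimes> s" "c \<otimes> t \<oplus> b \<otimes> u = b \<otimes> u \<oplus> c \<otimes> t"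
        "u \<otimes> s = s \<otimes> u" "u \<otimes> t = t \<otimes> u" using m by (simp_all add: a_comm m_comm)
      then show "?r `` {(fst w \<otimes> snd x \<oplus> fst x \<otimes> snd w, snd w \<otimes> snd x)} =
          ?r `` {(fst w \<otimes> snd y \<oplus> fst y \<otimes> snd w, snd w \<otimes> snd y)}"
        using 2 e by (simp add: fr_def)
    qed
    from UN_equiv_class2[OF eq eq this, of "(a, s)" "(b, t)"] show ?thesis
      unfolding fr_def L_def localization_def using that by simp
  qed
  have zero: "\<zero>\<^bsub>L\<^esub> = fr \<zero> \<one>" and one: "\<one>\<^bsub>L\<^esub> = fr \<one> \<one>"
    by (simp_all add: L_def localization_def fr_def)
  define I where "I = {fr a s | a s. a \<in> P \<and> s \<in> S}"
  have Pc: "a \<in> carrier R" if "a \<in> P" for a using P.Icarr[OF that] .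
  have Ii: "fr a s \<in> I" if "a \<in> P" "s \<in> S" for a s using that by (auto simp: I_def)
  have "ideal I L"
  proof (rule L.idealI')
    show "I \<subseteq> carrier L"
    proof
      fix x assume "x \<in> I"
      then obtain a s where "x = fr a s" "a \<in> P" "s \<in> S" unfolding I_def by blast
      then show "x \<in> carrier L" using frc[OF Pc] by simp
    qed
    show "\<zero>\<^bsub>L\<^esub> \<in> I" unfolding zero by (rule Ii[OF P.zero_closed S1])
  next
    fix x y assume "x \<in> I" "y \<in> I"
    then obtain a s b t where e: "x = fr a s" "y = fr b t" and m: "a \<in> P" "s \<in> S" "b \<in> P" "t \<in> S"
      unfolding I_def by blast
    have "a \<otimes> t \<oplus> b \<otimes> s \<in> P"
      by (intro P.a_closed P.I_r_closed m Sc[OF m(2)] Sc[OF m(4)])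
    then show "x \<oplus>\<^bsub>L\<^esub> y \<in> I"
      unfolding e add[OF Pc[OF m(1)] m(2) Pc[OF m(3)] m(4)] by (rule Ii[OF _ Sm[OF m(2,4)]])
  next
    fix x y assume "x \<in> carrier L" "y \<in> I"
    then obtain a s b t where e: "x = fr a s" "y = fr b t" and m: "a \<in> carrier R" "s \<in> S" "b \<in> P" "t \<in> S"
      unfolding I_def carL by blast
    show "x \<otimes>\<^bsub>L\<^esub> y \<in> I"
      unfolding e mult[OF m(1,2) Pc[OF m(3)] m(4)] by (rule Ii[OF P.I_l_closed[OF m(3,1)] Sm[OF m(2,4)]])
  qed
  then obtain g where g: "g \<in> carrier L" "I = PIdl\<^bsub>L\<^esub> g" using L.exists_gen by blast
  have "g \<in> I" using L.cgenideal_self[OF g(1)] g(2) by simp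
  then obtain \<pi> s0 where \<pi>: "g = fr \<pi> s0" "\<pi> \<in> P" "s0 \<in> S" by (auto simp: I_def)
  have \<pi>c: "\<pi> \<in> carrier R" using \<pi>(2) P.Icarr by blast
  have unif: "\<exists>s\<in>S. \<exists>c\<in>carrier R. s \<otimes> a = c \<otimes> \<pi>" if a: "a \<in> P" for a
  proof -
    have ac: "a \<in> carrier R" using a P.Icarr by blast
    have "fr a \<one> \<in> PIdl\<^bsub>L\<^esub> g" using Ii[OF a S1] g(2) by simp
    then obtain x where "x \<in> carrier L" "fr a \<one> = x \<otimes>\<^bsub>L\<^esub> g" by (auto simp: cgenideal_def)
    then obtain b t where b: "b \<in> carrier R" "t \<in> S" "fr a \<one> = fr b t \<otimes>\<^bsub>L\<^esub> fr \<pi> s0" using \<pi>(1) by (auto simp: carL)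
    then have "a \<otimes> (t \<otimes> s0) = (b \<otimes> \<pi>) \<otimes> \<one>"
      using mult[OF b(1,2) \<pi>c \<pi>(3)] fr_eq[of a "\<one>" "b \<otimes> \<pi>" "t \<otimes> s0"] ac \<pi>c \<pi>(3) by simp
    then have "(t \<otimes> s0) \<otimes> a = b \<otimes> \<pi>" using ac b \<pi>c \<pi>(3) by (simp add: m_comm)
    then show ?thesis using b(1,2) \<pi>(3) Sm by blast
  qed
  \<comment> \<open>A zero generator would force \<open>P\<close> to be zero; every nonzero element
    would then be a denominator and the localization a field.\<close>
  have "\<pi> \<noteq> \<zero>"
  proof
    assume 0: "\<pi> = \<zero>"
    have P0: "a = \<zero>" if a: "a \<in> P" for a
    proof -
      obtain s c where s: "s \<in> S" "c \<in> carrier R" "s \<otimes> a = c \<otimes> \<pi>" using unif[OF a] by blast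
      then show ?thesis using integral[of s a] S0[OF s(1)] Sc[OF s(1)] Pc[OF a] 0 by auto
    qed
    have "Units L = carrier L - {\<zero>\<^bsub>L\<^esub>}"
    proof
      show "Units L \<subseteq> carrier L - {\<zero>\<^bsub>L\<^esub>}"
      proof
        fix x assume x: "x \<in> Units L"
        have "x \<noteq> \<zero>\<^bsub>L\<^esub>"
        proof
          assume "x = \<zero>\<^bsub>L\<^esub>"
          then obtain y where "y \<in> carrier L" "y \<otimes>\<^bsub>L\<^esub> \<zero>\<^bsub>L\<^esub> = \<one>\<^bsub>L\<^esub>" using x unfolding Units_def by blast
          then show False by simp
        qed
        then show "x \<in> carrier L - {\<zero>\<^bsub>L\<^esub>}" using L.Units_closed[OF x] by blast
      qed
      show "carrier L - {\<zero>\<^bsub>L\<^esub>} \<subseteq> Units L"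
      proof
        fix x assume x: "x \<in> carrier L - {\<zero>\<^bsub>L\<^esub>}"
        then obtain a s where a: "a \<in> carrier R" "s \<in> S" "x = fr a s" by (auto simp: carL)
        have "a \<noteq> \<zero>" using x a zero fr_eq[of a s "\<zero>" "\<one>"] by auto
        then have aS: "a \<in> S" using P0 a by (auto simp: S_def)
        have "fr a s \<otimes>\<^bsub>L\<^esub> fr s a = \<one>\<^bsub>L\<^esub>" "fr s a \<otimes>\<^bsub>L\<^esub> fr a s = \<one>\<^bsub>L\<^esub>"
          using a aS by (simp_all add: mult one fr_eq m_comm)
        then show "x \<in> Units L" unfolding Units_def a(3) using frc[OF a(1,2)] frc[OF Sc[OF a(2)] aS] by blast
      qed
    qed
    then show False using not_field L.cring_fieldI by blast
  qed
  then show ?thesis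
    using \<pi>(2) unif by (intro exI[of _ \<pi>] unif_prime.intro unif_prime_axioms.intro R P) (simp_all add: S_def)
qed

section \<open>Cyclic modules\<close>

context cring
begin

lemma quotient_module_carrier: "carrier (quotient_module R I) = (\<lambda>a. I +> a) ` carrier R"
  by (auto simp: quotient_module_def FactRing_def A_RCOSETS_def')

lemma quotient_module_simps:
  assumes I: "ideal I R"
  shows "a \<in> carrier R \<Longrightarrow> b \<in> carrier R \<Longrightarrow> (I +> a) \<oplus>\<^bsub>quotient_module R I\<^esub> (I +> b) = I +> (a \<oplus> b)"
    "r \<in> carrier R \<Longrightarrow> a \<in> carrier R \<Longrightarrow> r \<odot>\<^bsub>quotient_module R I\<^esub> (I +> a) = I +> (r \<otimes> a)"
    "\<zero>\<^bsub>quotient_module R I\<^esub> = I +> \<zero>"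
    "a \<in> carrier R \<Longrightarrow> b \<in> carrier R \<Longrightarrow> I +> a = I +> b \<longleftrightarrow> a \<ominus> b \<in> I"
proof -
  interpret I: ideal I R by fact
  show "a \<in> carrier R \<Longrightarrow> b \<in> carrier R \<Longrightarrow> (I +> a) \<oplus>\<^bsub>quotient_module R I\<^esub> (I +> b) = I +> (a \<oplus> b)"
    by (simp add: quotient_module_def FactRing_def I.a_rcos_sum)
  show "r \<in> carrier R \<Longrightarrow> a \<in> carrier R \<Longrightarrow> r \<odot>\<^bsub>quotient_module R I\<^esub> (I +> a) = I +> (r \<otimes> a)"
    by (simp add: quotient_module_def FactRing_def I.rcoset_mult_add)
  show "\<zero>\<^bsub>quotient_module R I\<^esub> = I +> \<zero>"
    using I.a_rcos_const[OF I.zero_closed] by (simp add: quotient_module_def FactRing_def)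
  show "a \<in> carrier R \<Longrightarrow> b \<in> carrier R \<Longrightarrow> I +> a = I +> b \<longleftrightarrow> a \<ominus> b \<in> I"
    using quotient_eq_iff_same_a_r_cos[OF I] by simp
qed

lemma quotient_module:
  assumes I: "ideal I R"
  shows "module R (quotient_module R I)"
proof -
  note q = quotient_module_simps[OF I] quotient_module_carrier[of I]
  interpret Q: ring "R Quot I" by (rule ideal.quotient_is_ring[OF I])
  have add: "abelian_group (quotient_module R I)"
    by (rule abelian_groupI) (use Q.a_closed Q.zero_closed Q.a_assoc Q.a_comm Q.l_zero Q.add.l_inv_ex in \<open>auto simp: quotient_module_def\<close>)
  show ?thesis
    by (rule moduleI) (use cring_axioms add q in \<open>auto simp: l_distr r_distr m_assoc\<close>)
qed

lemma quotient_module_proj: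
  assumes I: "ideal I R"
  shows "(\<lambda>a\<in>carrier (regular_module R). I +> a) \<in> module_hom R (regular_module R) (quotient_module R I)"
  by (rule module_homI) (use quotient_module_simps[OF I] quotient_module_carrier[of I] regular_module in auto)

lemma quotient_module_fin_gen:
  assumes I: "ideal I R"
  shows "fin_gen R (quotient_module R I)"
  by (rule fin_gen_image[OF regular_module quotient_module[OF I] quotient_module_proj[OF I] _ fin_gen_regular])
    (auto simp: quotient_module_carrier)

lemma cyclic_module_iso:
  assumes I: "ideal I R" and M: "module R M" and x: "x \<in> carrier M"
    and ann: "\<And>r. r \<in> carrier R \<Longrightarrow> r \<odot>\<^bsub>M\<^esub> x = \<zero>\<^bsub>M\<^esub> \<longleftrightarrow> r \<in> I"
  shows "module_iso R (M\<lparr>carrier := {y. \<exists>r\<in>carrier R. y = r \<odot>\<^bsub>M\<^esub> x}\<rparr>) (quotient_module R I)"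
proof -
  interpret M: rmod R M by (rule rmod.intro) fact
  let ?N = "M\<lparr>carrier := {y. \<exists>r\<in>carrier R. y = r \<odot>\<^bsub>M\<^esub> x}\<rparr>"
  have N: "module R ?N" by (rule submodule.submodule_is_module[OF M.cyclic_submodule[OF x] M])
  have Q: "module R (quotient_module R I)" by (rule quotient_module[OF I])
  interpret I: ideal I R by fact
  let ?q = "\<lambda>a\<in>carrier (regular_module R). I +> a"
  let ?g = "\<lambda>a\<in>carrier (regular_module R). a \<odot>\<^bsub>M\<^esub> x"
  have g: "?g \<in> module_hom R (regular_module R) ?N"
    by (rule module_homI) (use x in \<open>auto simp: M.smult_l_distr M.smult_assoc1 regular_module\<close>)
  have eq: "a \<odot>\<^bsub>M\<^esub> x = b \<odot>\<^bsub>M\<^esub> x \<longleftrightarrow> a \<ominus> b \<in> I" if a: "a \<in> carrier R" "b \<in> carrier R" for a b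
  proof -
    have "(a \<ominus> b) \<odot>\<^bsub>M\<^esub> x = a \<odot>\<^bsub>M\<^esub> x \<ominus>\<^bsub>M\<^esub> b \<odot>\<^bsub>M\<^esub> x"
      using a x by (simp add: a_minus_def M.smult_l_distr M.smult_l_minus)
    then show ?thesis using ann[of "a \<ominus> b"] M.diff_eq_zero a x by simp
  qed
  obtain h where h: "h \<in> module_hom R (quotient_module R I) ?N"
    and hq: "\<And>a. a \<in> carrier (regular_module R) \<Longrightarrow> h (?q a) = ?g a"
  proof (rule module_hom_factor[OF regular_module Q N quotient_module_proj[OF I] _ g])
    fix a assume a: "a \<in> carrier (regular_module R)" "?q a = \<zero>\<^bsub>quotient_module R I\<^esub>"
    then have "a \<ominus> \<zero> \<in> I" using quotient_module_simps(3,4)[OF I] by simp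
    then show "?g a = \<zero>\<^bsub>?N\<^esub>" using eq[of a \<zero>] a x by simp
  qed (auto simp: quotient_module_carrier)
  have hq': "h (I +> a) = a \<odot>\<^bsub>M\<^esub> x" if "a \<in> carrier R" for a using hq[of a] that by simp
  have "bij_betw h (carrier (quotient_module R I)) (carrier ?N)"
    unfolding bij_betw_def
  proof
    show "inj_on h (carrier (quotient_module R I))"
    proof (rule inj_onI)
      fix u v assume "u \<in> carrier (quotient_module R I)" "v \<in> carrier (quotient_module R I)" and e: "h u = h v"
      then obtain a b where ab: "a \<in> carrier R" "b \<in> carrier R" "u = I +> a" "v = I +> b"
        unfolding quotient_module_carrier by blast
      have "a \<odot>\<^bsub>M\<^esub> x = b \<odot>\<^bsub>M\<^esub> x" using e unfolding ab(3,4) hq'[OF ab(1)] hq'[OF ab(2)] .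
      then show "u = v" unfolding ab(3,4) eq[OF ab(1,2)] quotient_module_simps(4)[OF I ab(1,2)] .
    qed
    show "h ` carrier (quotient_module R I) = carrier ?N"
      unfolding quotient_module_carrier using hq' by (force simp: image_iff)
  qed
  then have "module_iso R (quotient_module R I) ?N" using h unfolding module_iso_def by blast
  then show ?thesis by (rule module_iso_sym[OF _ Q])
qed

end

section \<open>Torsion-free modules\<close>

definition torsion_free :: "('a, 'b) ring_scheme \<Rightarrow> ('a, 'm) module \<Rightarrow> bool" where
  "torsion_free R M \<longleftrightarrow>
     (\<forall>r\<in>carrier R. \<forall>x\<in>carrier M. r \<odot>\<^bsub>M\<^esub> x = \<zero>\<^bsub>M\<^esub> \<longrightarrow> r = \<zero>\<^bsub>R\<^esub> \<or> x = \<zero>\<^bsub>M\<^esub>)"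

lemma fin_rank_lincomb:
  assumes M: "module R M" and c: "\<And>i. i < n \<Longrightarrow> c i \<in> module_hom R M (regular_module R)"
    and x: "\<And>i. i < n \<Longrightarrow> x i \<in> carrier M"
  shows "fin_rank R M (\<lambda>y\<in>carrier M. lincomb M (\<lambda>i. c i y) x n)"
  using c x
proof (induction n)
  case 0
  show ?case unfolding lincomb.simps(1) by (rule fin_rank.zero)
next
  case (Suc n)
  interpret M: rmod R M by (rule rmod.intro) fact
  have "fin_rank R M (\<lambda>y\<in>carrier M. c n y \<odot>\<^bsub>M\<^esub> x n \<oplus>\<^bsub>M\<^esub> (\<lambda>y\<in>carrier M. lincomb M (\<lambda>i. c i y) x n) y)"
    by (rule fin_rank.step) (use Suc in auto)
  moreover have "(\<lambda>y\<in>carrier M. c n y \<odot>\<^bsub>M\<^esub> x n \<oplus>\<^bsub>M\<^esub> (\<lambda>y\<in>carrier M. lincomb M (\<lambda>i. c i y) x n) y) =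
    (\<lambda>y\<in>carrier M. lincomb M (\<lambda>i. c i y) x (Suc n))"
  proof (rule restrict_ext)
    fix y assume y: "y \<in> carrier M"
    have "c i y \<in> carrier R" if "i < Suc n" for i using module_hom_closed[OF Suc.prems(1)[OF that] y] by simp
    then have "lincomb M (\<lambda>i. c i y) x n \<in> carrier M" "c n y \<odot>\<^bsub>M\<^esub> x n \<in> carrier M"
      using Suc.prems(2) by (auto intro!: M.lincomb_closed)
    then show "c n y \<odot>\<^bsub>M\<^esub> x n \<oplus>\<^bsub>M\<^esub> (\<lambda>y\<in>carrier M. lincomb M (\<lambda>i. c i y) x n) y = lincomb M (\<lambda>i. c i y) x (Suc n)"
      using y by (simp add: M.a_comm)
  qed
  ultimately show ?case by (rule back_subst[of "fin_rank R M"])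
qed

text \<open>Independent generators make the combination map bijective, and the coordinates of its
  inverse form a dual basis.\<close>

lemma (in cring) fin_rank_independent:
  assumes M: "module R M" and gen: "generates R M (x ` {..<n})"
    and ind: "\<And>a. a \<in> carrier (free_module R n) \<Longrightarrow> lincomb M a x n = \<zero>\<^bsub>M\<^esub> \<Longrightarrow> a = \<zero>\<^bsub>free_module R n\<^esub>"
  shows "fin_rank R M (\<lambda>y\<in>carrier M. y)"
proof -
  interpret M: rmod R M by (rule rmod.intro) fact
  let ?F = "free_module R n"
  interpret F: rmod R ?F by (rule rmod.intro) (rule free_module)
  have x: "x i \<in> carrier M" if "i < n" for i using generatesD(1)[OF gen] that by auto
  let ?f = "\<lambda>a\<in>carrier ?F. lincomb M a x n"
  have f: "?f \<in> module_hom R ?F M" by (rule M.lincomb_hom) (rule x)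
  have inj: "inj_on ?f (carrier ?F)"
  proof (rule inj_onI)
    fix a b assume a: "a \<in> carrier ?F" and b: "b \<in> carrier ?F" and eq: "?f a = ?f b"
    have ab: "a \<ominus>\<^bsub>?F\<^esub> b \<in> carrier ?F" by (rule F.minus_closed[OF a b])
    have "?f (a \<ominus>\<^bsub>?F\<^esub> b) = ?f a \<ominus>\<^bsub>M\<^esub> ?f b"
      unfolding a_minus_def using module_hom_add[OF f a, of "\<ominus>\<^bsub>?F\<^esub> b"] module_hom_neg[OF f F.module_axioms M b] b by simp
    also have "\<dots> = \<zero>\<^bsub>M\<^esub>" unfolding eq using module_hom_closed[OF f b] M.diff_eq_zero by blast
    finally have "a \<ominus>\<^bsub>?F\<^esub> b = \<zero>\<^bsub>?F\<^esub>" using ind[OF ab] ab by simp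
    then show "a = b" using F.diff_eq_zero a b by blast
  qed
  have surj: "?f ` carrier ?F = carrier M"
  proof
    show "?f ` carrier ?F \<subseteq> carrier M" using module_hom_closed[OF f] by blast
    show "carrier M \<subseteq> ?f ` carrier ?F"
    proof
      fix y assume "y \<in> carrier M"
      then obtain a where "a \<in> carrier ?F" "y = lincomb M a x n" using M.generators_lincomb[OF gen] by blast
      then show "y \<in> ?f ` carrier ?F" by (auto simp: image_iff)
    qed
  qed
  \<comment> \<open>The coordinate vector of an element; its components are the functionals of the
    dual basis.\<close>
  define g where "g = inv_into (carrier ?F) ?f"
  have gc: "g y \<in> carrier ?F" and fg: "lincomb M (g y) x n = y" if "y \<in> carrier M" for y
  proof -
    have "y \<in> ?f ` carrier ?F" using that surj by simp
    then show 1: "g y \<in> carrier ?F" and "lincomb M (g y) x n = y"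
      using inv_into_into[of y ?f "carrier ?F"] f_inv_into_f[of y ?f "carrier ?F"] unfolding g_def by simp_all
  qed
  have gi: "g y i \<in> carrier R" if "y \<in> carrier M" "i < n" for y i
    using gc[OF that(1)] that(2) unfolding carrier_free_module by (auto simp: PiE_iff)
  have gf: "g (lincomb M a x n) = a" if "a \<in> carrier ?F" for a
    using inv_into_f_f[OF inj that] that by (simp add: g_def)
  have c: "(\<lambda>y\<in>carrier M. g y i) \<in> module_hom R M (regular_module R)" if i: "i < n" for i
  proof (rule module_homI)
    fix y z assume yz: "y \<in> carrier M" "z \<in> carrier M"
    let ?a = "g y \<oplus>\<^bsub>?F\<^esub> g z"
    have a: "?a \<in> carrier ?F" by (rule F.a_closed[OF gc[OF yz(1)] gc[OF yz(2)]])
    have "?f ?a = y \<oplus>\<^bsub>M\<^esub> z" using module_hom_add[OF f gc[OF yz(1)] gc[OF yz(2)]] gc yz fg by simp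
    then have "g (y \<oplus>\<^bsub>M\<^esub> z) = ?a" using gf[OF a] a by simp
    then show "g (y \<oplus>\<^bsub>M\<^esub> z) i = g y i \<oplus>\<^bsub>regular_module R\<^esub> g z i" using i by (simp add: free_module_def)
  next
    fix r y assume ry: "r \<in> carrier R" "y \<in> carrier M"
    let ?a = "r \<odot>\<^bsub>?F\<^esub> g y"
    have a: "?a \<in> carrier ?F" by (rule F.smult_closed[OF ry(1) gc[OF ry(2)]])
    have "?f ?a = r \<odot>\<^bsub>M\<^esub> y" using module_hom_smult[OF f ry(1) gc[OF ry(2)]] gc ry fg by simp
    then have "g (r \<odot>\<^bsub>M\<^esub> y) = ?a" using gf[OF a] a by simp
    then show "g (r \<odot>\<^bsub>M\<^esub> y) i = r \<odot>\<^bsub>regular_module R\<^esub> g y i" using i by (simp add: free_module_def)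
  qed (use gi i M in auto)
  have "fin_rank R M (\<lambda>y\<in>carrier M. lincomb M (\<lambda>i. (\<lambda>y\<in>carrier M. g y i) y) x n)"
    by (rule fin_rank_lincomb[OF M c x])
  moreover have "(\<lambda>y\<in>carrier M. lincomb M (\<lambda>i. (\<lambda>y\<in>carrier M. g y i) y) x n) = (\<lambda>y\<in>carrier M. y)"
    by (rule restrict_ext) (simp add: fg)
  ultimately show ?thesis by simp
qed

text \<open>Over a discrete valuation ring a finitely generated torsion-free module is free; this is
  that proof with denominators cleared. In a nontrivial relation the coefficient of least valuation
  is divided out, which expresses s times one generator through the others. Then s M lies in a
  submodule with fewer generators, and the induction hypothesis is transferred along multiplication
  by \<open>s\<close>.\<close>

lemma (in unif_prime) torsion_free_fin_rank_local:
  assumes "module R M" "torsion_free R M" "finite Y" "generates R M Y"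
  shows "\<exists>s\<in>S. fin_rank R M (\<lambda>x\<in>carrier M. s \<odot>\<^bsub>M\<^esub> x)"
  using assms
proof (induction "card Y" arbitrary: M Y rule: less_induct)
  case less
  note M = less.prems(1)
  interpret M: rmod R M by (rule rmod.intro) fact
  let ?n = "card Y"
  obtain x where x0: "bij_betw x {0..<?n} Y" using ex_bij_betw_nat_finite[OF less.prems(3)] by blast
  then have xY: "x ` {..<?n} = Y" "inj_on x {..<?n}" by (auto simp: bij_betw_def lessThan_atLeast0)
  have Yc: "Y \<subseteq> carrier M" using generatesD(1)[OF less.prems(4)] .
  have x: "x i \<in> carrier M" if "i < ?n" for i using xY(1) Yc that by blast
  show ?case
  proof (cases "\<forall>a\<in>carrier (free_module R ?n). lincomb M a x ?n = \<zero>\<^bsub>M\<^esub> \<longrightarrow> a = \<zero>\<^bsub>free_module R ?n\<^esub>")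
    case True
    then have "fin_rank R M (\<lambda>y\<in>carrier M. y)"
      using less.prems(4) xY(1) by (intro fin_rank_independent[OF M, of x ?n]) auto
    moreover have "(\<lambda>y\<in>carrier M. \<one> \<odot>\<^bsub>M\<^esub> y) = (\<lambda>y\<in>carrier M. y)" by (rule restrict_ext) simp
    ultimately show ?thesis using one_S by (intro bexI[of _ \<one>]) simp_all
  next
    case False
    then obtain a where a: "a \<in> carrier (free_module R ?n)" "lincomb M a x ?n = \<zero>\<^bsub>M\<^esub>"
      "a \<noteq> \<zero>\<^bsub>free_module R ?n\<^esub>" by blast
    have ac: "a i \<in> carrier R" if "i < ?n" for i using a(1) that unfolding carrier_free_module by (auto simp: PiE_iff)
    have "\<exists>i0<?n. a i0 \<noteq> \<zero>"
    proof (rule ccontr)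
      assume "\<not> (\<exists>i0<?n. a i0 \<noteq> \<zero>)"
      then have "a = \<zero>\<^bsub>free_module R ?n\<^esub>"
        using a(1) unfolding carrier_free_module by (intro ext) (auto simp: free_module_def PiE_iff extensional_def)
      then show False using a(3) by simp
    qed
    then obtain i0 where "i0 < ?n" "a i0 \<noteq> \<zero>" by blast
    then obtain i s where i: "i < ?n" "a i \<noteq> \<zero>" and s: "s \<in> S" "\<forall>j<?n. \<exists>c\<in>carrier R. s \<otimes> a j = c \<otimes> a i"
      using valuation_family[of ?n a i0] ac by blast
    from s(2) obtain c where c: "\<forall>j<?n. c j \<in> carrier R \<and> s \<otimes> a j = c j \<otimes> a i" by metis
    have sc: "s \<in> carrier R" using s by simp
    \<comment> \<open>At the index \<open>i\<close> itself the equation s a i = c i (a i) forces the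
      factor \<open>s\<close>, so the generator \<open>x i\<close> keeps a coefficient outside
      \<open>P\<close>.\<close>
    have ci: "c i = s" using m_rcancel[OF i(2) ac[OF i(1)], of s "c i"] c i sc by auto
    \<comment> \<open>The original relation times \<open>s\<close> is \<open>a i\<close> times the
      combination with coefficients \<open>c\<close>; torsion-freeness removes
      \<open>a i\<close>.\<close>
    have "a i \<odot>\<^bsub>M\<^esub> lincomb M c x ?n = lincomb M (\<lambda>j. c j \<otimes> a i) x ?n"
      by (rule lincomb_smult_right[OF M ac[OF i(1)], symmetric]) (use c x in auto)
    also have "\<dots> = lincomb M (\<lambda>j. s \<otimes> a j) x ?n" by (rule M.lincomb_cong) (use c in auto)
    also have "\<dots> = \<zero>\<^bsub>M\<^esub>" using M.lincomb_smult[of s ?n a x] sc ac x a(2) by simp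
    finally have "lincomb M c x ?n = \<zero>\<^bsub>M\<^esub>"
      using less.prems(2) i(2) ac[OF i(1)] M.lincomb_closed[of ?n c x] c x unfolding torsion_free_def by blast
    define Z where "Z = Y - {x i}"
    have Zc: "Z \<subseteq> carrier M" using Yc by (auto simp: Z_def)
    have N: "submodule (M.spn Z) R M" by (rule M.spn_submodule[OF Zc])
    note n = M.submoduleE[OF N] submodule_zero[OF N]
    have xiY: "x i \<in> Y" using xY(1) i(1) by blast
    have "lincomb M c (x(i := \<zero>\<^bsub>M\<^esub>)) ?n \<in> M.spn Z"
    proof (rule M.lincomb_submodule[OF N])
      fix j assume j: "j < ?n"
      show "c j \<in> carrier R" using c j by blast
      show "(x(i := \<zero>\<^bsub>M\<^esub>)) j \<in> M.spn Z"
      proof (cases "j = i")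
        case False
        then have "x j \<in> Z" using xY j i(1) by (auto simp: Z_def inj_on_def)
        then show ?thesis using M.spn_incl[of Z] False by auto
      qed (use n in simp)
    qed
    moreover have "lincomb M c (x(i := \<zero>\<^bsub>M\<^esub>)) ?n \<oplus>\<^bsub>M\<^esub> s \<odot>\<^bsub>M\<^esub> x i \<in> M.spn Z"
      using lincomb_split[OF M i(1), of c x] c x \<open>lincomb M c x ?n = \<zero>\<^bsub>M\<^esub>\<close> ci submodule_zero[OF N] by simp
    ultimately have sxi: "s \<odot>\<^bsub>M\<^esub> x i \<in> M.spn Z"
      using M.submodule_diff_cancel[OF N] sc x[OF i(1)] by simp
    let ?H = "{y \<in> carrier M. s \<odot>\<^bsub>M\<^esub> y \<in> M.spn Z}"
    have "submodule ?H R M"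
      using preimage_submodule[OF M M smult_hom[OF M sc] N]
      by (rule back_subst[of "\<lambda>K. submodule K R M"]) auto
    moreover have "Y \<subseteq> ?H"
    proof
      fix y assume y: "y \<in> Y"
      show "y \<in> ?H"
      proof (cases "y = x i")
        case False
        then have "y \<in> M.spn Z" using y M.spn_incl[of Z] by (auto simp: Z_def)
        then show ?thesis using n(4)[OF sc] y Yc by auto
      qed (use sxi x i in simp)
    qed
    ultimately have sH: "s \<odot>\<^bsub>M\<^esub> y \<in> M.spn Z" if "y \<in> carrier M" for y
      using generatesD(2)[OF less.prems(4)] that by blast
    let ?N = "M\<lparr>carrier := M.spn Z\<rparr>"
    have Nm: "module R ?N" by (rule submodule.submodule_is_module[OF N M])
    have "torsion_free R ?N" using less.prems(2) n(1) unfolding torsion_free_def by auto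
    moreover have "generates R ?N Z"
      unfolding generates_def M.submodule_restrict[OF N] using M.spn_incl M.spn_least by auto
    moreover have "card Z < ?n" "finite Z" 
      unfolding Z_def using card_Diff1_less[OF less.prems(3) xiY] less.prems(3) by blast+
    ultimately obtain t where t: "t \<in> S" "fin_rank R ?N (\<lambda>x\<in>carrier ?N. t \<odot>\<^bsub>?N\<^esub> x)"
      using less.hyps[OF _ Nm] by blast
    have f: "(\<lambda>y\<in>carrier M. s \<odot>\<^bsub>M\<^esub> y) \<in> module_hom R M ?N"
      using smult_hom[OF M sc] sH by (auto simp: module_hom_def)
    have g: "(\<lambda>y\<in>carrier ?N. y) \<in> module_hom R ?N M" by (rule module_homI[OF _ _ _ Nm]) (use n in auto)
    have tc: "t \<in> carrier R" using t by simp
    from fin_rank_transfer[OF M Nm f g t(2)]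
    have "fin_rank R M (\<lambda>x\<in>carrier M. (t \<otimes> s) \<odot>\<^bsub>M\<^esub> x)"
    proof (rule back_subst[of "fin_rank R M"])
      show "(\<lambda>x\<in>carrier M. (\<lambda>y\<in>carrier ?N. y) ((\<lambda>x\<in>carrier ?N. t \<odot>\<^bsub>?N\<^esub> x) ((\<lambda>y\<in>carrier M. s \<odot>\<^bsub>M\<^esub> y) x)))
        = (\<lambda>x\<in>carrier M. (t \<otimes> s) \<odot>\<^bsub>M\<^esub> x)"
        by (rule restrict_ext) (use sH n(4)[OF tc] sc tc in \<open>simp add: M.smult_assoc1\<close>)
    qed
    then show ?thesis using S_mult[OF t(1) s(1)] by blast
  qed
qed

lemma (in noetherian_cring) maximal_ideal_ex:
  assumes J: "ideal J R" and ne: "J \<noteq> carrier R"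
  obtains P where "maximalideal P R" "J \<subseteq> P"
proof -
  let ?F = "{H. ideal H R \<and> H \<noteq> carrier R \<and> J \<subseteq> H}"
  obtain P where P: "P \<in> ?F" "\<And>K. K \<in> ?F \<Longrightarrow> P \<subseteq> K \<Longrightarrow> K = P"
    by (rule submodule_maximal[OF regular_module fin_gen_regular, of J ?F]) (use J ne in \<open>auto simp: ideal_iff_submodule\<close>)
  have "maximalideal P R"
  proof (rule maximalidealI)
    fix K assume "ideal K R" "P \<subseteq> K" "K \<subseteq> carrier R"
    then show "K = P \<or> K = carrier R" using P(2)[of K] P(1) by blast
  qed (use P(1) in auto)
  then show ?thesis using that P(1) by blast
qed

text \<open>The elementwise form of the Dedekind condition, freed from the ring of
  fractions.\<close>

locale dedekind = noetherian_domain R for R (structure) +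
  assumes unif_ex: "maximalideal P R \<Longrightarrow> \<exists>\<pi>. unif_prime R P \<pi>"
begin

text \<open>The scalars whose multiplication map has finite rank form an ideal. The local result
  puts an element outside each maximal ideal into it, so it contains 1 and the dual basis property
  holds for the identity.\<close>

lemma torsion_free_projective:
  assumes M: "M \<in> Obj RM" and tf: "torsion_free R M"
  shows "projective RM M"
proof (rule fin_rank_projective[OF M])
  have Mm: "module R M" "fin_gen R M" using M Obj_Rmod by auto
  interpret M: rmod R M by (rule rmod.intro) (rule Mm)
  obtain Y where Y: "finite Y" "generates R M Y" using fin_genE[OF Mm(2)] .
  let ?J = "{s \<in> carrier R. fin_rank R M (\<lambda>x\<in>carrier M. s \<odot>\<^bsub>M\<^esub> x)}"
  have J: "ideal ?J R"
  proof (rule idealI')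
    have "(\<lambda>x\<in>carrier M. \<zero>\<^bsub>M\<^esub>) = (\<lambda>x\<in>carrier M. \<zero> \<odot>\<^bsub>M\<^esub> x)" by (rule restrict_ext) simp
    then show "\<zero> \<in> ?J" using fin_rank.zero[of R M] by simp
  next
    fix s t assume st: "s \<in> ?J" "t \<in> ?J"
    then have "fin_rank R M (\<lambda>x\<in>carrier M. (\<lambda>x\<in>carrier M. s \<odot>\<^bsub>M\<^esub> x) x \<oplus>\<^bsub>M\<^esub> (\<lambda>x\<in>carrier M. t \<odot>\<^bsub>M\<^esub> x) x)"
      
      using fin_rank_add[OF Mm(1), of "\<lambda>x\<in>carrier M. s \<odot>\<^bsub>M\<^esub> x" "\<lambda>x\<in>carrier M. t \<odot>\<^bsub>M\<^esub> x"] by blast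
    moreover have "(\<lambda>x\<in>carrier M. (\<lambda>x\<in>carrier M. s \<odot>\<^bsub>M\<^esub> x) x \<oplus>\<^bsub>M\<^esub> (\<lambda>x\<in>carrier M. t \<odot>\<^bsub>M\<^esub> x) x)
      = (\<lambda>x\<in>carrier M. (s \<oplus> t) \<odot>\<^bsub>M\<^esub> x)" by (rule restrict_ext) (use st in \<open>simp add: M.smult_l_distr\<close>)
    ultimately show "s \<oplus> t \<in> ?J" using st by simp
  next
    fix r s assume rs: "r \<in> carrier R" "s \<in> ?J"
    then have "fin_rank R M (\<lambda>x\<in>carrier M. r \<odot>\<^bsub>M\<^esub> (\<lambda>x\<in>carrier M. s \<odot>\<^bsub>M\<^esub> x) x)"
      
      using fin_rank_smult[OF Mm(1), of r "\<lambda>x\<in>carrier M. s \<odot>\<^bsub>M\<^esub> x"] by blast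
    moreover have "(\<lambda>x\<in>carrier M. r \<odot>\<^bsub>M\<^esub> (\<lambda>x\<in>carrier M. s \<odot>\<^bsub>M\<^esub> x) x) = (\<lambda>x\<in>carrier M. (r \<otimes> s) \<odot>\<^bsub>M\<^esub> x)"
      by (rule restrict_ext) (use rs in \<open>simp add: M.smult_assoc1\<close>)
    ultimately show "r \<otimes> s \<in> ?J" using rs by simp
  qed auto
  have "?J = carrier R"
  proof (rule ccontr)
    assume "?J \<noteq> carrier R"
    then obtain P where P: "maximalideal P R" "?J \<subseteq> P" using maximal_ideal_ex[OF J] by blast
    obtain \<pi> where "unif_prime R P \<pi>" using unif_ex[OF P(1)] by blast
    from unif_prime.torsion_free_fin_rank_local[OF this Mm(1) tf Y] show False using P(2) by blast
  qed
  then have "\<one> \<in> ?J" by simp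
  moreover have "(\<lambda>x\<in>carrier M. \<one> \<odot>\<^bsub>M\<^esub> x) = (\<lambda>x\<in>carrier M. x)" by (rule restrict_ext) simp
  ultimately show "fin_rank R M (\<lambda>x\<in>carrier M. x)" by simp
qed

text \<open>A projective module is a retract of a free module, where torsion-freeness can be read
  off coordinatewise in the domain.\<close>

lemma projective_torsion_free:
  assumes "projective RM M"
  shows "torsion_free R M"
proof -
  have Mo: "M \<in> Obj RM" using assms by (simp add: projective_def)
  then have M: "module R M" "fin_gen R M" using Obj_Rmod by auto
  interpret M: rmod R M by (rule rmod.intro) (rule M)
  obtain n g where g: "g \<in> module_hom R (free_module R n) M" "g ` carrier (free_module R n) = carrier M"
    using M.fin_gen_free_surj[OF M(2)] .
  let ?F = "free_module R n"
  \<comment> \<open>Projectivity speaks only of objects of the category, so the free module is first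
    replaced by a copy inside it.\<close>
  obtain F where F: "F \<in> Obj RM" "module_iso R ?F F" using transport_Rmod[OF free_module fin_gen_free] .
  have Fm: "module R F" by (rule Rmod_module[OF F(1)])
  obtain f f' where f: "f \<in> module_hom R ?F F" "f' \<in> module_hom R F ?F"
    "\<forall>x\<in>carrier ?F. f' (f x) = x" "\<forall>y\<in>carrier F. f (f' y) = y"
    using module_isoE[OF F(2) free_module] .
  let ?e = "\<lambda>x\<in>carrier F. g (f' x)"
  have e: "?e \<in> module_hom R F M" by (rule module_hom_comp_closed[OF Fm f(2) g(1)])
  have es: "?e ` carrier F = carrier M"
  proof
    show "?e ` carrier F \<subseteq> carrier M" using module_hom_closed[OF e] by blast
    show "carrier M \<subseteq> ?e ` carrier F"
    proof
      fix y assume "y \<in> carrier M"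
      then obtain v where v: "v \<in> carrier ?F" "y = g v" using g(2) by blast
      then show "y \<in> ?e ` carrier F" using f(3) module_hom_closed[OF f(1) v(1)] by (intro image_eqI[of _ _ "f v"]) auto
    qed
  qed
  have "\<exists>h\<in>Mor RM M F. Comp RM M ?e h = IdMor RM M"
    using additive_category.projectiveD[OF Rmod_additive assms F(1) Mo Rmod_surj_epi[OF e es], of "IdMor RM M"]
      module_hom_id[OF M(1)] unfolding additive_category.cmp_def[OF Rmod_additive] Mor_Rmod Rmod_Id by blast
  then obtain h where h: "h \<in> module_hom R M F" and eh: "Comp RM M ?e h = IdMor RM M"
    unfolding Mor_Rmod by blast
  have inj: "?e (h x) = x" if "x \<in> carrier M" for x using fun_cong[OF eh, of x] that module_hom_closed[OF h that] by simp
  have fz: "f' \<zero>\<^bsub>F\<^esub> = \<zero>\<^bsub>?F\<^esub>" by (rule module_hom_zero[OF f(2) Fm free_module])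
  have gz: "g \<zero>\<^bsub>?F\<^esub> = \<zero>\<^bsub>M\<^esub>" by (rule module_hom_zero[OF g(1) free_module M(1)])
  show ?thesis
    unfolding torsion_free_def
  proof (intro ballI impI)
    fix r x assume rx: "r \<in> carrier R" "x \<in> carrier M" "r \<odot>\<^bsub>M\<^esub> x = \<zero>\<^bsub>M\<^esub>"
    have hx: "h x \<in> carrier F" by (rule module_hom_closed[OF h rx(2)])
    let ?v = "f' (h x)"
    have v: "?v \<in> carrier ?F" by (rule module_hom_closed[OF f(2) hx])
    have "r \<odot>\<^bsub>?F\<^esub> ?v = f' (h (r \<odot>\<^bsub>M\<^esub> x))"
      using module_hom_smult[OF h rx(1,2)] module_hom_smult[OF f(2) rx(1) hx] by simp
    also have "\<dots> = \<zero>\<^bsub>?F\<^esub>" unfolding rx(3) using module_hom_zero[OF h M(1) Fm] fz by simp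
    finally have rv0: "r \<odot>\<^bsub>?F\<^esub> ?v = \<zero>\<^bsub>?F\<^esub>" .
    have rv: "r \<otimes> ?v i = \<zero>" if "i < n" for i
      using fun_cong[OF rv0, of i] that by (simp add: free_module_def)
    show "r = \<zero> \<or> x = \<zero>\<^bsub>M\<^esub>"
    proof (rule disjCI)
      assume "\<not> x = \<zero>\<^bsub>M\<^esub>"
      have vi: "?v i \<in> carrier R" if "i < n" for i using v that unfolding carrier_free_module by (auto simp: PiE_iff)
      have "\<exists>i<n. ?v i \<noteq> \<zero>"
      proof (rule ccontr)
        assume "\<not> (\<exists>i<n. ?v i \<noteq> \<zero>)"
        then have "?v = \<zero>\<^bsub>?F\<^esub>"
          using v unfolding carrier_free_module by (intro ext) (auto simp: free_module_def PiE_iff extensional_def)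
        then have "?e (h x) = \<zero>\<^bsub>M\<^esub>" using gz hx by simp
        then show False using inj[OF rx(2)] \<open>\<not> x = \<zero>\<^bsub>M\<^esub>\<close> by simp
      qed
      then show "r = \<zero>" using rv vi rx(1) integral by blast
    qed
  qed
qed

end

section \<open>Splitting off a cyclic torsion module\<close>

lemma (in cring) internal_direct_sum:
  assumes M: "module R M" and N: "submodule N R M" and K: "submodule K R M"
    and int: "N \<inter> K \<subseteq> {\<zero>\<^bsub>M\<^esub>}" and sum: "\<And>y. y \<in> carrier M \<Longrightarrow> \<exists>n\<in>N. \<exists>k\<in>K. y = n \<oplus>\<^bsub>M\<^esub> k"
  shows "module_iso R M (module_sum2 (M\<lparr>carrier := N\<rparr>) (M\<lparr>carrier := K\<rparr>))"
proof -
  interpret M: rmod R M by (rule rmod.intro) fact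
  note n = M.submoduleE[OF N] and k = M.submoduleE[OF K]
  let ?S = "module_sum2 (M\<lparr>carrier := N\<rparr>) (M\<lparr>carrier := K\<rparr>)"
  have S: "module R ?S"
    by (rule module_sum2[OF submodule.submodule_is_module[OF N M] submodule.submodule_is_module[OF K M]])
  let ?h = "\<lambda>z\<in>carrier ?S. fst z \<oplus>\<^bsub>M\<^esub> snd z"
  have Nc: "a \<in> carrier M" if "a \<in> N" for a using n(1) that by blast
  have Kc: "a \<in> carrier M" if "a \<in> K" for a using k(1) that by blast
  have h: "?h \<in> module_hom R ?S M"
  proof (rule module_homI[OF _ _ _ S])
    fix y z assume "y \<in> carrier ?S" "z \<in> carrier ?S"
    then obtain a b c d where "y = (a, b)" "z = (c, d)" "a \<in> N" "b \<in> K" "c \<in> N" "d \<in> K" by (cases y; cases z) simp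
    then show "fst (y \<oplus>\<^bsub>?S\<^esub> z) \<oplus>\<^bsub>M\<^esub> snd (y \<oplus>\<^bsub>?S\<^esub> z) = fst y \<oplus>\<^bsub>M\<^esub> snd y \<oplus>\<^bsub>M\<^esub> (fst z \<oplus>\<^bsub>M\<^esub> snd z)"
      using Nc[of a] Nc[of c] Kc[of b] Kc[of d] by (simp add: M.a_ac)
  next
    fix r y assume "r \<in> carrier R" "y \<in> carrier ?S"
    then show "fst (r \<odot>\<^bsub>?S\<^esub> y) \<oplus>\<^bsub>M\<^esub> snd (r \<odot>\<^bsub>?S\<^esub> y) = r \<odot>\<^bsub>M\<^esub> (fst y \<oplus>\<^bsub>M\<^esub> snd y)"
      using Nc Kc by (cases y) (simp add: M.smult_r_distr)
  qed (use Nc Kc in auto)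
  have "bij_betw ?h (carrier ?S) (carrier M)"
    unfolding bij_betw_def
  proof
    show "inj_on ?h (carrier ?S)"
    proof (rule inj_onI)
      fix y z assume yz: "y \<in> carrier ?S" "z \<in> carrier ?S" and e: "?h y = ?h z"
      obtain a b c d where abcd: "y = (a, b)" "z = (c, d)" "a \<in> N" "b \<in> K" "c \<in> N" "d \<in> K"
        using yz by (cases y; cases z) simp
      note car = Nc[OF abcd(3)] Kc[OF abcd(4)] Nc[OF abcd(5)] Kc[OF abcd(6)]
      have e': "a \<oplus>\<^bsub>M\<^esub> b = c \<oplus>\<^bsub>M\<^esub> d" using e yz abcd(1,2) by simp
      have "(a \<ominus>\<^bsub>M\<^esub> c) \<oplus>\<^bsub>M\<^esub> (b \<ominus>\<^bsub>M\<^esub> d) = (a \<oplus>\<^bsub>M\<^esub> b) \<ominus>\<^bsub>M\<^esub> (c \<oplus>\<^bsub>M\<^esub> d)"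
        by (rule M.diff_add_diff[symmetric]) (use car in auto)
      also have "\<dots> = \<zero>\<^bsub>M\<^esub>" unfolding e' using car M.diff_eq_zero by blast
      finally have 0: "(a \<ominus>\<^bsub>M\<^esub> c) \<oplus>\<^bsub>M\<^esub> (b \<ominus>\<^bsub>M\<^esub> d) = \<zero>\<^bsub>M\<^esub>" .
      have "a \<ominus>\<^bsub>M\<^esub> c = \<ominus>\<^bsub>M\<^esub> (b \<ominus>\<^bsub>M\<^esub> d)"
        using M.minus_equality[OF 0] car by simp
      also have "\<dots> = d \<ominus>\<^bsub>M\<^esub> b" using car M.minus_minus_diff by blast
      finally have 1: "a \<ominus>\<^bsub>M\<^esub> c = d \<ominus>\<^bsub>M\<^esub> b" .
      have "a \<ominus>\<^bsub>M\<^esub> c \<in> N" by (rule M.submodule_minus[OF N abcd(3,5)])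
      moreover have "a \<ominus>\<^bsub>M\<^esub> c \<in> K" unfolding 1 by (rule M.submodule_minus[OF K abcd(6,4)])
      ultimately have "a \<ominus>\<^bsub>M\<^esub> c = \<zero>\<^bsub>M\<^esub>" using int by blast
      then have "a \<ominus>\<^bsub>M\<^esub> c = \<zero>\<^bsub>M\<^esub>" "d \<ominus>\<^bsub>M\<^esub> b = \<zero>\<^bsub>M\<^esub>" using 1 by simp_all
      then have "a = c" "d = b" using M.diff_eq_zero[OF car(1,3)] M.diff_eq_zero[OF car(4,2)] by blast+
      then show "y = z" using abcd by simp
    qed
    show "?h ` carrier ?S = carrier M"
    proof
      show "?h ` carrier ?S \<subseteq> carrier M" using module_hom_closed[OF h] by blast
      show "carrier M \<subseteq> ?h ` carrier ?S"
      proof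
        fix y assume "y \<in> carrier M"
        then obtain a b where "a \<in> N" "b \<in> K" "y = a \<oplus>\<^bsub>M\<^esub> b" using sum by blast
        then show "y \<in> ?h ` carrier ?S" by (intro image_eqI[of _ _ "(a, b)"]) auto
      qed
    qed
  qed
  then have "module_iso R ?S M" using h unfolding module_iso_def by blast
  then show ?thesis by (rule module_iso_sym[OF _ S])
qed

context unif_prime
begin

lemma pow_D: "\<pi> [^] l \<in> D l" using pow_Pw unfolding Pw_eq_D .

text \<open>The elements of \<open>M\<close> that \<pi>^l annihilates after localization at
  \<open>P\<close>.\<close>

definition tors :: "('a, 'm) module \<Rightarrow> nat \<Rightarrow> 'm set" where
  "tors M l = {m \<in> carrier M. \<exists>s\<in>S. (s \<otimes> \<pi> [^] l) \<odot>\<^bsub>M\<^esub> m = \<zero>\<^bsub>M\<^esub>}"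

lemma tors_submodule:
  assumes M: "module R M"
  shows "submodule (tors M l) R M"
proof -
  interpret M: rmod R M by (rule rmod.intro) fact
  from saturation_submodule[OF M kernel_submodule[OF M M smult_hom[OF M pow_closed]], of l] show ?thesis
    unfolding tors_def
    by (rule back_subst[of "\<lambda>K. submodule K R M"]) (auto simp: m_comm simp flip: M.smult_assoc1)
qed

lemma tors_mono:
  assumes M: "module R M" and kl: "k \<le> l"
  shows "tors M k \<subseteq> tors M l"
proof
  interpret M: rmod R M by (rule rmod.intro) fact
  fix x assume "x \<in> tors M k"
  then obtain s where s: "x \<in> carrier M" "s \<in> S" "(s \<otimes> \<pi> [^] k) \<odot>\<^bsub>M\<^esub> x = \<zero>\<^bsub>M\<^esub>" unfolding tors_def by blast
  have "s \<otimes> \<pi> [^] l = \<pi> [^] (l - k) \<otimes> (s \<otimes> \<pi> [^] k)" using s(2) kl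
    by (simp add: m_lcomm[of "\<pi> [^] (l - k)"] nat_pow_mult)
  then have "(s \<otimes> \<pi> [^] l) \<odot>\<^bsub>M\<^esub> x = \<zero>\<^bsub>M\<^esub>" using s by (simp add: M.smult_assoc1)
  then show "x \<in> tors M l" unfolding tors_def using s by blast
qed

text \<open>An element of maximal order in the localized torsion submodule; multiplying by a suitable
  element outside \<open>P\<close> makes its annihilator exactly \<open>D l\<close>.\<close>

lemma torsion_element:
  assumes M: "module R M" "fin_gen R M" and y: "y \<in> carrier M"
    and ann: "\<And>r. r \<in> carrier R \<Longrightarrow> r \<odot>\<^bsub>M\<^esub> y = \<zero>\<^bsub>M\<^esub> \<Longrightarrow> r \<in> P"
    and r0: "r0 \<in> carrier R" "r0 \<noteq> \<zero>" "r0 \<odot>\<^bsub>M\<^esub> y = \<zero>\<^bsub>M\<^esub>"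
  obtains x l where "x \<in> carrier M" "l \<ge> 1" "\<forall>r\<in>carrier R. r \<odot>\<^bsub>M\<^esub> x = \<zero>\<^bsub>M\<^esub> \<longleftrightarrow> r \<in> D l"
    "\<forall>k. tors M k \<subseteq> tors M l"
proof -
  interpret M: rmod R M by (rule rmod.intro) fact
  obtain H where H: "H \<in> range (tors M)" "\<And>K. K \<in> range (tors M) \<Longrightarrow> H \<subseteq> K \<Longrightarrow> K = H"
    by (rule submodule_maximal[OF M, of "tors M 0" "range (tors M)"]) (use tors_submodule[OF M(1)] in auto)
  then obtain L where L: "H = tors M L" by blast
  have "tors M k \<subseteq> tors M L" for k
    using H(2)[of "tors M (max k L)"] tors_mono[OF M(1), of L "max k L"] tors_mono[OF M(1), of k "max k L"] L by auto
  then have ex: "\<exists>l. \<forall>k. tors M k \<subseteq> tors M l" by blast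
  \<comment> \<open>The ascending chain of the \<open>tors M k\<close> becomes stationary at
    \<open>l\<close>; minimality of \<open>l\<close> yields an element \<open>m0\<close> whose local
    order is exactly \<open>l\<close>.\<close>
  define l where "l = (LEAST l. \<forall>k. tors M k \<subseteq> tors M l)"
  have l: "\<forall>k. tors M k \<subseteq> tors M l" unfolding l_def by (rule LeastI_ex[OF ex])
  obtain s t k where st: "s \<in> S" "t \<in> S" "s \<otimes> r0 = t \<otimes> \<pi> [^] (k::nat)" using valuation[OF r0(1,2)] .
  have "(t \<otimes> \<pi> [^] k) \<odot>\<^bsub>M\<^esub> y = s \<odot>\<^bsub>M\<^esub> (r0 \<odot>\<^bsub>M\<^esub> y)" using st r0(1) y by (simp flip: st(3) M.smult_assoc1)
  also have "\<dots> = \<zero>\<^bsub>M\<^esub>" using r0(3) st(1) by simp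
  finally have "y \<in> tors M k" unfolding tors_def using st(2) y by blast
  moreover have "y \<notin> tors M 0"
  proof
    assume "y \<in> tors M 0"
    then obtain s where s: "s \<in> S" "(s \<otimes> \<pi> [^] (0::nat)) \<odot>\<^bsub>M\<^esub> y = \<zero>\<^bsub>M\<^esub>" unfolding tors_def by blast
    then show False using ann[of s] by simp
  qed
  ultimately have l0: "l \<noteq> 0" using l by (metis subsetD)
  have "\<not> (\<forall>k. tors M k \<subseteq> tors M (l - 1))"
    using not_less_Least[of "l - 1" "\<lambda>l. \<forall>k. tors M k \<subseteq> tors M l"] l0 unfolding l_def[symmetric] by simp
  then obtain m0 where m0: "m0 \<in> tors M l" "m0 \<notin> tors M (l - 1)" using l by blast
  have m0c: "m0 \<in> carrier M" using m0(1) by (simp add: tors_def)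
  obtain s' where s': "s' \<in> S" "(s' \<otimes> \<pi> [^] l) \<odot>\<^bsub>M\<^esub> m0 = \<zero>\<^bsub>M\<^esub>" using m0(1) unfolding tors_def by blast
  have one: "\<exists>u\<in>S. (u \<otimes> a) \<odot>\<^bsub>M\<^esub> m0 = \<zero>\<^bsub>M\<^esub>" if aD: "a \<in> D l" for a
  proof -
    obtain u c where u: "a \<in> carrier R" "u \<in> S" "c \<in> carrier R" "u \<otimes> a = c \<otimes> \<pi> [^] l" using aD unfolding D_def by blast
    have "(s' \<otimes> u) \<otimes> a = s' \<otimes> (u \<otimes> a)" using u s'(1) by (simp add: m_assoc)
    also have "\<dots> = c \<otimes> (s' \<otimes> \<pi> [^] l)" unfolding u(4) using u(3) s'(1) by (simp add: m_lcomm)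
    finally have "((s' \<otimes> u) \<otimes> a) \<odot>\<^bsub>M\<^esub> m0 = c \<odot>\<^bsub>M\<^esub> ((s' \<otimes> \<pi> [^] l) \<odot>\<^bsub>M\<^esub> m0)"
      using u(3) s'(1) m0c by (simp add: M.smult_assoc1)
    also have "\<dots> = \<zero>\<^bsub>M\<^esub>" unfolding s'(2) using u(3) by simp
    finally show ?thesis using S_mult[OF s'(1) u(2)] by blast
  qed
  \<comment> \<open>So far each element of \<open>D l\<close> kills \<open>m0\<close> only after a
    factor depending on it. As \<open>D l\<close> is finitely generated, one common factor
    \<open>u\<close> suffices, and u m0 is killed by all of \<open>D l\<close>.\<close>
  obtain A where A: "A \<subseteq> carrier R" "finite A" "D l = Idl A" using finetely_gen[OF D_ideal] by blast
  have "A \<subseteq> D l" using A genideal_self by simp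
  with A(2) have "\<exists>u\<in>S. \<forall>a\<in>A. (u \<otimes> a) \<odot>\<^bsub>M\<^esub> m0 = \<zero>\<^bsub>M\<^esub>"
  proof (induction A rule: finite_induct)
    case empty
    then show ?case using one_S by blast
  next
    case (insert b A)
    then obtain u where u: "u \<in> S" "\<forall>a\<in>A. (u \<otimes> a) \<odot>\<^bsub>M\<^esub> m0 = \<zero>\<^bsub>M\<^esub>" by blast
    obtain v where v: "v \<in> S" "(v \<otimes> b) \<odot>\<^bsub>M\<^esub> m0 = \<zero>\<^bsub>M\<^esub>" using one insert.prems by blast
    have "((u \<otimes> v) \<otimes> a) \<odot>\<^bsub>M\<^esub> m0 = \<zero>\<^bsub>M\<^esub>" if a: "a \<in> insert b A" for a
    proof -
      have ac: "a \<in> carrier R" using a insert.prems ideal.Icarr[OF D_ideal] by blast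
      have "((u \<otimes> v) \<otimes> a) \<odot>\<^bsub>M\<^esub> m0 = u \<odot>\<^bsub>M\<^esub> ((v \<otimes> a) \<odot>\<^bsub>M\<^esub> m0)"
        using ac u(1) v(1) m0c by (simp add: m_assoc flip: M.smult_assoc1)
      moreover have "((u \<otimes> v) \<otimes> a) \<odot>\<^bsub>M\<^esub> m0 = v \<odot>\<^bsub>M\<^esub> ((u \<otimes> a) \<odot>\<^bsub>M\<^esub> m0)"
        using ac u(1) v(1) m0c by (simp add: m_ac flip: M.smult_assoc1)
      ultimately show ?thesis using a u v by auto
    qed
    then show ?case using S_mult[OF u(1) v(1)] by blast
  qed
  then obtain u where u: "u \<in> S" "\<forall>a\<in>A. (u \<otimes> a) \<odot>\<^bsub>M\<^esub> m0 = \<zero>\<^bsub>M\<^esub>" by blast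
  have uc: "u \<in> carrier R" using u(1) by simp
  let ?x = "u \<odot>\<^bsub>M\<^esub> m0"
  have xc: "?x \<in> carrier M" using uc m0c by simp
  have ax: "a \<odot>\<^bsub>M\<^esub> ?x = (u \<otimes> a) \<odot>\<^bsub>M\<^esub> m0" if "a \<in> carrier R" for a
    using that uc m0c by (simp add: m_comm flip: M.smult_assoc1)
  have "ideal {a \<in> carrier R. a \<odot>\<^bsub>M\<^esub> ?x = \<zero>\<^bsub>M\<^esub>} R"
    by (rule idealI') (use xc in \<open>auto simp: M.smult_l_distr M.smult_assoc1\<close>)
  moreover have "A \<subseteq> {a \<in> carrier R. a \<odot>\<^bsub>M\<^esub> ?x = \<zero>\<^bsub>M\<^esub>}" using A(1) u(2) ax by auto
  ultimately have Dx: "D l \<subseteq> {a \<in> carrier R. a \<odot>\<^bsub>M\<^esub> ?x = \<zero>\<^bsub>M\<^esub>}" unfolding A(3) by (rule genideal_minimal)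
  have "r \<in> D l" if r: "r \<in> carrier R" "r \<odot>\<^bsub>M\<^esub> ?x = \<zero>\<^bsub>M\<^esub>" for r
  proof (cases "r = \<zero>")
    case True
    then show ?thesis using additive_subgroup.zero_closed[OF ideal.axioms(1)[OF D_ideal]] by simp
  next
    case False
    obtain s t j where st: "s \<in> S" "t \<in> S" "s \<otimes> r = t \<otimes> \<pi> [^] (j::nat)" using valuation[OF r(1) False] .
    \<comment> \<open>If \<open>r\<close> of valuation \<open>j\<close> kills u m0, then
      \<open>m0\<close> is locally \<pi>^j-torsion. Since \<open>m0\<close> is outside
      \<open>tors M (l - 1)\<close>, this forces j >= l.\<close>
    have "((t \<otimes> u) \<otimes> \<pi> [^] j) \<odot>\<^bsub>M\<^esub> m0 = ((s \<otimes> r) \<otimes> u) \<odot>\<^bsub>M\<^esub> m0"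
      unfolding st(3) using st(2) uc by (simp add: m_ac)
    also have "\<dots> = s \<odot>\<^bsub>M\<^esub> (r \<odot>\<^bsub>M\<^esub> ?x)" using st(1) r(1) uc m0c by (simp add: m_assoc flip: M.smult_assoc1)
    also have "\<dots> = \<zero>\<^bsub>M\<^esub>" unfolding r(2) using st(1) by simp
    finally have "m0 \<in> tors M j" unfolding tors_def using m0c S_mult[OF st(2) u(1)] by blast
    then have "\<not> j \<le> l - 1" using m0(2) tors_mono[OF M(1), of j "l - 1"] by blast
    then have "l \<le> j" by simp
    moreover have "r \<in> D j" unfolding D_def using st r(1) by auto
    ultimately show ?thesis using D_mono by blast
  qed
  then have "\<forall>r\<in>carrier R. r \<odot>\<^bsub>M\<^esub> ?x = \<zero>\<^bsub>M\<^esub> \<longleftrightarrow> r \<in> D l" using Dx by blast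
  then show ?thesis using that[OF xc _ _ l] l0 by simp
qed

text \<open>A submodule \<open>N\<close> that contains the saturation \<open>W\<close> of \<open>\<pi>\<^sup>l M\<close> and is maximal with
  \<open>N \<inter> R x = 0\<close> is a complement of \<open>R x\<close>.\<close>

lemma torsion_complement:
  assumes M: "module R M" "fin_gen R M" and x: "x \<in> carrier M" and l1: "l \<ge> 1"
    and ann: "\<forall>r\<in>carrier R. r \<odot>\<^bsub>M\<^esub> x = \<zero>\<^bsub>M\<^esub> \<longleftrightarrow> r \<in> D l"
    and tors: "\<forall>k. tors M k \<subseteq> tors M l"
  obtains N where "submodule N R M" "N \<inter> {y. \<exists>r\<in>carrier R. y = r \<odot>\<^bsub>M\<^esub> x} \<subseteq> {\<zero>\<^bsub>M\<^esub>}"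
    "\<forall>y\<in>carrier M. \<exists>n\<in>N. \<exists>k\<in>{y. \<exists>r\<in>carrier R. y = r \<odot>\<^bsub>M\<^esub> x}. y = n \<oplus>\<^bsub>M\<^esub> k"
proof -
  interpret M: rmod R M by (rule rmod.intro) fact
  let ?X = "{y. \<exists>r\<in>carrier R. y = r \<odot>\<^bsub>M\<^esub> x}"
  have X: "submodule ?X R M" by (rule M.cyclic_submodule[OF x])
  define W where "W = {w \<in> carrier M. \<exists>s\<in>S. \<exists>m\<in>carrier M. s \<odot>\<^bsub>M\<^esub> w = \<pi> [^] l \<odot>\<^bsub>M\<^esub> m}"
  have W: "submodule W R M"
    using saturation_submodule[OF M(1) image_submodule[OF M(1) M(1) smult_hom[OF M(1) pow_closed, of l] M.carrier_is_submodule]]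
    by (rule back_subst[of "\<lambda>K. submodule K R M"]) (auto simp: W_def image_iff)
  have powW: "\<pi> [^] l \<odot>\<^bsub>M\<^esub> m \<in> W" if "m \<in> carrier M" for m
    unfolding W_def using that by (intro CollectI conjI bexI[of _ \<one>] bexI[of _ m]) simp_all
  \<comment> \<open>Submodules containing \<open>W\<close> are saturated: \<open>s\<close> is
    invertible modulo \<open>D l\<close>, and the error term q y lies in \<open>W\<close>.\<close>
  have sat: "y \<in> K" if K: "submodule K R M" "W \<subseteq> K" and s: "s \<in> S" "s \<odot>\<^bsub>M\<^esub> y \<in> K" and y: "y \<in> carrier M" for K s y
  proof -
    note k = M.submoduleE[OF K(1)]
    obtain t q where t: "t \<in> carrier R" "q \<in> D l" "\<one> = t \<otimes> s \<oplus> q" using D_cancel[OF s(1)] by blast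
    obtain s' c where c: "q \<in> carrier R" "s' \<in> S" "c \<in> carrier R" "s' \<otimes> q = c \<otimes> \<pi> [^] l" using t(2) unfolding D_def by blast
    have "s' \<odot>\<^bsub>M\<^esub> (q \<odot>\<^bsub>M\<^esub> y) = \<pi> [^] l \<odot>\<^bsub>M\<^esub> (c \<odot>\<^bsub>M\<^esub> y)"
      using c(1,2,3) y by (simp add: c(4) m_comm[of c] flip: M.smult_assoc1)
    then have "q \<odot>\<^bsub>M\<^esub> y \<in> W" unfolding W_def using c y by auto
    then have qy: "q \<odot>\<^bsub>M\<^esub> y \<in> K" using K(2) by blast
    have "y = \<one> \<odot>\<^bsub>M\<^esub> y" using y by simp
    also have "\<dots> = t \<odot>\<^bsub>M\<^esub> (s \<odot>\<^bsub>M\<^esub> y) \<oplus>\<^bsub>M\<^esub> q \<odot>\<^bsub>M\<^esub> y"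
      unfolding t(3) using t(1) c(1) s(1) y by (simp add: M.smult_l_distr M.smult_assoc1)
    finally show ?thesis using k(5)[OF k(4)[OF t(1) s(2)] qy] by simp
  qed
  \<comment> \<open>If s w = \<pi>^l m with \<open>w\<close> a multiple of \<open>x\<close>, then
    \<pi>^(2l) kills \<open>m\<close>. Maximality of the exponent already makes \<open>m\<close>
    locally \<pi>^l-torsion, so \<open>w\<close> is locally zero, hence zero because
    \<open>D l\<close> is saturated.\<close>
  have WX: "W \<inter> ?X \<subseteq> {\<zero>\<^bsub>M\<^esub>}"
  proof
    fix w assume "w \<in> W \<inter> ?X"
    then obtain r s m where 1: "r \<in> carrier R" "w = r \<odot>\<^bsub>M\<^esub> x" "s \<in> S" "m \<in> carrier M" "s \<odot>\<^bsub>M\<^esub> w = \<pi> [^] l \<odot>\<^bsub>M\<^esub> m"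
      unfolding W_def by blast
    have px: "\<pi> [^] l \<odot>\<^bsub>M\<^esub> x = \<zero>\<^bsub>M\<^esub>" using ann pow_D by simp
    have "(\<one> \<otimes> \<pi> [^] (l + l)) \<odot>\<^bsub>M\<^esub> m = \<pi> [^] l \<odot>\<^bsub>M\<^esub> (s \<odot>\<^bsub>M\<^esub> w)"
      unfolding 1(5) using 1(4) by (simp flip: M.smult_assoc1 nat_pow_mult)
    also have "\<dots> = (s \<otimes> r) \<odot>\<^bsub>M\<^esub> (\<pi> [^] l \<odot>\<^bsub>M\<^esub> x)" unfolding 1(2) using 1(1,3) x by (simp add: m_ac flip: M.smult_assoc1)
    also have "\<dots> = \<zero>\<^bsub>M\<^esub>" unfolding px using 1(1,3) by simp
    finally have "m \<in> tors M (l + l)" unfolding tors_def using 1(4) one_S by blast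
    then have "m \<in> tors M l" using tors by blast
    then obtain s' where s': "s' \<in> S" "(s' \<otimes> \<pi> [^] l) \<odot>\<^bsub>M\<^esub> m = \<zero>\<^bsub>M\<^esub>" unfolding tors_def by blast
    have "((s' \<otimes> s) \<otimes> r) \<odot>\<^bsub>M\<^esub> x = s' \<odot>\<^bsub>M\<^esub> (s \<odot>\<^bsub>M\<^esub> w)" unfolding 1(2) using 1(1,3) s'(1) x by (simp add: m_assoc flip: M.smult_assoc1)
    also have "\<dots> = \<zero>\<^bsub>M\<^esub>" unfolding 1(5) using s' 1(4) by (simp flip: M.smult_assoc1)
    finally have "(s' \<otimes> s) \<otimes> r \<in> D l" using ann 1(1,3) s'(1) by simp
    then have "r \<in> D l" by (rule D_saturated[OF S_mult[OF s'(1) 1(3)] 1(1)])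
    then show "w \<in> {\<zero>\<^bsub>M\<^esub>}" using ann 1(1,2) by simp
  qed
  let ?F = "{N. submodule N R M \<and> W \<subseteq> N \<and> N \<inter> ?X \<subseteq> {\<zero>\<^bsub>M\<^esub>}}"
  obtain N where N0: "N \<in> ?F" and max: "\<And>K. K \<in> ?F \<Longrightarrow> N \<subseteq> K \<Longrightarrow> K = N"
    by (rule submodule_maximal[OF M, of W ?F]) (use W WX in auto)
  then have N: "submodule N R M" and WN: "W \<subseteq> N" and NX: "N \<inter> ?X \<subseteq> {\<zero>\<^bsub>M\<^esub>}" by auto
  have NX0: "r \<odot>\<^bsub>M\<^esub> x = \<zero>\<^bsub>M\<^esub>" if "r \<odot>\<^bsub>M\<^esub> x \<in> N" "r \<in> carrier R" for r using NX that by blast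
  note n = M.submoduleE[OF N]
  have Nc: "a \<in> carrier M" if "a \<in> N" for a using n(1) that by blast
  define B where "B = {y. \<exists>h\<in>N. \<exists>k\<in>?X. y = h \<oplus>\<^bsub>M\<^esub> k}"
  have B: "submodule B R M" unfolding B_def by (rule M.add_submodule[OF N X])
  note b = M.submoduleE[OF B]
  have NB: "N \<subseteq> B"
  proof
    fix a assume "a \<in> N"
    then show "a \<in> B" unfolding B_def using Nc submodule_zero[OF X] by (intro CollectI bexI[of _ a] bexI[of _ "\<zero>\<^bsub>M\<^esub>"]) auto
  qed
  have XB: "r \<odot>\<^bsub>M\<^esub> x \<in> B" if "r \<in> carrier R" for r
    unfolding B_def using that x submodule_zero[OF N] by (intro CollectI bexI[of _ "\<zero>\<^bsub>M\<^esub>"] bexI[of _ "r \<odot>\<^bsub>M\<^esub> x"]) auto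
  have WB: "W \<subseteq> B" using WN NB by blast
  have "y \<in> B" if y: "y \<in> carrier M" for y
  proof (rule ccontr)
    assume "y \<notin> B"
    let ?Q = "\<lambda>k::nat. \<pi> [^] k \<odot>\<^bsub>M\<^esub> y \<in> B"
    have Ql: "?Q l" using powW[OF y] WB by blast
    \<comment> \<open>The power just before the first one that carries \<open>y\<close> into
      \<open>B\<close>, applied to \<open>y\<close>, is an element \<open>z\<close> outside
      \<open>B\<close> with \<pi> z in \<open>B\<close>.\<close>
    define k where "k = (LEAST k. ?Q k)"
    have Qk: "?Q k" unfolding k_def by (rule LeastI[of ?Q, OF Ql])
    have k0: "k \<noteq> 0" using Qk \<open>y \<notin> B\<close> y by (intro notI) simp
    define z where "z = \<pi> [^] (k - 1) \<odot>\<^bsub>M\<^esub> y"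
    have zc: "z \<in> carrier M" using y by (simp add: z_def)
    have zB: "z \<notin> B" using not_less_Least[of "k - 1" ?Q] k0 unfolding k_def[symmetric] z_def by simp
    have "\<pi> \<odot>\<^bsub>M\<^esub> z = \<pi> [^] k \<odot>\<^bsub>M\<^esub> y"
      unfolding z_def using y k0 by (cases k) (simp_all add: m_comm flip: M.smult_assoc1)
    then have "\<pi> \<odot>\<^bsub>M\<^esub> z \<in> B" using Qk by simp
    then obtain a r where ar: "a \<in> N" "r \<in> carrier R" "\<pi> \<odot>\<^bsub>M\<^esub> z = a \<oplus>\<^bsub>M\<^esub> r \<odot>\<^bsub>M\<^esub> x" unfolding B_def by blast
    note ac = Nc[OF ar(1)]
    show False
    proof (cases "r \<in> P")
      case False
      \<comment> \<open>Here \<open>r\<close> is a local unit. Multiplying by \<pi>^(l-1) brings the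
        left side into \<open>W\<close>, so \<pi>^(l-1) r x lies in the intersection of
        \<open>N\<close> with R x and vanishes. That contradicts the annihilator \<open>D l\<close>
        of \<open>x\<close>.\<close>
      have "\<pi> [^] l \<odot>\<^bsub>M\<^esub> z = \<pi> [^] (l - 1) \<odot>\<^bsub>M\<^esub> (\<pi> \<odot>\<^bsub>M\<^esub> z)"
        using l1 zc by (cases l) (simp_all flip: M.smult_assoc1)
      also have "\<dots> = \<pi> [^] (l - 1) \<odot>\<^bsub>M\<^esub> a \<oplus>\<^bsub>M\<^esub> (\<pi> [^] (l - 1) \<otimes> r) \<odot>\<^bsub>M\<^esub> x"
        unfolding ar(3) using ar(2) ac x by (simp add: M.smult_r_distr M.smult_assoc1)
      finally have "\<pi> [^] (l - 1) \<odot>\<^bsub>M\<^esub> a \<oplus>\<^bsub>M\<^esub> (\<pi> [^] (l - 1) \<otimes> r) \<odot>\<^bsub>M\<^esub> x \<in> N" using powW[OF zc] WN by auto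
      then have "(\<pi> [^] (l - 1) \<otimes> r) \<odot>\<^bsub>M\<^esub> x \<in> N"
        by (rule M.submodule_diff_cancel[OF N]) (use n(4) ar x in auto)
      then have "(\<pi> [^] (l - 1) \<otimes> r) \<odot>\<^bsub>M\<^esub> x = \<zero>\<^bsub>M\<^esub>" by (rule NX0) (use ar(2) in simp)
      then have "\<pi> [^] (l - 1) \<otimes> r \<in> D l" using ann ar(2) by simp
      then obtain s c where s: "s \<in> S" "c \<in> carrier R" "s \<otimes> (\<pi> [^] (l - 1) \<otimes> r) = c \<otimes> \<pi> [^] l" unfolding D_def by blast
      have "\<pi> [^] (l - 1) \<otimes> (s \<otimes> r) = \<pi> [^] (l - 1) \<otimes> (c \<otimes> \<pi>)"
        using s ar(2) l1 by (cases l) (simp_all add: m_ac)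
      then have "s \<otimes> r = c \<otimes> \<pi>" using m_lcancel[OF pow_nonzero] s(1,2) ar(2) by simp
      then have "s \<otimes> r \<in> P" using P.I_l_closed[OF unif_mem s(2)] by simp
      then show False using S_mult[OF s(1), of r] False ar(2) by simp
    next
      case True
      obtain s c where s: "s \<in> S" "c \<in> carrier R" "s \<otimes> r = c \<otimes> \<pi>" using unif[OF True] by blast
      have sc: "s \<in> carrier R" using s by simp
      \<comment> \<open>Now \<open>r\<close> is locally divisible by \<pi>. Correcting s z by a
        multiple of \<open>x\<close> removes the part in R x: z' is still outside \<open>B\<close>,
        but \<pi> z' lies in \<open>N\<close> itself.\<close>
      define z' where "z' = s \<odot>\<^bsub>M\<^esub> z \<ominus>\<^bsub>M\<^esub> c \<odot>\<^bsub>M\<^esub> x"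
      have z'c: "z' \<in> carrier M" using sc s(2) zc x by (simp add: z'_def)
      have pz': "\<pi> \<odot>\<^bsub>M\<^esub> z' \<in> N"
      proof -
        have "\<pi> \<odot>\<^bsub>M\<^esub> z' = s \<odot>\<^bsub>M\<^esub> (\<pi> \<odot>\<^bsub>M\<^esub> z) \<ominus>\<^bsub>M\<^esub> (c \<otimes> \<pi>) \<odot>\<^bsub>M\<^esub> x"
          unfolding z'_def a_minus_def using sc s(2) zc x
          by (simp add: M.smult_r_distr M.smult_r_minus m_comm flip: M.smult_assoc1)
        also have "\<dots> = s \<odot>\<^bsub>M\<^esub> a \<oplus>\<^bsub>M\<^esub> (s \<otimes> r) \<odot>\<^bsub>M\<^esub> x \<ominus>\<^bsub>M\<^esub> (s \<otimes> r) \<odot>\<^bsub>M\<^esub> x"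
          unfolding ar(3) s(3)[symmetric] using sc ar(2) ac x by (simp add: M.smult_r_distr M.smult_assoc1)
        also have "\<dots> = s \<odot>\<^bsub>M\<^esub> a" using sc ar(2) ac x by (simp add: a_minus_def M.a_assoc M.r_neg)
        finally show ?thesis using n(4)[OF sc ar(1)] by simp
      qed
      have z'B: "z' \<notin> B"
      proof
        assume "z' \<in> B"
        then have "z' \<oplus>\<^bsub>M\<^esub> c \<odot>\<^bsub>M\<^esub> x \<in> B" using b(5) XB[OF s(2)] by blast
        moreover have "z' \<oplus>\<^bsub>M\<^esub> c \<odot>\<^bsub>M\<^esub> x = s \<odot>\<^bsub>M\<^esub> z"
          unfolding z'_def using sc s(2) zc x by (simp add: a_minus_def M.a_assoc M.l_neg)
        ultimately show False using sat[OF B WB s(1) _ zc] zB by simp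
      qed
      let ?Z = "{y. \<exists>r\<in>carrier R. y = r \<odot>\<^bsub>M\<^esub> z'}"
      let ?K = "{y. \<exists>h\<in>N. \<exists>k\<in>?Z. y = h \<oplus>\<^bsub>M\<^esub> k}"
      have K: "submodule ?K R M" by (rule M.add_submodule[OF N M.cyclic_submodule[OF z'c]])
      have NK: "N \<subseteq> ?K"
      proof
        fix h assume h: "h \<in> N"
        have "\<zero>\<^bsub>M\<^esub> \<in> ?Z" using submodule_zero[OF M.cyclic_submodule[OF z'c]] .
        moreover have "h = h \<oplus>\<^bsub>M\<^esub> \<zero>\<^bsub>M\<^esub>" using Nc[OF h] by simp
        ultimately show "h \<in> ?K" using h by blast
      qed
      have "z' = \<zero>\<^bsub>M\<^esub> \<oplus>\<^bsub>M\<^esub> \<one> \<odot>\<^bsub>M\<^esub> z'" using z'c by simp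
      then have "z' \<in> ?K" using submodule_zero[OF N] by blast
      then have "?K \<noteq> N" using z'B NB by blast
      \<comment> \<open>\<open>N\<close> + R z' is strictly larger than \<open>N\<close>, so by
        maximality it must meet R x outside zero.\<close>
      then have "\<not> ?K \<inter> ?X \<subseteq> {\<zero>\<^bsub>M\<^esub>}" using max[of ?K] K NK WN by blast
      then obtain d where d: "d \<in> ?K" "d \<in> ?X" "d \<noteq> \<zero>\<^bsub>M\<^esub>" by blast
      from d(1) obtain h e where he: "h \<in> N" "e \<in> carrier R" "d = h \<oplus>\<^bsub>M\<^esub> e \<odot>\<^bsub>M\<^esub> z'" by blast
      from d(2) obtain v where v: "v \<in> carrier R" "d = v \<odot>\<^bsub>M\<^esub> x" by blast
      \<comment> \<open>A coefficient \<open>e\<close> in \<open>P\<close> turns e z' locally into a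
        multiple of \<pi> z', which puts a multiple of \<open>d\<close> by an element outside
        \<open>P\<close> into \<open>N\<close> and forces d = 0. A coefficient outside
        \<open>P\<close> can be cancelled and puts z' into \<open>B\<close>.\<close>
      show False
      proof (cases "e \<in> P")
        case True
        obtain s' c' where s': "s' \<in> S" "c' \<in> carrier R" "s' \<otimes> e = c' \<otimes> \<pi>" using unif[OF True] by blast
        have s'c: "s' \<in> carrier R" using s' by simp
        have "s' \<odot>\<^bsub>M\<^esub> d = s' \<odot>\<^bsub>M\<^esub> h \<oplus>\<^bsub>M\<^esub> (s' \<otimes> e) \<odot>\<^bsub>M\<^esub> z'"
          unfolding he(3) using s'c Nc[OF he(1)] he(2) z'c by (simp add: M.smult_r_distr M.smult_assoc1)
        also have "\<dots> = s' \<odot>\<^bsub>M\<^esub> h \<oplus>\<^bsub>M\<^esub> c' \<odot>\<^bsub>M\<^esub> (\<pi> \<odot>\<^bsub>M\<^esub> z')"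
          unfolding s'(3) using s'(2) z'c by (simp add: M.smult_assoc1)
        finally have "s' \<odot>\<^bsub>M\<^esub> d \<in> N" using n(5)[OF n(4)[OF s'c he(1)] n(4)[OF s'(2) pz']] by simp
        moreover have e: "s' \<odot>\<^bsub>M\<^esub> d = (s' \<otimes> v) \<odot>\<^bsub>M\<^esub> x" using v s'c x by (simp add: M.smult_assoc1)
        moreover have "s' \<otimes> v \<in> carrier R" using s'c v(1) by simp
        ultimately have "(s' \<otimes> v) \<odot>\<^bsub>M\<^esub> x = \<zero>\<^bsub>M\<^esub>" using NX0[of "s' \<otimes> v"] by simp
        then have "s' \<otimes> v \<in> D l" using ann s'c v(1) by simp
        then have "v \<in> D l" by (rule D_saturated[OF s'(1) v(1)])
        then show False using ann v d(3) by simp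
      next
        case False
        have "h \<oplus>\<^bsub>M\<^esub> e \<odot>\<^bsub>M\<^esub> z' \<in> B" using XB[OF v(1)] v(2) he(3) by simp
        then have "e \<odot>\<^bsub>M\<^esub> z' \<in> B"
          by (rule M.submodule_diff_cancel[OF B]) (use he NB z'c in auto)
        then show False using sat[OF B WB, of e z'] False he(2) z'c z'B by simp
      qed
    qed
  qed
  then show ?thesis using that[OF N NX] unfolding B_def by blast
qed

end

context dedekind
begin

text \<open>Besides the splitting it keeps the projection onto \<open>N\<close> and a nonzero
  element of its kernel: the later induction is measured by kernels and needs them to grow strictly.
  \<open>N\<close> stays on the carrier type of \<open>M\<close> for the same reason.\<close>

lemma torsion_summand:
  fixes M :: "('a, 'm) module"
  assumes M: "module R M" "fin_gen R M" and tf: "\<not> torsion_free R M"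
  obtains N :: "('a, 'm) module" and p x P l where "module R N" "p \<in> module_hom R M N" "p ` carrier M = carrier N"
    "x \<in> carrier M" "x \<noteq> \<zero>\<^bsub>M\<^esub>" "p x = \<zero>\<^bsub>N\<^esub>" "maximalideal P R" "l \<ge> (1::nat)"
    "module_iso R M (module_sum2 N (quotient_module R (P [^]\<^bsub>ideals_set R\<^esub> l)))"
proof -
  interpret M: rmod R M by (rule rmod.intro) fact
  obtain r0 y where y: "r0 \<in> carrier R" "y \<in> carrier M" "r0 \<odot>\<^bsub>M\<^esub> y = \<zero>\<^bsub>M\<^esub>" "r0 \<noteq> \<zero>" "y \<noteq> \<zero>\<^bsub>M\<^esub>"
    using tf unfolding torsion_free_def by blast
  let ?A = "{r \<in> carrier R. r \<odot>\<^bsub>M\<^esub> y = \<zero>\<^bsub>M\<^esub>}"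
  have A: "ideal ?A R"
    by (rule idealI') (use y(2) in \<open>auto simp: M.smult_l_distr M.smult_assoc1\<close>)
  have "\<one> \<notin> ?A" using y by simp
  then have "?A \<noteq> carrier R" by blast
  then obtain P where P: "maximalideal P R" "?A \<subseteq> P" using maximal_ideal_ex[OF A] by blast
  obtain \<pi> where "unif_prime R P \<pi>" using unif_ex[OF P(1)] by blast
  then interpret U: unif_prime R P \<pi> .
  obtain x l where x: "x \<in> carrier M" "l \<ge> 1" "\<forall>r\<in>carrier R. r \<odot>\<^bsub>M\<^esub> x = \<zero>\<^bsub>M\<^esub> \<longleftrightarrow> r \<in> U.D l"
    "\<forall>k. U.tors M k \<subseteq> U.tors M l"
    by (rule U.torsion_element[OF M y(2) _ y(1,4,3)]) (use P(2) in auto)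
  let ?X = "{y. \<exists>r\<in>carrier R. y = r \<odot>\<^bsub>M\<^esub> x}"
  obtain N where N: "submodule N R M" "N \<inter> ?X \<subseteq> {\<zero>\<^bsub>M\<^esub>}" "\<forall>y\<in>carrier M. \<exists>n\<in>N. \<exists>k\<in>?X. y = n \<oplus>\<^bsub>M\<^esub> k"
    using U.torsion_complement[OF M x] .
  let ?N = "M\<lparr>carrier := N\<rparr>" and ?C = "M\<lparr>carrier := ?X\<rparr>" and ?Q = "quotient_module R (U.D l)"
  have X: "submodule ?X R M" by (rule M.cyclic_submodule[OF x(1)])
  have Nm: "module R ?N" by (rule submodule.submodule_is_module[OF N(1) M(1)])
  have Cm: "module R ?C" by (rule submodule.submodule_is_module[OF X M(1)])
  have Qm: "module R ?Q" by (rule quotient_module[OF U.D_ideal])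
  have 1: "module_iso R M (module_sum2 ?N ?C)"
    by (rule internal_direct_sum[OF M(1) N(1) X N(2)]) (use N(3) in blast)
  have 2: "module_iso R ?C ?Q" by (rule cyclic_module_iso[OF U.D_ideal M(1) x(1)]) (use x(3) in blast)
  have 3: "module_iso R M (module_sum2 ?N ?Q)"
    by (rule module_iso_trans[OF 1 module_sum2_cong[OF module_iso_refl[OF Nm] 2 Nm Cm] M(1) module_sum2[OF Nm Cm]])
  have NQ: "module R (module_sum2 ?N ?Q)" by (rule module_sum2[OF Nm Qm])
  obtain f g where f: "f \<in> module_hom R M (module_sum2 ?N ?Q)" "g \<in> module_hom R (module_sum2 ?N ?Q) M"
    "\<forall>x\<in>carrier M. g (f x) = x" "\<forall>y\<in>carrier (module_sum2 ?N ?Q). f (g y) = y"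
    using module_isoE[OF 3 M(1)] .
  have fst: "(\<lambda>z\<in>carrier (module_sum2 ?N ?Q). fst z) \<in> module_hom R (module_sum2 ?N ?Q) ?N"
    by (rule module_homI[OF _ _ _ NQ]) auto
  let ?p = "\<lambda>y\<in>carrier M. (\<lambda>z\<in>carrier (module_sum2 ?N ?Q). fst z) (f y)"
  have p: "?p \<in> module_hom R M ?N" by (rule module_hom_comp_closed[OF M(1) f(1) fst])
  have 0: "U.D l +> \<zero> \<in> carrier ?Q" "U.D l +> \<one> \<in> carrier ?Q" by (auto simp: quotient_module_carrier)
  have ps: "?p ` carrier M = carrier ?N"
  proof
    show "?p ` carrier M \<subseteq> carrier ?N" using module_hom_closed[OF p] by blast
    show "carrier ?N \<subseteq> ?p ` carrier M"
    proof
      fix v assume "v \<in> carrier ?N"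
      then have v: "(v, U.D l +> \<zero>) \<in> carrier (module_sum2 ?N ?Q)" using 0 by simp
      have "?p (g (v, U.D l +> \<zero>)) = v" using v f(4) module_hom_closed[OF f(2) v] by simp
      then show "v \<in> ?p ` carrier M" using module_hom_closed[OF f(2) v] by (metis (no_types, lifting) image_eqI)
    qed
  qed
  have v: "(\<zero>\<^bsub>?N\<^esub>, U.D l +> \<one>) \<in> carrier (module_sum2 ?N ?Q)" using 0 submodule_zero[OF N(1)] by simp
  \<comment> \<open>The preimage of the generator 1 of the cyclic summand.\<close>
  define w where "w = g (\<zero>\<^bsub>?N\<^esub>, U.D l +> \<one>)"
  have wc: "w \<in> carrier M" unfolding w_def by (rule module_hom_closed[OF f(2) v])
  have fw: "f w = (\<zero>\<^bsub>?N\<^esub>, U.D l +> \<one>)" unfolding w_def using f(4) v by blast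
  have pw: "?p w = \<zero>\<^bsub>?N\<^esub>" using wc fw v by simp
  have w0: "w \<noteq> \<zero>\<^bsub>M\<^esub>"
  proof
    assume "w = \<zero>\<^bsub>M\<^esub>"
    then have "f w = \<zero>\<^bsub>module_sum2 ?N ?Q\<^esub>" using module_hom_zero[OF f(1) M(1) NQ] by simp
    then have "U.D l +> \<one> = U.D l +> \<zero>" using fw quotient_module_simps(3)[OF U.D_ideal] by simp
    then have "\<one> \<ominus> \<zero> \<in> U.D l" using quotient_module_simps(4)[OF U.D_ideal, of \<one> \<zero>] by simp
    then have "\<one> \<in> U.D l" by (simp add: a_minus_def)
    \<comment> \<open>Here l >= 1 matters: 1 cannot lie in \<open>D 1\<close>, because that would
      make an element outside \<open>P\<close> a multiple of \<pi>.\<close>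
    then have "\<one> \<in> U.D 1" using U.D_mono[OF x(2)] by blast
    then obtain s c where s: "s \<in> U.S" "c \<in> carrier R" "s \<otimes> \<one> = c \<otimes> \<pi> [^] (1::nat)" unfolding U.D_def by blast
    then have "s = c \<otimes> \<pi>" by simp
    then show False using U.P.I_l_closed[OF U.unif_mem s(2)] s(1) by simp
  qed
  have "U.D l = P [^]\<^bsub>ideals_set R\<^esub> l" using U.Pw_eq_D U.Pw_def by simp
  then show ?thesis using that[OF Nm p ps wc w0 pw P(1) x(2)] 3 by simp
qed

end

section \<open>The structure theorem\<close>

lemma module_sum_cong:
  assumes "\<And>i. i \<in> I \<Longrightarrow> D i = D' i"
  shows "module_sum I D = module_sum I D'"
proof -
  have "{x \<in> \<Pi>\<^sub>E i\<in>I. carrier (D i). finite {i \<in> I. x i \<noteq> \<zero>\<^bsub>D i\<^esub>}} =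
    {x \<in> \<Pi>\<^sub>E i\<in>I. carrier (D' i). finite {i \<in> I. x i \<noteq> \<zero>\<^bsub>D' i\<^esub>}}"
    using assms by (auto simp: PiE_iff cong: conj_cong)
  then show ?thesis unfolding module_sum_def using assms by (auto intro!: ext restrict_ext cong: restrict_cong)
qed

definition module_sum_inj :: "'i set \<Rightarrow> ('i \<Rightarrow> ('a, 'm) module) \<Rightarrow> 'i \<Rightarrow> 'm \<Rightarrow> 'i \<Rightarrow> 'm" where
  "module_sum_inj I D k y = (\<lambda>i\<in>I. if i = k then y else \<zero>\<^bsub>D i\<^esub>)"

context cring
begin

context
  fixes I :: "'i set" and D :: "'i \<Rightarrow> ('a, 'm) module"
  assumes D: "\<And>i. i \<in> I \<Longrightarrow> module R (D i)"
begin

lemma module_sum_zero_closed: "i \<in> I \<Longrightarrow> \<zero>\<^bsub>D i\<^esub> \<in> carrier (D i)"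
proof -
  assume "i \<in> I"
  then interpret M: module R "D i" by (rule D)
  show "\<zero>\<^bsub>D i\<^esub> \<in> carrier (D i)" by simp
qed

lemma module_sum_proj_hom:
  assumes i: "i \<in> I"
  shows "(\<lambda>x\<in>carrier (module_sum I D). x i) \<in> module_hom R (module_sum I D) (D i)"
  by (rule module_homI[OF _ _ _ module_sum[OF cring_axioms D]]) (use i in \<open>auto simp: PiE_iff\<close>)

lemma module_sum_inj_closed:
  assumes k: "k \<in> I" and y: "y \<in> carrier (D k)"
  shows "module_sum_inj I D k y \<in> carrier (module_sum I D)"
proof -
  have "{i \<in> I. module_sum_inj I D k y i \<noteq> \<zero>\<^bsub>D i\<^esub>} \<subseteq> {k}" by (auto simp: module_sum_inj_def)
  then have "finite {i \<in> I. module_sum_inj I D k y i \<noteq> \<zero>\<^bsub>D i\<^esub>}" using finite_subset by blast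
  then show ?thesis using y module_sum_zero_closed by (auto simp: module_sum_inj_def)
qed


lemma module_sum_inj_smult:
  assumes k: "k \<in> I" and y: "r \<in> carrier R" "y \<in> carrier (D k)"
  shows "module_sum_inj I D k (r \<odot>\<^bsub>D k\<^esub> y) = r \<odot>\<^bsub>module_sum I D\<^esub> module_sum_inj I D k y"
proof
  fix i
  show "module_sum_inj I D k (r \<odot>\<^bsub>D k\<^esub> y) i = (r \<odot>\<^bsub>module_sum I D\<^esub> module_sum_inj I D k y) i"
  proof (cases "i \<in> I")
    case True
    then interpret M: module R "D i" by (rule D)
    show ?thesis using True y by (simp add: module_sum_inj_def)
  qed (simp add: module_sum_inj_def)
qed

lemma module_sum_inj_zero: "module_sum_inj I D k \<zero>\<^bsub>D k\<^esub> = \<zero>\<^bsub>module_sum I D\<^esub>"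
  by (auto simp: module_sum_inj_def)

lemma module_sum_span:
  assumes fin: "finite I" and H: "submodule H R (module_sum I D)" and x: "x \<in> carrier (module_sum I D)"
    and xH: "\<And>i. i \<in> I \<Longrightarrow> module_sum_inj I D i (x i) \<in> H"
  shows "x \<in> H"
proof -
  interpret M: module R "module_sum I D" by (rule module_sum[OF cring_axioms D])
  have "(\<lambda>i\<in>I. if i \<in> F then x i else \<zero>\<^bsub>D i\<^esub>) \<in> H" if "finite F" "F \<subseteq> I" for F
    using that
  proof (induction F rule: finite_induct)
    case empty
    then show ?case using submodule_zero[OF H] by (simp add: restrict_def)
  next
    case (insert k F)
    have "(\<lambda>i\<in>I. if i \<in> F then x i else \<zero>\<^bsub>D i\<^esub>) \<oplus>\<^bsub>module_sum I D\<^esub> module_sum_inj I D k (x k) =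
      (\<lambda>i\<in>I. if i \<in> insert k F then x i else \<zero>\<^bsub>D i\<^esub>)"
    proof
      fix i
      show "((\<lambda>i\<in>I. if i \<in> F then x i else \<zero>\<^bsub>D i\<^esub>) \<oplus>\<^bsub>module_sum I D\<^esub> module_sum_inj I D k (x k)) i =
        (\<lambda>i\<in>I. if i \<in> insert k F then x i else \<zero>\<^bsub>D i\<^esub>) i"
      proof (cases "i \<in> I")
        case True
        then interpret N: module R "D i" by (rule D)
        have xi: "x i \<in> carrier (D i)" using x True by auto
        show ?thesis using True insert(2) N.l_zero[OF xi] N.r_zero[OF xi] by (auto simp: module_sum_inj_def PiE_iff)
      qed simp
    qed
    moreover have "(\<lambda>i\<in>I. if i \<in> F then x i else \<zero>\<^bsub>D i\<^esub>) \<oplus>\<^bsub>module_sum I D\<^esub> module_sum_inj I D k (x k) \<in> H"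
      by (rule M.submoduleE(5)[OF H insert.IH xH]) (use insert.prems in auto)
    ultimately show ?case by (rule back_subst[of "\<lambda>x. x \<in> H", rotated])
  qed
  from this[OF fin] have "(\<lambda>i\<in>I. if i \<in> I then x i else \<zero>\<^bsub>D i\<^esub>) \<in> H" by simp
  moreover have "(\<lambda>i\<in>I. if i \<in> I then x i else \<zero>\<^bsub>D i\<^esub>) = x"
    using x by (intro ext) (auto simp: PiE_iff extensional_def)
  ultimately show ?thesis by metis
qed

end

end

text \<open>Steinitz exchange: on elements annihilated by \<open>P\<close> the span behaves as over the field
  \<open>R / P\<close>.\<close>

lemma (in unif_prime) span_exchange:
  assumes M: "module R M" and x: "x \<in> carrier M" "Xs \<subseteq> carrier M" and kill: "\<And>r. r \<in> P \<Longrightarrow> r \<odot>\<^bsub>M\<^esub> x = \<zero>\<^bsub>M\<^esub>"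
    and y: "y \<in> rmod.spn R M (insert x Xs)" "y \<notin> rmod.spn R M Xs"
  shows "x \<in> rmod.spn R M (insert y Xs)"
proof -
  interpret M: rmod R M by (rule rmod.intro) fact
  obtain r z where r: "r \<in> carrier R" "z \<in> M.spn Xs" "y = r \<odot>\<^bsub>M\<^esub> x \<oplus>\<^bsub>M\<^esub> z" using M.spn_insert[OF x y(1)] by blast
  have zc: "z \<in> carrier M" using M.submoduleE(1)[OF M.spn_submodule[OF x(2)]] r(2) by blast
  have "r \<notin> P"
  proof
    assume "r \<in> P"
    then have "y = z" using r(3) kill zc by simp
    then show False using r(2) y(2) by simp
  qed
  then obtain t q where t: "t \<in> carrier R" "q \<in> P" "\<one> = t \<otimes> r \<oplus> q" using maximal_cancel[of r] r(1) by blast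
  have yc: "y \<in> carrier M" using r x zc by simp
  have S: "submodule (M.spn (insert y Xs)) R M" by (rule M.spn_submodule) (use yc x in auto)
  have "z \<in> M.spn (insert y Xs)"
    using M.spn_least[OF S, of Xs] M.spn_incl[of "insert y Xs"] r(2) by blast
  moreover have "y \<in> M.spn (insert y Xs)" using M.spn_incl[of "insert y Xs"] by blast
  ultimately have "y \<ominus>\<^bsub>M\<^esub> z \<in> M.spn (insert y Xs)" using M.submodule_minus[OF S] by blast
  moreover have "y \<ominus>\<^bsub>M\<^esub> z = r \<odot>\<^bsub>M\<^esub> x" using r(1,3) x(1) zc by (simp add: a_minus_def M.a_assoc M.r_neg)
  ultimately have "t \<odot>\<^bsub>M\<^esub> (r \<odot>\<^bsub>M\<^esub> x) \<in> M.spn (insert y Xs)" using M.submoduleE(4)[OF S t(1)] by simp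
  moreover have "x = t \<odot>\<^bsub>M\<^esub> (r \<odot>\<^bsub>M\<^esub> x)"
  proof -
    have "x = \<one> \<odot>\<^bsub>M\<^esub> x" using x by simp
    also have "\<dots> = t \<odot>\<^bsub>M\<^esub> (r \<odot>\<^bsub>M\<^esub> x) \<oplus>\<^bsub>M\<^esub> q \<odot>\<^bsub>M\<^esub> x"
      unfolding t(3) using t(1) r(1) x(1) P.Icarr[OF t(2)] by (simp add: M.smult_l_distr M.smult_assoc1)
    finally show ?thesis using kill[OF t(2)] t(1) r(1) x(1) by simp
  qed
  ultimately show ?thesis by simp
qed

text \<open>As long as \<open>E\<close> is not contained in \<open>G\<close>, one of its vectors
  outside \<open>G\<close> is exchanged for a vector of \<open>G\<close> that is not in the span of
  the rest. Size and independence survive, and the part of \<open>E\<close> outside \<open>G\<close>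
  shrinks.\<close>

lemma (in unif_prime) independent_card_le:
  assumes M: "module R M" and G: "finite G" "G \<subseteq> carrier M" "\<And>x r. x \<in> G \<Longrightarrow> r \<in> P \<Longrightarrow> r \<odot>\<^bsub>M\<^esub> x = \<zero>\<^bsub>M\<^esub>"
    and E: "finite E" "E \<subseteq> carrier M" "\<forall>x\<in>E. \<forall>r\<in>P. r \<odot>\<^bsub>M\<^esub> x = \<zero>\<^bsub>M\<^esub>"
    and ind: "\<forall>e\<in>E. e \<notin> rmod.spn R M (E - {e})" and EG: "E \<subseteq> rmod.spn R M G"
  shows "card E \<le> card G"
  using E ind EG
proof (induction "card (E - G)" arbitrary: E rule: less_induct)
  case less
  interpret M: rmod R M by (rule rmod.intro) fact
  show ?case
  proof (cases "E \<subseteq> G")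
    case True
    then show ?thesis using card_mono[OF G(1)] by blast
  next
    case False
    then obtain e where e: "e \<in> E" "e \<notin> G" by blast
    let ?F = "E - {e}"
    have Fc: "?F \<subseteq> carrier M" using less.prems(2) by blast
    have SF: "submodule (M.spn ?F) R M" by (rule M.spn_submodule[OF Fc])
    have "\<not> G \<subseteq> M.spn ?F"
    proof
      assume "G \<subseteq> M.spn ?F"
      then have "M.spn G \<subseteq> M.spn ?F" by (rule M.spn_least[OF SF])
      then show False using e(1) less.prems(4,5) by blast
    qed
    then obtain g where g: "g \<in> G" "g \<notin> M.spn ?F" by blast
    have gF: "g \<notin> ?F" using g(2) M.spn_incl[of ?F] by blast
    let ?E = "insert g ?F"
    have gc: "g \<in> carrier M" using g(1) G(2) by blast
    have "\<forall>f\<in>?E. f \<notin> M.spn (?E - {f})"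
    proof
      fix f assume f: "f \<in> ?E"
      show "f \<notin> M.spn (?E - {f})"
      proof (cases "f = g")
        case True
        then show ?thesis using g(2) gF by simp
      next
        case False
        then have fF: "f \<in> ?F" using f by blast
        have eq: "?E - {f} = insert g (?F - {f})" using False by blast
        show ?thesis
        proof
          assume "f \<in> M.spn (?E - {f})"
          then have 1: "f \<in> M.spn (insert g (?F - {f}))" unfolding eq .
          have SE: "submodule (M.spn (E - {f})) R M" by (rule M.spn_submodule) (use less.prems(2) in blast)
          have "M.spn (?F - {f}) \<subseteq> M.spn (E - {f})"
            by (rule M.spn_least[OF SE]) (use M.spn_incl[of "E - {f}"] in blast)
          then have 2: "f \<notin> M.spn (?F - {f})" using less.prems(4) fF by blast
          \<comment> \<open>If \<open>f\<close> became dependent through \<open>g\<close>, exchange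
            would put \<open>g\<close> into the span of the old vectors, against its choice.\<close>
          have "g \<in> M.spn (insert f (?F - {f}))"
            by (rule span_exchange[OF M gc _ _ 1 2]) (use Fc G(3)[OF g(1)] in auto)
          moreover have "insert f (?F - {f}) = ?F" using fF by blast
          ultimately show False using g(2) by simp
        qed
      qed
    qed
    moreover have "?E \<subseteq> M.spn G" using less.prems(5) M.spn_incl[of G] g(1) by blast
    moreover have "card (?E - G) < card (E - G)"
      by (rule psubset_card_mono) (use less.prems(1) e g(1) in auto)
    moreover have "\<forall>x\<in>?E. \<forall>r\<in>P. r \<odot>\<^bsub>M\<^esub> x = \<zero>\<^bsub>M\<^esub>" using less.prems(3) G(3)[OF g(1)] by blast
    ultimately have "card ?E \<le> card G" using less.hyps[of ?E] less.prems(1) gc Fc by simp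
    moreover have "card ?E = card E"
      using gF less.prems(1) e(1) by (simp add: card_Suc_Diff1 del: card_Diff_insert)
    ultimately show ?thesis by simp
  qed
qed

section \<open>Existence of the decomposition and uniqueness of its projective part\<close>

context dedekind
begin

lemma unif_primeE:
  assumes "p \<in> mSpec R"
  obtains \<pi> where "unif_prime R p \<pi>"
  using assms unif_ex by (auto simp: mSpec_def)

definition fin_supp :: "('a set \<Rightarrow> nat \<Rightarrow> nat) \<Rightarrow> bool" where
  "fin_supp m \<longleftrightarrow> finite {(p, l) \<in> torsion_index R. m p l \<noteq> 0}"

text \<open>A triple (p, l, i) names the i-th copy of R/p^l. Values of \<open>m\<close> outside
  \<open>torsion_index R\<close> are invisible here, so different \<open>m\<close> may give the same
  module.\<close>

definition tix :: "('a set \<Rightarrow> nat \<Rightarrow> nat) \<Rightarrow> ('a set \<times> nat \<times> nat) set" where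
  "tix m = {(p, l, i). (p, l) \<in> torsion_index R \<and> i < m p l}"

definition cyc :: "'a set \<times> nat \<times> nat \<Rightarrow> ('a, 'a set) module" where
  "cyc = (\<lambda>(p, l, i). quotient_module R (p [^]\<^bsub>ideals_set R\<^esub> l))"

definition tsum :: "('a set \<Rightarrow> nat \<Rightarrow> nat) \<Rightarrow> ('a, 'a set \<times> nat \<times> nat \<Rightarrow> 'a set) module" where
  "tsum m = module_sum (tix m) cyc"

lemma decomposes_iff: "decomposes R M P m \<longleftrightarrow> projective RM P \<and> fin_supp m \<and> module_iso R M (module_sum2 P (tsum m))"
  unfolding decomposes_def fin_supp_def tsum_def tix_def cyc_def additive_category.Obj_Proj[OF Rmod_additive] by simp

lemma finite_tix:
  assumes "fin_supp m"
  shows "finite (tix m)"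
proof -
  have "tix m \<subseteq> (\<lambda>((p, l), i). (p, l, i)) ` (SIGMA pl:{(p, l) \<in> torsion_index R. m p l \<noteq> 0}. {..<m (fst pl) (snd pl)})"
    unfolding tix_def by force
  then show ?thesis using finite_subset assms unfolding fin_supp_def by blast
qed

lemma cyc_module:
  assumes "k \<in> tix m"
  shows "module R (cyc k)" "fin_gen R (cyc k)"
proof -
  obtain p l i where k: "k = (p, l, i)" "p \<in> mSpec R" using assms by (auto simp: tix_def torsion_index_def)
  obtain \<pi> where "unif_prime R p \<pi>" using unif_primeE[OF k(2)] .
  then have "ideal (p [^]\<^bsub>ideals_set R\<^esub> l) R"
    using unif_prime.Pw_ideal[of R p \<pi> l] unif_prime.Pw_def[of R p \<pi> l] by simp
  then show "module R (cyc k)" "fin_gen R (cyc k)"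
    unfolding cyc_def k by (simp_all add: quotient_module quotient_module_fin_gen)
qed

lemma tsum_module: "module R (tsum m)"
  unfolding tsum_def by (rule module_sum[OF cring_axioms cyc_module(1)])

abbreviation "tinj m \<equiv> module_sum_inj (tix m) cyc"

lemma tinj_closed: "k \<in> tix m \<Longrightarrow> y \<in> carrier (cyc k) \<Longrightarrow> tinj m k y \<in> carrier (tsum m)"
  unfolding tsum_def by (rule module_sum_inj_closed[OF cyc_module(1)[of _ m]])

lemma tinj_smult:
  "k \<in> tix m \<Longrightarrow> r \<in> carrier R \<Longrightarrow> y \<in> carrier (cyc k) \<Longrightarrow> tinj m k (r \<odot>\<^bsub>cyc k\<^esub> y) = r \<odot>\<^bsub>tsum m\<^esub> tinj m k y"
  unfolding tsum_def by (rule module_sum_inj_smult[OF cyc_module(1)[of _ m]])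

lemma tinj_zero: "tinj m k \<zero>\<^bsub>cyc k\<^esub> = \<zero>\<^bsub>tsum m\<^esub>"
  unfolding tsum_def by (rule module_sum_inj_zero[OF cyc_module(1)[of _ m]])

lemma tsum_span:
  assumes "fin_supp m" "submodule H R (tsum m)" "x \<in> carrier (tsum m)" "\<And>i. i \<in> tix m \<Longrightarrow> tinj m i (x i) \<in> H"
  shows "x \<in> H"
  using assms module_sum_span[where I = "tix m" and D = cyc, OF cyc_module(1)[of _ m] finite_tix] unfolding tsum_def by blast

lemma tsum_fin_gen: "fin_supp m \<Longrightarrow> fin_gen R (tsum m)"
  unfolding tsum_def by (rule fin_gen_sum[OF cring_axioms finite_tix cyc_module]) assumption+

lemma tsum_add:
  assumes m: "fin_supp m" "fin_supp m'"
  shows "fin_supp (\<lambda>p l. m p l + m' p l)"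
    "module_iso R (tsum (\<lambda>p l. m p l + m' p l)) (module_sum2 (tsum m) (tsum m'))"
proof -
  have "{(p, l) \<in> torsion_index R. m p l + m' p l \<noteq> 0} \<subseteq>
    {(p, l) \<in> torsion_index R. m p l \<noteq> 0} \<union> {(p, l) \<in> torsion_index R. m' p l \<noteq> 0}" by auto
  then show "fin_supp (\<lambda>p l. m p l + m' p l)" using m finite_subset unfolding fin_supp_def by blast
  \<comment> \<open>The copies of the second family are numbered after the \<open>m p l\<close>
    copies of the first.\<close>
  let ?b = "\<lambda>(p, l, i). (p, l, m p l + i)"
  let ?J = "tix (\<lambda>p l. m p l + m' p l)"
  have J: "?J = id ` tix m \<union> ?b ` tix m'"
  proof
    show "?J \<subseteq> id ` tix m \<union> ?b ` tix m'"
    proof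
      fix k assume "k \<in> ?J"
      then obtain p l i where k: "k = (p, l, i)" "(p, l) \<in> torsion_index R" "i < m p l + m' p l" by (auto simp: tix_def)
      show "k \<in> id ` tix m \<union> ?b ` tix m'"
      proof (cases "i < m p l")
        case False
        then have "(p, l, i - m p l) \<in> tix m'" "k = ?b (p, l, i - m p l)" using k by (auto simp: tix_def)
        then show ?thesis by blast
      qed (use k in \<open>auto simp: tix_def\<close>)
    qed
  qed (auto simp: tix_def)
  have "module_iso R (module_sum ?J cyc) (module_sum2 (module_sum (tix m) (\<lambda>i. cyc (id i))) (module_sum (tix m') (\<lambda>i. cyc (?b i))))"
    by (rule module_sum_disjoint[OF cring_axioms finite_tix[OF m(1)] finite_tix[OF m(2)] _ _ _ J cyc_module(1)])
      (auto simp: inj_on_def tix_def)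
  moreover have "(\<lambda>i. cyc (id i)) = cyc" "(\<lambda>i. cyc (?b i)) = cyc" by (auto simp: cyc_def)
  ultimately show "module_iso R (tsum (\<lambda>p l. m p l + m' p l)) (module_sum2 (tsum m) (tsum m'))"
    unfolding tsum_def by simp
qed

lemma tsum_zero: "fin_supp (\<lambda>p l. 0)" "carrier (tsum (\<lambda>p l. 0)) = {\<zero>\<^bsub>tsum (\<lambda>p l. 0)\<^esub>}"
  by (auto simp: fin_supp_def tsum_def tix_def PiE_iff extensional_def)

lemma tsum_single:
  fixes l :: nat
  assumes p: "p \<in> mSpec R" and l: "l \<ge> 1"
  defines "m \<equiv> \<lambda>p' l'. if p' = p \<and> l' = l then 1 else (0::nat)"
  shows "fin_supp m" "module_iso R (tsum m) (quotient_module R (p [^]\<^bsub>ideals_set R\<^esub> l))"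
proof -
  have "{(p, l) \<in> torsion_index R. m p l \<noteq> 0} \<subseteq> {(p, l)}" by (auto simp: m_def split: if_splits)
  then show "fin_supp m" unfolding fin_supp_def using finite_subset by blast
  have t: "tix m = {(p, l, 0)}" using p l by (auto simp: tix_def m_def torsion_index_def split: if_splits)
  have "module_sum {(p, l, 0)} cyc = module_sum {(p, l, 0)} (\<lambda>_. cyc (p, l, 0))" by (rule module_sum_cong) simp
  moreover have "module_iso R (module_sum {(p, l, 0)} (\<lambda>_. cyc (p, l, 0))) (cyc (p, l, 0))"
    by (rule module_sum_singleton[OF cyc_module(1)[of _ m]]) (simp add: t)
  ultimately show "module_iso R (tsum m) (quotient_module R (p [^]\<^bsub>ideals_set R\<^esub> l))"
    unfolding tsum_def t by (simp add: cyc_def)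
qed

lemma torsion_free_iso:
  assumes tf: "torsion_free R M" and M: "module R M" and N: "module R N" and iso: "module_iso R M N"
  shows "torsion_free R N"
proof -
  obtain f g where f: "f \<in> module_hom R M N" "g \<in> module_hom R N M"
    "\<forall>x\<in>carrier M. g (f x) = x" "\<forall>y\<in>carrier N. f (g y) = y"
    using module_isoE[OF iso M] .
  show ?thesis
    unfolding torsion_free_def
  proof (intro ballI impI)
    fix r y assume ry: "r \<in> carrier R" "y \<in> carrier N" "r \<odot>\<^bsub>N\<^esub> y = \<zero>\<^bsub>N\<^esub>"
    have gy: "g y \<in> carrier M" by (rule module_hom_closed[OF f(2) ry(2)])
    have "r \<odot>\<^bsub>M\<^esub> g y = \<zero>\<^bsub>M\<^esub>"
      using module_hom_smult[OF f(2) ry(1,2)] ry(3) module_hom_zero[OF f(2) N M] by simp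
    then have "r = \<zero> \<or> g y = \<zero>\<^bsub>M\<^esub>" using tf ry(1) gy unfolding torsion_free_def by blast
    moreover have "y = \<zero>\<^bsub>N\<^esub>" if "g y = \<zero>\<^bsub>M\<^esub>" using f(4) ry(2) that module_hom_zero[OF f(1) M N] by force
    ultimately show "r = \<zero> \<or> y = \<zero>\<^bsub>N\<^esub>" by blast
  qed
qed

text \<open>\<open>decomposes\<close> for modules on an arbitrary carrier type, so that the
  induction need not return to the fixed universe at each quotient.\<close>

definition splits :: "('a, 'm) module \<Rightarrow> bool" where
  "splits M \<longleftrightarrow> (\<exists>P m. projective RM P \<and> fin_supp m \<and> module_iso R M (module_sum2 P (tsum m)))"

lemma projective_module: "projective RM P \<Longrightarrow> module R P"
  using Rmod_module by (simp add: projective_def)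

lemma splits_torsion_free:
  assumes M: "module R M" "fin_gen R M" and tf: "torsion_free R M"
  shows "splits M"
proof -
  obtain P where P: "P \<in> Obj RM" "module_iso R M P" using transport_Rmod[OF M] .
  have Pm: "module R P" by (rule Rmod_module[OF P(1)])
  have "projective RM P" by (rule torsion_free_projective[OF P(1) torsion_free_iso[OF tf M(1) Pm P(2)]])
  moreover have "module_iso R P (module_sum2 P (tsum (\<lambda>p l. 0)))"
    by (rule module_sum2_zero[OF Pm tsum_module tsum_zero(2)])
  ultimately show ?thesis
    unfolding splits_def using module_iso_trans[OF P(2) _ M(1) Pm] tsum_zero(1) by blast
qed

lemma splits_add_cyclic:
  fixes l :: nat
  assumes M: "module R M" and N: "module R N" "splits N" and p: "p \<in> mSpec R" "l \<ge> 1"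
    and iso: "module_iso R M (module_sum2 N (quotient_module R (p [^]\<^bsub>ideals_set R\<^esub> l)))"
  shows "splits M"
proof -
  obtain P m where P: "projective RM P" and m: "fin_supp m" and N': "module_iso R N (module_sum2 P (tsum m))"
    using N(2) unfolding splits_def by blast
  let ?Q = "quotient_module R (p [^]\<^bsub>ideals_set R\<^esub> l)"
  let ?d = "\<lambda>(p' :: 'a set) (l' :: nat). if p' = p \<and> l' = l then 1 else (0::nat)"
  let ?m = "\<lambda>p l. m p l + ?d p l"
  note d = tsum_single[OF p]
  have Pm: "module R P" by (rule projective_module[OF P])
  have Qm: "module R ?Q"
    using cyc_module(1)[of "(p, l, 0)" ?d] p by (simp add: cyc_def tix_def torsion_index_def)
  note t = tsum_module[of m] tsum_module[of ?d]
  have 1: "module_iso R (module_sum2 N ?Q) (module_sum2 (module_sum2 P (tsum m)) (tsum ?d))"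
    by (rule module_sum2_cong[OF N' module_iso_sym[OF d(2) t(2)] N(1) Qm])
  have 2: "module_iso R (module_sum2 (module_sum2 P (tsum m)) (tsum ?d)) (module_sum2 P (module_sum2 (tsum m) (tsum ?d)))"
    by (rule module_sum2_assoc[OF Pm t])
  have 3: "module_iso R (module_sum2 P (module_sum2 (tsum m) (tsum ?d))) (module_sum2 P (tsum ?m))"
    by (rule module_sum2_cong[OF module_iso_refl[OF Pm] module_iso_sym[OF tsum_add(2)[OF m d(1)] tsum_module] Pm module_sum2[OF t]])
  have "module_iso R M (module_sum2 P (tsum ?m))"
    by (rule module_iso_trans[OF module_iso_trans[OF module_iso_trans[OF iso 1] 2] 3])
      (use M N(1) Qm Pm t in \<open>simp_all add: module_sum2\<close>)
  then show ?thesis unfolding splits_def using P tsum_add(1)[OF m d(1)] by blast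
qed

text \<open>Noetherian induction over the kernels of the epimorphisms onto a quotient that does not
  split.\<close>

lemma splits_fin_gen:
  fixes M :: "('a, 'm) module"
  assumes M: "module R M" "fin_gen R M"
  shows "splits M"
proof (rule ccontr)
  assume "\<not> splits M"
  interpret M: rmod R M by (rule rmod.intro) (rule M)
  \<comment> \<open>The quotients \<open>Q\<close> range over one type, that of \<open>M\<close>.
    This is enough since each further summand \<open>N\<close> split off stays on it.\<close>
  define bad where "bad K \<longleftrightarrow> (\<exists>(Q :: ('a, 'm) module) q. module R Q \<and> q \<in> module_hom R M Q \<and> q ` carrier M = carrier Q \<and>
    K = {x \<in> carrier M. q x = \<zero>\<^bsub>Q\<^esub>} \<and> \<not> splits Q)" for K
  have "bad {x \<in> carrier M. (\<lambda>x\<in>carrier M. x) x = \<zero>\<^bsub>M\<^esub>}"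
    unfolding bad_def using M(1) module_hom_id[OF M(1)] \<open>\<not> splits M\<close>
    by (intro exI[of _ M] exI[of _ "\<lambda>x\<in>carrier M. x"]) auto
  then have ne: "{x \<in> carrier M. (\<lambda>x\<in>carrier M. x) x = \<zero>\<^bsub>M\<^esub>} \<in> Collect bad" by simp
  obtain K where K: "K \<in> Collect bad" and max: "\<And>K'. K' \<in> Collect bad \<Longrightarrow> K \<subseteq> K' \<Longrightarrow> K' = K"
    by (rule submodule_maximal[OF M ne]) (use kernel_submodule[OF M(1)] in \<open>auto simp: bad_def\<close>)
  then obtain Q :: "('a, 'm) module" and q where Q: "module R Q" "q \<in> module_hom R M Q" "q ` carrier M = carrier Q"
    "K = {x \<in> carrier M. q x = \<zero>\<^bsub>Q\<^esub>}" "\<not> splits Q" unfolding bad_def by blast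
  have Qf: "fin_gen R Q" by (rule fin_gen_image[OF M(1) Q(1-3) M(2)])
  then have ntf: "\<not> torsion_free R Q" using splits_torsion_free[OF Q(1)] Q(5) by blast
  obtain N :: "('a, 'm) module" and p x P l where N: "module R N" "p \<in> module_hom R Q N" "p ` carrier Q = carrier N"
    "x \<in> carrier Q" "x \<noteq> \<zero>\<^bsub>Q\<^esub>" "p x = \<zero>\<^bsub>N\<^esub>" "maximalideal P R" "l \<ge> (1::nat)"
    "module_iso R Q (module_sum2 N (quotient_module R (P [^]\<^bsub>ideals_set R\<^esub> l)))"
    using torsion_summand[OF Q(1) Qf ntf] .
  have nN: "\<not> splits N" using splits_add_cyclic[OF Q(1) N(1) _ _ N(8,9)] N(7) Q(5) by (auto simp: mSpec_def)
  let ?pq = "\<lambda>x\<in>carrier M. p (q x)"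
  have "bad {x \<in> carrier M. ?pq x = \<zero>\<^bsub>N\<^esub>}"
    unfolding bad_def
  proof (intro exI conjI)
    show "?pq \<in> module_hom R M N" by (rule module_hom_comp_closed[OF M(1) Q(2) N(2)])
    show "?pq ` carrier M = carrier N" using N(3) unfolding Q(3)[symmetric] by (simp add: image_image)
  qed (use N nN in auto)
  moreover have "K \<subseteq> {x \<in> carrier M. ?pq x = \<zero>\<^bsub>N\<^esub>}" using Q(4) module_hom_zero[OF N(2) Q(1) N(1)] by auto
  ultimately have eq: "{x \<in> carrier M. ?pq x = \<zero>\<^bsub>N\<^esub>} = K" using max by blast
  \<comment> \<open>\<open>x\<close> is nonzero in \<open>Q\<close> but dies in \<open>N\<close>, so
    a preimage of it lies in the larger kernel and not in \<open>K\<close>.\<close>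
  obtain u where u: "u \<in> carrier M" "x = q u" using N(4) Q(3) by blast
  then have "u \<in> K" unfolding eq[symmetric] using N(6) by simp
  then show False using u N(5) Q(4) by simp
qed

lemma decomposes_ex:
  assumes "M \<in> Obj RM"
  obtains P m where "decomposes R M P m"
proof -
  have "splits M" using assms splits_fin_gen Obj_Rmod by blast
  then show ?thesis using that unfolding splits_def decomposes_iff by blast
qed

text \<open>Elements with a nonzero annihilator form a submodule because \<open>R\<close> is a
  domain; on each cyclic summand a power of the uniformizer annihilates.\<close>

lemma tsum_torsion:
  assumes m: "fin_supp m" and x: "x \<in> carrier (tsum m)"
  shows "\<exists>r\<in>carrier R. r \<noteq> \<zero> \<and> r \<odot>\<^bsub>tsum m\<^esub> x = \<zero>\<^bsub>tsum m\<^esub>"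
proof -
  interpret T: rmod R "tsum m" by (rule rmod.intro) (rule tsum_module)
  let ?H = "{x \<in> carrier (tsum m). \<exists>r\<in>carrier R. r \<noteq> \<zero> \<and> r \<odot>\<^bsub>tsum m\<^esub> x = \<zero>\<^bsub>tsum m\<^esub>}"
  have H: "submodule ?H R (tsum m)"
  proof (rule T.submoduleI')
    show "\<zero>\<^bsub>tsum m\<^esub> \<in> ?H" using one_not_zero by (auto intro!: bexI[of _ \<one>])
  next
    fix x y assume "x \<in> ?H" "y \<in> ?H"
    then obtain r t where rt: "x \<in> carrier (tsum m)" "y \<in> carrier (tsum m)" "r \<in> carrier R" "t \<in> carrier R" "r \<noteq> \<zero>" "t \<noteq> \<zero>"
      "r \<odot>\<^bsub>tsum m\<^esub> x = \<zero>\<^bsub>tsum m\<^esub>" "t \<odot>\<^bsub>tsum m\<^esub> y = \<zero>\<^bsub>tsum m\<^esub>" by blast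
    have "(r \<otimes> t) \<odot>\<^bsub>tsum m\<^esub> (x \<oplus>\<^bsub>tsum m\<^esub> y) = (t \<otimes> r) \<odot>\<^bsub>tsum m\<^esub> x \<oplus>\<^bsub>tsum m\<^esub> (r \<otimes> t) \<odot>\<^bsub>tsum m\<^esub> y"
      using rt(1-4) by (simp add: T.smult_r_distr m_comm)
    also have "\<dots> = \<zero>\<^bsub>tsum m\<^esub>" using rt by (simp add: T.smult_assoc1)
    finally show "x \<oplus>\<^bsub>tsum m\<^esub> y \<in> ?H" using rt integral[of r t] by (intro CollectI conjI bexI[of _ "r \<otimes> t"]) auto
  next
    fix a x assume a: "a \<in> carrier R" and "x \<in> ?H"
    then obtain r where r: "x \<in> carrier (tsum m)" "r \<in> carrier R" "r \<noteq> \<zero>" "r \<odot>\<^bsub>tsum m\<^esub> x = \<zero>\<^bsub>tsum m\<^esub>" by blast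
    have "r \<odot>\<^bsub>tsum m\<^esub> (a \<odot>\<^bsub>tsum m\<^esub> x) = a \<odot>\<^bsub>tsum m\<^esub> (r \<odot>\<^bsub>tsum m\<^esub> x)"
      using r(1,2) a by (simp add: m_comm flip: T.smult_assoc1)
    then show "a \<odot>\<^bsub>tsum m\<^esub> x \<in> ?H" using r a by auto
  qed auto
  have "x \<in> ?H"
  proof (rule tsum_span[OF m H x])
    fix k assume k: "k \<in> tix m"
    then obtain p l i where pl: "k = (p, l, i)" "p \<in> mSpec R" by (auto simp: tix_def torsion_index_def)
    obtain \<pi> where "unif_prime R p \<pi>" using unif_primeE[OF pl(2)] .
    then interpret U: unif_prime R p \<pi> .
    have ck: "cyc k = quotient_module R (U.D l)" unfolding cyc_def pl(1) U.Pw_eq_D[symmetric] U.Pw_def by simp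
    have xk: "x k \<in> carrier (cyc k)" using x k by (auto simp: tsum_def PiE_iff)
    then obtain a where a: "a \<in> carrier R" "x k = U.D l +> a" unfolding ck quotient_module_carrier by blast
    have "\<pi> [^] l \<odot>\<^bsub>cyc k\<^esub> x k = U.D l +> (\<pi> [^] l \<otimes> a)"
      unfolding ck a(2) by (rule quotient_module_simps(2)[OF U.D_ideal]) (use a(1) in auto)
    also have "\<dots> = U.D l +> \<zero>"
      unfolding quotient_module_simps(4)[OF U.D_ideal m_closed[OF U.pow_closed a(1)] zero_closed]
      using ideal.I_r_closed[OF U.D_ideal U.pow_D a(1)] a(1) by (simp add: a_minus_def)
    also have "\<dots> = \<zero>\<^bsub>cyc k\<^esub>" unfolding ck quotient_module_simps(3)[OF U.D_ideal] ..
    finally have z: "\<pi> [^] l \<odot>\<^bsub>cyc k\<^esub> x k = \<zero>\<^bsub>cyc k\<^esub>" .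
    have "\<pi> [^] l \<odot>\<^bsub>tsum m\<^esub> tinj m k (x k) = \<zero>\<^bsub>tsum m\<^esub>"
      using tinj_smult[OF k U.pow_closed xk, of l] tinj_zero unfolding z by simp
    moreover have "tinj m k (x k) \<in> carrier (tsum m)" by (rule tinj_closed[OF k xk])
    ultimately show "tinj m k (x k) \<in> ?H" using U.pow_nonzero U.pow_closed by blast
  qed
  then show ?thesis by blast
qed

text \<open>The torsion component of f (x, 0) goes under \<open>g\<close> to a torsion element,
  whose projective component vanishes. Dropping torsion components before applying \<open>g\<close>
  therefore loses nothing, and the projective components of \<open>f\<close> and \<open>g\<close>
  are mutually inverse.\<close>

lemma splitting_projective_iso:
  assumes P: "projective RM P" "projective RM P'" and m: "fin_supp m" "fin_supp m'"
    and f: "f \<in> module_hom R (module_sum2 P (tsum m)) (module_sum2 P' (tsum m'))"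
    and g: "g \<in> module_hom R (module_sum2 P' (tsum m')) (module_sum2 P (tsum m))"
    and gf: "\<forall>x\<in>carrier (module_sum2 P (tsum m)). g (f x) = x"
    and fg: "\<forall>y\<in>carrier (module_sum2 P' (tsum m')). f (g y) = y"
  shows "\<exists>h\<in>module_hom R P P'. \<exists>h'\<in>module_hom R P' P. (\<forall>x\<in>carrier P. h' (h x) = x) \<and> (\<forall>y\<in>carrier P'. h (h' y) = y)"
proof -
  have res: "\<exists>h\<in>module_hom R P P'. \<forall>x\<in>carrier P. h x = fst (f (x, \<zero>\<^bsub>tsum m\<^esub>))"
    if P: "projective RM P" "projective RM P'" and f: "f \<in> module_hom R (module_sum2 P (tsum m)) (module_sum2 P' (tsum m'))"
    for P P' f m m'
  proof -
    note M = projective_module[OF P(1)] projective_module[OF P(2)]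
    interpret T: rmod R "tsum m" by (rule rmod.intro) (rule tsum_module)
    interpret P: module R P by (rule M)
    have i: "(\<lambda>x\<in>carrier P. (x, \<zero>\<^bsub>tsum m\<^esub>)) \<in> module_hom R P (module_sum2 P (tsum m))"
      by (rule module_homI[OF _ _ _ M(1)]) auto
    have s: "(\<lambda>x\<in>carrier (module_sum2 P' (tsum m')). fst x) \<in> module_hom R (module_sum2 P' (tsum m')) P'"
      by (rule module_homI[OF _ _ _ module_sum2[OF M(2) tsum_module]]) auto
    note h = module_hom_comp_closed[OF M(1) module_hom_comp_closed[OF M(1) i f] s]
    show ?thesis
    proof (rule bexI[OF _ h], intro ballI)
      fix x assume x: "x \<in> carrier P"
      have "f (x, \<zero>\<^bsub>tsum m\<^esub>) \<in> carrier (module_sum2 P' (tsum m'))" by (rule module_hom_closed[OF f]) (use x in simp)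
      then show "(\<lambda>x\<in>carrier P. (\<lambda>x\<in>carrier (module_sum2 P' (tsum m')). fst x) ((\<lambda>x\<in>carrier P. f ((\<lambda>x\<in>carrier P. (x, \<zero>\<^bsub>tsum m\<^esub>)) x)) x)) x =
        fst (f (x, \<zero>\<^bsub>tsum m\<^esub>))" using x by simp
    qed
  qed
  have inv: "fst (g (fst (f (x, \<zero>\<^bsub>tsum m\<^esub>)), \<zero>\<^bsub>tsum m'\<^esub>)) = x"
    if P: "projective RM P" "projective RM P'" and m': "fin_supp m'"
      and f: "f \<in> module_hom R (module_sum2 P (tsum m)) (module_sum2 P' (tsum m'))"
      and g: "g \<in> module_hom R (module_sum2 P' (tsum m')) (module_sum2 P (tsum m))"
      and gf: "\<forall>x\<in>carrier (module_sum2 P (tsum m)). g (f x) = x" and x: "x \<in> carrier P"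
    for P P' f g m m' x
  proof -
    note M = projective_module[OF P(1)] projective_module[OF P(2)]
    interpret T: rmod R "tsum m" by (rule rmod.intro) (rule tsum_module)
    interpret T': rmod R "tsum m'" by (rule rmod.intro) (rule tsum_module)
    interpret P: module R P by (rule M)
    interpret P': module R P' by (rule M)
    interpret A: module R "module_sum2 P (tsum m)" by (rule module_sum2[OF M(1) tsum_module])
    have xc: "(x, \<zero>\<^bsub>tsum m\<^esub>) \<in> carrier (module_sum2 P (tsum m))" using x by simp
    obtain y t where yt: "f (x, \<zero>\<^bsub>tsum m\<^esub>) = (y, t)" by (cases "f (x, \<zero>\<^bsub>tsum m\<^esub>)")
    have c: "y \<in> carrier P'" "t \<in> carrier (tsum m')" using module_hom_closed[OF f xc] yt by simp_all
    obtain r where r: "r \<in> carrier R" "r \<noteq> \<zero>" "r \<odot>\<^bsub>tsum m'\<^esub> t = \<zero>\<^bsub>tsum m'\<^esub>" using tsum_torsion[OF m' c(2)] by blast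
    have yc: "(y, \<zero>\<^bsub>tsum m'\<^esub>) \<in> carrier (module_sum2 P' (tsum m'))"
      and tc: "(\<zero>\<^bsub>P'\<^esub>, t) \<in> carrier (module_sum2 P' (tsum m'))" using c by simp_all
    obtain a b where ab: "g (\<zero>\<^bsub>P'\<^esub>, t) = (a, b)" by (cases "g (\<zero>\<^bsub>P'\<^esub>, t)")
    have abc: "a \<in> carrier P" "b \<in> carrier (tsum m)" using module_hom_closed[OF g tc] ab by simp_all
    have "r \<odot>\<^bsub>module_sum2 P (tsum m)\<^esub> (a, b) = g (r \<odot>\<^bsub>module_sum2 P' (tsum m')\<^esub> (\<zero>\<^bsub>P'\<^esub>, t))"
      using module_hom_smult[OF g r(1) tc] ab by simp
    also have "\<dots> = g \<zero>\<^bsub>module_sum2 P' (tsum m')\<^esub>" using r by simp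
    also have "\<dots> = \<zero>\<^bsub>module_sum2 P (tsum m)\<^esub>"
      by (rule module_hom_zero[OF g module_sum2[OF M(2) tsum_module] A.module_axioms])
    finally have "r \<odot>\<^bsub>P\<^esub> a = \<zero>\<^bsub>P\<^esub>" by simp
    then have a0: "a = \<zero>\<^bsub>P\<^esub>" using projective_torsion_free[OF P(1)] r(1,2) abc(1) unfolding torsion_free_def by blast
    have "(x, \<zero>\<^bsub>tsum m\<^esub>) = g (y, t)" using gf xc yt by force
    also have "\<dots> = g ((y, \<zero>\<^bsub>tsum m'\<^esub>) \<oplus>\<^bsub>module_sum2 P' (tsum m')\<^esub> (\<zero>\<^bsub>P'\<^esub>, t))" using c by simp
    also have "\<dots> = g (y, \<zero>\<^bsub>tsum m'\<^esub>) \<oplus>\<^bsub>module_sum2 P (tsum m)\<^esub> (a, b)"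
      using module_hom_add[OF g yc tc] ab by simp
    finally have "x = fst (g (y, \<zero>\<^bsub>tsum m'\<^esub>)) \<oplus>\<^bsub>P\<^esub> a" by (cases "g (y, \<zero>\<^bsub>tsum m'\<^esub>)") simp
    moreover have "fst (g (y, \<zero>\<^bsub>tsum m'\<^esub>)) \<in> carrier P"
      using module_hom_closed[OF g yc] by (cases "g (y, \<zero>\<^bsub>tsum m'\<^esub>)") simp
    ultimately show ?thesis using a0 yt by simp
  qed
  obtain h where h: "h \<in> module_hom R P P'" "\<forall>x\<in>carrier P. h x = fst (f (x, \<zero>\<^bsub>tsum m\<^esub>))"
    using res[OF P f] by blast
  obtain h' where h': "h' \<in> module_hom R P' P" "\<forall>x\<in>carrier P'. h' x = fst (g (x, \<zero>\<^bsub>tsum m'\<^esub>))"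
    using res[OF P(2,1) g] by blast
  have "h' (h x) = x" if "x \<in> carrier P" for x
    using inv[OF P m(2) f g gf that] h'(2) module_hom_closed[OF h(1) that] h(2) that by simp
  moreover have "h (h' y) = y" if "y \<in> carrier P'" for y
    using inv[OF P(2,1) m(1) g f fg that] h(2) module_hom_closed[OF h'(1) that] h'(2) that by simp
  ultimately show ?thesis using h(1) h'(1) by blast
qed

end

section \<open>Uniqueness of the multiplicities\<close>

context unif_prime
begin

lemma kill_power_quotient:
  assumes x: "x \<in> carrier (quotient_module R (D j))" and jk: "j \<le> k"
  shows "\<pi> [^] k \<odot>\<^bsub>quotient_module R (D j)\<^esub> x = \<zero>\<^bsub>quotient_module R (D j)\<^esub>"
proof -
  obtain a where a: "a \<in> carrier R" "x = D j +> a" using x unfolding quotient_module_carrier by blast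
  have "\<pi> [^] k \<otimes> a \<in> D j" using ideal.I_r_closed[OF D_ideal _ a(1)] pow_D D_mono[OF jk] by blast
  then have "\<pi> [^] k \<otimes> a \<ominus> \<zero> \<in> D j" using a(1) by (simp add: a_minus_def)
  then have "D j +> (\<pi> [^] k \<otimes> a) = D j +> \<zero>"
    using quotient_module_simps(4)[OF D_ideal, of "\<pi> [^] k \<otimes> a" \<zero>] a(1) by simp
  then show ?thesis
    unfolding a(2) quotient_module_simps(2)[OF D_ideal pow_closed a(1)] quotient_module_simps(3)[OF D_ideal] .
qed

text \<open>The elements of R/P^j killed by the uniformizer form a one-dimensional space over R/P,
  so each summand contributes exactly one to the dimensions counted below.\<close>

lemma socle_quotient:
  assumes x: "x \<in> carrier (quotient_module R (D j))" and j: "j \<ge> 1"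
    and px: "\<pi> \<odot>\<^bsub>quotient_module R (D j)\<^esub> x = \<zero>\<^bsub>quotient_module R (D j)\<^esub>"
  shows "\<exists>a\<in>carrier R. x = a \<odot>\<^bsub>quotient_module R (D j)\<^esub> (D j +> \<pi> [^] (j - 1))"
proof -
  obtain b where b: "b \<in> carrier R" "x = D j +> b" using x unfolding quotient_module_carrier by blast
  have "D j +> (\<pi> \<otimes> b) = D j +> \<zero>"
    using px unfolding b(2) quotient_module_simps(2)[OF D_ideal unif_carrier b(1)] quotient_module_simps(3)[OF D_ideal] .
  then have "\<pi> \<otimes> b \<ominus> \<zero> \<in> D j" using quotient_module_simps(4)[OF D_ideal, of "\<pi> \<otimes> b" \<zero>] b(1) by simp
  then have "\<pi> \<otimes> b \<in> D j" using b(1) by (simp add: a_minus_def)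
  then obtain s c where s: "s \<in> S" "c \<in> carrier R" "s \<otimes> (\<pi> \<otimes> b) = c \<otimes> \<pi> [^] j" unfolding D_def by blast
  have "\<pi> \<otimes> (s \<otimes> b) = \<pi> \<otimes> (c \<otimes> \<pi> [^] (j - 1))"
    using s b(1) j by (cases j) (simp_all add: m_ac)
  then have sb: "s \<otimes> b = c \<otimes> \<pi> [^] (j - 1)" using m_lcancel[OF unif_nonzero] s(1,2) b(1) by simp
  obtain t q where t: "t \<in> carrier R" "q \<in> P" "\<one> = t \<otimes> s \<oplus> q" using maximal_cancel[OF s(1)] .
  have qc: "q \<in> carrier R" using P.Icarr[OF t(2)] .
  have sc: "s \<in> carrier R" using s(1) by simp
  \<comment> \<open>Cancelling \<pi> has put \<open>b\<close> into \<open>D (j - 1)\<close>. The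
    error term q b then gains one more power from \<open>q\<close> and disappears modulo
    \<open>D j\<close>.\<close>
  have "b \<in> D (j - 1)" unfolding D_def using b(1) s(1,2) sb by blast
  moreover have "q \<in> D 1" using P_sub_D1 t(2) by blast
  ultimately have "q \<otimes> b \<in> D j" using D_mult[of q 1 b "j - 1"] j by simp
  moreover have "b \<ominus> (t \<otimes> c) \<otimes> \<pi> [^] (j - 1) = q \<otimes> b"
  proof -
    have "b = \<one> \<otimes> b" using b(1) by simp
    also have "\<dots> = t \<otimes> (s \<otimes> b) \<oplus> q \<otimes> b" unfolding t(3) using t(1) sc qc b(1) by (simp add: l_distr m_assoc)
    also have "\<dots> = (t \<otimes> c) \<otimes> \<pi> [^] (j - 1) \<oplus> q \<otimes> b" unfolding sb using t(1) s(2) by (simp add: m_assoc)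
    finally have "b = (t \<otimes> c) \<otimes> \<pi> [^] (j - 1) \<oplus> q \<otimes> b" .
    then show ?thesis using add_diff_cancel[of "(t \<otimes> c) \<otimes> \<pi> [^] (j - 1)" "q \<otimes> b"] t(1) s(2) qc b(1) by simp
  qed
  ultimately have "x = D j +> ((t \<otimes> c) \<otimes> \<pi> [^] (j - 1))"
    unfolding b(2) using quotient_module_simps(4)[OF D_ideal b(1), of "(t \<otimes> c) \<otimes> \<pi> [^] (j - 1)"] t(1) s(2) by simp
  then show ?thesis
    using quotient_module_simps(2)[OF D_ideal, of "t \<otimes> c" "\<pi> [^] (j - 1)" j] t(1) s(2) by (intro bexI[of _ "t \<otimes> c"]) simp_all
qed

lemma socle_generator:
  assumes j: "j \<ge> 1"
  shows "D j +> \<pi> [^] (j - 1) \<noteq> \<zero>\<^bsub>quotient_module R (D j)\<^esub>"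
    and "r \<in> P \<Longrightarrow> r \<odot>\<^bsub>quotient_module R (D j)\<^esub> (D j +> \<pi> [^] (j - 1)) = \<zero>\<^bsub>quotient_module R (D j)\<^esub>"
proof -
  have D: "D j +> a = \<zero>\<^bsub>quotient_module R (D j)\<^esub> \<longleftrightarrow> a \<in> D j" if "a \<in> carrier R" for a
    unfolding quotient_module_simps(3)[OF D_ideal] quotient_module_simps(4)[OF D_ideal that zero_closed]
    using that by (simp add: a_minus_def)
  have "\<pi> [^] (j - 1) \<notin> D j"
  proof
    assume "\<pi> [^] (j - 1) \<in> D j"
    then obtain s c where s: "s \<in> S" "c \<in> carrier R" "s \<otimes> \<pi> [^] (j - 1) = c \<otimes> \<pi> [^] j" unfolding D_def by blast
    have "s \<otimes> \<pi> [^] (j - 1) = (c \<otimes> \<pi>) \<otimes> \<pi> [^] (j - 1)" using s j by (cases j) (simp_all add: m_ac)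
    then have "s = c \<otimes> \<pi>" using m_rcancel[OF pow_nonzero] s(1,2) by simp
    then show False using P.I_l_closed[OF unif_mem s(2)] s(1) by simp
  qed
  then show "D j +> \<pi> [^] (j - 1) \<noteq> \<zero>\<^bsub>quotient_module R (D j)\<^esub>" using D by simp
  assume r: "r \<in> P"
  then have rc: "r \<in> carrier R" by (rule P.Icarr)
  have "r \<otimes> \<pi> [^] (j - 1) \<in> D j" using D_mult[of r 1 "\<pi> [^] (j - 1)" "j - 1"] P_sub_D1 r pow_D j by auto
  then show "r \<odot>\<^bsub>quotient_module R (D j)\<^esub> (D j +> \<pi> [^] (j - 1)) = \<zero>\<^bsub>quotient_module R (D j)\<^esub>"
    using quotient_module_simps(2)[OF D_ideal rc, of "\<pi> [^] (j - 1)"] D rc by simp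
qed

end

context dedekind
begin

text \<open>Distinct maximal ideals stay comaximal after raising one to a power: some s^j in q^j is
  outside \<open>p\<close>, so 1 is a sum of two scalars that kill \<open>x\<close>.\<close>

lemma socle_other:
  fixes M :: "('a, 'm) module"
  assumes q: "maximalideal q R" and p: "maximalideal p R" and pq: "q \<noteq> p" and M: "module R M"
    and x: "x \<in> carrier M" and kq: "\<And>r. r \<in> q [^]\<^bsub>ideals_set R\<^esub> (j::nat) \<Longrightarrow> r \<odot>\<^bsub>M\<^esub> x = \<zero>\<^bsub>M\<^esub>"
    and kp: "\<And>r. r \<in> p \<Longrightarrow> r \<odot>\<^bsub>M\<^esub> x = \<zero>\<^bsub>M\<^esub>"
  shows "x = \<zero>\<^bsub>M\<^esub>"
proof -
  obtain \<pi> where "unif_prime R p \<pi>" using unif_ex[OF p] by blast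
  then interpret U: unif_prime R p \<pi> .
  obtain \<rho> where "unif_prime R q \<rho>" using unif_ex[OF q] by blast
  then interpret V: unif_prime R q \<rho> .
  interpret M: rmod R M by (rule rmod.intro) fact
  have "\<not> q \<subseteq> p"
  proof
    assume "q \<subseteq> p"
    moreover have "p \<subseteq> carrier R" using U.P.Icarr by blast
    ultimately have "p = q \<or> p = carrier R" using V.P.I_maximal[OF U.P.ideal_axioms] by blast
    then show False using pq U.P.I_notcarr by blast
  qed
  then obtain s where s: "s \<in> q" "s \<notin> p" by blast
  have sc: "s \<in> carrier R" using V.P.Icarr[OF s(1)] .
  have "s [^] j \<in> V.Pw j \<inter> U.S"
  proof (induction j)
    case (Suc j)
    then show ?case using s sc U.S_mult[of "s [^] j" s] by (auto simp: V.Pw_Suc intro: ideal_prod.prod)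
  qed (simp add: V.Pw_0)
  then have sj: "s [^] j \<in> q [^]\<^bsub>ideals_set R\<^esub> j" "s [^] j \<in> U.S" by (simp_all add: V.Pw_def)
  obtain t r where t: "t \<in> carrier R" "r \<in> p" "\<one> = t \<otimes> s [^] j \<oplus> r" using U.maximal_cancel[OF sj(2)] .
  have "x = \<one> \<odot>\<^bsub>M\<^esub> x" using x by simp
  also have "\<dots> = t \<odot>\<^bsub>M\<^esub> (s [^] j \<odot>\<^bsub>M\<^esub> x) \<oplus>\<^bsub>M\<^esub> r \<odot>\<^bsub>M\<^esub> x"
    unfolding t(3) using t(1) sc x U.P.Icarr[OF t(2)] by (simp add: M.smult_l_distr M.smult_assoc1)
  also have "\<dots> = \<zero>\<^bsub>M\<^esub>" using kq[OF sj(1)] kp[OF t(2)] t(1) by simp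
  finally show ?thesis .
qed

text \<open>The summands R/p^j with j >= l. Their number is the dimension over R/p of the elements
  of p^(l-1) M that \<open>p\<close> annihilates.\<close>

definition tall :: "('a set \<Rightarrow> nat \<Rightarrow> nat) \<Rightarrow> 'a set \<Rightarrow> nat \<Rightarrow> ('a set \<times> nat \<times> nat) set" where
  "tall m p l = {k \<in> tix m. fst k = p \<and> l \<le> fst (snd k)}"

text \<open>A split embedding \<open>f\<close> carries the socle vectors of the tall summands to
  independent vectors. These are again divisible by \<pi>^(l-1) and killed by \<open>p\<close>, so
  they lie in the span of the socle vectors on the other side, and counting gives the
  inequality.\<close>

lemma tall_card_le:
  assumes P: "projective RM P" "projective RM P'" and m: "fin_supp m" "fin_supp m'"
    and f: "f \<in> module_hom R (module_sum2 P (tsum m)) (module_sum2 P' (tsum m'))"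
    and g: "g \<in> module_hom R (module_sum2 P' (tsum m')) (module_sum2 P (tsum m))"
    and gf: "\<forall>x\<in>carrier (module_sum2 P (tsum m)). g (f x) = x"
    and p: "p \<in> mSpec R" and l: "l \<ge> 1"
  shows "card (tall m p l) \<le> card (tall m' p l)"
proof -
  obtain \<pi> where "unif_prime R p \<pi>" using unif_primeE[OF p] .
  then interpret U: unif_prime R p \<pi> .
  note Pm = projective_module[OF P(1)] projective_module[OF P(2)]
  let ?Y = "module_sum2 P (tsum m)" and ?Y' = "module_sum2 P' (tsum m')"
  have Y: "module R ?Y" and Y': "module R ?Y'" by (rule module_sum2[OF Pm(1) tsum_module] module_sum2[OF Pm(2) tsum_module])+
  interpret Y: rmod R ?Y by (rule rmod.intro) (rule Y)
  interpret Y': rmod R ?Y' by (rule rmod.intro) (rule Y')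
  interpret P: module R P by (rule Pm)
  interpret P': module R P' by (rule Pm)
  \<comment> \<open>The class of \<pi>^(j-1), which spans the socle of the summand R/p^j.\<close>
  define u where "u k = U.D (fst (snd k)) +> \<pi> [^] (fst (snd k) - 1)" for k :: "'a set \<times> nat \<times> nat"
  define e where "e n k = tinj n k (u k)" for n k
  have tl: "k \<in> tix n" "cyc k = quotient_module R (U.D (fst (snd k)))" "1 \<le> fst (snd k)" "l \<le> fst (snd k)"
    if "k \<in> tall n p l" for n k
    using that l unfolding U.Pw_eq_D[symmetric] U.Pw_def cyc_def tall_def by (auto split: prod.split)
  have uc: "u k \<in> carrier (cyc k)" and u0: "u k \<noteq> \<zero>\<^bsub>cyc k\<^esub>" if "k \<in> tall n p l" for n k
    unfolding tl(2)[OF that] u_def using U.socle_generator(1)[OF tl(3)[OF that]]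
    by (auto simp: quotient_module_carrier)
  have up: "r \<odot>\<^bsub>cyc k\<^esub> u k = \<zero>\<^bsub>cyc k\<^esub>" if "k \<in> tall n p l" "r \<in> p" for n k r
    unfolding tl(2)[OF that(1)] u_def by (rule U.socle_generator(2)[OF tl(3)[OF that(1)] that(2)])
  have ec: "e n k \<in> carrier (tsum n)" if k: "k \<in> tall n p l" for n k
    unfolding e_def by (rule tinj_closed[OF tl(1)[OF k] uc[OF k]])
  have ep: "r \<odot>\<^bsub>tsum n\<^esub> e n k = \<zero>\<^bsub>tsum n\<^esub>" if k: "k \<in> tall n p l" and r: "r \<in> p" for n k r
    unfolding e_def using tinj_smult[OF tl(1)[OF k] U.P.Icarr[OF r] uc[OF k]] tinj_zero up[OF k r] by simp
  have ek: "e n k k' = (if k' = k then u k else \<zero>\<^bsub>cyc k'\<^esub>)" if "k' \<in> tix n" for n k k'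
    using that by (simp add: e_def module_sum_inj_def)
  let ?i = "\<lambda>k. (\<zero>\<^bsub>P\<^esub>, e m k)" and ?i' = "\<lambda>k. (\<zero>\<^bsub>P'\<^esub>, e m' k)"
  have ic: "?i k \<in> carrier ?Y" if "k \<in> tall m p l" for k using ec[OF that] by simp
  have ic': "?i' k \<in> carrier ?Y'" if "k \<in> tall m' p l" for k using ec[OF that] by simp
  have gfi: "g (f (?i k)) = ?i k" if "k \<in> tall m p l" for k using gf ic[OF that] by blast
  have fc: "f (?i k) \<in> carrier ?Y'" if "k \<in> tall m p l" for k by (rule module_hom_closed[OF f ic[OF that]])
  have rip: "r \<odot>\<^bsub>?Y\<^esub> ?i k = \<zero>\<^bsub>?Y\<^esub>" if "k \<in> tall m p l" "r \<in> p" for k r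
    using ep[OF that] U.P.Icarr[OF that(2)] by simp
  have rfp: "r \<odot>\<^bsub>?Y'\<^esub> f (?i k) = \<zero>\<^bsub>?Y'\<^esub>" if "k \<in> tall m p l" "r \<in> p" for k r
    using module_hom_smult[OF f U.P.Icarr[OF that(2)] ic[OF that(1)]] rip[OF that] module_hom_zero[OF f Y Y'] by simp
  let ?E = "(\<lambda>k. f (?i k)) ` tall m p l" and ?G = "?i' ` tall m' p l"
  have fin: "finite (tall n p l)" if "fin_supp n" for n using finite_tix[OF that] by (simp add: tall_def)
  have Gc: "?G \<subseteq> carrier ?Y'" using ic' by blast
  have inj: "inj_on (\<lambda>k. f (?i k)) (tall m p l)"
  proof (rule inj_onI)
    fix k k' assume k: "k \<in> tall m p l" "k' \<in> tall m p l" and eq: "f (?i k) = f (?i k')"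
    have "e m k = e m k'" using gfi[OF k(1)] gfi[OF k(2)] unfolding eq by simp
    then have "e m k k = e m k' k" by simp
    then show "k = k'" using ek[OF tl(1)[OF k(1)]] u0[OF k(1)] by (auto split: if_splits)
  qed
  \<comment> \<open>Applying \<open>g\<close> and reading the k-th coordinate separates the vectors:
    it vanishes on every other image and not on this one.\<close>
  have ind: "f (?i k) \<notin> Y'.spn (?E - {f (?i k)})" if k: "k \<in> tall m p l" for k
  proof -
    let ?h1 = "\<lambda>x\<in>carrier ?Y. (\<lambda>x\<in>carrier (tsum m). x k) ((\<lambda>x\<in>carrier ?Y. snd x) x)"
    have s: "(\<lambda>x\<in>carrier ?Y. snd x) \<in> module_hom R ?Y (tsum m)" by (rule module_homI[OF _ _ _ Y]) auto
    have pr: "(\<lambda>x\<in>carrier (tsum m). x k) \<in> module_hom R (tsum m) (cyc k)"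
      unfolding tsum_def by (rule module_sum_proj_hom[where I = "tix m" and D = cyc, OF cyc_module(1)[of _ m] tl(1)[OF k]])
    let ?h = "\<lambda>y\<in>carrier ?Y'. ?h1 (g y)"
    have h: "?h \<in> module_hom R ?Y' (cyc k)"
      by (rule module_hom_comp_closed[OF Y' g module_hom_comp_closed[OF Y s pr]])
    let ?H = "{y \<in> carrier ?Y'. ?h y = \<zero>\<^bsub>cyc k\<^esub>}"
    have H: "submodule ?H R ?Y'" by (rule kernel_submodule[OF Y' cyc_module(1)[OF tl(1)[OF k]] h])
    have hv: "?h (f (?i k')) = e m k' k" if "k' \<in> tall m p l" for k'
      using fc[OF that] gfi[OF that] ic[OF that] ec[OF that] by simp
    have "?E - {f (?i k)} \<subseteq> ?H"
    proof
      fix y assume "y \<in> ?E - {f (?i k)}"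
      then obtain k' where k': "k' \<in> tall m p l" "y = f (?i k')" "k' \<noteq> k" by blast
      have "?h y = \<zero>\<^bsub>cyc k\<^esub>" unfolding k'(2) hv[OF k'(1)] using ek[OF tl(1)[OF k], of k'] k'(3) by simp
      then show "y \<in> ?H" using fc[OF k'(1)] k'(2) by blast
    qed
    then have "Y'.spn (?E - {f (?i k)}) \<subseteq> ?H" by (rule Y'.spn_least[OF H])
    moreover have "f (?i k) \<notin> ?H" using hv[OF k] ek[OF tl(1)[OF k], of k] u0[OF k] by simp
    ultimately show ?thesis by blast
  qed
  have sub: "f (?i k) \<in> Y'.spn ?G" if k: "k \<in> tall m p l" for k
  proof -
    obtain a v where av: "f (?i k) = (a, v)" by (cases "f (?i k)")
    have avc: "a \<in> carrier P'" "v \<in> carrier (tsum m')" using fc[OF k] unfolding av by simp_all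
    have kav: "r \<odot>\<^bsub>P'\<^esub> a = \<zero>\<^bsub>P'\<^esub>" "r \<odot>\<^bsub>tsum m'\<^esub> v = \<zero>\<^bsub>tsum m'\<^esub>" if "r \<in> p" for r
      using rfp[OF k that] unfolding av by simp_all
    have a0: "a = \<zero>\<^bsub>P'\<^esub>"
      using projective_torsion_free[OF P(2)] kav(1)[OF U.unif_mem] U.unif_nonzero U.unif_carrier avc(1)
      unfolding torsion_free_def by blast
    have vk: "r \<odot>\<^bsub>cyc i\<^esub> v i = \<zero>\<^bsub>cyc i\<^esub>" if "r \<in> p" "i \<in> tix m'" for r i
      using fun_cong[OF kav(2)[OF that(1)], of i] that(2) by (simp add: tsum_def)
    have vc: "v i \<in> carrier (cyc i)" if "i \<in> tix m'" for i using avc(2) that by (auto simp: tsum_def PiE_iff)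
    \<comment> \<open>For j >= l the socle vector is \<pi>^(l-1) times the class of \<pi>^(j-l). Its
      image under \<open>f\<close> inherits this divisibility, which is what excludes short
      summands.\<close>
    define w where "w = tinj m k (U.D (fst (snd k)) +> \<pi> [^] (fst (snd k) - l))"
    have wq: "U.D (fst (snd k)) +> \<pi> [^] (fst (snd k) - l) \<in> carrier (cyc k)"
      unfolding tl(2)[OF k] by (simp add: quotient_module_carrier)
    have wc: "w \<in> carrier (tsum m)" unfolding w_def by (rule tinj_closed[OF tl(1)[OF k] wq])
    have "u k = \<pi> [^] (l - 1) \<odot>\<^bsub>cyc k\<^esub> (U.D (fst (snd k)) +> \<pi> [^] (fst (snd k) - l))"
      unfolding tl(2)[OF k] u_def quotient_module_simps(2)[OF U.D_ideal U.pow_closed U.pow_closed] nat_pow_mult[OF U.unif_carrier]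
      using tl(4)[OF k] l by simp
    then have "e m k = \<pi> [^] (l - 1) \<odot>\<^bsub>tsum m\<^esub> w"
      unfolding e_def w_def using tinj_smult[OF tl(1)[OF k] U.pow_closed wq] by simp
    then have "?i k = \<pi> [^] (l - 1) \<odot>\<^bsub>?Y\<^esub> (\<zero>\<^bsub>P\<^esub>, w)" by simp
    then have fi: "f (?i k) = \<pi> [^] (l - 1) \<odot>\<^bsub>?Y'\<^esub> f (\<zero>\<^bsub>P\<^esub>, w)"
      using module_hom_smult[OF f U.pow_closed, of "(\<zero>\<^bsub>P\<^esub>, w)"] wc by simp
    obtain b v' where bv: "f (\<zero>\<^bsub>P\<^esub>, w) = (b, v')" by (cases "f (\<zero>\<^bsub>P\<^esub>, w)")
    have v'c: "v' \<in> carrier (tsum m')" using module_hom_closed[OF f, of "(\<zero>\<^bsub>P\<^esub>, w)"] wc unfolding bv by simp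
    have v': "v = \<pi> [^] (l - 1) \<odot>\<^bsub>tsum m'\<^esub> v'" using fi unfolding av bv by simp
    have v'i: "v i = \<pi> [^] (l - 1) \<odot>\<^bsub>cyc i\<^esub> v' i" "v' i \<in> carrier (cyc i)" if "i \<in> tix m'" for i
      using v'c that by (auto simp: v' tsum_def PiE_iff)
    have j: "(\<lambda>x\<in>carrier (tsum m'). (\<zero>\<^bsub>P'\<^esub>, x)) \<in> module_hom R (tsum m') ?Y'"
      by (rule module_homI[OF _ _ _ tsum_module]) auto
    let ?H = "{x \<in> carrier (tsum m'). (\<lambda>x\<in>carrier (tsum m'). (\<zero>\<^bsub>P'\<^esub>, x)) x \<in> Y'.spn ?G}"
    have H: "submodule ?H R (tsum m')" by (rule preimage_submodule[OF tsum_module Y' j Y'.spn_submodule[OF Gc]])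
    have eH: "e m' i \<in> ?H" if "i \<in> tall m' p l" for i
      using ec[OF that] Y'.spn_incl[of ?G] that by auto
    have "v \<in> ?H"
    proof (rule tsum_span[OF m(2) H avc(2)])
      fix i assume i: "i \<in> tix m'"
      obtain q jj n where qj: "i = (q, jj, n)" "q \<in> mSpec R" "jj \<ge> 1" using i by (auto simp: tix_def torsion_index_def)
      show "tinj m' i (v i) \<in> ?H"
      proof (cases "i \<in> tall m' p l")
        case True
        note t = tl[OF True]
        have "\<pi> \<odot>\<^bsub>cyc i\<^esub> v i = \<zero>\<^bsub>cyc i\<^esub>" by (rule vk[OF U.unif_mem i])
        then obtain c where c: "c \<in> carrier R" "v i = c \<odot>\<^bsub>cyc i\<^esub> u i"
          using U.socle_quotient[of "v i" "fst (snd i)"] vc[OF i] t(3) unfolding t(2) u_def by blast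
        have "tinj m' i (v i) = c \<odot>\<^bsub>tsum m'\<^esub> e m' i"
          unfolding e_def c(2) by (rule tinj_smult[OF i c(1) uc[OF True]])
        then show ?thesis using module.submoduleE(4)[OF tsum_module H c(1) eH[OF True]] by (simp only:)
      next
        case False
        \<comment> \<open>A short summand at \<open>p\<close> is annihilated by \<pi>^(l-1), and
          \<open>v i\<close> is a multiple of that power. At a different prime no nonzero element is
          killed by \<open>p\<close>.\<close>
        have "v i = \<zero>\<^bsub>cyc i\<^esub>"
        proof (cases "q = p")
          case True
          have ci: "cyc i = quotient_module R (U.D jj)" unfolding qj True cyc_def by (simp flip: U.Pw_eq_D U.Pw_def)
          have "jj < l" using False i qj True by (auto simp: tall_def)
          then show ?thesis
            using v'i[OF i] U.kill_power_quotient[of "v' i" jj "l - 1"] unfolding ci by simp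
        next
          case False
          obtain \<rho> where "unif_prime R q \<rho>" using unif_primeE[OF qj(2)] .
          then interpret V: unif_prime R q \<rho> .
          have ci: "cyc i = quotient_module R (q [^]\<^bsub>ideals_set R\<^esub> jj)" unfolding qj cyc_def by simp
          have I: "ideal (q [^]\<^bsub>ideals_set R\<^esub> jj) R" using V.Pw_ideal[of jj] unfolding V.Pw_def .
          obtain d where d: "d \<in> carrier R" "v i = (q [^]\<^bsub>ideals_set R\<^esub> jj) +> d"
            using vc[OF i] unfolding ci quotient_module_carrier by blast
          show ?thesis
          proof (rule socle_other[OF _ _ False cyc_module(1)[OF i] vc[OF i]])
            show "maximalideal q R" "maximalideal p R" using qj(2) p by (simp_all add: mSpec_def)
            fix r assume r: "r \<in> q [^]\<^bsub>ideals_set R\<^esub> jj"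
            have rc: "r \<in> carrier R" using ideal.Icarr[OF I r] .
            have "r \<otimes> d \<ominus> \<zero> \<in> q [^]\<^bsub>ideals_set R\<^esub> jj" using ideal.I_r_closed[OF I r d(1)] rc d(1) by (simp add: a_minus_def)
            then show "r \<odot>\<^bsub>cyc i\<^esub> v i = \<zero>\<^bsub>cyc i\<^esub>"
              unfolding ci d(2) quotient_module_simps(2)[OF I rc d(1)] quotient_module_simps(3)[OF I]
              using quotient_module_simps(4)[OF I, of "r \<otimes> d" \<zero>] rc d(1) by simp
          qed (rule vk[OF _ i])
        qed
        then show ?thesis using submodule_zero[OF H] tinj_zero by (simp only:)
      qed
    qed
    then show ?thesis unfolding av a0 using avc(2) by auto
  qed
  have "card (tall m p l) = card ?E" by (rule card_image[OF inj, symmetric])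
  also have "\<dots> \<le> card ?G"
  proof (rule U.independent_card_le[OF Y' _ Gc])
    show "finite ?E" "finite ?G" using fin m by blast+
    show "?E \<subseteq> carrier ?Y'" using fc by blast
    show "\<forall>x\<in>?E. \<forall>r\<in>p. r \<odot>\<^bsub>?Y'\<^esub> x = \<zero>\<^bsub>?Y'\<^esub>" using rfp by blast
    show "\<forall>e\<in>?E. e \<notin> Y'.spn (?E - {e})" using ind by blast
    show "?E \<subseteq> Y'.spn ?G" using sub by blast
    fix x r assume "x \<in> ?G" "r \<in> p"
    then show "r \<odot>\<^bsub>?Y'\<^esub> x = \<zero>\<^bsub>?Y'\<^esub>" using ep U.P.Icarr by auto
  qed
  also have "\<dots> \<le> card (tall m' p l)" by (rule card_image_le[OF fin[OF m(2)]])
  finally show ?thesis .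
qed

text \<open>Passing from l to l + 1 discards precisely the copies of R/p^l.\<close>

lemma card_tall_Suc:
  assumes m: "fin_supp m" and p: "p \<in> mSpec R" and l: "l \<ge> 1"
  shows "card (tall m p l) = card (tall m p (Suc l)) + m p l"
proof -
  have "tall m p l = tall m p (Suc l) \<union> (\<lambda>i. (p, l, i)) ` {..<m p l}"
    using p l by (auto simp: tall_def tix_def torsion_index_def image_iff Suc_le_eq nat_less_le[of l])
  moreover have "tall m p (Suc l) \<inter> (\<lambda>i. (p, l, i)) ` {..<m p l} = {}" by (auto simp: tall_def)
  moreover have "finite (tall m p (Suc l))" using finite_tix[OF m] by (simp add: tall_def)
  ultimately have "card (tall m p l) = card (tall m p (Suc l)) + card ((\<lambda>i. (p, l, i)) ` {..<m p l})"
    by (simp add: card_Un_disjoint)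
  then show ?thesis by (simp add: card_image inj_on_def)
qed

text \<open>\<open>tall_card_le\<close> is applied to \<open>f\<close> and to its inverse, which
  makes the counts of tall summands agree for every exponent; a multiplicity is the difference of
  two consecutive counts.\<close>

theorem decomposes_unique:
  assumes M: "module R M" "module R M'" "module_iso R M M'" and d: "decomposes R M P m" "decomposes R M' P' m'"
  shows "\<exists>h\<in>module_hom R P P'. \<exists>h'\<in>module_hom R P' P. (\<forall>x\<in>carrier P. h' (h x) = x) \<and> (\<forall>y\<in>carrier P'. h (h' y) = y)"
    and "\<And>p l. p \<in> mSpec R \<Longrightarrow> l \<ge> 1 \<Longrightarrow> m p l = m' p l"
proof -
  have P: "projective RM P" "projective RM P'" and m: "fin_supp m" "fin_supp m'"
    and iso: "module_iso R M (module_sum2 P (tsum m))" "module_iso R M' (module_sum2 P' (tsum m'))"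
    using d unfolding decomposes_iff by blast+
  have Y: "module R (module_sum2 P (tsum m))" "module R (module_sum2 P' (tsum m'))"
    by (rule module_sum2[OF projective_module[OF P(1)] tsum_module] module_sum2[OF projective_module[OF P(2)] tsum_module])+
  have "module_iso R (module_sum2 P (tsum m)) (module_sum2 P' (tsum m'))"
    by (rule module_iso_trans[OF module_iso_trans[OF module_iso_sym[OF iso(1) M(1)] M(3)] iso(2)]) (use M Y in auto)
  then obtain f g where f: "f \<in> module_hom R (module_sum2 P (tsum m)) (module_sum2 P' (tsum m'))"
    and g: "g \<in> module_hom R (module_sum2 P' (tsum m')) (module_sum2 P (tsum m))"
    and gf: "\<forall>x\<in>carrier (module_sum2 P (tsum m)). g (f x) = x"
    and fg: "\<forall>y\<in>carrier (module_sum2 P' (tsum m')). f (g y) = y"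
    using module_isoE[OF _ Y(1)] by blast
  show "\<exists>h\<in>module_hom R P P'. \<exists>h'\<in>module_hom R P' P. (\<forall>x\<in>carrier P. h' (h x) = x) \<and> (\<forall>y\<in>carrier P'. h (h' y) = y)"
    by (rule splitting_projective_iso[OF P m f g gf fg])
  fix p l assume pl: "p \<in> mSpec R" "l \<ge> (1::nat)"
  have "card (tall m p l) = card (tall m' p l)" if "l \<ge> 1" for l
    using tall_card_le[OF P m f g gf pl(1) that] tall_card_le[OF P(2,1) m(2,1) g f fg pl(1) that] by simp
  from this[OF pl(2)] this[of "Suc l"] show "m p l = m' p l"
    using card_tall_Suc[OF m(1) pl] card_tall_Suc[OF m(2) pl] by simp
qed

end

section \<open>The isomorphism\<close>

context additive_category
begin

text \<open>Additivity provides a homomorphism with the prescribed values, and generation by classes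
  makes it unique, so the definite description evaluates to it.\<close>

lemma K0_add_induced:
  assumes H: "comm_group H" and \<phi>: "\<And>A. A \<in> Ob \<Longrightarrow> \<phi> A \<in> carrier H"
    and add: "\<And>A S B. \<lbrakk>A \<in> Ob; S \<in> Ob; B \<in> Ob; is_direct_sum C A B S\<rbrakk> \<Longrightarrow> \<phi> S = \<phi> A \<otimes>\<^bsub>H\<^esub> \<phi> B"
  shows "K0_add_induced C H \<phi> \<in> hom K.KG H" "A \<in> Ob \<Longrightarrow> K0_add_induced C H \<phi> (K.cls A) = \<phi> A"
proof -
  interpret H: comm_group H by fact
  obtain h where h: "h \<in> hom K.KG H" "\<And>A. A \<in> Ob \<Longrightarrow> h (K.cls A) = \<phi> A"
    by (rule K.hom_from_cls[OF H, of \<phi>]) (use \<phi> add in \<open>auto simp: direct_sum_triples_def\<close>)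
  have eq: "K0_add_induced C H \<phi> x = h x" if x: "x \<in> carrier K.KG" for x
    unfolding K0_add_induced_def K0_add_eq cls_add_eq
  proof (rule the_equality)
    show "\<exists>h'\<in>hom K.KG H. (\<forall>A\<in>Ob. h' (K.cls A) = \<phi> A) \<and> h x = h' x" using h by blast
    fix y assume "\<exists>h'\<in>hom K.KG H. (\<forall>A\<in>Ob. h' (K.cls A) = \<phi> A) \<and> y = h' x"
    then obtain h' where h': "h' \<in> hom K.KG H" "\<forall>A\<in>Ob. h' (K.cls A) = \<phi> A" "y = h' x" by blast
    show "y = h x" unfolding h'(3) by (rule K.hom_unique[OF H.is_group h'(1) h(1) _ x]) (use h'(2) h(2) in simp)
  qed
  show "K0_add_induced C H \<phi> \<in> hom K.KG H"
  proof (rule homI)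
    fix x y assume xy: "x \<in> carrier K.KG" "y \<in> carrier K.KG"
    show "K0_add_induced C H \<phi> x \<in> carrier H" using eq[OF xy(1)] hom_in_carrier[OF h(1) xy(1)] by simp
    show "K0_add_induced C H \<phi> (x \<otimes>\<^bsub>K.KG\<^esub> y) = K0_add_induced C H \<phi> x \<otimes>\<^bsub>H\<^esub> K0_add_induced C H \<phi> y"
      using eq[OF xy(1)] eq[OF xy(2)] eq[OF K.K.m_closed[OF xy]] hom_mult[OF h(1) xy] by simp
  qed
  show "K0_add_induced C H \<phi> (K.cls A) = \<phi> A" if "A \<in> Ob" using eq[OF K.cls_closed[OF that]] h(2)[OF that] by simp
qed

end

lemma module_sum2_exchange:
  assumes "module R A" "module R B" "module R A'" "module R B'"
  shows "module_iso R (module_sum2 (module_sum2 A B) (module_sum2 A' B')) (module_sum2 (module_sum2 A A') (module_sum2 B B'))"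
  by (rule module_isoI'[where h = "\<lambda>((a, b), (a', b')). ((a, a'), (b, b'))" and g = "\<lambda>((a, a'), (b, b')). ((a, b), (a', b'))"])
    (auto simp: module_sum2 assms)

section \<open>The invariants on the Grothendieck group of modules\<close>

context dedekind
begin

interpretation C: additive_category RM by (rule Rmod_additive)

abbreviation "TG \<equiv> sum_group (torsion_index R) (\<lambda>_. integer_group)"

lemma decomposes_unique_class:
  assumes M: "M \<in> Obj RM" and d: "decomposes R M P m" "decomposes R M P' m'"
  shows "C.KP.cls P = C.KP.cls P'" "(p, l) \<in> torsion_index R \<Longrightarrow> m p l = m' p l"
proof -
  have Mm: "module R M" by (rule Rmod_module[OF M])
  note u = decomposes_unique[OF Mm Mm module_iso_refl[OF Mm] d]
  have P: "projective RM P" "projective RM P'" using d by (auto simp: decomposes_iff)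
  obtain h h' where h: "h \<in> module_hom R P P'" "h' \<in> module_hom R P' P"
    "\<forall>x\<in>carrier P. h' (h x) = x" "\<forall>y\<in>carrier P'. h (h' y) = y" using u(1) by blast
  show "C.KP.cls P = C.KP.cls P'"
    by (rule C.clsP_iso[OF P, of h h']) (use h in \<open>auto simp: C.cmp_def intro!: restrict_ext\<close>)
  show "(p, l) \<in> torsion_index R \<Longrightarrow> m p l = m' p l" using u(2)[of p l] by (simp add: torsion_index_def)
qed

lemma pr_module_eq:
  assumes "M \<in> Obj RM" "decomposes R M P m"
  shows "pr_module R M = C.KP.cls P"
  unfolding pr_module_def C.cls_Proj_eq
  by (rule the_equality) (use assms decomposes_unique_class(1)[OF assms(1) _ assms(2)] in blast)+

lemma mult_module_eq:
  assumes "M \<in> Obj RM" "decomposes R M P m" "(p, l) \<in> torsion_index R"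
  shows "mult_module R p l M = int (m p l)"
proof -
  have "(THE k. \<exists>P m. decomposes R M P m \<and> k = m p l) = m p l"
    by (rule the_equality) (use assms decomposes_unique_class(2)[OF assms(1) _ assms(2,3)] in blast)+
  then show ?thesis by (simp add: mult_module_def)
qed

lemma decomposes_direct_sum:
  assumes ob: "A \<in> Obj RM" "B \<in> Obj RM" "S \<in> Obj RM" and S: "is_direct_sum RM A B S"
    and d: "decomposes R A P m" "decomposes R B P' m'"
  obtains Q where "is_direct_sum RM P P' Q" "decomposes R S Q (\<lambda>p l. m p l + m' p l)"
proof -
  have P: "projective RM P" "projective RM P'" and m: "fin_supp m" "fin_supp m'"
    and iso: "module_iso R A (module_sum2 P (tsum m))" "module_iso R B (module_sum2 P' (tsum m'))"
    using d unfolding decomposes_iff by blast+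
  note Pm = projective_module[OF P(1)] projective_module[OF P(2)]
  note t = tsum_module[of m] tsum_module[of m']
  note M = Rmod_module[OF ob(1)] Rmod_module[OF ob(2)] Rmod_module[OF ob(3)]
  obtain Q i j where c: "C.coprod Q P P' i j" using C.coprod_ex P C.projective_obj by blast
  have Q: "projective RM Q" by (rule C.projective_coprod[OF P c])
  have ds: "is_direct_sum RM P P' Q" by (rule C.coprod_direct_sum[OF c])
  have Qm: "module R Q" by (rule projective_module[OF Q])
  let ?m = "\<lambda>p l. m p l + m' p l"
  have 1: "module_iso R S (module_sum2 A B)" using S direct_sum_iff[OF M] by simp
  have 2: "module_iso R (module_sum2 A B) (module_sum2 (module_sum2 P (tsum m)) (module_sum2 P' (tsum m')))"
    by (rule module_sum2_cong[OF iso M(1,2)])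
  have 3: "module_iso R (module_sum2 (module_sum2 P (tsum m)) (module_sum2 P' (tsum m')))
      (module_sum2 (module_sum2 P P') (module_sum2 (tsum m) (tsum m')))"
    by (rule module_sum2_exchange[OF Pm(1) t(1) Pm(2) t(2)])
  have QP: "module_iso R (module_sum2 P P') Q"
    using ds direct_sum_iff[OF Pm Qm] module_iso_sym[OF _ Qm] by simp
  have 4: "module_iso R (module_sum2 (module_sum2 P P') (module_sum2 (tsum m) (tsum m'))) (module_sum2 Q (tsum ?m))"
    by (rule module_sum2_cong[OF QP module_iso_sym[OF tsum_add(2)[OF m] tsum_module] module_sum2[OF Pm] module_sum2[OF t]])
  have "module_iso R S (module_sum2 Q (tsum ?m))"
    by (rule module_iso_trans[OF module_iso_trans[OF module_iso_trans[OF 1 2] 3] 4])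
      (use M Pm t in \<open>simp_all add: module_sum2\<close>)
  then have "decomposes R S Q ?m" using Q tsum_add(1)[OF m] by (simp add: decomposes_iff)
  then show ?thesis by (rule that[OF ds])
qed

lemma pr_K0: "pr_K0 R \<in> hom C.K.KG C.KP.KG" "A \<in> Obj RM \<Longrightarrow> pr_K0 R (C.K.cls A) = pr_module R A"
proof -
  have 1: "pr_module R A \<in> carrier C.KP.KG" if A: "A \<in> Obj RM" for A
  proof -
    obtain P m where d: "decomposes R A P m" using decomposes_ex[OF A] .
    then show ?thesis using pr_module_eq[OF A d] by (simp add: decomposes_iff)
  qed
  have 2: "pr_module R S = pr_module R A \<otimes>\<^bsub>C.KP.KG\<^esub> pr_module R B"
    if ob: "A \<in> Obj RM" "S \<in> Obj RM" "B \<in> Obj RM" and S: "is_direct_sum RM A B S" for A S B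
  proof -
    obtain P m where d: "decomposes R A P m" using decomposes_ex[OF ob(1)] .
    obtain P' m' where d': "decomposes R B P' m'" using decomposes_ex[OF ob(3)] .
    obtain Q where Q: "is_direct_sum RM P P' Q" "decomposes R S Q (\<lambda>p l. m p l + m' p l)"
      using decomposes_direct_sum[OF ob(1,3,2) S d d'] .
    have "C.KP.cls Q = C.KP.cls P \<otimes>\<^bsub>C.KP.KG\<^esub> C.KP.cls P'"
      by (rule C.clsP_sum[OF Q(1)]) (use d d' Q(2) in \<open>simp_all add: decomposes_iff\<close>)
    then show ?thesis unfolding pr_module_eq[OF ob(1) d] pr_module_eq[OF ob(3) d'] pr_module_eq[OF ob(2) Q(2)] .
  qed
  show "pr_K0 R \<in> hom C.K.KG C.KP.KG" "A \<in> Obj RM \<Longrightarrow> pr_K0 R (C.K.cls A) = pr_module R A"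
    unfolding pr_K0_def C.K0_Proj_eq
    by (rule C.K0_add_induced[OF C.KP.K0_comm_group 1 2]; assumption)+
qed

lemma mult_K0:
  assumes pl: "(p, l) \<in> torsion_index R"
  shows "mult_K0 R p l \<in> hom C.K.KG integer_group" "A \<in> Obj RM \<Longrightarrow> mult_K0 R p l (C.K.cls A) = mult_module R p l A"
proof -
  have 1: "mult_module R p l A \<in> carrier integer_group" for A by simp
  have 2: "mult_module R p l S = mult_module R p l A \<otimes>\<^bsub>integer_group\<^esub> mult_module R p l B"
    if ob: "A \<in> Obj RM" "S \<in> Obj RM" "B \<in> Obj RM" and S: "is_direct_sum RM A B S" for A S B
  proof -
    obtain P m where d: "decomposes R A P m" using decomposes_ex[OF ob(1)] .
    obtain P' m' where d': "decomposes R B P' m'" using decomposes_ex[OF ob(3)] .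
    obtain Q where Q: "decomposes R S Q (\<lambda>p l. m p l + m' p l)"
      using decomposes_direct_sum[OF ob(1,3,2) S d d'] .
    show ?thesis
      unfolding mult_module_eq[OF ob(1) d pl] mult_module_eq[OF ob(3) d' pl] mult_module_eq[OF ob(2) Q pl] by simp
  qed
  show "mult_K0 R p l \<in> hom C.K.KG integer_group" "A \<in> Obj RM \<Longrightarrow> mult_K0 R p l (C.K.cls A) = mult_module R p l A"
    unfolding mult_K0_def
    by (rule C.K0_add_induced[OF abelian_integer_group 1 2]; assumption)+
qed

definition invariants ::
    "(('a, 'a fp_univ) module \<Rightarrow>\<^sub>0 int) set \<Rightarrow> (('a, 'a fp_univ) module \<Rightarrow>\<^sub>0 int) set \<times> ('a set \<times> nat \<Rightarrow> int)" where
  "invariants x = (pr_K0 R x, \<lambda>(p, l)\<in>torsion_index R. mult_K0 R p l x)"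

lemma invariants_diff:
  assumes A: "A \<in> Obj RM" "decomposes R A P m" and B: "B \<in> Obj RM" "decomposes R B P' m'"
  shows "invariants (C.K.cls A \<otimes>\<^bsub>C.K.KG\<^esub> inv\<^bsub>C.K.KG\<^esub> C.K.cls B) =
    (C.KP.cls P \<otimes>\<^bsub>C.KP.KG\<^esub> inv\<^bsub>C.KP.KG\<^esub> C.KP.cls P', \<lambda>(p, l)\<in>torsion_index R. int (m p l) - int (m' p l))"
proof -
  have c: "C.K.cls A \<in> carrier C.K.KG" "C.K.cls B \<in> carrier C.K.KG" using A B by simp_all
  interpret p: group_hom C.K.KG C.KP.KG "pr_K0 R"
    by (intro group_hom.intro group_hom_axioms.intro C.K.K.is_group C.KP.K.is_group pr_K0(1))
  have 1: "pr_K0 R (C.K.cls A \<otimes>\<^bsub>C.K.KG\<^esub> inv\<^bsub>C.K.KG\<^esub> C.K.cls B) = C.KP.cls P \<otimes>\<^bsub>C.KP.KG\<^esub> inv\<^bsub>C.KP.KG\<^esub> C.KP.cls P'"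
    using c pr_K0(2)[OF A(1)] pr_K0(2)[OF B(1)] pr_module_eq[OF A] pr_module_eq[OF B] by simp
  have 2: "mult_K0 R p l (C.K.cls A \<otimes>\<^bsub>C.K.KG\<^esub> inv\<^bsub>C.K.KG\<^esub> C.K.cls B) = int (m p l) - int (m' p l)"
    if pl: "(p, l) \<in> torsion_index R" for p l
  proof -
    interpret q: group_hom C.K.KG integer_group "mult_K0 R p l"
      by (intro group_hom.intro group_hom_axioms.intro C.K.K.is_group group_integer_group mult_K0(1)[OF pl])
    show ?thesis
      using c mult_K0(2)[OF pl A(1)] mult_K0(2)[OF pl B(1)] mult_module_eq[OF A pl] mult_module_eq[OF B pl] by simp
  qed
  show ?thesis unfolding invariants_def 1 by (auto simp: 2 intro!: restrict_ext)
qed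

lemma K0_element:
  assumes "x \<in> carrier C.K.KG"
  obtains A B P m P' m' where "A \<in> Obj RM" "decomposes R A P m" "B \<in> Obj RM" "decomposes R B P' m'"
    "x = C.K.cls A \<otimes>\<^bsub>C.K.KG\<^esub> inv\<^bsub>C.K.KG\<^esub> C.K.cls B"
proof -
  obtain A B where A: "A \<in> Obj RM" and B: "B \<in> Obj RM" and x: "x = C.K.cls A \<otimes>\<^bsub>C.K.KG\<^esub> inv\<^bsub>C.K.KG\<^esub> C.K.cls B"
    using C.K_diff[OF assms] by blast
  obtain P m where d: "decomposes R A P m" using decomposes_ex[OF A] .
  obtain P' m' where d': "decomposes R B P' m'" using decomposes_ex[OF B] .
  show ?thesis by (rule that[OF A d B d' x])
qed

lemma invariants_hom: "invariants \<in> hom C.K.KG (C.KP.KG \<times>\<times> TG)"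
proof (rule homI)
  fix x y assume x: "x \<in> carrier C.K.KG" and y: "y \<in> carrier C.K.KG"
  obtain A B P m P' m' where d: "A \<in> Obj RM" "decomposes R A P m" "B \<in> Obj RM" "decomposes R B P' m'"
    "x = C.K.cls A \<otimes>\<^bsub>C.K.KG\<^esub> inv\<^bsub>C.K.KG\<^esub> C.K.cls B" using K0_element[OF x] .
  have fin: "fin_supp m" "fin_supp m'" and P: "projective RM P" "projective RM P'"
    using d(2,4) by (auto simp: decomposes_iff)
  have "{i \<in> torsion_index R. (\<lambda>(p, l)\<in>torsion_index R. int (m p l) - int (m' p l)) i \<noteq> 0} \<subseteq>
    {(p, l) \<in> torsion_index R. m p l \<noteq> 0} \<union> {(p, l) \<in> torsion_index R. m' p l \<noteq> 0}" by auto
  then have "finite {i \<in> torsion_index R. (\<lambda>(p, l)\<in>torsion_index R. int (m p l) - int (m' p l)) i \<noteq> 0}"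
    using fin finite_subset unfolding fin_supp_def by blast
  then have "(\<lambda>(p, l)\<in>torsion_index R. int (m p l) - int (m' p l)) \<in> carrier TG"
    by (simp add: carrier_sum_group)
  then show "invariants x \<in> carrier (C.KP.KG \<times>\<times> TG)"
    unfolding d(5) invariants_diff[OF d(1-4)] using P by simp
  have "(\<lambda>(p, l)\<in>torsion_index R. mult_K0 R p l (x \<otimes>\<^bsub>C.K.KG\<^esub> y)) =
    (\<lambda>(p, l)\<in>torsion_index R. mult_K0 R p l x) \<otimes>\<^bsub>TG\<^esub> (\<lambda>(p, l)\<in>torsion_index R. mult_K0 R p l y)"
    unfolding mult_sum_group
  proof (rule restrict_ext)
    fix i assume i: "i \<in> torsion_index R"
    obtain p l where pl: "i = (p, l)" by (cases i)
    show "(\<lambda>(p, l). mult_K0 R p l (x \<otimes>\<^bsub>C.K.KG\<^esub> y)) i =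
      (\<lambda>(p, l)\<in>torsion_index R. mult_K0 R p l x) i \<otimes>\<^bsub>integer_group\<^esub> (\<lambda>(p, l)\<in>torsion_index R. mult_K0 R p l y) i"
      using i hom_mult[OF mult_K0(1) x y] unfolding pl by simp
  qed
  then show "invariants (x \<otimes>\<^bsub>C.K.KG\<^esub> y) = invariants x \<otimes>\<^bsub>C.KP.KG \<times>\<times> TG\<^esub> invariants y"
    unfolding invariants_def using hom_mult[OF pr_K0(1) x y] by simp
qed

lemma cls_decomposes:
  assumes A: "A \<in> Obj RM" "decomposes R A P m" and T: "T \<in> Obj RM" "module_iso R (tsum m) T"
  shows "C.K.cls A = C.K.cls P \<otimes>\<^bsub>C.K.KG\<^esub> C.K.cls T"
proof -
  have P: "projective RM P" and iso: "module_iso R A (module_sum2 P (tsum m))" using A(2) by (auto simp: decomposes_iff)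
  note Pm = projective_module[OF P] and Tm = Rmod_module[OF T(1)] and Am = Rmod_module[OF A(1)]
  have "module_iso R A (module_sum2 P T)"
    by (rule module_iso_trans[OF iso module_sum2_cong[OF module_iso_refl[OF Pm] T(2) Pm tsum_module] Am module_sum2[OF Pm tsum_module]])
  then have "is_direct_sum RM P T A" using direct_sum_iff[OF Pm Tm Am] by simp
  then have "(P, A, T) \<in> direct_sum_triples RM"
    using A(1) T(1) C.projective_obj[OF P] by (simp add: direct_sum_triples_def)
  then show ?thesis by (rule C.K.cls_sum)
qed

text \<open>Write x = [A] - [B]. Equal multiplicities give the same torsion module. The projective
  parts are only known to agree in the group of projectives, possibly without being isomorphic, but
  the inclusion homomorphism carries their equality over.\<close>

lemma invariants_kernel:
  assumes x: "x \<in> carrier C.K.KG" and inv: "invariants x = \<one>\<^bsub>C.KP.KG \<times>\<times> TG\<^esub>"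
  shows "x = \<one>\<^bsub>C.K.KG\<^esub>"
proof -
  obtain A B P m P' m' where d: "A \<in> Obj RM" "decomposes R A P m" "B \<in> Obj RM" "decomposes R B P' m'"
    "x = C.K.cls A \<otimes>\<^bsub>C.K.KG\<^esub> inv\<^bsub>C.K.KG\<^esub> C.K.cls B" using K0_element[OF x] .
  have P: "projective RM P" "projective RM P'" and m: "fin_supp m" using d(2,4) by (auto simp: decomposes_iff)
  have e: "C.KP.cls P \<otimes>\<^bsub>C.KP.KG\<^esub> inv\<^bsub>C.KP.KG\<^esub> C.KP.cls P' = \<one>\<^bsub>C.KP.KG\<^esub>"
    "(\<lambda>(p, l)\<in>torsion_index R. int (m p l) - int (m' p l)) = (\<lambda>i\<in>torsion_index R. 0)"
    using inv unfolding d(5) invariants_diff[OF d(1-4)] by (simp_all add: DirProd_def)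
  have mm: "m p l = m' p l" if "(p, l) \<in> torsion_index R" for p l
    using fun_cong[OF e(2), of "(p, l)"] that by simp
  \<comment> \<open>The two multiplicity functions may differ outside
    \<open>torsion_index R\<close>, but the index sets, and hence the torsion sums, are literally
    equal.\<close>
  have "tix m = tix m'" using mm by (auto simp: tix_def)
  then have ts: "tsum m = tsum m'" by (simp add: tsum_def)
  obtain T where T: "T \<in> Obj RM" "module_iso R (tsum m) T" using transport_Rmod[OF tsum_module tsum_fin_gen[OF m]] .
  have "C.KP.cls P = C.KP.cls P'"
    using e(1) C.KP.K.inv_equality[of "C.KP.cls P" "inv\<^bsub>C.KP.KG\<^esub> C.KP.cls P'"] P by simp
  moreover obtain \<iota> where "\<iota> \<in> hom C.KP.KG C.K.KG" and \<iota>: "\<forall>P. projective RM P \<longrightarrow> \<iota> (C.KP.cls P) = C.K.cls P"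
    by (rule C.Proj_inclusion_hom, rule that) auto
  ultimately have "C.K.cls P = C.K.cls P'" using \<iota> P by metis
  then have "C.K.cls A = C.K.cls B"
    using cls_decomposes[OF d(1,2) T] cls_decomposes[OF d(3,4) T(1)] T(2) ts by simp
  then show ?thesis using d(3,5) by simp
qed

lemma object_ex:
  assumes P: "projective RM P" and m: "fin_supp m"
  obtains A where "A \<in> Obj RM" "decomposes R A P m"
proof -
  have Pm: "module R P" "fin_gen R P" using P Obj_Rmod by (auto simp: projective_def)
  have Y: "module R (module_sum2 P (tsum m))" by (rule module_sum2[OF Pm(1) tsum_module])
  obtain A where A: "A \<in> Obj RM" "module_iso R (module_sum2 P (tsum m)) A"
    using transport_Rmod[OF Y fin_gen_sum2[OF Pm(1) tsum_module Pm(2) tsum_fin_gen[OF m]]] .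
  show ?thesis by (rule that[OF A(1)]) (use module_iso_sym[OF A(2) Y] P m in \<open>simp add: decomposes_iff\<close>)
qed

lemma invariants_surj:
  assumes y: "y \<in> carrier (C.KP.KG \<times>\<times> TG)"
  shows "\<exists>x\<in>carrier C.K.KG. invariants x = y"
proof -
  obtain a c where ac: "y = (a, c)" "a \<in> carrier C.KP.KG" "c \<in> carrier TG" using y by (auto simp: DirProd_def)
  obtain P P' where P: "projective RM P" "projective RM P'" and a: "a = C.KP.cls P \<otimes>\<^bsub>C.KP.KG\<^esub> inv\<^bsub>C.KP.KG\<^esub> C.KP.cls P'"
    using C.KP_diff[OF ac(2)] by blast
  \<comment> \<open>Positive and negative parts of the given integer family, so that each is
    realised by an actual module.\<close>
  define m m' where "m p l = nat (c (p, l))" and "m' p l = nat (- c (p, l))" for p l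
  have c: "c \<in> extensional (torsion_index R)" "finite {i \<in> torsion_index R. c i \<noteq> 0}"
    using ac(3) by (auto simp: carrier_sum_group PiE_iff)
  have "fin_supp m" "fin_supp m'"
    unfolding fin_supp_def by (rule finite_subset[OF _ c(2)], auto simp: m_def m'_def)+
  obtain A where A: "A \<in> Obj RM" "decomposes R A P m" using object_ex[OF P(1) \<open>fin_supp m\<close>] .
  obtain B where B: "B \<in> Obj RM" "decomposes R B P' m'" using object_ex[OF P(2) \<open>fin_supp m'\<close>] .
  have "(\<lambda>(p, l)\<in>torsion_index R. int (m p l) - int (m' p l)) = c"
    using c(1) by (intro ext) (auto simp: m_def m'_def extensional_def)
  then have "invariants (C.K.cls A \<otimes>\<^bsub>C.K.KG\<^esub> inv\<^bsub>C.K.KG\<^esub> C.K.cls B) = y"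
    unfolding invariants_diff[OF A B] ac(1) a by simp
  then show ?thesis using A(1) B(1) by (intro bexI[of _ "C.K.cls A \<otimes>\<^bsub>C.K.KG\<^esub> inv\<^bsub>C.K.KG\<^esub> C.K.cls B"]) simp_all
qed

theorem invariants_iso: "invariants \<in> iso (K0_add RM) (K0_add (Proj RM) \<times>\<times> TG)"
proof -
  have TG: "group (C.KP.KG \<times>\<times> TG)" by (intro DirProd_group C.KP.K.is_group sum_group group_integer_group)
  interpret h: group_hom C.K.KG "C.KP.KG \<times>\<times> TG" invariants
    by (intro group_hom.intro group_hom_axioms.intro C.K.K.is_group TG invariants_hom)
  have "inj_on invariants (carrier C.K.KG)"
    unfolding h.inj_iff_trivial_ker kernel_def using invariants_kernel h.hom_one by auto
  moreover have "invariants ` carrier C.K.KG = carrier (C.KP.KG \<times>\<times> TG)"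
    using invariants_surj h.hom_closed by blast
  ultimately show ?thesis
    using invariants_hom by (simp add: iso_def bij_betw_def C.K0_add_eq C.K0_Proj_eq)
qed

theorem K0_fp_functors_invariants:
  "\<exists>\<Phi> \<in> iso (K0_ab (fp_functors RM)) (K0_add (Proj RM) \<times>\<times> TG).
     \<forall>G \<in> Obj (fp_functors RM). \<Phi> (cls_ab (fp_functors RM) G) =
       (pr_functor R G, \<lambda>(p, l)\<in>torsion_index R. mult_functor R p l G)"
proof -
  let ?F = "fp_functors RM"
  obtain \<Lambda> where \<Lambda>: "\<Lambda> \<in> iso (K0_ab ?F) (K0_add RM)" "\<forall>G\<in>Obj ?F. \<Lambda> (cls_ab ?F G) = C.lmc_class G"
    by (rule C.K0_fp_functors_iso, rule that) auto
  have l: "C.lmc_class G = lmc R G" for G :: "'a fp_functor" unfolding C.lmc_class_def lmc_def ..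
  show ?thesis
  proof (intro bexI ballI)
    show "invariants \<circ> \<Lambda> \<in> iso (K0_ab ?F) (K0_add (Proj RM) \<times>\<times> TG)"
      by (rule iso_set_trans[OF \<Lambda>(1) invariants_iso])
    fix G assume G: "G \<in> Obj ?F"
    then show "(invariants \<circ> \<Lambda>) (cls_ab ?F G) = (pr_functor R G, \<lambda>(p, l)\<in>torsion_index R. mult_functor R p l G)"
      using \<Lambda>(2) by (simp add: l invariants_def pr_functor_def mult_functor_def)
  qed
qed

end

lemma dedekind_domain_dedekind: "dedekind_domain R \<Longrightarrow> dedekind R"
  unfolding dedekind_domain_def mSpec_def
  by (intro dedekind.intro dedekind_axioms.intro uniformizer_ex) auto

theorem corollary10p7:
  fixes R :: "('a, 'b) ring_scheme"
  assumes "dedekind_domain R"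
  shows "\<exists>\<Phi> \<in> iso (K0_ab (fp_functors (Rmod R)))
                   (K0_add (Proj (Rmod R)) \<times>\<times> sum_group (torsion_index R) (\<lambda>_. integer_group)).
           \<forall>G \<in> Obj (fp_functors (Rmod R)).
             \<Phi> (cls_ab (fp_functors (Rmod R)) G) =
               (pr_functor R G, \<lambda>(\<pp>, l)\<in>torsion_index R. mult_functor R \<pp> l G)"
  by (rule dedekind.K0_fp_functors_invariants[OF dedekind_domain_dedekind[OF assms]])

end
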